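(* Let $\rho:E\to Q$ be an orbifold vector bundle over a (not necessarily reduced) orbifold $Q$, and suppose that $E$ and $Q$ admit almost complex structures. Let $\iota:Q\to E$ be the zero section. Then the restriction homomorphism $\iota^\ast : H_{orb}^\ast(E) \to H_{orb}^\ast(Q)$ in Chen-Ruan orbifold cohomology is an isomorphism of ungraded additive groups.
   Context: Orbifolds. A (smooth) orbifold $Q$ is a Hausdorff space covered by compatible orbifold charts $\{V,G,\pi\}$: $V$ is a connected smooth manifold, $G$ is a finite group acting smoothly on $V$ (not necessarily effectively), and $\pi: V\to U$ induces a homeomorphism $V/G\cong U$ onto an open set $U\subseteq Q$. Charts are related by injections $i$ consisting of a smooth open embedding $\phi:V_1\to V_2$ with $\pi_2\circ\phi=\pi_1$ and an injective homomorphism $\lambda:G_1\to G_2$ for which $\phi$ is equivariant and which restricts to an isomorphism between the kernels of the two actions. $Q$ is reduced if every local group acts effectively. A chart $\{V_p,G_p,\pi_p\}$ at $p$ is one with $G_p$ acting as a subgroup of $O(n)$ (possibly non-effectively) and $p$ the image of the origin. Orbifold vector bundles. A rank $k$ orbifold vector bundle $\rho:E\to Q$ is given over a compatible cover by charts $\{V\times\mathbb{R}^k,G,\tilde\pi\}$ lying over charts $\{V,G,\pi\}$ of $Q$, where the same $G$ acts on $V\times\mathbb{R}^k$ linearly on fibers and covering its action on $V$; each injection $i=(\phi,\lambda)$ has a smooth transition map $g_i:V_1\to\mathrm{Aut}(\mathbb{R}^k)$ satisfying the cocycle condition, and the injection of charts of $E$ is $(x,v)\mapsto(\phi(x),g_i(x)v)$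 with homomorphism $\lambda$. The total space $E$ is thereby an orbifold. Sectors and orbifold cohomology. For $q$ in the image of a chart at $p$, the conjugacy class of $g\in G_q$ is equivalent to that of $h\in G_p$ if some injection from a chart at $q$ into the chart at $p$ has homomorphism taking $g$ to $h$; $T$ is the set of classes of the generated equivalence relation. Using the charts of $E$ induced from those of $Q$, it is the same set for $Q$ and for $E$. For $(g)\in T$ the sector $\tilde Q_{(g)}$ is the orbifold of pairs $(p,(g'))$, $g'\in G_p$, $(g')$ in the class $(g)$, with charts $\{V_p^{g},C(g)\}$, where $V_p^g$ is the fixed-point set and $C(g)$ the centralizer of $g$ in $G_p$. Similarly $\tilde E_{(g)}$ has charts $\{(V_p\times\mathbb{R}^k)^g,C(g)\}$. For an orbifold $Q$ with an almost complex structure, $H^\ast_{orb}(Q)=\bigoplus_{(g)\in T}H_{dR}^{\ast-2\iota(g)}(\tilde Q_{(g)})$ with real coefficients, where $\iota(g)$ is the degree-shifting number of $g$ (if $g$ acts on the tangent space with eigenvalues $e^{2\pi i m_j/m}$, $0\le m_j<m$, then $\iota(g)=\sum_j m_j/m$), and $H_{dR}$ is computed by differential forms that are invariant in charts; likewise for $E$. The zero section induces $\iota_{(g)}:\tilde Q_{(g)}\to\tilde E_{(g)}$, $(p,(g))\mapsto((p,\mathbf 0),(g))$, and $\iota^\ast:=\bigoplus_{(g)\in T}\iota_{(g)}^\ast$, where $\iota_{(g)}^\ast:H^\ast_{dR}(\tilde E_{(g)})\to H^\ast_{dR}(\tilde Q_{(g)})$. "Ungraded" means that the isomorphism is not claimed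 to preserve the (shifted) grading. *)

theory Defs
  imports
    "HOL-Analysis.Analysis"
    "HOL-Algebra.Group_Action"
    "HOL-Algebra.Multiplicative_Group"
    "HOL-Algebra.Product_Groups"
begin

section \<open>Calculus on open subsets of a linear subspace\<close>

text \<open>
  A Euclidean model space of dimension \<open>n\<close> is an \<open>n\<close>-dimensional linear subspace \<open>W\<close> of an
  ambient type of class \<^class>\<open>euclidean_space\<close>. In this way dimension 0 is included, and
  the model spaces of fixed-point sets, whose dimensions depend on a group element, live in the same
  type as those of the ambient manifold.
\<close>

definition dir_deriv :: "('a::real_normed_vector \<Rightarrow> 'b::real_normed_vector) \<Rightarrow> 'a \<Rightarrow> 'a \<Rightarrow> 'b" where
  "dir_deriv f y v = vector_derivative (\<lambda>s. f (y + s *\<^sub>R v)) (at 0)"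

text \<open>\<open>S\<close> is meant to be open in the subspace \<open>W\<close>; then \<open>f' y\<close> below is determined on \<open>W\<close>.\<close>

fun Ck_on :: "nat \<Rightarrow> 'a::euclidean_space set \<Rightarrow> 'a set \<Rightarrow> ('a \<Rightarrow> 'b::real_normed_vector) \<Rightarrow> bool" where
  "Ck_on 0 W S f = continuous_on S f"
| "Ck_on (Suc r) W S f =
    (\<exists>f'. (\<forall>y\<in>S. (f has_derivative f' y) (at y within S)) \<and> (\<forall>v\<in>W. Ck_on r W S (\<lambda>y. f' y v)))"

definition smooth_on :: "'a::euclidean_space set \<Rightarrow> 'a set \<Rightarrow> ('a \<Rightarrow> 'b::real_normed_vector) \<Rightarrow> bool" where
  "smooth_on W S f \<longleftrightarrow> (\<forall>r. Ck_on r W S f)"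

definition linear_map_on :: "'a::real_vector set \<Rightarrow> 'b::real_vector set \<Rightarrow> ('a \<Rightarrow> 'b) \<Rightarrow> bool" where
  "linear_map_on V W f \<longleftrightarrow> f ` V \<subseteq> W \<and>
     (\<forall>u\<in>V. \<forall>v\<in>V. \<forall>a b. f (a *\<^sub>R u + b *\<^sub>R v) = a *\<^sub>R f u + b *\<^sub>R f v)"

text \<open>
  Alternating \<open>d\<close>-linear forms on \<open>W\<close>, with the list of arguments as a single argument; they are
  normalised to vanish on all other lists, so that equality of forms is equality of functions.
\<close>

definition alt_form :: "'a::real_vector set \<Rightarrow> nat \<Rightarrow> ('a list \<Rightarrow> real) \<Rightarrow> bool" where
  "alt_form W d \<eta> \<longleftrightarrow>
     (\<forall>vs. \<not> (length vs = d \<and> set vs \<subseteq> W) \<longrightarrow> \<eta> vs = 0) \<and>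
     (\<forall>vs j u v a b. length vs = d \<and> set vs \<subseteq> W \<and> j < d \<and> u \<in> W \<and> v \<in> W \<longrightarrow>
        \<eta> (vs[j := a *\<^sub>R u + b *\<^sub>R v]) = a * \<eta> (vs[j := u]) + b * \<eta> (vs[j := v])) \<and>
     (\<forall>vs i j. length vs = d \<and> set vs \<subseteq> W \<and> i < j \<and> j < d \<and> vs ! i = vs ! j \<longrightarrow> \<eta> vs = 0)"

definition local_form :: "'a::euclidean_space set \<Rightarrow> 'a set \<Rightarrow> nat \<Rightarrow> ('a \<Rightarrow> 'a list \<Rightarrow> real) \<Rightarrow> bool" where
  "local_form W S d \<eta> \<longleftrightarrow>
     (\<forall>y\<in>S. alt_form W d (\<eta> y)) \<and> (\<forall>y. y \<notin> S \<longrightarrow> \<eta> y = (\<lambda>_. 0)) \<and>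
     (\<forall>vs. length vs = d \<and> set vs \<subseteq> W \<longrightarrow> smooth_on W S (\<lambda>y. \<eta> y vs))"

text \<open>
  The exterior derivative evaluated on constant vector fields, whose brackets vanish:
  \<open>d\<eta>(v\<^sub>0,\<dots>,v\<^sub>d) = \<Sum>\<^sub>j (-1)\<^sup>j D\<^bsub>v\<^sub>j\<^esub> \<eta>(v\<^sub>0,\<dots>,v\<^sub>j omitted,\<dots>,v\<^sub>d)\<close>.
\<close>

definition local_d :: "'a::euclidean_space set \<Rightarrow> 'a set \<Rightarrow> ('a \<Rightarrow> 'a list \<Rightarrow> real) \<Rightarrow> 'a \<Rightarrow> 'a list \<Rightarrow> real" where
  "local_d W S \<eta> y vs =
     (if y \<in> S \<and> set vs \<subseteq> W
      then \<Sum>j<length vs. (-1) ^ j * dir_deriv (\<lambda>z. \<eta> z (take j vs @ drop (Suc j) vs)) y (vs ! j)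
      else 0)"


section \<open>Smooth manifolds\<close>

datatype ('x, 'a) coord = Coord (cdom: "'x set") (cmap: "'x \<Rightarrow> 'a") (cmodel: "'a set")

abbreviation cimg :: "('x, 'a) coord \<Rightarrow> 'a set" where
  "cimg c \<equiv> cmap c ` cdom c"

abbreviation cinv :: "('x, 'a) coord \<Rightarrow> 'a \<Rightarrow> 'x" where
  "cinv c \<equiv> inv_into (cdom c) (cmap c)"

definition is_coord :: "'x topology \<Rightarrow> ('x, 'a::euclidean_space) coord \<Rightarrow> bool" where
  "is_coord X c \<longleftrightarrow> openin X (cdom c) \<and> subspace (cmodel c) \<and>
     openin (top_of_set (cmodel c)) (cimg c) \<and>
     homeomorphic_map (subtopology X (cdom c)) (top_of_set (cimg c)) (cmap c)"

definition local_rep :: "('x \<Rightarrow> 'y) \<Rightarrow> ('x, 'a) coord \<Rightarrow> ('y, 'b) coord \<Rightarrow> 'a \<Rightarrow> 'b" where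
  "local_rep f c c' = cmap c' \<circ> f \<circ> cinv c"

definition coord_compat :: "('x, 'a::euclidean_space) coord \<Rightarrow> ('x, 'a) coord \<Rightarrow> bool" where
  "coord_compat c c' \<longleftrightarrow>
     smooth_on (cmodel c) (cmap c ` (cdom c \<inter> cdom c')) (local_rep (\<lambda>x. x) c c') \<and>
     smooth_on (cmodel c') (cmap c' ` (cdom c \<inter> cdom c')) (local_rep (\<lambda>x. x) c' c)"

record ('x, 'a) manifold =
  mtop :: "'x topology"
  matlas :: "('x, 'a) coord set"

abbreviation mpts :: "('x, 'a) manifold \<Rightarrow> 'x set" where
  "mpts M \<equiv> topspace (mtop M)"

definition smooth_manifold :: "nat \<Rightarrow> ('x, 'a::euclidean_space) manifold \<Rightarrow> bool" where
  "smooth_manifold n M \<longleftrightarrow> Hausdorff_space (mtop M) \<and> second_countable (mtop M) \<and>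
     (\<forall>c\<in>matlas M. is_coord (mtop M) c \<and> dim (cmodel c) = n) \<and>
     (\<forall>c\<in>matlas M. \<forall>c'\<in>matlas M. coord_compat c c') \<and>
     mpts M = (\<Union>c\<in>matlas M. cdom c)"

definition max_atlas :: "('x, 'a::euclidean_space) manifold \<Rightarrow> ('x, 'a) coord set" where
  "max_atlas M = {c. is_coord (mtop M) c \<and> (\<forall>c'\<in>matlas M. coord_compat c c')}"

text \<open>Smoothness of \<open>f\<close> on the open subset \<open>S\<close> of \<open>M\<close>.\<close>

definition smooth_map_on ::
  "('x, 'a::euclidean_space) manifold \<Rightarrow> 'x set \<Rightarrow> ('y, 'b::euclidean_space) manifold \<Rightarrow> ('x \<Rightarrow> 'y) \<Rightarrow> bool" where
  "smooth_map_on M S N f \<longleftrightarrow> continuous_map (subtopology (mtop M) S) (mtop N) f \<and>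
     (\<forall>c\<in>matlas M. \<forall>c'\<in>matlas N.
        smooth_on (cmodel c) (cmap c ` {x \<in> cdom c \<inter> S. f x \<in> cdom c'}) (local_rep f c c'))"

definition smooth_open_embedding ::
  "('x, 'a::euclidean_space) manifold \<Rightarrow> ('y, 'b::euclidean_space) manifold \<Rightarrow> ('x \<Rightarrow> 'y) \<Rightarrow> bool" where
  "smooth_open_embedding M N f \<longleftrightarrow>
     smooth_map_on M (mpts M) N f \<and> inj_on f (mpts M) \<and> openin (mtop N) (f ` mpts M) \<and>
     smooth_map_on N (f ` mpts M) M (inv_into (mpts M) f)"

text \<open>
  The submanifold carried by \<open>A\<close>, with its slice coordinates: coordinates of \<open>M\<close> in which \<open>A\<close>
  becomes a linear subspace. Different components of \<open>A\<close> may have different dimensions.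
\<close>

definition submanifold :: "('x, 'a::euclidean_space) manifold \<Rightarrow> 'x set \<Rightarrow> ('x, 'a) manifold" where
  "submanifold M A =
     \<lparr>mtop = subtopology (mtop M) A,
      matlas = {Coord (cdom c \<inter> A) (cmap c) W | c W.
        c \<in> max_atlas M \<and> subspace W \<and> W \<subseteq> cmodel c \<and> cmap c ` (cdom c \<inter> A) = cimg c \<inter> W}\<rparr>"

definition prod_space :: "('x, 'a::euclidean_space) manifold \<Rightarrow> 'f::euclidean_space set \<Rightarrow> ('x \<times> 'f, 'a \<times> 'f) manifold" where
  "prod_space M F =
     \<lparr>mtop = prod_topology (mtop M) (top_of_set F),
      matlas = (\<lambda>c. Coord (cdom c \<times> F) (\<lambda>(x, v). (cmap c x, v)) (cmodel c \<times> F)) ` matlas M\<rparr>"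


section \<open>Differential forms on manifolds\<close>

text \<open>A form is given by its local expressions in the coordinates of the atlas.\<close>

type_synonym ('x, 'a) form = "('x, 'a) coord \<Rightarrow> 'a \<Rightarrow> 'a list \<Rightarrow> real"

definition forms :: "('x, 'a::euclidean_space) manifold \<Rightarrow> nat \<Rightarrow> ('x, 'a) form set" where
  "forms M d = {\<omega>.
     (\<forall>c. c \<notin> matlas M \<longrightarrow> \<omega> c = (\<lambda>_ _. 0)) \<and>
     (\<forall>c\<in>matlas M. local_form (cmodel c) (cimg c) d (\<omega> c)) \<and>
     (\<forall>c\<in>matlas M. \<forall>c'\<in>matlas M. \<forall>y \<in> cmap c ` (cdom c \<inter> cdom c'). \<forall>vs. set vs \<subseteq> cmodel c \<longrightarrow>
        \<omega> c y vs = \<omega> c' (local_rep (\<lambda>x. x) c c' y) (map (dir_deriv (local_rep (\<lambda>x. x) c c') y) vs))}"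

definition ext_d :: "('x, 'a::euclidean_space) manifold \<Rightarrow> ('x, 'a) form \<Rightarrow> ('x, 'a) form" where
  "ext_d M \<omega> = (\<lambda>c. if c \<in> matlas M then local_d (cmodel c) (cimg c) (\<omega> c) else (\<lambda>_ _. 0))"

text \<open>The choice of the coordinate \<open>c'\<close> around the image point is immaterial when \<open>\<omega>\<close> is a form.\<close>

definition pullback ::
  "('x \<Rightarrow> 'y) \<Rightarrow> ('x, 'a::euclidean_space) manifold \<Rightarrow> ('y, 'b::euclidean_space) manifold \<Rightarrow> ('y, 'b) form \<Rightarrow> ('x, 'a) form" where
  "pullback f M N \<omega> = (\<lambda>c y vs.
     if c \<in> matlas M \<and> y \<in> cimg c \<and> set vs \<subseteq> cmodel c
     then let c' = (SOME c'. c' \<in> matlas N \<and> f (cinv c y) \<in> cdom c')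
          in \<omega> c' (local_rep f c c' y) (map (dir_deriv (local_rep f c c') y) vs)
     else 0)"


section \<open>Orbifolds\<close>

text \<open>
  The charts, indexed by \<open>charts\<close>, and for any two of them the set of injections \<open>(\<phi>, \<theta>)\<close> by which
  they are related. The underlying space and the projections are added in \<open>orbifold_data\<close>; invariant
  forms and almost complex structures need only the part below.
\<close>

record ('i, 'x, 'a, 'g) chart_system =
  charts :: "'i set"
  cmfd :: "'i \<Rightarrow> ('x, 'a) manifold"
  cgrp :: "'i \<Rightarrow> 'g monoid"
  cact :: "'i \<Rightarrow> 'g \<Rightarrow> 'x \<Rightarrow> 'x"
  injs :: "'i \<Rightarrow> 'i \<Rightarrow> (('x \<Rightarrow> 'x) \<times> ('g \<Rightarrow> 'g)) set"

record ('i, 'x, 'a, 'g, 'q) orbifold_data = "('i, 'x, 'a, 'g) chart_system" +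
  qspace :: "'q topology"
  proj :: "'i \<Rightarrow> 'x \<Rightarrow> 'q"

abbreviation cpts :: "('i, 'x, 'a, 'g, 'm) chart_system_scheme \<Rightarrow> 'i \<Rightarrow> 'x set" where
  "cpts D i \<equiv> mpts (cmfd D i)"

abbreviation uset :: "('i, 'x, 'a, 'g, 'q) orbifold_data \<Rightarrow> 'i \<Rightarrow> 'q set" where
  "uset D i \<equiv> proj D i ` cpts D i"

text \<open>
  \<open>V/G\<close> is homeomorphic to \<open>U\<close> via \<open>\<pi>\<close>: the map \<open>\<pi> : V \<rightarrow> U\<close> is a quotient map
  whose fibres are the orbits.
\<close>

definition orbifold_chart :: "nat \<Rightarrow> ('i, 'x, 'a::euclidean_space, 'g, 'q) orbifold_data \<Rightarrow> 'i \<Rightarrow> bool" where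
  "orbifold_chart n D i \<longleftrightarrow>
     smooth_manifold n (cmfd D i) \<and> connected_space (mtop (cmfd D i)) \<and>
     finite (carrier (cgrp D i)) \<and> group_action (cgrp D i) (cpts D i) (cact D i) \<and>
     (\<forall>g\<in>carrier (cgrp D i). smooth_map_on (cmfd D i) (cpts D i) (cmfd D i) (cact D i g)) \<and>
     openin (qspace D) (uset D i) \<and>
     quotient_map (mtop (cmfd D i)) (subtopology (qspace D) (uset D i)) (proj D i) \<and>
     (\<forall>x\<in>cpts D i. \<forall>y\<in>cpts D i.
        proj D i x = proj D i y \<longleftrightarrow> (\<exists>g\<in>carrier (cgrp D i). cact D i g x = y))"

definition injection ::
  "('i, 'x, 'a::euclidean_space, 'g, 'q) orbifold_data \<Rightarrow> 'i \<Rightarrow> 'i \<Rightarrow> ('x \<Rightarrow> 'x) \<times> ('g \<Rightarrow> 'g) \<Rightarrow> bool" where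
  "injection D i j = (\<lambda>(\<phi>, \<theta>).
     \<phi> \<in> extensional (cpts D i) \<and> \<theta> \<in> extensional (carrier (cgrp D i)) \<and>
     smooth_open_embedding (cmfd D i) (cmfd D j) \<phi> \<and>
     (\<forall>x\<in>cpts D i. proj D j (\<phi> x) = proj D i x) \<and>
     \<theta> \<in> hom (cgrp D i) (cgrp D j) \<and> inj_on \<theta> (carrier (cgrp D i)) \<and>
     (\<forall>g\<in>carrier (cgrp D i). \<forall>x\<in>cpts D i. \<phi> (cact D i g x) = cact D j (\<theta> g) (\<phi> x)) \<and>
     bij_betw \<theta> (kernel (cgrp D i) (BijGroup (cpts D i)) (cact D i))
                 (kernel (cgrp D j) (BijGroup (cpts D j)) (cact D j)))"

definition id_injection :: "('i, 'x, 'a, 'g, 'm) chart_system_scheme \<Rightarrow> 'i \<Rightarrow> ('x \<Rightarrow> 'x) \<times> ('g \<Rightarrow> 'g)" where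
  "id_injection D i = (restrict (\<lambda>x. x) (cpts D i), restrict (\<lambda>g. g) (carrier (cgrp D i)))"

definition comp_injection ::
  "('i, 'x, 'a, 'g, 'm) chart_system_scheme \<Rightarrow> 'i \<Rightarrow> ('x \<Rightarrow> 'x) \<times> ('g \<Rightarrow> 'g) \<Rightarrow> ('x \<Rightarrow> 'x) \<times> ('g \<Rightarrow> 'g) \<Rightarrow> ('x \<Rightarrow> 'x) \<times> ('g \<Rightarrow> 'g)" where
  "comp_injection D i b a =
     (compose (cpts D i) (fst b) (fst a), compose (carrier (cgrp D i)) (snd b) (snd a))"

text \<open>
  The injections in use are part of the structure and need not be all pairs satisfying
  \<open>injection\<close>: when groups act non-effectively, \<open>\<phi>\<close> does not determine \<open>\<theta>\<close>. Taking all of them is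
  allowed.
\<close>

definition orbifold :: "nat \<Rightarrow> ('i, 'x, 'a::euclidean_space, 'g, 'q) orbifold_data \<Rightarrow> bool" where
  "orbifold n D \<longleftrightarrow>
     Hausdorff_space (qspace D) \<and>
     topspace (qspace D) = (\<Union>i\<in>charts D. uset D i) \<and>
     (\<forall>i\<in>charts D. orbifold_chart n D i) \<and>
     (\<forall>i\<in>charts D. \<forall>j\<in>charts D. \<forall>a\<in>injs D i j. injection D i j a) \<and>
     (\<forall>i\<in>charts D. id_injection D i \<in> injs D i i) \<and>
     (\<forall>i\<in>charts D. \<forall>j\<in>charts D. \<forall>k\<in>charts D. \<forall>a\<in>injs D i j. \<forall>b\<in>injs D j k.
        comp_injection D i b a \<in> injs D i k) \<and>
     (\<forall>i\<in>charts D. \<forall>j\<in>charts D. \<forall>p\<in>uset D i \<inter> uset D j.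
        \<exists>k\<in>charts D. p \<in> uset D k \<and> injs D k i \<noteq> {} \<and> injs D k j \<noteq> {})"

text \<open>
  Chart \<open>i\<close> is a chart at the image of \<open>x\<close>: a global coordinate identifies \<open>V\<close> with an open set of
  the model space, \<open>x\<close> with the origin and the group with orthogonal transformations. (An orthogonal
  transformation of a subspace extends to the ambient space.)
\<close>

definition centre_of :: "('i, 'x, 'a::euclidean_space, 'g, 'm) chart_system_scheme \<Rightarrow> 'i \<Rightarrow> 'x \<Rightarrow> bool" where
  "centre_of D i x \<longleftrightarrow> x \<in> cpts D i \<and>
     (\<exists>c\<in>max_atlas (cmfd D i). cdom c = cpts D i \<and> cmap c x = 0 \<and>
        (\<forall>g\<in>carrier (cgrp D i). \<exists>A. orthogonal_transformation A \<and>
           (\<forall>z\<in>cpts D i. cmap c (cact D i g z) = A (cmap c z))))"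

definition chart_at :: "('i, 'x, 'a::euclidean_space, 'g, 'q) orbifold_data \<Rightarrow> 'i \<Rightarrow> 'q \<Rightarrow> bool" where
  "chart_at D i p \<longleftrightarrow> i \<in> charts D \<and> (\<exists>x. centre_of D i x \<and> proj D i x = p)"

text \<open>Inside every chart of the cover there are charts at each of its points; their groups are the local
  groups.\<close>

definition has_point_charts :: "('i, 'x, 'a::euclidean_space, 'g, 'q) orbifold_data \<Rightarrow> bool" where
  "has_point_charts D \<longleftrightarrow>
     (\<forall>i\<in>charts D. \<forall>p\<in>uset D i. \<exists>k. chart_at D k p \<and> injs D k i \<noteq> {})"


section \<open>Orbifold vector bundles\<close>

text \<open>
  The fibre is a \<open>k\<close>-dimensional subspace of a Euclidean space. \<open>btrans i j a x\<close> is the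
  transition map of the injection \<open>a\<close> from chart \<open>i\<close> to chart \<open>j\<close> at \<open>x\<close>.
\<close>

record ('i, 'x, 'g, 'q, 'f, 'e) bundle_data =
  tspace :: "'e topology"
  bproj :: "'e \<Rightarrow> 'q"
  fibre :: "'f set"
  eproj :: "'i \<Rightarrow> 'x \<times> 'f \<Rightarrow> 'e"
  eact :: "'i \<Rightarrow> 'g \<Rightarrow> 'x \<times> 'f \<Rightarrow> 'x \<times> 'f"
  btrans :: "'i \<Rightarrow> 'i \<Rightarrow> ('x \<Rightarrow> 'x) \<times> ('g \<Rightarrow> 'g) \<Rightarrow> 'x \<Rightarrow> 'f \<Rightarrow> 'f"

definition bundle_injection ::
  "('i, 'x, 'a, 'g, 'q) orbifold_data \<Rightarrow> ('i, 'x, 'g, 'q, 'f, 'e) bundle_data \<Rightarrow> 'i \<Rightarrow> 'i \<Rightarrow>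
   ('x \<Rightarrow> 'x) \<times> ('g \<Rightarrow> 'g) \<Rightarrow> ('x \<times> 'f \<Rightarrow> 'x \<times> 'f) \<times> ('g \<Rightarrow> 'g)" where
  "bundle_injection Q B i j a =
     (restrict (\<lambda>(x, v). (fst a x, btrans B i j a x v)) (cpts Q i \<times> fibre B), snd a)"

definition total_space ::
  "('i, 'x, 'a::euclidean_space, 'g, 'q) orbifold_data \<Rightarrow> ('i, 'x, 'g, 'q, 'f::euclidean_space, 'e) bundle_data \<Rightarrow>
   ('i, 'x \<times> 'f, 'a \<times> 'f, 'g, 'e) orbifold_data" where
  "total_space Q B =
     \<lparr>charts = charts Q,
      cmfd = (\<lambda>i. prod_space (cmfd Q i) (fibre B)),
      cgrp = cgrp Q,
      cact = eact B,
      injs = (\<lambda>i j. bundle_injection Q B i j ` injs Q i j),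
      qspace = tspace B,
      proj = eproj B\<rparr>"

definition orbifold_vector_bundle ::
  "nat \<Rightarrow> nat \<Rightarrow> ('i, 'x, 'a::euclidean_space, 'g, 'q) orbifold_data \<Rightarrow> ('i, 'x, 'g, 'q, 'f::euclidean_space, 'e) bundle_data \<Rightarrow> bool" where
  "orbifold_vector_bundle n k Q B \<longleftrightarrow>
     subspace (fibre B) \<and> dim (fibre B) = k \<and>
     Hausdorff_space (tspace B) \<and> continuous_map (tspace B) (qspace Q) (bproj B) \<and>
     (\<forall>i\<in>charts Q.
        orbifold_chart (n + k) (total_space Q B) i \<and>
        uset (total_space Q B) i = {e \<in> topspace (tspace B). bproj B e \<in> uset Q i} \<and>
        (\<forall>x\<in>cpts Q i. \<forall>v\<in>fibre B. bproj B (eproj B i (x, v)) = proj Q i x) \<and>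
        (\<forall>g\<in>carrier (cgrp Q i). \<forall>x\<in>cpts Q i.
           (\<forall>v\<in>fibre B. fst (eact B i g (x, v)) = cact Q i g x) \<and>
           linear_map_on (fibre B) (fibre B) (\<lambda>v. snd (eact B i g (x, v))))) \<and>
     (\<forall>i\<in>charts Q. \<forall>j\<in>charts Q. \<forall>a\<in>injs Q i j.
        (\<forall>x\<in>cpts Q i. linear_map_on (fibre B) (fibre B) (btrans B i j a x) \<and>
                       bij_betw (btrans B i j a x) (fibre B) (fibre B)) \<and>
        (\<forall>v\<in>fibre B. \<forall>c\<in>matlas (cmfd Q i).
           smooth_on (cmodel c) (cimg c) (\<lambda>y. btrans B i j a (cinv c y) v)) \<and>
        injection (total_space Q B) i j (bundle_injection Q B i j a)) \<and>
     (\<forall>i\<in>charts Q. \<forall>j\<in>charts Q. \<forall>k\<in>charts Q. \<forall>a\<in>injs Q i j. \<forall>b\<in>injs Q j k.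
        \<forall>x\<in>cpts Q i. \<forall>v\<in>fibre B.
          btrans B i k (comp_injection Q i b a) x v = btrans B j k b (fst a x) (btrans B i j a x v))"


lemma total_space_simps [simp]:
  "charts (total_space Q B) = charts Q"
  "cmfd (total_space Q B) i = prod_space (cmfd Q i) (fibre B)"
  "cgrp (total_space Q B) = cgrp Q"
  "cact (total_space Q B) = eact B"
  "injs (total_space Q B) i j = bundle_injection Q B i j ` injs Q i j"
  "qspace (total_space Q B) = tspace B"
  "proj (total_space Q B) = eproj B"
  by (simp_all add: total_space_def)

lemma mpts_prod_space [simp]: "mpts (prod_space M F) = mpts M \<times> F"
  by (simp add: prod_space_def)

theorem total_space_orbifold:
  assumes Q: "orbifold n Q" and B: "orbifold_vector_bundle n k Q B"
  shows "orbifold (n + k) (total_space Q B)"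
proof -
  let ?E = "total_space Q B"
  have phi_in: "fst a x \<in> cpts Q j" if "i \<in> charts Q" "j \<in> charts Q" "a \<in> injs Q i j" "x \<in> cpts Q i" for i j a x
  proof -
    have "injection Q i j a" using Q that unfolding orbifold_def by blast
    then have "smooth_map_on (cmfd Q i) (cpts Q i) (cmfd Q j) (fst a)"
      by (auto simp: injection_def smooth_open_embedding_def split: prod.splits)
    then show ?thesis using that unfolding smooth_map_on_def
      by (auto simp: continuous_map_def)
  qed
  have lin: "linear_map_on (fibre B) (fibre B) (btrans B i j a x)" "bij_betw (btrans B i j a x) (fibre B) (fibre B)"
    if "i \<in> charts Q" "j \<in> charts Q" "a \<in> injs Q i j" "x \<in> cpts Q i" for i j a x
    using B that unfolding orbifold_vector_bundle_def by blast+
  have coc: "btrans B i k (comp_injection Q i b a) x v = btrans B j k b (fst a x) (btrans B i j a x v)"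
    if "i \<in> charts Q" "j \<in> charts Q" "k \<in> charts Q" "a \<in> injs Q i j" "b \<in> injs Q j k" "x \<in> cpts Q i" "v \<in> fibre B"
    for i j k a b x v using B that unfolding orbifold_vector_bundle_def by blast
  have im: "uset ?E i = {e \<in> topspace (tspace B). bproj B e \<in> uset Q i}" if "i \<in> charts Q" for i
    using B that by (simp only: orbifold_vector_bundle_def)
  have idin: "id_injection Q i \<in> injs Q i i" if "i \<in> charts Q" for i
    using Q that unfolding orbifold_def by blast
  have idid: "comp_injection Q i (id_injection Q i) (id_injection Q i) = id_injection Q i" for i
    by (auto simp: comp_injection_def id_injection_def compose_def restrict_def fun_eq_iff)
  have trid: "btrans B i i (id_injection Q i) x v = v" if i: "i \<in> charts Q" and x: "x \<in> cpts Q i" and v: "v \<in> fibre B" for i x v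
  proof -
    let ?T = "btrans B i i (id_injection Q i) x"
    have "?T v = ?T (?T v)"
      using coc[OF i i i idin[OF i] idin[OF i] x v] x by (simp add: idid) (simp add: id_injection_def)
    moreover have b: "bij_betw ?T (fibre B) (fibre B)" using lin(2)[OF i i idin[OF i] x] .
    ultimately show ?thesis using v
      by (metis bij_betw_apply bij_betw_imp_inj_on inj_on_def)
  qed
  have comp: "bundle_injection Q B i k (comp_injection Q i b a) = comp_injection ?E i (bundle_injection Q B j k b) (bundle_injection Q B i j a)"
    if "i \<in> charts Q" "j \<in> charts Q" "k \<in> charts Q" "a \<in> injs Q i j" "b \<in> injs Q j k" for i j k a b
  proof -
    have "btrans B i j a x v \<in> fibre B" if "x \<in> cpts Q i" "v \<in> fibre B" for x v
      using lin(1)[OF \<open>i \<in> charts Q\<close> \<open>j \<in> charts Q\<close> \<open>a \<in> injs Q i j\<close> that(1)] that(2)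
      unfolding linear_map_on_def by blast
    then show ?thesis
      using phi_in[OF that(1,2,4)] coc[OF that]
      by (auto simp: bundle_injection_def comp_injection_def compose_def fun_eq_iff restrict_def)
  qed
  have idE: "bundle_injection Q B i i (id_injection Q i) = id_injection ?E i" if "i \<in> charts Q" for i
    using trid[OF that] by (auto simp: bundle_injection_def id_injection_def fun_eq_iff restrict_def)
  have topE: "bproj B e \<in> topspace (qspace Q)" if "e \<in> topspace (tspace B)" for e
    proof -
    have "continuous_map (tspace B) (qspace Q) (bproj B)" using B by (simp only: orbifold_vector_bundle_def)
    then show ?thesis using that by (auto simp: continuous_map_def)
  qed
  have cov: "topspace (qspace Q) = (\<Union>i\<in>charts Q. uset Q i)" using Q unfolding orbifold_def by blast
  show ?thesis
    unfolding orbifold_def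
  proof (intro conjI ballI)
    show "Hausdorff_space (qspace ?E)" using B by (simp add: orbifold_vector_bundle_def)
    show "topspace (qspace ?E) = (\<Union>i\<in>charts ?E. uset ?E i)"
    proof -
      have "(\<Union>i\<in>charts ?E. uset ?E i) = (\<Union>i\<in>charts Q. {e \<in> topspace (tspace B). bproj B e \<in> uset Q i})"
        using im by (intro SUP_cong) (simp_all only: total_space_simps)
      also have "\<dots> = topspace (tspace B)" using topE unfolding cov by blast
      finally show ?thesis by (simp only: total_space_simps)
    qed
  next
    fix i assume "i \<in> charts ?E"
    then show "orbifold_chart (n + k) ?E i" using B by (simp add: orbifold_vector_bundle_def)
  next
    fix i j a assume "i \<in> charts ?E" "j \<in> charts ?E" "a \<in> injs ?E i j"
    then show "injection ?E i j a" using B by (auto simp: orbifold_vector_bundle_def)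
  next
    fix i assume "i \<in> charts ?E"
    then show "id_injection ?E i \<in> injs ?E i i" using idE idin by (metis image_eqI total_space_simps(1,5))
  next
    fix i j l a b assume "i \<in> charts ?E" "j \<in> charts ?E" "l \<in> charts ?E" "a \<in> injs ?E i j" "b \<in> injs ?E j l"
    then obtain a' b' where *: "i \<in> charts Q" "j \<in> charts Q" "l \<in> charts Q" "a' \<in> injs Q i j" "b' \<in> injs Q j l"
      "a = bundle_injection Q B i j a'" "b = bundle_injection Q B j l b'" by auto
    have "comp_injection Q i b' a' \<in> injs Q i l" using Q * unfolding orbifold_def by blast
    then show "comp_injection ?E i b a \<in> injs ?E i l" using comp[OF *(1-5)] * by (metis image_eqI total_space_simps(5))
  next
    fix i j e assume i: "i \<in> charts ?E" and j: "j \<in> charts ?E" and e: "e \<in> uset ?E i \<inter> uset ?E j"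
    then have "bproj B e \<in> uset Q i \<inter> uset Q j" "e \<in> topspace (tspace B)" using im[of i] im[of j] by (simp_all only: total_space_simps Int_iff mem_Collect_eq)
    then obtain l where l: "l \<in> charts Q" "bproj B e \<in> uset Q l" "injs Q l i \<noteq> {}" "injs Q l j \<noteq> {}"
    proof -
      have "\<forall>i\<in>charts Q. \<forall>j\<in>charts Q. \<forall>p\<in>uset Q i \<inter> uset Q j.
        \<exists>k\<in>charts Q. p \<in> uset Q k \<and> injs Q k i \<noteq> {} \<and> injs Q k j \<noteq> {}"
        using Q unfolding orbifold_def by (elim conjE) assumption
      moreover have "i \<in> charts Q" "j \<in> charts Q" using i j by simp_all
      ultimately show ?thesis using that \<open>bproj B e \<in> uset Q i \<inter> uset Q j\<close> by fast
    qed
    then show "\<exists>k\<in>charts ?E. e \<in> uset ?E k \<and> injs ?E k i \<noteq> {} \<and> injs ?E k j \<noteq> {}"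
    proof (intro bexI[of _ l] conjI)
      show "e \<in> uset ?E l" unfolding im[OF l(1)] using l(2) \<open>e \<in> topspace (tspace B)\<close> by blast
    qed (use l in auto)
  qed
qed


section \<open>Almost complex structures\<close>

type_synonym ('i, 'x, 'a) endo_field = "'i \<Rightarrow> ('x, 'a) coord \<Rightarrow> 'a \<Rightarrow> 'a \<Rightarrow> 'a"

definition intertwines ::
  "('x \<Rightarrow> 'y) \<Rightarrow> ('x, 'a::euclidean_space) manifold \<Rightarrow> ('y, 'b::euclidean_space) manifold \<Rightarrow>
   (('x, 'a) coord \<Rightarrow> 'a \<Rightarrow> 'a \<Rightarrow> 'a) \<Rightarrow> (('y, 'b) coord \<Rightarrow> 'b \<Rightarrow> 'b \<Rightarrow> 'b) \<Rightarrow> bool" where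
  "intertwines f M N J J' \<longleftrightarrow>
     (\<forall>c\<in>matlas M. \<forall>c'\<in>matlas N. \<forall>y \<in> cmap c ` {x \<in> cdom c. f x \<in> cdom c'}. \<forall>v\<in>cmodel c.
        dir_deriv (local_rep f c c') y (J c y v) =
        J' c' (local_rep f c c' y) (dir_deriv (local_rep f c c') y v))"

definition almost_complex ::
  "('i, 'x, 'a::euclidean_space, 'g, 'm) chart_system_scheme \<Rightarrow> ('i, 'x, 'a) endo_field \<Rightarrow> bool" where
  "almost_complex D J \<longleftrightarrow>
     (\<forall>i\<in>charts D.
        (\<forall>c\<in>matlas (cmfd D i).
           (\<forall>y\<in>cimg c. linear_map_on (cmodel c) (cmodel c) (J i c y) \<and>
              (\<forall>v\<in>cmodel c. J i c y (J i c y v) = - v)) \<and>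
           (\<forall>v\<in>cmodel c. smooth_on (cmodel c) (cimg c) (\<lambda>y. J i c y v))) \<and>
        intertwines (\<lambda>x. x) (cmfd D i) (cmfd D i) (J i) (J i) \<and>
        (\<forall>g\<in>carrier (cgrp D i). intertwines (cact D i g) (cmfd D i) (cmfd D i) (J i) (J i))) \<and>
     (\<forall>i\<in>charts D. \<forall>j\<in>charts D. \<forall>a\<in>injs D i j.
        intertwines (fst a) (cmfd D i) (cmfd D j) (J i) (J j))"

text \<open>
  The degree-shifting number at a point \<open>x\<close> fixed by \<open>g\<close>. The eigenspace of the complex linear map
  \<open>A\<close> for the eigenvalue \<open>e\<^bsup>2 \<pi> i l/m\<^esup>\<close> is a complex subspace; half its real dimension is
  the multiplicity of the eigenvalue.
\<close>

definition degree_shift ::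
  "('i, 'x, 'a::euclidean_space, 'g, 'm) chart_system_scheme \<Rightarrow> ('i, 'x, 'a) endo_field \<Rightarrow> 'i \<Rightarrow> 'x \<Rightarrow> 'g \<Rightarrow> real" where
  "degree_shift D J i x g =
     (let c = (SOME c. c \<in> matlas (cmfd D i) \<and> x \<in> cdom c);
          A = dir_deriv (local_rep (cact D i g) c c) (cmap c x);
          J\<^sub>x = J i c (cmap c x);
          m = group.ord (cgrp D i) g
      in \<Sum>l<m. real l / real m *
           (real (dim {v \<in> cmodel c. A v = cos (2 * pi * real l / real m) *\<^sub>R v
                                          + sin (2 * pi * real l / real m) *\<^sub>R J\<^sub>x v}) / 2))"


section \<open>Sectors\<close>

definition point_elems :: "('i, 'x, 'a::euclidean_space, 'g, 'm) chart_system_scheme \<Rightarrow> ('i \<times> 'g) set" where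
  "point_elems D = {(i, g). i \<in> charts D \<and> (\<exists>x. centre_of D i x) \<and> g \<in> carrier (cgrp D i)}"

text \<open>
  Conjugacy classes in local groups are represented by pairs (chart at a point, group element);
  conjugate elements are identified by the second part of the relation.
\<close>

definition sector_step :: "('i, 'x, 'a::euclidean_space, 'g, 'm) chart_system_scheme \<Rightarrow> (('i \<times> 'g) \<times> ('i \<times> 'g)) set" where
  "sector_step D =
     {((i, g), (j, snd a g)) | i g j a.
        (i, g) \<in> point_elems D \<and> (j, snd a g) \<in> point_elems D \<and> a \<in> injs D i j} \<union>
     {((i, g), (i, h \<otimes>\<^bsub>cgrp D i\<^esub> g \<otimes>\<^bsub>cgrp D i\<^esub> inv\<^bsub>cgrp D i\<^esub> h)) | i g h.
        (i, g) \<in> point_elems D \<and> h \<in> carrier (cgrp D i)}"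

definition sector_classes :: "('i, 'x, 'a::euclidean_space, 'g, 'm) chart_system_scheme \<Rightarrow> ('i \<times> 'g) set set" where
  "sector_classes D =
     point_elems D // ((sector_step D \<union> (sector_step D)\<inverse>)\<^sup>* \<inter> point_elems D \<times> point_elems D)"

definition fixed_pts :: "('i, 'x, 'a, 'g, 'm) chart_system_scheme \<Rightarrow> 'i \<Rightarrow> 'g \<Rightarrow> 'x set" where
  "fixed_pts D i g = {x \<in> cpts D i. cact D i g x = x}"

definition centralizer :: "('g, 'm) monoid_scheme \<Rightarrow> 'g \<Rightarrow> 'g set" where
  "centralizer G g = {h \<in> carrier G. h \<otimes>\<^bsub>G\<^esub> g = g \<otimes>\<^bsub>G\<^esub> h}"

text \<open>
  The charts \<open>{V\<^sup>g, C(g)}\<close> of the sector of the class \<open>t\<close>. They are related by the restrictions of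
  the injections of the charts of \<open>D\<close>, and, as all elements \<open>g\<close> of a conjugacy class get
  a chart, by the action of \<open>h\<close>, which maps \<open>V\<^sup>g\<close> to the fixed-point set of the conjugate of \<open>g\<close>
  by \<open>h\<close>.
\<close>

definition sector ::
  "('i, 'x, 'a::euclidean_space, 'g, 'm) chart_system_scheme \<Rightarrow> ('i \<times> 'g) set \<Rightarrow> ('i \<times> 'g, 'x, 'a, 'g) chart_system" where
  "sector D t =
     \<lparr>charts = t,
      cmfd = (\<lambda>(i, g). submanifold (cmfd D i) (fixed_pts D i g)),
      cgrp = (\<lambda>(i, g). (cgrp D i)\<lparr>carrier := centralizer (cgrp D i) g\<rparr>),
      cact = (\<lambda>(i, g) h. restrict (cact D i h) (fixed_pts D i g)),
      injs = (\<lambda>(i, g) (j, g').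
        {(restrict (fst a) (fixed_pts D i g), restrict (snd a) (centralizer (cgrp D i) g)) | a.
           a \<in> injs D i j \<and> snd a g = g'} \<union>
        {(restrict (cact D i h) (fixed_pts D i g),
          restrict (\<lambda>x. h \<otimes>\<^bsub>cgrp D i\<^esub> x \<otimes>\<^bsub>cgrp D i\<^esub> inv\<^bsub>cgrp D i\<^esub> h) (centralizer (cgrp D i) g)) | h.
           i = j \<and> h \<in> carrier (cgrp D i) \<and> h \<otimes>\<^bsub>cgrp D i\<^esub> g \<otimes>\<^bsub>cgrp D i\<^esub> inv\<^bsub>cgrp D i\<^esub> h = g'})\<rparr>"


section \<open>De Rham cohomology\<close>

type_synonym ('i, 'x, 'a) orb_form = "'i \<Rightarrow> ('x, 'a) form"

definition orb_forms :: "('i, 'x, 'a::euclidean_space, 'g, 'm) chart_system_scheme \<Rightarrow> nat \<Rightarrow> ('i, 'x, 'a) orb_form set" where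
  "orb_forms D d = {\<omega>.
     (\<forall>i. i \<notin> charts D \<longrightarrow> \<omega> i = (\<lambda>_ _ _. 0)) \<and>
     (\<forall>i\<in>charts D. \<omega> i \<in> forms (cmfd D i) d \<and>
        (\<forall>g\<in>carrier (cgrp D i). pullback (cact D i g) (cmfd D i) (cmfd D i) (\<omega> i) = \<omega> i)) \<and>
     (\<forall>i\<in>charts D. \<forall>j\<in>charts D. \<forall>a\<in>injs D i j. pullback (fst a) (cmfd D i) (cmfd D j) (\<omega> j) = \<omega> i)}"

definition orb_d :: "('i, 'x, 'a::euclidean_space, 'g, 'm) chart_system_scheme \<Rightarrow> ('i, 'x, 'a) orb_form \<Rightarrow> ('i, 'x, 'a) orb_form" where
  "orb_d D \<omega> = (\<lambda>i. if i \<in> charts D then ext_d (cmfd D i) (\<omega> i) else (\<lambda>_ _ _. 0))"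

definition closed_forms :: "('i, 'x, 'a::euclidean_space, 'g, 'm) chart_system_scheme \<Rightarrow> nat \<Rightarrow> ('i, 'x, 'a) orb_form monoid" where
  "closed_forms D d =
     \<lparr>carrier = {\<omega> \<in> orb_forms D d. orb_d D \<omega> = (\<lambda>_ _ _ _. 0)},
      mult = (\<lambda>\<omega> \<eta> i c y vs. \<omega> i c y vs + \<eta> i c y vs),
      one = (\<lambda>_ _ _ _. 0)\<rparr>"

fun exact_forms :: "('i, 'x, 'a::euclidean_space, 'g, 'm) chart_system_scheme \<Rightarrow> nat \<Rightarrow> ('i, 'x, 'a) orb_form set" where
  "exact_forms D 0 = {\<lambda>_ _ _ _. 0}"
| "exact_forms D (Suc d) = orb_d D ` orb_forms D d"

definition deRham :: "('i, 'x, 'a::euclidean_space, 'g, 'm) chart_system_scheme \<Rightarrow> nat \<Rightarrow> ('i, 'x, 'a) orb_form set monoid" where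
  "deRham D d = closed_forms D d Mod exact_forms D d"

text \<open>
  The map induced in cohomology by a map given in charts by \<open>f i\<close>, for systems with the same index
  set.
\<close>

definition orb_pullback ::
  "('i \<Rightarrow> 'x \<Rightarrow> 'y) \<Rightarrow> ('i, 'x, 'a::euclidean_space, 'g, 'm) chart_system_scheme \<Rightarrow>
   ('i, 'y, 'b::euclidean_space, 'g, 'm) chart_system_scheme \<Rightarrow> ('i, 'y, 'b) orb_form \<Rightarrow> ('i, 'x, 'a) orb_form" where
  "orb_pullback f D D' \<omega> =
     (\<lambda>i. if i \<in> charts D then pullback (f i) (cmfd D i) (cmfd D' i) (\<omega> i) else (\<lambda>_ _ _. 0))"

definition deRham_pullback ::
  "('i \<Rightarrow> 'x \<Rightarrow> 'y) \<Rightarrow> ('i, 'x, 'a::euclidean_space, 'g, 'm) chart_system_scheme \<Rightarrow>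
   ('i, 'y, 'b::euclidean_space, 'g, 'm) chart_system_scheme \<Rightarrow> nat \<Rightarrow>
   ('i, 'y, 'b) orb_form set \<Rightarrow> ('i, 'x, 'a) orb_form set" where
  "deRham_pullback f D D' d K =
     (\<Union>\<omega>\<in>K. exact_forms D d #>\<^bsub>closed_forms D d\<^esub> orb_pullback f D D' \<omega>)"


section \<open>Chen--Ruan orbifold cohomology\<close>

definition centre :: "('i, 'x, 'a::euclidean_space, 'g, 'm) chart_system_scheme \<Rightarrow> 'i \<Rightarrow> 'x" where
  "centre D i = (SOME x. centre_of D i x)"

text \<open>
  \<open>z\<close> supplies the points at which tangent spaces are taken: the origins of the charts at points for
  \<open>Q\<close>, their images under the zero section for \<open>E\<close>.
\<close>

definition class_shift ::
  "('i, 'x, 'a::euclidean_space, 'g, 'm) chart_system_scheme \<Rightarrow> ('i, 'x, 'a) endo_field \<Rightarrow> ('i \<Rightarrow> 'x) \<Rightarrow> ('i \<times> 'g) set \<Rightarrow> real" where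
  "class_shift D J z t = (let (i, g) = (SOME s. s \<in> t) in degree_shift D J i (z i) g)"

text \<open>
  The direct sum over all degrees \<open>r\<close> and all classes \<open>t \<in> T\<close> of the de Rham groups in degree
  \<open>r - 2 \<iota>(t)\<close>; the summand \<open>(r, t)\<close> has degree \<open>r\<close>, a real number. The argument
  \<open>\<sigma>\<close> is the function \<open>\<iota>\<close>.
\<close>

definition orb_degrees :: "('i \<times> 'g) set set \<Rightarrow> (('i \<times> 'g) set \<Rightarrow> real) \<Rightarrow> (real \<times> ('i \<times> 'g) set) set" where
  "orb_degrees T \<sigma> = {(r, t). t \<in> T \<and> r - 2 * \<sigma> t \<in> \<nat>}"

definition orb_cohomology ::
  "('i, 'x, 'a::euclidean_space, 'g, 'm) chart_system_scheme \<Rightarrow> ('i \<times> 'g) set set \<Rightarrow> (('i \<times> 'g) set \<Rightarrow> real) \<Rightarrow>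
   (real \<times> ('i \<times> 'g) set \<Rightarrow> ('i \<times> 'g, 'x, 'a) orb_form set) monoid" where
  "orb_cohomology D T \<sigma> =
     sum_group (orb_degrees T \<sigma>) (\<lambda>(r, t). deRham (sector D t) (nat \<lfloor>r - 2 * \<sigma> t\<rfloor>))"

definition base_shift :: "('i, 'x, 'a::euclidean_space, 'g, 'q) orbifold_data \<Rightarrow> ('i, 'x, 'a) endo_field \<Rightarrow> ('i \<times> 'g) set \<Rightarrow> real" where
  "base_shift Q J = class_shift Q J (centre Q)"

definition total_shift ::
  "('i, 'x, 'a::euclidean_space, 'g, 'q) orbifold_data \<Rightarrow> ('i, 'x, 'g, 'q, 'f::euclidean_space, 'e) bundle_data \<Rightarrow>
   ('i, 'x \<times> 'f, 'a \<times> 'f) endo_field \<Rightarrow> ('i \<times> 'g) set \<Rightarrow> real" where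
  "total_shift Q B J = class_shift (total_space Q B) J (\<lambda>i. (centre Q i, 0))"

definition H_orb_base where
  "H_orb_base Q J = orb_cohomology Q (sector_classes Q) (base_shift Q J)"

definition H_orb_total where
  "H_orb_total Q B J = orb_cohomology (total_space Q B) (sector_classes Q) (total_shift Q B J)"

text \<open>
  The restriction to the zero section. It maps the summand of class \<open>t\<close> in
  degree \<open>s + 2 \<iota>\<^sub>E(t)\<close> to the one in degree \<open>s + 2 \<iota>\<^sub>Q(t)\<close>.
\<close>

definition zero_section_restriction ::
  "('i, 'x, 'a::euclidean_space, 'g, 'q) orbifold_data \<Rightarrow> ('i, 'x, 'g, 'q, 'f::euclidean_space, 'e) bundle_data \<Rightarrow>
   ('i, 'x, 'a) endo_field \<Rightarrow> ('i, 'x \<times> 'f, 'a \<times> 'f) endo_field \<Rightarrow>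
   (real \<times> ('i \<times> 'g) set \<Rightarrow> ('i \<times> 'g, 'x \<times> 'f, 'a \<times> 'f) orb_form set) \<Rightarrow>
   (real \<times> ('i \<times> 'g) set \<Rightarrow> ('i \<times> 'g, 'x, 'a) orb_form set)" where
  "zero_section_restriction Q B J J' K =
     restrict (\<lambda>(r, t).
       deRham_pullback (\<lambda>_ x. (x, 0)) (sector Q t) (sector (total_space Q B) t)
         (nat \<lfloor>r - 2 * base_shift Q J t\<rfloor>)
         (K (r - 2 * base_shift Q J t + 2 * total_shift Q B J' t, t)))
     (orb_degrees (sector_classes Q) (base_shift Q J))"

end

theory Submission
  imports Defs
begin

text \<open>
  The restriction is treated one class at a time, since both sides are direct sums over the same
  classes and the two degree shifts only relabel the summands. Fibrewise multiplication \<open>v \<mapsto> s v\<close>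
  commutes with the fibrewise linear action of \<open>g\<close>, so it restricts to \<open>(V \<times> \<real>\<^sup>k)\<^sup>g\<close> and
  contracts it onto the zero section over \<open>V\<^sup>g\<close>; it also commutes with the group actions and with
  the injections. Integrating over \<open>s \<in> [0, 1]\<close> the contraction of the pulled back form with
  \<open>\<partial>/\<partial>s\<close> is therefore an operator on invariant forms, and it is a chain homotopy between the
  identity and the composition of the restriction with the pullback along the projection.

  That the fixed-point sets are submanifolds, so that forms on them are given by slice coordinates,
  is seen for \<open>V\<^sup>g\<close> in the linear coordinate of a chart at a point, and for \<open>(V \<times> \<real>\<^sup>k)\<^sup>g\<close> by
  averaging fibre coordinates over the powers of \<open>g\<close>.
\<close>

section \<open>Calculus on relatively open sets\<close>

text \<open>The difficulty sits in the fixed-point sets of the total space. In a chart at a point of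
  \<open>Q\<close> the group is linear, but on the product with the fibre it acts through matrices
  depending on the base point, so no linearising coordinate is given there. Averaged coordinates
  exist only near a given point, and they make g constant on the fibres only over the fixed points
  of g. Inverting the averaging map smoothly needs a theorem on inverses of families of linear maps,
  and the calculus is developed up to that point. Model spaces are subspaces W of a fixed type, and
  a derivative within an open subset of W is determined only in directions of W. Differential
  statements are therefore phrased with \<open>dir_deriv\<close> in such directions, and vectors
  varying with the point are expanded in a fixed basis of W. Every structure map of a sector of E
  covers one of the sector of Q linearly on the fibres. This one fact makes zero section, projection
  and scaling compatible with the structure maps, so the homotopy argument can be done for abstract
  chart systems. The projection after the zero section is the identity strictly, so only one of the
  two compositions needs a homotopy.\<close>

text \<open>Only the expansion formula is recorded, not orthonormality: every later use replaces a
  vector of W by its coordinates.\<close>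

definition onb :: "'a::euclidean_space set \<Rightarrow> 'a set" where
  "onb W = (SOME B. finite B \<and> B \<subseteq> W \<and> (\<forall>w\<in>W. (\<Sum>b\<in>B. (w \<bullet> b) *\<^sub>R b) = w))"

lemma onb:
  fixes W :: "'a::euclidean_space set"
  assumes "subspace W"
  shows "finite (onb W)" "onb W \<subseteq> W" "\<And>w. w \<in> W \<Longrightarrow> (\<Sum>b\<in>onb W. (w \<bullet> b) *\<^sub>R b) = w"
proof -
  obtain B where B: "B \<subseteq> W" "pairwise orthogonal B" "\<And>x. x \<in> B \<Longrightarrow> norm x = 1"
    "independent B" "card B = dim W" "span B = W"
    using orthonormal_basis_subspace[OF assms] by metis
  have "finite B" using B(4) by (rule independent_imp_finite)
  have "finite B \<and> B \<subseteq> W \<and> (\<forall>w\<in>W. (\<Sum>b\<in>B. (w \<bullet> b) *\<^sub>R b) = w)"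
    using B \<open>finite B\<close> by (auto intro: orthonormal_basis_expand)
  then have "finite (onb W) \<and> onb W \<subseteq> W \<and> (\<forall>w\<in>W. (\<Sum>b\<in>onb W. (w \<bullet> b) *\<^sub>R b) = w)"
    unfolding onb_def by (rule someI)
  then show "finite (onb W)" "onb W \<subseteq> W" "\<And>w. w \<in> W \<Longrightarrow> (\<Sum>b\<in>onb W. (w \<bullet> b) *\<^sub>R b) = w"
    by auto
qed

text \<open>A bounded linear retraction onto W. It turns a map known only on W into one on the
  ambient space, as \<open>has_derivative\<close> requires.\<close>

definition oproj :: "'a::euclidean_space set \<Rightarrow> 'a \<Rightarrow> 'a" where
  "oproj W x = (\<Sum>b\<in>onb W. (x \<bullet> b) *\<^sub>R b)"

lemma oproj:
  assumes "subspace W"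
  shows "bounded_linear (oproj W)" "oproj W x \<in> W" "x \<in> W \<Longrightarrow> oproj W x = x"
proof -
  show "bounded_linear (oproj W)"
    unfolding oproj_def[abs_def]
    by (intro bounded_linear_sum bounded_linear_compose[OF bounded_linear_scaleR_left] bounded_linear_inner_left)
  show "oproj W x \<in> W" unfolding oproj_def
    using onb[OF assms] assms by (intro subspace_sum subspace_scale) auto
  show "x \<in> W \<Longrightarrow> oproj W x = x" unfolding oproj_def by (rule onb(3)[OF assms])
qed

definition relopen :: "'a::euclidean_space set \<Rightarrow> 'a set \<Rightarrow> bool" where
  "relopen W S \<longleftrightarrow> subspace W \<and> openin (top_of_set W) S"

lemma relopen_subspace: "relopen W S \<Longrightarrow> subspace W"
  and relopen_subset: "relopen W S \<Longrightarrow> S \<subseteq> W"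
  and relopen_in: "relopen W S \<Longrightarrow> y \<in> S \<Longrightarrow> y \<in> W"
  by (auto simp: relopen_def dest: openin_imp_subset)

text \<open>Differentiability and continuity at y are thereby independent of the open subset of W in
  which they are taken; local arguments pass between neighbourhoods in this way.\<close>

lemma relopen_at:
  assumes "relopen W S" "y \<in> S"
  shows "at y within S = at y within W"
proof -
  obtain U where U: "open U" "S = W \<inter> U"
    using assms by (auto simp: relopen_def openin_open)
  show ?thesis by (rule at_within_nhd[of y U]) (use U assms in auto)
qed

lemma relopen_ball:
  assumes "relopen W S" "y \<in> S"
  obtains e where "e > 0" "relopen W (ball y e \<inter> W)" "ball y e \<inter> W \<subseteq> S" "y \<in> ball y e \<inter> W"
proof -
  obtain e where e: "e > 0" "ball y e \<inter> W \<subseteq> S"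
    using assms unfolding relopen_def openin_contains_ball by blast
  have "openin (top_of_set W) (W \<inter> ball y e)" by (rule openin_open_Int) simp
  then have "relopen W (ball y e \<inter> W)" using assms by (simp add: relopen_def Int_commute)
  then show ?thesis using that e relopen_in[OF assms] by simp
qed

lemma relopen_preimage:
  assumes "relopen W S" "relopen V T" "continuous_on S f" "f ` S \<subseteq> V"
  shows "relopen W {y \<in> S. f y \<in> T}"
proof -
  have "openin (top_of_set S) (S \<inter> f -` T)"
    using assms by (intro continuous_openin_preimage[where T=V]) (auto simp: relopen_def)
  then have "openin (top_of_set W) (S \<inter> f -` T)"
    using assms(1) by (auto simp: relopen_def intro: openin_trans)
  moreover have "S \<inter> f -` T = {y \<in> S. f y \<in> T}" by auto
  ultimately show ?thesis using assms(1) by (simp add: relopen_def)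
qed

lemma relopen_Un_local:
  assumes "subspace W" "\<And>y. y \<in> S \<Longrightarrow> \<exists>T. relopen W T \<and> y \<in> T \<and> T \<subseteq> S"
  shows "relopen W S"
  unfolding relopen_def
proof
  show "openin (top_of_set W) S"
    by (subst openin_subopen) (use assms(2) in \<open>auto simp: relopen_def\<close>)
qed (rule assms(1))

lemma relopen_Times:
  "relopen W S \<Longrightarrow> relopen V T \<Longrightarrow> relopen (W \<times> V) (S \<times> T)"
  by (auto simp: relopen_def intro: subspace_Times openin_Times)

lemma relopen_self: "subspace W \<Longrightarrow> relopen W W"
  by (simp add: relopen_def)

lemma relopen_mono: "relopen W S \<Longrightarrow> subspace V \<Longrightarrow> V \<subseteq> W \<Longrightarrow> relopen V (S \<inter> V)"
  by (auto simp: relopen_def openin_open)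

section \<open>Directional derivatives within a subspace\<close>

text \<open>For v in W the line through y in direction v stays in S for parameters in an open set
  around 0. So the one-variable derivative is two-sided although f is differentiated within S only,
  and \<open>D\<close> is determined on W.\<close>

lemma dir_deriv_eq:
  assumes "relopen W S" "y \<in> S" "v \<in> W" "(f has_derivative D) (at y within S)"
  shows "dir_deriv f y v = D v" "((\<lambda>s. f (y + s *\<^sub>R v)) has_vector_derivative D v) (at 0)"
proof -
  obtain U where U: "open U" "S = W \<inter> U"
    using assms by (auto simp: relopen_def openin_open)
  let ?l = "\<lambda>s::real. y + s *\<^sub>R v"
  let ?T = "?l -` U"
  have W: "subspace W" "y \<in> W" using assms(1,2) by (auto simp: relopen_subspace relopen_in)
  have oT: "open ?T" using U(1) by (intro continuous_open_vimage) (auto intro!: continuous_intros)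
  have T0: "0 \<in> ?T" using U(2) assms(2) by auto
  have TS: "?l ` ?T \<subseteq> S" using U W assms(3) by (auto intro!: subspace_add subspace_scale)
  have l: "(?l has_derivative (\<lambda>s. s *\<^sub>R v)) (at 0 within ?T)"
    by (auto intro!: derivative_eq_intros)
  have "(f has_derivative D) (at (?l 0) within ?l ` ?T)"
    using has_derivative_subset[OF assms(4) TS] by simp
  then have "((\<lambda>s. f (?l s)) has_derivative (\<lambda>s. D (s *\<^sub>R v))) (at 0 within ?T)"
    using has_derivative_in_compose[OF l] by simp
  then have "((\<lambda>s. f (?l s)) has_derivative (\<lambda>s. D (s *\<^sub>R v))) (at 0)"
    using at_within_open[OF T0 oT] by simp
  moreover have "linear D" using assms(4) by (rule has_derivative_linear)
  ultimately show vd: "((\<lambda>s. f (?l s)) has_vector_derivative D v) (at 0)"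
    unfolding has_vector_derivative_def by (simp add: linear_scale)
  show "dir_deriv f y v = D v" unfolding dir_deriv_def
    using vd by (rule vector_derivative_at)
qed

lemma dir_deriv_linear:
  assumes "relopen W S" "y \<in> S" "f differentiable (at y within S)" "u \<in> W" "v \<in> W"
  shows "dir_deriv f y (a *\<^sub>R u + b *\<^sub>R v) = a *\<^sub>R dir_deriv f y u + b *\<^sub>R dir_deriv f y v"
proof -
  obtain D where D: "(f has_derivative D) (at y within S)" using assms(3) by (auto simp: differentiable_def)
  have "a *\<^sub>R u + b *\<^sub>R v \<in> W" using assms by (auto dest: relopen_subspace intro: subspace_add subspace_scale)
  then show ?thesis
    using dir_deriv_eq(1)[OF assms(1,2) _ D] assms(4,5) has_derivative_linear[OF D]
    by (simp add: linear_add linear_scale)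
qed

lemma dir_deriv_local:
  assumes "relopen W S" "y \<in> S" "v \<in> W" "\<And>z. z \<in> S \<Longrightarrow> f z = g z"
  shows "dir_deriv f y v = dir_deriv g y v"
proof -
  obtain U where U: "open U" "S = W \<inter> U"
    using assms by (auto simp: relopen_def openin_open)
  let ?T = "(\<lambda>s::real. y + s *\<^sub>R v) -` U"
  have W: "subspace W" "y \<in> W" using assms(1,2) by (auto simp: relopen_subspace relopen_in)
  have oT: "open ?T" using U(1) by (intro continuous_open_vimage) (auto intro!: continuous_intros)
  have T0: "0 \<in> ?T" using U(2) assms(2) by auto
  have "eventually (\<lambda>s. s \<in> ?T) (nhds 0)" using oT T0 by (rule eventually_nhds_in_open)
  then have "eventually (\<lambda>s. s \<in> UNIV \<longrightarrow> f (y + s *\<^sub>R v) = g (y + s *\<^sub>R v)) (nhds 0)"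
    by eventually_elim (use U W assms(3,4) in \<open>auto intro!: subspace_add subspace_scale\<close>)
  then show ?thesis unfolding dir_deriv_def by (rule vector_derivative_cong_eq) simp_all
qed

lemma dir_deriv_const [simp]: "dir_deriv (\<lambda>z. c) y v = 0"
  by (simp add: dir_deriv_def)

text \<open>Composition with \<open>oproj V\<close> does not change f on S but gives a derivative
  all of whose values lie in V; the directional derivative cannot tell the two derivatives
  apart.\<close>

lemma dir_deriv_in_subspace:
  fixes f :: "'a::euclidean_space \<Rightarrow> 'b::euclidean_space"
  assumes "relopen W S" "y \<in> S" "v \<in> W" "f differentiable (at y within S)"
    "subspace V" "f ` S \<subseteq> V"
  shows "dir_deriv f y v \<in> V"
proof -
  obtain D where D: "(f has_derivative D) (at y within S)" using assms(4) by (auto simp: differentiable_def)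
  interpret P: bounded_linear "oproj V" by (rule oproj(1)[OF assms(5)])
  have D2: "((\<lambda>z. oproj V (f z)) has_derivative (\<lambda>h. oproj V (D h))) (at y within S)"
    by (rule P.has_derivative[OF D])
  have D3: "((\<lambda>z. f z) has_derivative (\<lambda>h. oproj V (D h))) (at y within S)"
    by (rule has_derivative_transform[OF assms(2) _ D2]) (use oproj(3)[OF assms(5)] assms(6) in auto)
  show ?thesis using dir_deriv_eq(1)[OF assms(1-3) D3] oproj(2)[OF assms(5)] by simp
qed

subsection \<open>The classes \<open>C\<^sup>k\<close>\<close>

lemma Ck_on_cong_imp:
  assumes "\<And>y. y \<in> S \<Longrightarrow> f y = g y" "Ck_on r W S f"
  shows "Ck_on r W S g"
proof (cases r)
  case 0
  have "continuous_on S f" using assms(2) 0 by simp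
  then have "continuous_on S g" by (rule continuous_on_eq) (rule assms(1))
  then show ?thesis using 0 by simp
next
  case (Suc r')
  then obtain f' where f': "\<forall>y\<in>S. (f has_derivative f' y) (at y within S)" "\<forall>v\<in>W. Ck_on r' W S (\<lambda>y. f' y v)"
    using assms(2) by auto
  have "\<forall>y\<in>S. (g has_derivative f' y) (at y within S)"
  proof
    fix y assume y: "y \<in> S"
    show "(g has_derivative f' y) (at y within S)"
      by (rule has_derivative_transform[OF y, of g f]) (use assms(1) f'(1) y in auto)
  qed
  then show ?thesis using f'(2) unfolding Suc Ck_on.simps by blast
qed

lemma Ck_on_cong:
  assumes "\<And>y. y \<in> S \<Longrightarrow> f y = g y"
  shows "Ck_on r W S f = Ck_on r W S g"
  using Ck_on_cong_imp[of S f g r W] Ck_on_cong_imp[of S g f r W] assms by auto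

lemma smooth_on_cong: "(\<And>y. y \<in> S \<Longrightarrow> f y = g y) \<Longrightarrow> smooth_on W S f = smooth_on W S g"
  unfolding smooth_on_def using Ck_on_cong by blast

lemma Ck_on_subset:
  "Ck_on r W S f \<Longrightarrow> T \<subseteq> S \<Longrightarrow> V \<subseteq> W \<Longrightarrow> Ck_on r V T f"
proof (induction r arbitrary: f)
  case 0 then show ?case by (auto intro: continuous_on_subset)
next
  case (Suc r)
  then obtain f' where f': "\<forall>y\<in>S. (f has_derivative f' y) (at y within S)" "\<forall>v\<in>W. Ck_on r W S (\<lambda>y. f' y v)"
    by auto
  have "\<forall>y\<in>T. (f has_derivative f' y) (at y within T)"
    using f'(1) Suc.prems has_derivative_subset by blast
  moreover have "\<forall>v\<in>V. Ck_on r V T (\<lambda>y. f' y v)" using f'(2) Suc by blast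
  ultimately show ?case unfolding Ck_on.simps by blast
qed

lemma smooth_on_subset: "smooth_on W S f \<Longrightarrow> T \<subseteq> S \<Longrightarrow> V \<subseteq> W \<Longrightarrow> smooth_on V T f"
  unfolding smooth_on_def using Ck_on_subset by blast

text \<open>The derivative field in the definition of \<open>Ck_on\<close> is arbitrary off W. Since
  it is forced on W, the existential quantifier can be traded for the canonical field
  \<open>dir_deriv f\<close>.\<close>

lemma Ck_on_Suc_iff:
  assumes "relopen W S"
  shows "Ck_on (Suc r) W S f \<longleftrightarrow> (\<forall>y\<in>S. f differentiable (at y within S)) \<and>
     (\<forall>v\<in>W. Ck_on r W S (\<lambda>y. dir_deriv f y v))"
proof
  assume "Ck_on (Suc r) W S f"
  then obtain f' where f': "\<forall>y\<in>S. (f has_derivative f' y) (at y within S)" "\<forall>v\<in>W. Ck_on r W S (\<lambda>y. f' y v)"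
    by auto
  have "Ck_on r W S (\<lambda>y. dir_deriv f y v)" if "v \<in> W" for v
    by (rule Ck_on_cong_imp[where f="\<lambda>y. f' y v"]) (use dir_deriv_eq(1)[OF assms _ that] f' that in fastforce)+
  then show "(\<forall>y\<in>S. f differentiable (at y within S)) \<and> (\<forall>v\<in>W. Ck_on r W S (\<lambda>y. dir_deriv f y v))"
    using f' by (auto simp: differentiable_def)
next
  assume r: "(\<forall>y\<in>S. f differentiable (at y within S)) \<and> (\<forall>v\<in>W. Ck_on r W S (\<lambda>y. dir_deriv f y v))"
  then obtain f' where f': "\<forall>y\<in>S. (f has_derivative f' y) (at y within S)"
    unfolding differentiable_def by metis
  have "Ck_on r W S (\<lambda>y. f' y v)" if "v \<in> W" for v
    by (rule Ck_on_cong_imp[where f="\<lambda>y. dir_deriv f y v"]) (use dir_deriv_eq(1)[OF assms _ that] f' r that in fastforce)+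
  then show "Ck_on (Suc r) W S f" using f' by auto
qed

lemma Ck_on_continuous: "Ck_on r W S f \<Longrightarrow> continuous_on S f"
  by (cases r) (auto intro: has_derivative_continuous_on)

lemma Ck_on_Suc: "relopen W S \<Longrightarrow> Ck_on (Suc r) W S f \<Longrightarrow> Ck_on r W S f"
proof (induction r arbitrary: f)
  case 0 then show ?case using Ck_on_continuous[of 1] by simp
next
  case (Suc r) then show ?case using Ck_on_Suc_iff by blast
qed

lemma smooth_on_continuous: "smooth_on W S f \<Longrightarrow> continuous_on S f"
  unfolding smooth_on_def using Ck_on_continuous by blast

lemma smooth_on_differentiable: "smooth_on W S f \<Longrightarrow> y \<in> S \<Longrightarrow> f differentiable (at y within S)"
  unfolding smooth_on_def by (metis Ck_on.simps(2) differentiable_def)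

lemma smooth_on_dir_deriv: "relopen W S \<Longrightarrow> smooth_on W S f \<Longrightarrow> v \<in> W \<Longrightarrow> smooth_on W S (\<lambda>y. dir_deriv f y v)"
  unfolding smooth_on_def using Ck_on_Suc_iff by blast

lemma smooth_on_has_derivative:
  assumes "relopen W S" "smooth_on W S f" "y \<in> S"
  obtains D where "(f has_derivative D) (at y within S)" "\<And>v. v \<in> W \<Longrightarrow> D v = dir_deriv f y v"
  using smooth_on_differentiable[OF assms(2,3)] dir_deriv_eq(1)[OF assms(1,3)]
  unfolding differentiable_def by metis

lemma Ck_on_local:
  assumes "relopen W S" "\<And>y. y \<in> S \<Longrightarrow> \<exists>T. relopen W T \<and> y \<in> T \<and> T \<subseteq> S \<and> Ck_on r W T f"
  shows "Ck_on r W S f"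
  using assms(2)
proof (induction r arbitrary: f)
  case 0
  have "continuous (at y within S) f" if y: "y \<in> S" for y
  proof -
    obtain T where T: "relopen W T" "y \<in> T" "T \<subseteq> S" "continuous_on T f" using 0[OF y] by (auto simp only: Ck_on.simps)
    then have "continuous (at y within T) f" by (simp add: continuous_on_eq_continuous_within)
    then show ?thesis using relopen_at[OF T(1,2)] relopen_at[OF assms(1) y] by simp
  qed
  then show ?case by (simp add: continuous_on_eq_continuous_within)
next
  case (Suc r)
  have *: "\<exists>T. relopen W T \<and> y \<in> T \<and> T \<subseteq> S \<and> f differentiable (at y within S) \<and> (\<forall>v\<in>W. Ck_on r W T (\<lambda>y. dir_deriv f y v))"
    if y: "y \<in> S" for y
  proof -
    obtain T where T: "relopen W T" "y \<in> T" "T \<subseteq> S" "Ck_on (Suc r) W T f" using Suc.prems[OF y] by auto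
    then show ?thesis
      using Ck_on_Suc_iff[OF T(1)] relopen_at[OF T(1,2)] relopen_at[OF assms(1) y] by metis
  qed
  show ?case unfolding Ck_on_Suc_iff[OF assms(1)]
  proof (intro conjI ballI)
    fix v assume "v \<in> W" then show "Ck_on r W S (\<lambda>y. dir_deriv f y v)"
      using * by (intro Suc.IH) blast
  qed (use * in blast)
qed

lemma smooth_on_local:
  assumes "relopen W S" "\<And>y. y \<in> S \<Longrightarrow> \<exists>T. relopen W T \<and> y \<in> T \<and> T \<subseteq> S \<and> smooth_on W T f"
  shows "smooth_on W S f"
  unfolding smooth_on_def using Ck_on_local[OF assms(1)] assms(2) unfolding smooth_on_def by meson

lemma Ck_on_const: "Ck_on r W S (\<lambda>_. c)"
proof (induction r arbitrary: c)
  case (Suc r) then show ?case unfolding Ck_on.simps by (intro exI[of _ "\<lambda>_ _. 0"]) simp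
qed simp

lemma Ck_on_bounded_linear:
  assumes "bounded_linear h" shows "Ck_on r W S h"
proof (cases r)
  case 0 then show ?thesis using assms by (simp add: linear_continuous_on)
next
  case (Suc r')
  have "\<forall>y\<in>S. (h has_derivative h) (at y within S)" using assms bounded_linear_imp_has_derivative by blast
  moreover have "\<forall>v\<in>W. Ck_on r' W S (\<lambda>y. h v)" by (simp add: Ck_on_const)
  ultimately show ?thesis unfolding Suc Ck_on.simps by (intro exI[of _ "\<lambda>_. h"]) simp
qed

lemma Ck_on_bounded_linear_comp: "bounded_linear h \<Longrightarrow> Ck_on r W S f \<Longrightarrow> Ck_on r W S (\<lambda>y. h (f y))"
proof (induction r arbitrary: f)
  case 0 then show ?case by (simp add: bounded_linear.continuous_on)
next
  case (Suc r)
  then obtain f' where f': "\<forall>y\<in>S. (f has_derivative f' y) (at y within S)" "\<forall>v\<in>W. Ck_on r W S (\<lambda>y. f' y v)"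
    by auto
  have "\<forall>y\<in>S. ((\<lambda>y. h (f y)) has_derivative (\<lambda>v. h (f' y v))) (at y within S)"
    using f' bounded_linear.has_derivative[OF Suc.prems(1)] by blast
  moreover have "\<forall>v\<in>W. Ck_on r W S (\<lambda>y. h (f' y v))" using f' Suc by blast
  ultimately show ?case unfolding Ck_on.simps by (intro exI[of _ "\<lambda>y v. h (f' y v)"] conjI)
qed

lemma Ck_on_add: "Ck_on r W S f \<Longrightarrow> Ck_on r W S g \<Longrightarrow> Ck_on r W S (\<lambda>y. f y + g y)"
proof (induction r arbitrary: f g)
  case 0 then show ?case by (auto intro: continuous_intros)
next
  case (Suc r)
  then obtain f' g' where f': "\<forall>y\<in>S. (f has_derivative f' y) (at y within S)" "\<forall>v\<in>W. Ck_on r W S (\<lambda>y. f' y v)"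
     "\<forall>y\<in>S. (g has_derivative g' y) (at y within S)" "\<forall>v\<in>W. Ck_on r W S (\<lambda>y. g' y v)"
    by auto
  have "\<forall>v\<in>W. Ck_on r W S (\<lambda>y. f' y v + g' y v)" using f' Suc by blast
  moreover have "\<forall>y\<in>S. ((\<lambda>y. f y + g y) has_derivative (\<lambda>v. f' y v + g' y v)) (at y within S)"
    using f' has_derivative_add by blast
  ultimately show ?case unfolding Ck_on.simps by (intro exI[of _ "\<lambda>y v. f' y v + g' y v"] conjI)
qed

lemma Ck_on_bilinear:
  assumes "bounded_bilinear p" "relopen W S"
  shows "Ck_on r W S f \<Longrightarrow> Ck_on r W S g \<Longrightarrow> Ck_on r W S (\<lambda>y. p (f y) (g y))"
proof (induction r arbitrary: f g)
  case 0 then show ?case using assms(1) by (auto intro: bounded_bilinear.continuous_on)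
next
  case (Suc r)
  then obtain f' g' where f': "\<forall>y\<in>S. (f has_derivative f' y) (at y within S)" "\<forall>v\<in>W. Ck_on r W S (\<lambda>y. f' y v)"
     "\<forall>y\<in>S. (g has_derivative g' y) (at y within S)" "\<forall>v\<in>W. Ck_on r W S (\<lambda>y. g' y v)"
    by auto
  have "\<forall>v\<in>W. Ck_on r W S (\<lambda>y. p (f y) (g' y v) + p (f' y v) (g y))"
    using f' Ck_on_Suc[OF assms(2) Suc.prems(1)] Ck_on_Suc[OF assms(2) Suc.prems(2)]
    by (intro ballI Ck_on_add Suc.IH) (simp_all only: Ball_def)
  moreover have "\<forall>y\<in>S. ((\<lambda>y. p (f y) (g y)) has_derivative (\<lambda>v. p (f y) (g' y v) + p (f' y v) (g y))) (at y within S)"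
    using f' bounded_bilinear.FDERIV[OF assms(1)] by blast
  ultimately show ?case unfolding Ck_on.simps
    by (intro exI[of _ "\<lambda>y v. p (f y) (g' y v) + p (f' y v) (g y)"] conjI)
qed

lemma Ck_on_sum: "(\<And>i. i \<in> I \<Longrightarrow> Ck_on r W S (f i)) \<Longrightarrow> Ck_on r W S (\<lambda>y. \<Sum>i\<in>I. f i y)"
  by (induction I rule: infinite_finite_induct) (auto intro: Ck_on_add Ck_on_const)

text \<open>In the derivative \<open>g' (f y) (f' y v)\<close> the inner vector moves with y,
  whereas the induction hypothesis covers only constant directions of V. Expanding that vector in
  \<open>onb V\<close> gives a finite sum of products of a coordinate of \<open>f' y v\<close> with
  a derivative of g in a fixed direction.\<close>

lemma Ck_on_compose:
  assumes S: "relopen W S" and T: "relopen V T"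
  shows "Ck_on r W S f \<Longrightarrow> f ` S \<subseteq> T \<Longrightarrow> Ck_on r V T g \<Longrightarrow> Ck_on r W S (\<lambda>y. g (f y))"
proof (induction r arbitrary: f g)
  case 0 then show ?case by (auto intro: continuous_on_compose2)
next
  case (Suc r)
  note V = relopen_subspace[OF T]
  obtain f' g' where f': "\<forall>y\<in>S. (f has_derivative f' y) (at y within S)" "\<forall>v\<in>W. Ck_on r W S (\<lambda>y. f' y v)"
     "\<forall>y\<in>T. (g has_derivative g' y) (at y within T)" "\<forall>v\<in>V. Ck_on r V T (\<lambda>y. g' y v)"
    using Suc.prems by auto
  have fr: "Ck_on r W S f" using Ck_on_Suc[OF S] Suc.prems by blast
  have D: "((\<lambda>y. g (f y)) has_derivative (\<lambda>v. g' (f y) (f' y v))) (at y within S)" if "y \<in> S" for y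
    using f' Suc.prems(2) that has_derivative_in_compose2[of T g g' f S y "f' y"] by blast
  have "Ck_on r W S (\<lambda>y. g' (f y) (f' y v))" if v: "v \<in> W" for v
  proof -
    have "g' (f y) (f' y v) = (\<Sum>b\<in>onb V. (f' y v \<bullet> b) *\<^sub>R g' (f y) b)" if y: "y \<in> S" for y
    proof -
      have fy: "(f has_derivative f' y) (at y within S)" "(g has_derivative g' (f y)) (at (f y) within T)"
        using f' y Suc.prems(2) by blast+
      have "f' y v \<in> V"
        using dir_deriv_in_subspace[OF S y v _ V, of f] dir_deriv_eq(1)[OF S y v fy(1)] fy(1)
          Suc.prems(2) relopen_subset[OF T] by (auto simp: differentiable_def)
      then have "g' (f y) (f' y v) = g' (f y) (\<Sum>b\<in>onb V. (f' y v \<bullet> b) *\<^sub>R b)"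
        using onb(3)[OF V] by simp
      also have "\<dots> = (\<Sum>b\<in>onb V. (f' y v \<bullet> b) *\<^sub>R g' (f y) b)"
        using has_derivative_linear[OF fy(2)] by (simp add: linear_sum linear_scale)
      finally show ?thesis .
    qed
    moreover have "Ck_on r W S (\<lambda>y. \<Sum>b\<in>onb V. (f' y v \<bullet> b) *\<^sub>R g' (f y) b)"
    proof (intro Ck_on_sum Ck_on_bilinear[OF bounded_bilinear_scaleR S])
      fix b assume b: "b \<in> onb V"
      show "Ck_on r W S (\<lambda>y. f' y v \<bullet> b)"
        using f'(2) v by (intro Ck_on_bounded_linear_comp[OF bounded_linear_inner_left]) auto
      show "Ck_on r W S (\<lambda>y. g' (f y) b)"
        using f'(4) b onb(2)[OF V] fr Suc.prems(2) by (intro Suc.IH) auto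
    qed
    ultimately show ?thesis by (simp cong: Ck_on_cong)
  qed
  then show ?case using D unfolding Ck_on.simps by (intro exI[of _ "\<lambda>y v. g' (f y) (f' y v)"] conjI ballI)
qed

lemma smooth_on_compose:
  "relopen W S \<Longrightarrow> relopen V T \<Longrightarrow> smooth_on W S f \<Longrightarrow> f ` S \<subseteq> T \<Longrightarrow> smooth_on V T g \<Longrightarrow> smooth_on W S (\<lambda>y. g (f y))"
  unfolding smooth_on_def by (auto intro: Ck_on_compose[of W S V T])

lemma smooth_on_const: "smooth_on W S (\<lambda>_. c)"
  unfolding smooth_on_def by (simp add: Ck_on_const)

lemma smooth_on_bounded_linear: "bounded_linear h \<Longrightarrow> smooth_on W S h"
  unfolding smooth_on_def by (simp add: Ck_on_bounded_linear)

lemma smooth_on_bounded_linear_comp: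
  "bounded_linear h \<Longrightarrow> smooth_on W S f \<Longrightarrow> smooth_on W S (\<lambda>y. h (f y))"
  unfolding smooth_on_def by (simp add: Ck_on_bounded_linear_comp)

lemma smooth_on_add: "smooth_on W S f \<Longrightarrow> smooth_on W S g \<Longrightarrow> smooth_on W S (\<lambda>y. f y + g y)"
  unfolding smooth_on_def by (simp add: Ck_on_add)

lemma smooth_on_sum:
  "(\<And>i. i \<in> I \<Longrightarrow> smooth_on W S (f i)) \<Longrightarrow> smooth_on W S (\<lambda>y. \<Sum>i\<in>I. f i y)"
  unfolding smooth_on_def by (simp add: Ck_on_sum)

lemma smooth_on_bilinear:
  "bounded_bilinear p \<Longrightarrow> relopen W S \<Longrightarrow> smooth_on W S f \<Longrightarrow> smooth_on W S g \<Longrightarrow> smooth_on W S (\<lambda>y. p (f y) (g y))"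
  unfolding smooth_on_def by (simp add: Ck_on_bilinear)

lemma smooth_on_minus: "smooth_on W S f \<Longrightarrow> smooth_on W S (\<lambda>y. - f y)"
  by (rule smooth_on_bounded_linear_comp[OF bounded_linear_minus[OF bounded_linear_ident]])

lemma smooth_on_diff: "smooth_on W S f \<Longrightarrow> smooth_on W S g \<Longrightarrow> smooth_on W S (\<lambda>y. f y - g y)"
  using smooth_on_add[OF _ smooth_on_minus] by fastforce

lemma smooth_on_cmult: "smooth_on W S f \<Longrightarrow> smooth_on W S (\<lambda>y. (c::real) * f y)"
  by (rule smooth_on_bounded_linear_comp[OF bounded_linear_mult_right])

lemma smooth_on_Pair:
  assumes "smooth_on W S f" "smooth_on W S g"
  shows "smooth_on W S (\<lambda>y. (f y, g y))"
proof -
  have "smooth_on W S (\<lambda>y. (f y, 0) + (0, g y))"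
    using assms by (intro smooth_on_add smooth_on_bounded_linear_comp[where h="\<lambda>x. (x, 0)"]
       smooth_on_bounded_linear_comp[where h="\<lambda>x. (0, x)"]) (auto intro: bounded_linear_Pair bounded_linear_ident bounded_linear_zero)
  then show ?thesis by simp
qed

lemma smooth_on_snd: "smooth_on W S f \<Longrightarrow> smooth_on W S (\<lambda>y. snd (f y))"
  by (rule smooth_on_bounded_linear_comp[OF bounded_linear_snd])

lemma dir_deriv_chain:
  assumes "relopen W S" "relopen V T" "smooth_on W S f" "f ` S \<subseteq> T" "smooth_on V T g" "y \<in> S" "v \<in> W"
  shows "dir_deriv (\<lambda>y. g (f y)) y v = dir_deriv g (f y) (dir_deriv f y v)"
proof -
  obtain D where D: "(f has_derivative D) (at y within S)" "D v = dir_deriv f y v"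
    using smooth_on_has_derivative[OF assms(1,3,6)] assms(7) by metis
  have fy: "f y \<in> T" using assms by auto
  obtain E where E: "(g has_derivative E) (at (f y) within T)" "\<And>v. v \<in> V \<Longrightarrow> E v = dir_deriv g (f y) v"
    using smooth_on_has_derivative[OF assms(2,5) fy] by metis
  have "((\<lambda>y. g (f y)) has_derivative (\<lambda>v. E (D v))) (at y within S)"
    using has_derivative_in_compose[OF D(1) has_derivative_subset[OF E(1) assms(4)]] .
  then have "dir_deriv (\<lambda>y. g (f y)) y v = E (D v)"
    using dir_deriv_eq(1)[OF assms(1,6,7)] by blast
  also have "\<dots> = dir_deriv g (f y) (D v)"
  proof (rule E(2))
    show "D v \<in> V" unfolding D(2)
      using assms relopen_subset[OF assms(2)] relopen_subspace[OF assms(2)]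
      by (intro dir_deriv_in_subspace[OF assms(1,6,7)] smooth_on_differentiable[OF assms(3)]) auto
  qed
  finally show ?thesis using D(2) by simp
qed

lemma dir_deriv_image:
  fixes f :: "'a::euclidean_space \<Rightarrow> 'b::euclidean_space"
  assumes "relopen W S" "smooth_on W S f" "f ` S \<subseteq> V" "subspace V" "y \<in> S" "v \<in> W"
  shows "dir_deriv f y v \<in> V"
  using dir_deriv_in_subspace[OF assms(1,5,6) _ assms(4,3)] smooth_on_differentiable[OF assms(2,5)] by blast

lemma dir_deriv_bounded_linear:
  fixes h :: "'a::euclidean_space \<Rightarrow> 'b::real_normed_vector"
  shows "bounded_linear h \<Longrightarrow> dir_deriv h y v = h v"
  using dir_deriv_eq(1)[of UNIV UNIV y v h h]
  by (auto simp: relopen_def intro: bounded_linear_imp_has_derivative)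

lemma dir_deriv_ident [simp]: "dir_deriv (\<lambda>z::'a::euclidean_space. z) y v = v"
  by (rule dir_deriv_bounded_linear) (rule bounded_linear_ident)

lemma dir_deriv_add:
  assumes "relopen W S" "smooth_on W S f" "smooth_on W S g" "y \<in> S" "v \<in> W"
  shows "dir_deriv (\<lambda>y. f y + g y) y v = dir_deriv f y v + dir_deriv g y v"
proof -
  obtain D E where "(f has_derivative D) (at y within S)" "D v = dir_deriv f y v"
     "(g has_derivative E) (at y within S)" "E v = dir_deriv g y v"
    using smooth_on_has_derivative[OF assms(1,2,4)] smooth_on_has_derivative[OF assms(1,3,4)] assms(5) by metis
  then show ?thesis using dir_deriv_eq(1)[OF assms(1,4,5) has_derivative_add] by fastforce
qed

lemma dir_deriv_bilinear:
  assumes "bounded_bilinear p" "relopen W S" "smooth_on W S f" "smooth_on W S g" "y \<in> S" "v \<in> W"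
  shows "dir_deriv (\<lambda>y. p (f y) (g y)) y v = p (f y) (dir_deriv g y v) + p (dir_deriv f y v) (g y)"
proof -
  obtain D E where "(f has_derivative D) (at y within S)" "D v = dir_deriv f y v"
     "(g has_derivative E) (at y within S)" "E v = dir_deriv g y v"
    using smooth_on_has_derivative[OF assms(2,3,5)] smooth_on_has_derivative[OF assms(2,4,5)] assms(6) by metis
  then show ?thesis using dir_deriv_eq(1)[OF assms(2,5,6) bounded_bilinear.FDERIV[OF assms(1)]] by fastforce
qed

lemma dir_deriv_bounded_linear_comp:
  assumes "relopen W S" "smooth_on W S f" "bounded_linear h" "y \<in> S" "v \<in> W"
  shows "dir_deriv (\<lambda>y. h (f y)) y v = h (dir_deriv f y v)"
proof -
  obtain D where "(f has_derivative D) (at y within S)" "D v = dir_deriv f y v"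
    using smooth_on_has_derivative[OF assms(1,2,4)] assms(5) by metis
  then show ?thesis using dir_deriv_eq(1)[OF assms(1,4,5) bounded_linear.has_derivative[OF assms(3)]] by fastforce
qed

lemma dir_deriv_cmult:
  assumes "relopen W S" "smooth_on W S f" "y \<in> S" "v \<in> W"
  shows "dir_deriv (\<lambda>y. (c::real) * f y) y v = c * dir_deriv f y v"
  using dir_deriv_bounded_linear_comp[OF assms(1,2) bounded_linear_mult_right assms(3,4)] .

lemma dir_deriv_sum:
  assumes "relopen W S" "\<And>i. i \<in> I \<Longrightarrow> smooth_on W S (f i)" "y \<in> S" "v \<in> W"
  shows "dir_deriv (\<lambda>y. \<Sum>i\<in>I. f i y) y v = (\<Sum>i\<in>I. dir_deriv (f i) y v)"
  using assms(2)
proof (induction I rule: infinite_finite_induct)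
  case (insert i I)
  then have "dir_deriv (\<lambda>y. f i y + (\<Sum>i\<in>I. f i y)) y v = dir_deriv (f i) y v + dir_deriv (\<lambda>y. \<Sum>i\<in>I. f i y) y v"
    by (intro dir_deriv_add[OF assms(1)] assms(3,4) smooth_on_sum) auto
  then show ?case using insert by simp
qed simp_all

lemma dir_deriv_pair:
  assumes "relopen W S" "smooth_on W S f" "smooth_on W S g" "y \<in> S" "v \<in> W"
  shows "dir_deriv (\<lambda>y. (f y, g y)) y v = (dir_deriv f y v, dir_deriv g y v)"
proof -
  obtain D E where "(f has_derivative D) (at y within S)" "D v = dir_deriv f y v"
     "(g has_derivative E) (at y within S)" "E v = dir_deriv g y v"
    using smooth_on_has_derivative[OF assms(1,2,4)] smooth_on_has_derivative[OF assms(1,3,4)] assms(5) by metis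
  then show ?thesis using dir_deriv_eq(1)[OF assms(1,4,5) has_derivative_Pair] by fastforce
qed

subsection \<open>Symmetry of second derivatives\<close>

lemma line_deriv:
  assumes "relopen W S" "smooth_on W S f" "v \<in> W" "y + t *\<^sub>R v \<in> S"
  shows "((\<lambda>r. f (y + r *\<^sub>R v)) has_vector_derivative dir_deriv f (y + t *\<^sub>R v) v) (at t)"
proof -
  obtain D where D: "(f has_derivative D) (at (y + t *\<^sub>R v) within S)" "D v = dir_deriv f (y + t *\<^sub>R v) v"
    using smooth_on_has_derivative[OF assms(1,2,4)] assms(3) by metis
  have 1: "((\<lambda>s. f (y + t *\<^sub>R v + s *\<^sub>R v)) has_vector_derivative dir_deriv f (y + t *\<^sub>R v) v) (at (t - t))"
    using dir_deriv_eq(2)[OF assms(1,4,3) D(1)] D(2) by simp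
  have 2: "((\<lambda>r. r - t) has_vector_derivative 1) (at t)"
    by (auto intro!: derivative_eq_intros)
  have 3: "(\<lambda>s. f (y + t *\<^sub>R v + s *\<^sub>R v)) \<circ> (\<lambda>r. r - t) = (\<lambda>r. f (y + r *\<^sub>R v))"
    by (auto simp: algebra_simps fun_eq_iff)
  show ?thesis using vector_diff_chain_at[OF 2 1] unfolding 3 by simp
qed

text \<open>The increment of f in direction w is the integral of its w-derivative. Differentiating
  this identity in direction v under the integral, and then in the upper limit s at 0, gives both
  second derivatives of the same function.\<close>

lemma dir_deriv_commute:
  fixes f :: "'a::euclidean_space \<Rightarrow> 'b::euclidean_space"
  assumes W: "relopen W S" and f: "smooth_on W S f" and y: "y \<in> S" and v: "v \<in> W" and w: "w \<in> W"
  shows "dir_deriv (\<lambda>z. dir_deriv f z v) y w = dir_deriv (\<lambda>z. dir_deriv f z w) y v"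
proof -
  obtain e where e: "e > 0" "ball y e \<inter> W \<subseteq> S"
    using relopen_ball[OF W y] by metis
  \<comment> \<open>Parallelograms with both parameters below \<delta> stay in the ball of radius e;
    the summand 1 keeps the denominator positive when v and w vanish.\<close>
  define \<delta> where "\<delta> = e / (norm v + norm w + 1)"
  have pos: "norm v + norm w + 1 > 0" by (simp add: add_nonneg_pos)
  have \<delta>: "\<delta> > 0" using e pos by (simp add: \<delta>_def)
  note sW = relopen_subspace[OF W]
  have yW: "y \<in> W" using relopen_in[OF W y] .
  have inS: "y + t *\<^sub>R v + s *\<^sub>R w \<in> S" if "\<bar>t\<bar> < \<delta>" "\<bar>s\<bar> < \<delta>" for t s
  proof -
    have "norm (t *\<^sub>R v + s *\<^sub>R w) \<le> \<bar>t\<bar> * norm v + \<bar>s\<bar> * norm w"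
      by (metis norm_scaleR norm_triangle_ineq)
    also have "\<dots> \<le> \<delta> * norm v + \<delta> * norm w"
      using that by (intro add_mono mult_right_mono) auto
    also have "\<dots> < \<delta> * (norm v + norm w + 1)" using \<delta> by (simp add: algebra_simps)
    also have "\<dots> = e" using pos by (simp add: \<delta>_def)
    finally have "norm (t *\<^sub>R v + s *\<^sub>R w) < e" .
    moreover have "dist y (y + t *\<^sub>R v + s *\<^sub>R w) = norm (t *\<^sub>R v + s *\<^sub>R w)"
      by (subst dist_commute) (simp add: dist_norm add.assoc)
    ultimately have "y + t *\<^sub>R v + s *\<^sub>R w \<in> ball y e" by simp
    moreover have "y + t *\<^sub>R v + s *\<^sub>R w \<in> W"
      using sW yW v w by (intro subspace_add subspace_scale)
    ultimately show ?thesis using e by auto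
  qed
  have ac: "y + t *\<^sub>R v + s *\<^sub>R w = (y + s *\<^sub>R w) + t *\<^sub>R v" for t s by simp
  have acg: "(\<lambda>t. g (y + t *\<^sub>R v + s *\<^sub>R w)) = (\<lambda>t. g ((y + s *\<^sub>R w) + t *\<^sub>R v))" for g :: "'a \<Rightarrow> 'b" and s
    by (intro ext arg_cong[where f=g] ac)
  define fw where "fw = (\<lambda>z. dir_deriv f z w)"
  define fv where "fv = (\<lambda>z. dir_deriv f z v)"
  have sfw: "smooth_on W S fw" "smooth_on W S (\<lambda>z. dir_deriv fw z v)" "smooth_on W S fv"
    unfolding fw_def fv_def using f v w by (auto intro!: smooth_on_dir_deriv[OF W])
  let ?U = "{-\<delta><..<\<delta>}"
  define b where "b = \<delta> / 2"
  have b: "0 < b" "b < \<delta>" using \<delta> by (auto simp: b_def)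
  have cts: "continuous_on A (\<lambda>p. g (y + a p *\<^sub>R v + c p *\<^sub>R w))"
    if "smooth_on W S g" "continuous_on A a" "continuous_on A c" "\<And>p. p \<in> A \<Longrightarrow> \<bar>a p\<bar> < \<delta> \<and> \<bar>c p\<bar> < \<delta>"
    for A :: "'z::topological_space set" and a c and g :: "'a \<Rightarrow> 'b"
    by (rule continuous_on_compose2[OF smooth_on_continuous[OF that(1)]])
       (use that(2-4) inS in \<open>auto intro!: continuous_intros\<close>)
  have ftc: "integral (cbox 0 s) (\<lambda>r. fw (y + t *\<^sub>R v + r *\<^sub>R w)) = f (y + t *\<^sub>R v + s *\<^sub>R w) - f (y + t *\<^sub>R v)"
    if "\<bar>t\<bar> < \<delta>" "0 \<le> s" "s \<le> b" for t s
  proof -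
    have "((\<lambda>r. fw (y + t *\<^sub>R v + r *\<^sub>R w)) has_integral
        f (y + t *\<^sub>R v + s *\<^sub>R w) - f (y + t *\<^sub>R v + 0 *\<^sub>R w)) {0..s}"
      unfolding fw_def using that b
      by (intro fundamental_theorem_of_calculus has_vector_derivative_at_within[OF line_deriv[OF W f w]] inS) auto
    then show ?thesis by (auto intro: integral_unique)
  qed
  \<comment> \<open>Both sides come from differentiating \<open>ftc\<close> with respect to t at 0:
    the integral by the Leibniz rule, the increment of f along the two lines in direction v.\<close>
  have main: "fv (y + s *\<^sub>R w) = fv y + integral {0..s} (\<lambda>r. dir_deriv fw (y + r *\<^sub>R w) v)"
    if s: "0 \<le> s" "s \<le> b" for s
  proof -
    have "((\<lambda>t. integral (cbox 0 s) (\<lambda>r. fw (y + t *\<^sub>R v + r *\<^sub>R w))) has_vector_derivative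
        integral (cbox 0 s) (\<lambda>r. dir_deriv fw (y + 0 *\<^sub>R v + r *\<^sub>R w) v)) (at 0 within ?U)"
    proof (rule leibniz_rule_vector_derivative)
      fix t r assume tr: "t \<in> ?U" "r \<in> cbox 0 s"
      have "((\<lambda>t. fw ((y + r *\<^sub>R w) + t *\<^sub>R v)) has_vector_derivative dir_deriv fw ((y + r *\<^sub>R w) + t *\<^sub>R v) v) (at t)"
        by (rule line_deriv[OF W sfw(1) v]) (use inS[of t r] tr s b ac[of t r] in auto)
      then show "((\<lambda>t. fw (y + t *\<^sub>R v + r *\<^sub>R w)) has_vector_derivative dir_deriv fw (y + t *\<^sub>R v + r *\<^sub>R w) v) (at t within ?U)"
        unfolding acg[of fw r] ac[of t r] by (rule has_vector_derivative_at_within)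
    next
      fix t assume "t \<in> ?U" then show "(\<lambda>r. fw (y + t *\<^sub>R v + r *\<^sub>R w)) integrable_on cbox 0 s"
        using s b by (intro integrable_continuous cts[OF sfw(1)] continuous_intros) auto
    next
      show "continuous_on (?U \<times> cbox 0 s) (\<lambda>(t, r). dir_deriv fw (y + t *\<^sub>R v + r *\<^sub>R w) v)"
        unfolding case_prod_unfold
        using s b by (intro cts[OF sfw(2)] continuous_intros) auto
    qed (use \<delta> in auto)
    moreover have "((\<lambda>t. integral (cbox 0 s) (\<lambda>r. fw (y + t *\<^sub>R v + r *\<^sub>R w))) has_vector_derivative
        fv (y + 0 *\<^sub>R v + s *\<^sub>R w) - fv (y + 0 *\<^sub>R v)) (at 0 within ?U)"
    proof (rule has_vector_derivative_transform[where f="\<lambda>t. f (y + t *\<^sub>R v + s *\<^sub>R w) - f (y + t *\<^sub>R v)"])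
      have "((\<lambda>t. f ((y + s *\<^sub>R w) + t *\<^sub>R v)) has_vector_derivative fv ((y + s *\<^sub>R w) + 0 *\<^sub>R v)) (at 0)"
        unfolding fv_def by (rule line_deriv[OF W f v]) (use inS[of 0 s] \<delta> s b in auto)
      moreover have "((\<lambda>t. f (y + t *\<^sub>R v)) has_vector_derivative fv (y + 0 *\<^sub>R v)) (at 0)"
        unfolding fv_def by (rule line_deriv[OF W f v]) (use y in auto)
      ultimately show "((\<lambda>t. f (y + t *\<^sub>R v + s *\<^sub>R w) - f (y + t *\<^sub>R v)) has_vector_derivative
        fv (y + 0 *\<^sub>R v + s *\<^sub>R w) - fv (y + 0 *\<^sub>R v)) (at 0 within ?U)"
        unfolding ac[of 0 s] using acg[of f s]
        by (intro has_vector_derivative_at_within[OF has_vector_derivative_diff]) (simp_all only:)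
    qed (use ftc s \<delta> in auto)
    ultimately have "integral (cbox 0 s) (\<lambda>r. dir_deriv fw (y + 0 *\<^sub>R v + r *\<^sub>R w) v) = fv (y + 0 *\<^sub>R v + s *\<^sub>R w) - fv (y + 0 *\<^sub>R v)"
      using at_within_open[of 0 ?U] \<delta> by (auto intro: vector_derivative_unique_at)
    then show ?thesis by simp
  qed
  \<comment> \<open>The integral is available for s in \<open>{0..b}\<close> only, so the comparison
    is made with one-sided derivatives at 0, which are unique within a nondegenerate
    interval.\<close>
  have "((\<lambda>s. integral {0..s} (\<lambda>r. dir_deriv fw (y + r *\<^sub>R w) v)) has_vector_derivative dir_deriv fw (y + 0 *\<^sub>R w) v)
      (at 0 within {0..b})"
  proof (rule integral_has_vector_derivative)
    show "continuous_on {0..b} (\<lambda>r. dir_deriv fw (y + r *\<^sub>R w) v)"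
      using cts[OF sfw(2), of "{0..b}" "\<lambda>_. 0" "\<lambda>r. r"] b \<delta> by (auto simp: continuous_on_id)
  qed (use b in auto)
  then have "((\<lambda>s. fv y + integral {0..s} (\<lambda>r. dir_deriv fw (y + r *\<^sub>R w) v)) has_vector_derivative dir_deriv fw y v)
      (at 0 within {0..b})" by (auto intro!: derivative_eq_intros)
  then have 1: "((\<lambda>s. fv (y + s *\<^sub>R w)) has_vector_derivative dir_deriv fw y v) (at 0 within {0..b})"
    by (rule has_vector_derivative_transform[rotated 2]) (use main b in auto)
  have 2: "((\<lambda>s. fv (y + s *\<^sub>R w)) has_vector_derivative dir_deriv fv (y + 0 *\<^sub>R w) w) (at 0 within {0..b})"
    by (rule has_vector_derivative_at_within, rule line_deriv[OF W sfw(3) w]) (use y in simp)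
  have "dir_deriv fw y v = dir_deriv fv (y + 0 *\<^sub>R w) w"
    by (rule vector_derivative_unique_within_closed_interval[OF b(1) _ 1[folded cbox_interval] 2[folded cbox_interval]]) (use b in auto)
  then show ?thesis by (simp add: fv_def fw_def)
qed

subsection \<open>Integrals depending on a parameter\<close>

lemma relopen_Times_UNIV: "relopen W S \<Longrightarrow> relopen (W \<times> (UNIV :: real set)) (S \<times> UNIV)"
  by (intro relopen_Times relopen_self subspace_UNIV)

text \<open>The Leibniz rule is applied on the intersection of a ball with W, which is convex. The
  parameter s ranges over the whole line in the smoothness hypothesis, so that the end points 0 and
  1 are interior.\<close>

lemma parameter_integral_has_derivative:
  fixes f :: "'a::euclidean_space \<times> real \<Rightarrow> 'b::euclidean_space"
  assumes W: "relopen W S" and f: "smooth_on (W \<times> UNIV) (S \<times> UNIV) f" and y: "y \<in> S"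
  shows "((\<lambda>z. integral {0..1} (\<lambda>s. f (z, s))) has_derivative
    (\<lambda>h. integral {0..1} (\<lambda>s. dir_deriv f (y, s) (oproj W h, 0)))) (at y within S)"
proof -
  note WR = relopen_Times_UNIV[OF W]
  note sW = relopen_subspace[OF W]
  obtain e where e: "e > 0" "relopen W (ball y e \<inter> W)" "ball y e \<inter> W \<subseteq> S" "y \<in> ball y e \<inter> W"
    using relopen_ball[OF W y] .
  let ?U = "ball y e \<inter> W"
  \<comment> \<open>The partial derivative in x means something only in directions of W;
    precomposing with \<open>oproj W\<close> makes it a bounded linear map on the ambient type, as
    \<open>Blinfun\<close> needs.\<close>
  define L where "L x t = (\<lambda>h. dir_deriv f (x, t) (oproj W h, 0))" for x t
  have P: "bounded_linear (\<lambda>h. (oproj W h, 0::real))"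
    by (intro bounded_linear_Pair oproj(1) sW bounded_linear_zero)
  have Dex: "\<exists>D. (f has_derivative D) (at (x, t) within S \<times> UNIV) \<and> L x t = D \<circ> (\<lambda>h. (oproj W h, 0))" if "x \<in> S" for x t
  proof -
    obtain D where D: "(f has_derivative D) (at (x, t) within S \<times> UNIV)" "\<And>v. v \<in> W \<times> UNIV \<Longrightarrow> D v = dir_deriv f (x, t) v"
    proof (rule smooth_on_has_derivative[OF WR f, of "(x, t)"])
      show "(x, t) \<in> S \<times> UNIV" using \<open>x \<in> S\<close> by simp
    qed auto
    then show ?thesis using oproj(2)[OF sW] by (intro exI[of _ D]) (auto simp: L_def fun_eq_iff)
  qed
  have L: "bounded_linear (L x t)" if x: "x \<in> S" for x t
  proof -
    obtain D where D: "(f has_derivative D) (at (x, t) within S \<times> UNIV)" "L x t = D \<circ> (\<lambda>h. (oproj W h, 0))"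
      using Dex[OF x] by blast
    show ?thesis unfolding D(2) o_def
      by (rule bounded_linear_compose[OF has_derivative_bounded_linear[OF D(1)] P])
  qed
  have cf: "continuous_on A (\<lambda>p. g (a p, c p))"
    if "smooth_on (W \<times> UNIV) (S \<times> UNIV) g" "continuous_on A a" "continuous_on A c" "\<And>p. p \<in> A \<Longrightarrow> a p \<in> S"
    for A :: "'z::topological_space set" and a c and g :: "'a \<times> real \<Rightarrow> 'b"
    by (rule continuous_on_compose2[OF smooth_on_continuous[OF that(1)]])
       (use that(2-4) in \<open>auto intro!: continuous_intros\<close>)
  have lr: "((\<lambda>x. integral (cbox 0 1) (\<lambda>t. f (x, t))) has_derivative integral (cbox 0 1) (\<lambda>t. Blinfun (L y t))) (at y within ?U)"
  proof (rule leibniz_rule[where fx="\<lambda>x t. Blinfun (L x t)" and f="\<lambda>x t. f (x, t)"])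
    fix x t assume x: "x \<in> ?U"
    then have xS: "x \<in> S" using e by auto
    obtain D where D: "(f has_derivative D) (at (x, t) within S \<times> UNIV)" "L x t = D \<circ> (\<lambda>h. (oproj W h, 0))"
      using Dex[OF xS] by blast
    have "((\<lambda>z. (oproj W z, t)) has_derivative (\<lambda>h. (oproj W h, 0))) (at x within ?U)"
      by (intro derivative_intros bounded_linear_imp_has_derivative oproj(1) sW)
    moreover have "(f has_derivative D) (at (oproj W x, t) within (\<lambda>z. (oproj W z, t)) ` ?U)"
      using x oproj(3)[OF sW, of x] e(3) oproj(3)[OF sW] D(1)
      by (auto intro!: has_derivative_subset[OF D(1)])
    ultimately have "((\<lambda>z. f (oproj W z, t)) has_derivative L x t) (at x within ?U)"
      unfolding D(2) o_def by (rule has_derivative_in_compose)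
    then have "((\<lambda>z. f (z, t)) has_derivative L x t) (at x within ?U)"
      by (rule has_derivative_transform[OF x, rotated]) (use oproj(3)[OF sW] in auto)
    then show "((\<lambda>z. f (z, t)) has_derivative blinfun_apply (Blinfun (L x t))) (at x within ?U)"
      using L[OF xS] by (simp add: bounded_linear_Blinfun_apply)
  next
    fix x assume "x \<in> ?U" then show "(\<lambda>t. f (x, t)) integrable_on cbox 0 1"
      using e(3) by (intro integrable_continuous cf[OF f]) (auto intro: continuous_intros)
  next
    show "continuous_on (?U \<times> cbox 0 1) (\<lambda>(x, t). Blinfun (L x t))"
    proof (rule continuous_on_blinfun_componentwise)
      fix i :: 'a
      have "continuous_on (?U \<times> cbox 0 1) (\<lambda>p. dir_deriv f (fst p, snd p) (oproj W i, 0))"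
        using e(3) oproj(2)[OF sW]
        by (intro cf[of "\<lambda>p. dir_deriv f p (oproj W i, 0)"] smooth_on_dir_deriv[OF WR f]) (auto intro: continuous_intros)
      then show "continuous_on (?U \<times> cbox 0 1) (\<lambda>x. blinfun_apply (case x of (x, t) \<Rightarrow> Blinfun (L x t)) i)"
        by (rule continuous_on_eq) (use L e(3) in \<open>auto simp: bounded_linear_Blinfun_apply L_def\<close>)
    qed
  qed (use e in \<open>auto intro: convex_Int convex_ball subspace_imp_convex sW\<close>)
  have eq: "blinfun_apply (integral (cbox 0 1) (\<lambda>t. Blinfun (L y t))) = (\<lambda>h. integral {0..1} (\<lambda>s. dir_deriv f (y, s) (oproj W h, 0)))"
  proof
    fix h
    have "continuous_on (cbox 0 1) (\<lambda>t. Blinfun (L y t))"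
    proof (rule continuous_on_blinfun_componentwise)
      fix i :: 'a
      have "continuous_on (cbox 0 1) (\<lambda>t. dir_deriv f (y, t) (oproj W i, 0))"
        using y oproj(2)[OF sW]
        by (intro cf[of "\<lambda>p. dir_deriv f p (oproj W i, 0)"] smooth_on_dir_deriv[OF WR f]) (auto intro: continuous_intros)
      then show "continuous_on (cbox 0 1) (\<lambda>t. blinfun_apply (Blinfun (L y t)) i)"
        using L[OF y] by (simp add: bounded_linear_Blinfun_apply L_def)
    qed
    then have "blinfun_apply (integral (cbox 0 1) (\<lambda>t. Blinfun (L y t))) h = integral (cbox 0 1) (\<lambda>t. blinfun_apply (Blinfun (L y t)) h)"
      by (intro blinfun_apply_integral integrable_continuous)
    then show "blinfun_apply (integral (cbox 0 1) (\<lambda>t. Blinfun (L y t))) h = integral {0..1} (\<lambda>s. dir_deriv f (y, s) (oproj W h, 0))"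
      using L[OF y] by (simp add: bounded_linear_Blinfun_apply L_def)
  qed
  show ?thesis using lr unfolding eq relopen_at[OF e(2,4)] relopen_at[OF W y] by simp
qed

text \<open>The derivative in a fixed direction is again a parameter integral of a smooth function,
  so the induction over the order of differentiability closes.\<close>

lemma smooth_on_parameter_integral:
  fixes f :: "'a::euclidean_space \<times> real \<Rightarrow> 'b::euclidean_space"
  assumes W: "relopen W S" and f: "smooth_on (W \<times> UNIV) (S \<times> UNIV) f"
  shows "smooth_on W S (\<lambda>z. integral {0..1} (\<lambda>s. f (z, s)))"
proof -
  have "Ck_on r W S (\<lambda>z. integral {0..1} (\<lambda>s. f (z, s)))" for r using f
  proof (induction r arbitrary: f)
    case 0
    show ?case using parameter_integral_has_derivative[OF W 0]
      by (auto simp: continuous_on_eq_continuous_within intro: has_derivative_continuous)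
  next
    case (Suc r)
    have "Ck_on r W S (\<lambda>y. integral {0..1} (\<lambda>s. dir_deriv f (y, s) (oproj W v, 0)))" if "v \<in> W" for v
      by (rule Suc.IH) (use oproj(2)[OF relopen_subspace[OF W]] in \<open>auto intro!: smooth_on_dir_deriv[OF relopen_Times_UNIV[OF W] Suc.prems]\<close>)
    then show ?case unfolding Ck_on.simps using parameter_integral_has_derivative[OF W Suc.prems]
      by (intro exI[of _ "\<lambda>y h. integral {0..1} (\<lambda>s. dir_deriv f (y, s) (oproj W h, 0))"] conjI ballI)
  qed
  then show ?thesis by (simp add: smooth_on_def)
qed

lemma dir_deriv_parameter_integral:
  fixes f :: "'a::euclidean_space \<times> real \<Rightarrow> 'b::euclidean_space"
  assumes W: "relopen W S" and f: "smooth_on (W \<times> UNIV) (S \<times> UNIV) f" and y: "y \<in> S" and v: "v \<in> W"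
  shows "dir_deriv (\<lambda>z. integral {0..1} (\<lambda>s. f (z, s))) y v = integral {0..1} (\<lambda>s. dir_deriv f (y, s) (v, 0))"
  using dir_deriv_eq(1)[OF W y v parameter_integral_has_derivative[OF W f y]]
    oproj(3)[OF relopen_subspace[OF W] v] by simp

subsection \<open>Inverting families of linear maps\<close>

lemma linear_map_on_zero: "linear_map_on V W f \<Longrightarrow> subspace V \<Longrightarrow> f 0 = 0"
proof -
  assume "linear_map_on V W f" "subspace V"
  then have "f (0 *\<^sub>R 0 + 0 *\<^sub>R 0) = 0 *\<^sub>R f 0 + 0 *\<^sub>R f 0" unfolding linear_map_on_def using subspace_0 by blast
  then show "f 0 = 0" by simp
qed

lemma linear_map_on_in: "linear_map_on V W f \<Longrightarrow> v \<in> V \<Longrightarrow> f v \<in> W"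
  by (auto simp: linear_map_on_def)

lemma linear_map_on_add: "linear_map_on V W f \<Longrightarrow> u \<in> V \<Longrightarrow> v \<in> V \<Longrightarrow> f (u + v) = f u + f v"
  and linear_map_on_scale: "linear_map_on V W f \<Longrightarrow> u \<in> V \<Longrightarrow> f (a *\<^sub>R u) = a *\<^sub>R f u"
  and linear_map_on_diff: "linear_map_on V W f \<Longrightarrow> u \<in> V \<Longrightarrow> v \<in> V \<Longrightarrow> f (u - v) = f u - f v"
proof -
  assume l: "linear_map_on V W f"
  have *: "u \<in> V \<Longrightarrow> v \<in> V \<Longrightarrow> f (a *\<^sub>R u + b *\<^sub>R v) = a *\<^sub>R f u + b *\<^sub>R f v" for u v a b
    using l unfolding linear_map_on_def by blast
  show "u \<in> V \<Longrightarrow> v \<in> V \<Longrightarrow> f (u + v) = f u + f v" using *[of u v 1 1] by simp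
  show "u \<in> V \<Longrightarrow> f (a *\<^sub>R u) = a *\<^sub>R f u" using *[of u u a 0] by simp
  show "u \<in> V \<Longrightarrow> v \<in> V \<Longrightarrow> f (u - v) = f u - f v" using *[of u v 1 "-1"] by simp
qed

lemma linear_map_on_sum:
  assumes "linear_map_on V W f" "subspace V" "\<And>i. i \<in> I \<Longrightarrow> x i \<in> V"
  shows "f (\<Sum>i\<in>I. x i) = (\<Sum>i\<in>I. f (x i))"
  using assms(3)
proof (induction I rule: infinite_finite_induct)
  case (insert i I)
  then have "f (x i + (\<Sum>i\<in>I. x i)) = f (x i) + f (\<Sum>i\<in>I. x i)"
    by (intro linear_map_on_add[OF assms(1)] subspace_sum[OF assms(2)]) auto
  then show ?case using insert by simp
qed (use assms in \<open>auto simp: linear_map_on_zero\<close>)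

lemma linear_map_on_expand:
  assumes "linear_map_on V W f" "subspace V" "v \<in> V"
  shows "f v = (\<Sum>b\<in>onb V. (v \<bullet> b) *\<^sub>R f b)"
proof -
  note o = onb[OF assms(2)]
  have "f v = f (\<Sum>b\<in>onb V. (v \<bullet> b) *\<^sub>R b)" using o(3)[OF assms(3)] by simp
  also have "\<dots> = (\<Sum>b\<in>onb V. f ((v \<bullet> b) *\<^sub>R b))"
    using o assms(2) by (intro linear_map_on_sum[OF assms(1,2)]) (auto intro: subspace_scale)
  also have "\<dots> = (\<Sum>b\<in>onb V. (v \<bullet> b) *\<^sub>R f b)"
    using o(2) by (intro sum.cong refl linear_map_on_scale[OF assms(1)]) auto
  finally show ?thesis .
qed

text \<open>An injective linear map on a finite-dimensional space is bounded below by some e, and a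
  perturbation of size at most e/2 leaves the bound e/2. The neighbourhood is where
  \<open>N\<close>, an estimate of the operator norm of \<open>T z - T y\<close>, stays below
  e/2.\<close>

lemma linear_family_lower_bound:
  fixes T :: "'a::euclidean_space \<Rightarrow> 'f::euclidean_space \<Rightarrow> 'f"
  assumes X: "relopen X S" and F: "subspace F" and y: "y \<in> S"
    and lin: "\<And>z. z \<in> S \<Longrightarrow> linear_map_on F F (T z)"
    and cont: "\<And>v. v \<in> F \<Longrightarrow> continuous_on S (\<lambda>z. T z v)"
    and inj: "inj_on (T y) F"
  obtains U c where "c > 0" "relopen X U" "y \<in> U" "U \<subseteq> S"
    "\<And>z v. z \<in> U \<Longrightarrow> v \<in> F \<Longrightarrow> c * norm v \<le> norm (T z v)"
proof -
  have "bounded_linear (\<lambda>v. \<Sum>b\<in>onb F. (v \<bullet> b) *\<^sub>R T y b)"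
    by (intro bounded_linear_sum bounded_linear_compose[OF bounded_linear_scaleR_left] bounded_linear_inner_left)
  moreover have "\<forall>v\<in>F. (\<Sum>b\<in>onb F. (v \<bullet> b) *\<^sub>R T y b) = 0 \<longrightarrow> v = 0"
  proof (intro ballI impI)
    fix v assume v: "v \<in> F" and 0: "(\<Sum>b\<in>onb F. (v \<bullet> b) *\<^sub>R T y b) = 0"
    then have "T y v = T y 0" using linear_map_on_expand[OF lin[OF y] F v] linear_map_on_zero[OF lin[OF y] F] by simp
    then show "v = 0" using inj v subspace_0[OF F] by (auto dest: inj_onD)
  qed
  ultimately obtain e where e: "e > 0" "\<forall>v\<in>F. e * norm v \<le> norm (\<Sum>b\<in>onb F. (v \<bullet> b) *\<^sub>R T y b)"
    using injective_imp_isometric[OF closed_subspace[OF F] F] by blast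
  have e': "e * norm v \<le> norm (T y v)" if "v \<in> F" for v
    using e(2) that linear_map_on_expand[OF lin[OF y] F that] by simp
  \<comment> \<open>The factor \<open>norm b\<close> comes from Cauchy-Schwarz for the coordinate of
    v along b, as nothing is recorded about the length of the vectors of
    \<open>onb F\<close>.\<close>
  define N where "N z = (\<Sum>b\<in>onb F. norm b * norm (T z b - T y b))" for z
  have cN: "continuous_on S N" unfolding N_def
    using onb(2)[OF F] by (intro continuous_on_sum continuous_intros cont) auto
  define U where "U = {z \<in> S. N z \<in> {..<e/2}}"
  show ?thesis
  proof (rule that[of "e/2" U])
    show "relopen X U" unfolding U_def
      by (rule relopen_preimage[OF X _ cN, of UNIV]) (auto simp: relopen_def)
    show "y \<in> U" using y e by (simp add: U_def N_def)
    fix z v assume z: "z \<in> U" and v: "v \<in> F"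
    then have zS: "z \<in> S" by (simp add: U_def)
    have "norm (T z v - T y v) = norm (\<Sum>b\<in>onb F. (v \<bullet> b) *\<^sub>R (T z b - T y b))"
      using linear_map_on_expand[OF lin[OF y] F v] linear_map_on_expand[OF lin[OF zS] F v]
      by (simp add: sum_subtractf scaleR_diff_right)
    also have "\<dots> \<le> (\<Sum>b\<in>onb F. norm v * (norm b * norm (T z b - T y b)))"
      by (intro order_trans[OF norm_sum] sum_mono)
         (auto simp: mult.assoc[symmetric] Cauchy_Schwarz_ineq2 intro!: mult_right_mono)
    also have "\<dots> = norm v * N z" by (simp add: N_def sum_distrib_left)
    also have "\<dots> \<le> norm v * (e/2)" using z by (intro mult_left_mono) (auto simp: U_def)
    finally have "norm (T z v - T y v) \<le> norm v * (e/2)" .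
    moreover have "norm (T y v) \<le> norm (T z v) + norm (T z v - T y v)"
      by (metis norm_triangle_sub norm_minus_commute)
    ultimately show "e/2 * norm v \<le> norm (T z v)" using e'[OF v] by (simp add: field_simps)
  qed (use e in \<open>auto simp: U_def\<close>)
qed

text \<open>At a zero of the first factor the product rule asks only continuity of the second. This
  breaks a circle in the next lemma, where the second factor is the inverse family whose
  differentiability is to be shown.\<close>

lemma has_derivative_mult_zero:
  fixes a :: "'a::real_normed_vector \<Rightarrow> real" and g :: "'a \<Rightarrow> 'b::real_normed_vector"
  assumes "(a has_derivative a') (at x within S)" "a x = 0" "continuous (at x within S) g"
  shows "((\<lambda>z. a z *\<^sub>R g z) has_derivative (\<lambda>h. a' h *\<^sub>R g x)) (at x within S)"
proof -
  have bl: "bounded_linear a'" by (rule has_derivative_bounded_linear[OF assms(1)])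
  obtain K where K: "0 \<le> K" "\<And>h. norm (a' h) \<le> norm h * K"
    using bounded_linear.nonneg_bounded[OF bl] by blast
  have t1: "((\<lambda>z. (1 / norm (z - x)) *\<^sub>R (a z - a' (z - x))) \<longlongrightarrow> 0) (at x within S)"
    using assms(1,2) unfolding has_derivative_within by (simp add: algebra_simps)
  have g: "(g \<longlongrightarrow> g x) (at x within S)" using assms(3) by (simp add: continuous_within)
  have g0: "((\<lambda>z. g z - g x) \<longlongrightarrow> 0) (at x within S)" using g by (simp add: LIM_zero_iff)
  have t2: "((\<lambda>z. ((1 / norm (z - x)) * a' (z - x)) *\<^sub>R (g z - g x)) \<longlongrightarrow> 0) (at x within S)"
  proof (rule tendsto_0_le[OF g0, of _ K])
    show "\<forall>\<^sub>F z in at x within S. norm ((1 / norm (z - x) * a' (z - x)) *\<^sub>R (g z - g x)) \<le> norm (g z - g x) * K"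
    proof (rule always_eventually, rule allI)
      fix z
      have "\<bar>1 / norm (z - x) * a' (z - x)\<bar> \<le> K"
      proof (cases "z = x")
        case True
        then show ?thesis using K(1) by simp
      next
        case False then show ?thesis using K(2)[of "z - x"] by (simp add: abs_mult divide_simps mult.commute)
      qed
      then show "norm ((1 / norm (z - x) * a' (z - x)) *\<^sub>R (g z - g x)) \<le> norm (g z - g x) * K"
        unfolding norm_scaleR by (metis mult.commute mult_right_mono norm_ge_zero real_norm_def)
    qed
  qed
  \<comment> \<open>The error quotient splits into the remainder of a times g, and the linear part
    of a, bounded by K after division, times the increment of g.\<close>
  have "((\<lambda>z. ((1 / norm (z - x)) *\<^sub>R (a z - a' (z - x))) *\<^sub>R g z + ((1 / norm (z - x)) * a' (z - x)) *\<^sub>R (g z - g x)) \<longlongrightarrow> 0 *\<^sub>R g x + 0) (at x within S)"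
    by (intro tendsto_add tendsto_scaleR t1 t2 g)
  then have "((\<lambda>z. (1 / norm (z - x)) *\<^sub>R (a z *\<^sub>R g z - (a x *\<^sub>R g x + a' (z - x) *\<^sub>R g x))) \<longlongrightarrow> 0) (at x within S)"
    by (simp add: assms(2) algebra_simps)
  then show ?thesis unfolding has_derivative_within
    by (auto intro: bounded_linear_compose[OF bounded_linear_scaleR_left bl])
qed

text \<open>Continuity of the inverses follows from the uniform lower bound. Differentiability then
  follows from \<open>R z w = u + R z (w - T z u)\<close> with u fixed: the argument on the right
  vanishes at the point in question, so continuity of R is enough. The resulting derivative is
  expressed by R and derivatives of T, which starts a bootstrap over the order.\<close>

lemma smooth_on_inverse_family:
  fixes T :: "'a::euclidean_space \<Rightarrow> 'f::euclidean_space \<Rightarrow> 'f"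
  assumes X: "relopen X S" and F: "subspace F"
    and lin: "\<And>z. z \<in> S \<Longrightarrow> linear_map_on F F (T z)"
    and smooth: "smooth_on (X \<times> F) (S \<times> F) (\<lambda>p. T (fst p) (snd p))"
    and R: "\<And>z v. z \<in> S \<Longrightarrow> v \<in> F \<Longrightarrow> R z v \<in> F"
      "\<And>z v. z \<in> S \<Longrightarrow> v \<in> F \<Longrightarrow> T z (R z v) = v" "\<And>z v. z \<in> S \<Longrightarrow> v \<in> F \<Longrightarrow> R z (T z v) = v"
  shows "smooth_on (X \<times> F) (S \<times> F) (\<lambda>p. R (fst p) (snd p))"
proof -
  have XF: "relopen (X \<times> F) (S \<times> F)" by (intro relopen_Times X relopen_self F)
  have TF: "T z v \<in> F" if "z \<in> S" "v \<in> F" for z v using linear_map_on_in[OF lin] that .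
  have inj: "inj_on (T z) F" if "z \<in> S" for z by (metis R(3) inj_onI that)
  have linR: "linear_map_on F F (R z)" if z: "z \<in> S" for z
    unfolding linear_map_on_def
  proof (intro conjI ballI allI)
    fix u v a b assume uv: "u \<in> F" "v \<in> F"
    have m: "a *\<^sub>R R z u + b *\<^sub>R R z v \<in> F" using R(1) z uv F by (intro subspace_add subspace_scale)
    have "T z (a *\<^sub>R R z u + b *\<^sub>R R z v) = a *\<^sub>R u + b *\<^sub>R v"
      using lin[OF z] R(1,2) z uv unfolding linear_map_on_def by simp
    then show "R z (a *\<^sub>R u + b *\<^sub>R v) = a *\<^sub>R R z u + b *\<^sub>R R z v" using R(3)[OF z m] by simp
  qed (use R z in auto)
  have cT: "continuous_on S (\<lambda>z. T z v)" if "v \<in> F" for v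
    by (rule continuous_on_compose2[OF smooth_on_continuous[OF smooth], of S "\<lambda>z. (z, v)", simplified])
       (use that in \<open>auto intro!: continuous_intros\<close>)
  have cR: "continuous (at y within S) (\<lambda>z. R z v)" if y: "y \<in> S" and v: "v \<in> F" for y v
  proof -
    obtain U c where U: "c > 0" "relopen X U" "y \<in> U" "U \<subseteq> S" "\<And>z v. z \<in> U \<Longrightarrow> v \<in> F \<Longrightarrow> c * norm v \<le> norm (T z v)"
      using linear_family_lower_bound[OF X F y lin cT inj[OF y]] by metis
    have u: "R y v \<in> F" using R(1) y v .
    \<comment> \<open>The lower bound for \<open>T z\<close> turns the difference of the inverses
      into that of \<open>T y\<close> and \<open>T z\<close> at the fixed vector
      \<open>R y v\<close>.\<close>
    have bd: "norm (R z v - R y v) \<le> norm (T z (R y v) - T y (R y v)) * (1/c)" if z: "z \<in> U" for z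
    proof -
      have zS: "z \<in> S" using z U by auto
      have "c * norm (R z v - R y v) \<le> norm (T z (R z v - R y v))"
        by (rule U(5)[OF z]) (use R(1) zS v u F in \<open>auto intro: subspace_diff\<close>)
      also have "T z (R z v - R y v) = T y (R y v) - T z (R y v)"
        using linear_map_on_diff[OF lin[OF zS] R(1)[OF zS v] u] R(2) zS y v by simp
      finally show ?thesis using U(1) by (simp add: field_simps norm_minus_commute)
    qed
    have "((\<lambda>z. T z (R y v) - T y (R y v)) \<longlongrightarrow> 0) (at y within U)"
      using cT[OF u] y U(4) by (auto simp: LIM_zero_iff continuous_on_def intro: tendsto_within_subset)
    then have "((\<lambda>z. R z v - R y v) \<longlongrightarrow> 0) (at y within U)"
      by (rule tendsto_0_le[where K="1/c"]) (use bd in \<open>auto simp: eventually_at_filter\<close>)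
    then show ?thesis using relopen_at[OF U(2,3)] relopen_at[OF X y] by (simp add: continuous_within LIM_zero_iff)
  qed
  define R' where "R' = (\<lambda>p. R (fst p) (snd p))"
  define T' where "T' = (\<lambda>p. T (fst p) (snd p))"
  \<comment> \<open>What differentiating \<open>T z (R z v) = v\<close> predicts:
    \<open>R (fst p)\<close> applied to \<open>snd h\<close> minus the derivative of T in the base
    direction, written out in the basis so that R occurs only at constant vectors.\<close>
  define f' where "f' p h = (\<Sum>b\<in>onb F. ((snd h - dir_deriv T' (fst p, R' p) (fst h, 0)) \<bullet> b) *\<^sub>R R' (fst p, b))" for p h
  have smT: "smooth_on (X \<times> F) (S \<times> F) T'" using smooth by (simp add: T'_def)
  have D: "(\<forall>p\<in>S \<times> F. R' differentiable (at p within S \<times> F) \<and> (\<forall>h\<in>X \<times> F. dir_deriv R' p h = f' p h))"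
  proof
    fix p assume p: "p \<in> S \<times> F"
    define y v where "y = fst p" and "v = snd p"
    have pyv: "p = (y, v)" and y: "y \<in> S" and v: "v \<in> F" using p by (auto simp: y_def v_def)
    define u where "u = R y v"
    have u: "u \<in> F" using R(1) y v by (simp add: u_def)
    have s1: "smooth_on (X \<times> F) (S \<times> F) (\<lambda>p. (fst p, u))"
      by (intro smooth_on_Pair smooth_on_const smooth_on_bounded_linear bounded_linear_fst)
    have i1: "(\<lambda>p. (fst p, u)) ` (S \<times> F) \<subseteq> S \<times> F" using u by auto
    have s2: "smooth_on (X \<times> F) (S \<times> F) (\<lambda>p. T' (fst p, u))"
      by (rule smooth_on_compose[OF XF XF s1 i1 smT])
    \<comment> \<open>The argument \<open>w - T z u\<close> as a function of (z, w); it is zero at p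
      because u is the preimage of v under \<open>T y\<close>.\<close>
    define k where "k = (\<lambda>p. snd p - T' (fst p, u))"
    have sk: "smooth_on (X \<times> F) (S \<times> F) k" unfolding k_def
      by (intro smooth_on_diff s2 smooth_on_bounded_linear bounded_linear_snd)
    have k0: "k p = 0" using R(2)[OF y v] by (simp add: k_def T'_def pyv u_def)
    obtain E where E: "(k has_derivative E) (at p within S \<times> F)" "\<And>h. h \<in> X \<times> F \<Longrightarrow> E h = dir_deriv k p h"
      using smooth_on_has_derivative[OF XF sk p] by metis
    have Eh: "E h = snd h - dir_deriv T' (y, u) (fst h, 0)" if h: "h \<in> X \<times> F" for h
    proof -
      have m: "smooth_on (X \<times> F) (S \<times> F) (\<lambda>p. - T' (fst p, u))" using s2 by (rule smooth_on_minus)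
      have "E h = dir_deriv (\<lambda>p. snd p + - T' (fst p, u)) p h" using E(2)[OF h] by (simp add: k_def)
      also have "\<dots> = dir_deriv snd p h + dir_deriv (\<lambda>p. - T' (fst p, u)) p h"
        by (rule dir_deriv_add[OF XF smooth_on_bounded_linear[OF bounded_linear_snd] m p h])
      also have "dir_deriv snd p h = snd h" by (rule dir_deriv_bounded_linear[OF bounded_linear_snd])
      also have "dir_deriv (\<lambda>p. - T' (fst p, u)) p h = - dir_deriv (\<lambda>p. T' (fst p, u)) p h"
        by (rule dir_deriv_bounded_linear_comp[OF XF s2 bounded_linear_minus[OF bounded_linear_ident] p h])
      also have "dir_deriv (\<lambda>p. T' (fst p, u)) p h = dir_deriv T' (fst p, u) (dir_deriv (\<lambda>p. (fst p, u)) p h)"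
        by (rule dir_deriv_chain[OF XF XF s1 i1 smT p h])
      also have "dir_deriv (\<lambda>p. (fst p, u)) p h = (fst h, 0)"
        using dir_deriv_pair[OF XF smooth_on_bounded_linear[OF bounded_linear_fst] smooth_on_const p h]
        by (simp add: dir_deriv_bounded_linear[OF bounded_linear_fst])
      finally show ?thesis by (simp add: pyv)
    qed
    have cfst: "continuous (at p within S \<times> F) (\<lambda>p. R (fst p) b)" if b: "b \<in> F" for b
    proof -
      have "isCont fst p" by (intro continuous_intros)
      then have "continuous (at p within S \<times> F) fst" by (rule continuous_at_imp_continuous_within)
      moreover have "continuous (at (fst p) within fst ` (S \<times> F)) (\<lambda>z. R z b)"
        using cR[OF y b] y v p by (auto simp: y_def intro!: continuous_within_subset[OF cR[OF _ b]])
      ultimately show ?thesis by (rule continuous_within_compose2)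
    qed
    have "((\<lambda>p. u + (\<Sum>b\<in>onb F. (k p \<bullet> b) *\<^sub>R R (fst p) b)) has_derivative
       (\<lambda>h. 0 + (\<Sum>b\<in>onb F. (E h \<bullet> b) *\<^sub>R R (fst p) b))) (at p within S \<times> F)"
    proof (intro has_derivative_add has_derivative_const has_derivative_sum has_derivative_mult_zero)
      fix b assume b: "b \<in> onb F"
      show "((\<lambda>p. k p \<bullet> b) has_derivative (\<lambda>h. E h \<bullet> b)) (at p within S \<times> F)"
        by (rule bounded_linear.has_derivative[OF bounded_linear_inner_left E(1)])
      show "k p \<bullet> b = 0" using k0 by simp
      show "continuous (at p within S \<times> F) (\<lambda>p. R (fst p) b)" using cfst b onb(2)[OF F] by auto
    qed
    then have HD: "(R' has_derivative (\<lambda>h. \<Sum>b\<in>onb F. (E h \<bullet> b) *\<^sub>R R (fst p) b)) (at p within S \<times> F)"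
    proof (rule has_derivative_transform[OF p, rotated, OF has_derivative_eq_rhs])
      fix q assume q: "q \<in> S \<times> F"
      then have z: "fst q \<in> S" and w: "snd q \<in> F" by auto
      have k: "k q \<in> F" unfolding k_def T'_def using w TF[OF z u] F by (auto intro: subspace_diff)
      have "T (fst q) (u + R (fst q) (k q)) = snd q"
        using linear_map_on_add[OF lin[OF z] u R(1)[OF z k]] R(2)[OF z k] by (simp add: k_def T'_def)
      then have "R (fst q) (snd q) = u + R (fst q) (k q)"
        using R(3)[OF z, of "u + R (fst q) (k q)"] u R(1)[OF z k] F by (metis subspace_add)
      then show "R' q = u + (\<Sum>b\<in>onb F. (k q \<bullet> b) *\<^sub>R R (fst q) b)"
        using linear_map_on_expand[OF linR[OF z] F k] by (simp add: R'_def)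
    qed auto
    moreover have "dir_deriv R' p h = f' p h" if h: "h \<in> X \<times> F" for h
      using dir_deriv_eq(1)[OF XF p h HD] Eh[OF h] by (simp add: f'_def R'_def u_def pyv)
    ultimately show "R' differentiable (at p within S \<times> F) \<and> (\<forall>h\<in>X \<times> F. dir_deriv R' p h = f' p h)"
      by (auto simp: differentiable_def)
  qed
  \<comment> \<open>The formula for the derivative contains R itself but no derivative of R; hence
    order r of R gives order r of its derivatives, that is order r + 1 of R.\<close>
  have "Ck_on r (X \<times> F) (S \<times> F) R'" for r
  proof (induction r)
    case 0
    show ?case unfolding Ck_on.simps continuous_on_eq_continuous_within
      using D differentiable_imp_continuous_within by blast
  next
    case (Suc r)
    have fst1: "Ck_on r (X \<times> F) (S \<times> F) (\<lambda>p. (fst p, c))" for c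
    proof -
      have "smooth_on (X \<times> F) (S \<times> F) (\<lambda>p. (fst p, c))"
        by (intro smooth_on_Pair smooth_on_const smooth_on_bounded_linear bounded_linear_fst)
      then show ?thesis by (simp add: smooth_on_def)
    qed
    have z2: "bounded_linear (\<lambda>q. (0::'a, q :: 'f))" by (intro bounded_linear_Pair bounded_linear_zero bounded_linear_ident)
    have pr: "Ck_on r (X \<times> F) (S \<times> F) (\<lambda>p. (fst p, R' p))"
      using Ck_on_add[OF fst1[of 0] Ck_on_bounded_linear_comp[OF z2 Suc.IH]] by simp
    have "Ck_on r (X \<times> F) (S \<times> F) (\<lambda>p. f' p h)" if h: "h \<in> X \<times> F" for h
      unfolding f'_def
    proof (intro Ck_on_sum Ck_on_bilinear[OF bounded_bilinear_scaleR XF])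
      fix b assume b: "b \<in> onb F"
      have hh: "(fst h, 0) \<in> X \<times> F" using h subspace_0[OF F] by auto
      have "Ck_on r (X \<times> F) (S \<times> F) (\<lambda>p. dir_deriv T' (fst p, R' p) (fst h, 0))"
        by (rule Ck_on_compose[OF XF XF pr]) (use R(1) smooth_on_dir_deriv[OF XF smT hh] in \<open>auto simp: R'_def smooth_on_def\<close>)
      then have "Ck_on r (X \<times> F) (S \<times> F) (\<lambda>p. snd h + - dir_deriv T' (fst p, R' p) (fst h, 0))"
        by (intro Ck_on_add Ck_on_const Ck_on_bounded_linear_comp[OF bounded_linear_minus[OF bounded_linear_ident]])
      then show "Ck_on r (X \<times> F) (S \<times> F) (\<lambda>p. (snd h - dir_deriv T' (fst p, R' p) (fst h, 0)) \<bullet> b)"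
        by (intro Ck_on_bounded_linear_comp[OF bounded_linear_inner_left]) simp
      show "Ck_on r (X \<times> F) (S \<times> F) (\<lambda>p. R' (fst p, b))"
        by (rule Ck_on_compose[OF XF XF fst1 _ Suc.IH]) (use b onb(2)[OF F] in auto)
    qed
    then show ?case unfolding Ck_on_Suc_iff[OF XF] using D
      Ck_on_cong_imp[of "S \<times> F" "\<lambda>p. f' p h" "\<lambda>p. dir_deriv R' p h" r "X \<times> F" for h] by (metis (no_types, lifting))
  qed
  then show ?thesis by (simp add: smooth_on_def R'_def)
qed

section \<open>Local differential forms\<close>

abbreviation omit :: "nat \<Rightarrow> 'a list \<Rightarrow> 'a list" where
  "omit j vs \<equiv> take j vs @ drop (Suc j) vs"

lemma length_omit: "j < length vs \<Longrightarrow> length (omit j vs) = length vs - 1"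
  by auto

lemma set_omit: "set (omit j vs) \<subseteq> set vs"
  using set_take_subset set_drop_subset by fastforce

lemma nth_omit:
  "i < length vs - 1 \<Longrightarrow> j < length vs \<Longrightarrow> omit j vs ! i = (if i < j then vs ! i else vs ! Suc i)"
  by (auto simp: nth_append min_def)

lemma omit_omit:
  assumes "i < j" "j < length vs"
  shows "omit i (omit j vs) = omit (j - 1) (omit i vs)"
proof (rule nth_equalityI)
  show "length (omit i (omit j vs)) = length (omit (j - 1) (omit i vs))" using assms by auto
  fix l assume "l < length (omit i (omit j vs))"
  then have l: "l < length vs - 2" using assms by auto
  have "omit i (omit j vs) ! l = (if l < i then omit j vs ! l else omit j vs ! Suc l)"
    using l assms by (intro nth_omit) auto
  moreover have "omit (j - 1) (omit i vs) ! l = (if l < j - 1 then omit i vs ! l else omit i vs ! Suc l)"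
    using l assms by (intro nth_omit) auto
  ultimately show "omit i (omit j vs) ! l = omit (j - 1) (omit i vs) ! l"
    using l assms nth_omit[of l vs j] nth_omit[of l vs i] nth_omit[of "Suc l" vs j] nth_omit[of "Suc l" vs i]
    by (auto split: if_splits)
qed

lemma omit_update:
  assumes "k \<noteq> j" "k < length vs" "j < length vs"
  shows "omit k (vs[j := u]) = (omit k vs)[(if j < k then j else j - 1) := u]"
proof (rule nth_equalityI)
  fix l assume "l < length (omit k (vs[j := u]))"
  then have l: "l < length vs - 1" using assms by auto
  have "omit k (vs[j := u]) ! l = (if l < k then vs[j := u] ! l else vs[j := u] ! Suc l)"
    using l assms by (subst nth_omit) auto
  moreover have "(omit k vs)[(if j < k then j else j - 1) := u] ! l =
     (if l = (if j < k then j else j - 1) then u else if l < k then vs ! l else vs ! Suc l)"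
    using l assms nth_omit[of l vs k] by (auto simp: nth_list_update min_def)
  ultimately show "omit k (vs[j := u]) ! l = (omit k vs)[(if j < k then j else j - 1) := u] ! l"
    using l assms by (auto simp: nth_list_update)
qed (use assms in auto)

lemma map_omit: "map f (omit j vs) = omit j (map f vs)"
  by (simp add: take_map drop_map)

text \<open>The terms cancel in pairs under the involution \<open>(j, i) \<mapsto> (i, j - 1)\<close> for \<open>i < j\<close>.\<close>

lemma alternating_double_sum:
  fixes a :: "nat \<Rightarrow> nat \<Rightarrow> real"
  assumes "\<And>i j. i < j \<Longrightarrow> j < n \<Longrightarrow> a j i = a i (j - 1)"
  shows "(\<Sum>j<n. (-1) ^ j * (\<Sum>i<n - 1. (-1) ^ i * a j i)) = 0"
proof -
  let ?A = "{..<n} \<times> {..<n - 1}"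
  let ?h = "\<lambda>(j, i). if i < j then (i, j - 1) else (Suc i, j)"
  let ?f = "\<lambda>(j, i). (-1) ^ j * ((-1) ^ i * a j i)"
  have "(\<Sum>j<n. (-1) ^ j * (\<Sum>i<n - 1. (-1) ^ i * a j i)) = sum ?f ?A"
    by (simp add: sum_distrib_left sum.cartesian_product)
  moreover have "sum ?f ?A = sum (\<lambda>p. - ?f p) ?A"
  proof (rule sum.reindex_bij_witness[of _ ?h ?h])
    fix p assume p: "p \<in> ?A"
    show "?h (?h p) = p" using p by (auto split: if_splits)
    show "?h p \<in> ?A" using p by (auto split: if_splits)
    show "- ?f (?h p) = ?f p"
    proof (cases p)
      case (Pair j i)
      show ?thesis
      proof (cases "i < j")
        case True
        then have 1: "(-1::real) ^ j = - ((-1) ^ (j - 1))" by (cases j) auto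
        have "a j i = a i (j - 1)" using assms[OF True] p Pair by simp
        then have "?f (j, i) = - ?f (i, j - 1)" by (simp only: prod.case 1 mult_minus_left mult.left_commute)
        then show ?thesis unfolding Pair by (simp only: prod.case True if_True minus_minus)
      next
        case False
        then have "a (Suc i) j = a j i" using assms[of j "Suc i"] p Pair by auto
        then have "?f (j, i) = - ?f (Suc i, j)"
          by (simp only: prod.case power_Suc mult_minus_left mult_minus_right mult_1 mult.left_commute minus_minus)
        then show ?thesis unfolding Pair by (simp only: prod.case False if_False minus_minus)
      qed
    qed
  qed auto
  then have "sum ?f ?A = - sum ?f ?A" by (rule trans) (rule sum_negf)
  then have "sum ?f ?A = 0" by linarith
  ultimately show ?thesis by (rule trans)
qed

subsection \<open>Alternating forms\<close>

lemma alt_form_zero: "alt_form W d \<eta> \<Longrightarrow> \<not> (length vs = d \<and> set vs \<subseteq> W) \<Longrightarrow> \<eta> vs = 0"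
  unfolding alt_form_def by blast

lemma alt_form_update:
  "alt_form W d \<eta> \<Longrightarrow> length vs = d \<Longrightarrow> set vs \<subseteq> W \<Longrightarrow> j < d \<Longrightarrow> u \<in> W \<Longrightarrow> v \<in> W \<Longrightarrow>
    \<eta> (vs[j := a *\<^sub>R u + b *\<^sub>R v]) = a * \<eta> (vs[j := u]) + b * \<eta> (vs[j := v])"
  unfolding alt_form_def by blast

lemma alt_form_repeat:
  assumes "alt_form W d \<eta>" "set vs \<subseteq> W" "i < j" "j < length vs" "vs ! i = vs ! j"
  shows "\<eta> vs = 0"
proof (cases "length vs = d")
  case True
  then show ?thesis using assms(1)[unfolded alt_form_def, THEN conjunct2, THEN conjunct2, rule_format, of vs i j] assms by simp
next
  case False
  then show ?thesis using alt_form_zero[OF assms(1)] by simp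
qed

lemma alt_form_linear:
  assumes "alt_form W d \<eta>" "subspace W" "set xs \<subseteq> W" "set ys \<subseteq> W" "u \<in> W" "v \<in> W"
  shows "\<eta> (xs @ (a *\<^sub>R u + b *\<^sub>R v) # ys) = a * \<eta> (xs @ u # ys) + b * \<eta> (xs @ v # ys)"
proof (cases "length xs + length ys + 1 = d")
  case True
  then show ?thesis using alt_form_update[OF assms(1), of "xs @ u # ys" "length xs" u v a b] assms by simp
next
  case False
  then have "\<eta> (xs @ w # ys) = 0" for w using alt_form_zero[OF assms(1), of "xs @ w # ys"] by simp
  then show ?thesis by simp
qed

text \<open>Polarisation: the form vanishes on the repeated argument u + v, and of the four terms of
  the expansion two vanish as well.\<close>

lemma alt_form_swap:
  assumes "alt_form W d \<eta>" "subspace W" "set xs \<subseteq> W" "set ys \<subseteq> W" "u \<in> W" "v \<in> W"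
  shows "\<eta> (xs @ u # v # ys) = - \<eta> (xs @ v # u # ys)"
proof -
  have r: "\<eta> (xs @ w # w # ys) = 0" if "w \<in> W" for w
    by (rule alt_form_repeat[OF assms(1), where i="length xs" and j="Suc (length xs)"])
       (use assms that in \<open>auto simp: nth_append\<close>)
  have l1: "\<eta> (xs @ (u + v) # w # ys) = \<eta> (xs @ u # w # ys) + \<eta> (xs @ v # w # ys)" if "w \<in> W" for w
    using alt_form_linear[OF assms(1-3), of "w # ys" u v 1 1] assms that by simp
  have l2: "\<eta> (xs @ w # (u + v) # ys) = \<eta> (xs @ w # u # ys) + \<eta> (xs @ w # v # ys)" if "w \<in> W" for w
    using alt_form_linear[OF assms(1,2), of "xs @ [w]" ys u v 1 1] assms that by simp
  have uv: "u + v \<in> W" using assms by (auto intro: subspace_add)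
  have "0 = \<eta> (xs @ u # (u + v) # ys) + \<eta> (xs @ v # (u + v) # ys)" using r[OF uv] l1[OF uv] by linarith
  then show ?thesis using l2[OF assms(5)] l2[OF assms(6)] r[OF assms(5)] r[OF assms(6)] by linarith
qed

lemma alt_form_front:
  assumes "alt_form W d \<eta>" "subspace W" "set xs \<subseteq> W" "set ys \<subseteq> W" "u \<in> W"
  shows "\<eta> (xs @ u # ys) = (-1) ^ length xs * \<eta> (u # xs @ ys)"
  using assms(3,4)
proof (induction xs arbitrary: ys rule: rev_induct)
  case (snoc x xs)
  have "\<eta> ((xs @ [x]) @ u # ys) = - \<eta> (xs @ u # x # ys)"
    using alt_form_swap[OF assms(1,2), of xs ys x u] snoc.prems assms(5) by simp
  also have "\<dots> = - ((-1) ^ length xs * \<eta> (u # xs @ x # ys))"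
    using snoc.IH[of "x # ys"] snoc.prems by simp
  finally show ?case by simp
qed simp

text \<open>Brings the terms of a Leibniz rule, in which one argument is replaced, to the signed
  shape that \<open>alternating_double_sum\<close> expects.\<close>

lemma alt_form_front_update:
  assumes "alt_form W d \<eta>" "subspace W" "set vs \<subseteq> W" "u \<in> W" "i < length vs"
  shows "\<eta> (vs[i := u]) = (-1) ^ i * \<eta> (u # omit i vs)"
proof -
  have "set (take i vs) \<subseteq> W" "set (drop (Suc i) vs) \<subseteq> W"
    by (rule order_trans[OF set_take_subset assms(3)], rule order_trans[OF set_drop_subset assms(3)])
  from alt_form_front[OF assms(1,2) this assms(4)]
  show ?thesis using assms(5) by (simp add: upd_conv_take_nth_drop)
qed

text \<open>Serves to trade an argument that varies with the point for coefficient functions and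
  constant arguments.\<close>

lemma alt_form_expand_head:
  assumes "alt_form W d \<eta>" "subspace W" "set vs \<subseteq> W" "u \<in> W"
  shows "\<eta> (u # vs) = (\<Sum>b\<in>onb W. (u \<bullet> b) * \<eta> (b # vs))"
proof -
  have "linear_map_on W UNIV (\<lambda>u. \<eta> (u # vs))"
    using alt_form_linear[OF assms(1,2), of "[]" vs] assms(3) by (auto simp: linear_map_on_def)
  from linear_map_on_expand[OF this assms(2,4)] show ?thesis by simp
qed

lemma alt_form_contract:
  assumes "alt_form W (Suc d) \<eta>" "w \<in> W"
  shows "alt_form W d (\<lambda>vs. \<eta> (w # vs))"
  unfolding alt_form_def
proof (intro conjI allI impI)
  fix vs assume "\<not> (length vs = d \<and> set vs \<subseteq> W)"
  then show "\<eta> (w # vs) = 0" using alt_form_zero[OF assms(1), of "w # vs"] by auto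
next
  fix vs j u v a b assume "length vs = d \<and> set vs \<subseteq> W \<and> j < d \<and> u \<in> W \<and> v \<in> W"
  then show "\<eta> (w # vs[j := a *\<^sub>R u + b *\<^sub>R v]) = a * \<eta> (w # vs[j := u]) + b * \<eta> (w # vs[j := v])"
    using alt_form_update[OF assms(1), of "w # vs" "Suc j" u v a b] assms(2) by simp
next
  fix vs i j assume "length vs = d \<and> set vs \<subseteq> W \<and> i < j \<and> j < d \<and> vs ! i = vs ! j"
  then show "\<eta> (w # vs) = 0"
    using alt_form_repeat[OF assms(1), of "w # vs" "Suc i" "Suc j"] assms(2) by simp
qed

lemma alt_form_zero_fun: "alt_form W d (\<lambda>_. 0)"
  by (simp add: alt_form_def)

lemma alt_form_lincomb:
  assumes "alt_form W d \<eta>" "alt_form W d \<zeta>"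
  shows "alt_form W d (\<lambda>vs. a * \<eta> vs + b * \<zeta> vs)"
  unfolding alt_form_def
proof (intro conjI allI impI)
  fix vs assume "\<not> (length vs = d \<and> set vs \<subseteq> W)"
  then show "a * \<eta> vs + b * \<zeta> vs = 0" using alt_form_zero[OF assms(1), of vs] alt_form_zero[OF assms(2), of vs] by simp
next
  fix vs j u v a' b' assume "length vs = d \<and> set vs \<subseteq> W \<and> j < d \<and> u \<in> W \<and> v \<in> W"
  then show "a * \<eta> (vs[j := a' *\<^sub>R u + b' *\<^sub>R v]) + b * \<zeta> (vs[j := a' *\<^sub>R u + b' *\<^sub>R v]) =
     a' * (a * \<eta> (vs[j := u]) + b * \<zeta> (vs[j := u])) + b' * (a * \<eta> (vs[j := v]) + b * \<zeta> (vs[j := v]))"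
    using alt_form_update[OF assms(1), of vs j u v a' b'] alt_form_update[OF assms(2), of vs j u v a' b']
    by (simp add: algebra_simps)
next
  fix vs i j assume "length vs = d \<and> set vs \<subseteq> W \<and> i < j \<and> j < d \<and> vs ! i = vs ! j"
  then show "a * \<eta> vs + b * \<zeta> vs = 0"
    using alt_form_repeat[OF assms(1), of vs i j] alt_form_repeat[OF assms(2), of vs i j] by simp
qed

subsection \<open>The exterior derivative\<close>

lemma local_formD:
  assumes "local_form W S d \<eta>"
  shows "y \<in> S \<Longrightarrow> alt_form W d (\<eta> y)" "y \<notin> S \<Longrightarrow> \<eta> y vs = 0"
    "smooth_on W S (\<lambda>y. \<eta> y vs)"
proof -
  show a: "y \<in> S \<Longrightarrow> alt_form W d (\<eta> y)" for y using assms by (auto simp: local_form_def)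
  show "y \<notin> S \<Longrightarrow> \<eta> y vs = 0" using assms by (auto simp: local_form_def)
  show "smooth_on W S (\<lambda>y. \<eta> y vs)"
  proof (cases "length vs = d \<and> set vs \<subseteq> W")
    case True then show ?thesis using assms by (auto simp: local_form_def)
  next
    case False
    then have "smooth_on W S (\<lambda>y. \<eta> y vs) = smooth_on W S (\<lambda>_. 0::real)"
      using smooth_on_cong[of S "\<lambda>y. \<eta> y vs" "\<lambda>_. 0" W] alt_form_zero[OF a] by blast
    then show ?thesis by (simp add: smooth_on_const)
  qed
qed

lemma local_form_contract:
  assumes "local_form W S (Suc d) \<eta>" "w \<in> W"
  shows "local_form W S d (\<lambda>y vs. \<eta> y (w # vs))"
  unfolding local_form_def
  using local_formD[OF assms(1)] assms(2) by (auto intro: alt_form_contract)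

lemma local_form_lincomb:
  assumes "local_form W S d \<eta>" "local_form W S d \<zeta>"
  shows "local_form W S d (\<lambda>y vs. a * \<eta> y vs + b * \<zeta> y vs)"
  unfolding local_form_def
  using local_formD[OF assms(1)] local_formD[OF assms(2)]
  by (auto intro!: alt_form_lincomb smooth_on_add smooth_on_cmult)

lemma dir_deriv_lincomb:
  assumes "relopen W S" "smooth_on W S f" "smooth_on W S g" "y \<in> S" "v \<in> W"
  shows "dir_deriv (\<lambda>y. a * f y + b * g y) y v = (a::real) * dir_deriv f y v + b * dir_deriv g y v"
  using dir_deriv_add[OF assms(1) smooth_on_cmult[OF assms(2)] smooth_on_cmult[OF assms(3)] assms(4,5)]
    dir_deriv_cmult[OF assms(1,2,4,5)] dir_deriv_cmult[OF assms(1,3,4,5)] by simp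

lemma local_d_local:
  assumes "relopen W T" "y \<in> T" "T \<subseteq> S" "T \<subseteq> S'" "\<And>z vs. z \<in> T \<Longrightarrow> set vs \<subseteq> W \<Longrightarrow> \<eta> z vs = \<zeta> z vs"
  shows "local_d W S \<eta> y vs = local_d W S' \<zeta> y vs"
proof (cases "set vs \<subseteq> W")
  case True
  have "dir_deriv (\<lambda>z. \<eta> z (omit j vs)) y (vs ! j) = dir_deriv (\<lambda>z. \<zeta> z (omit j vs)) y (vs ! j)" if "j < length vs" for j
  proof (rule dir_deriv_local[OF assms(1,2)])
    show "vs ! j \<in> W" using that True by auto
    show "\<eta> z (omit j vs) = \<zeta> z (omit j vs)" if "z \<in> T" for z
      by (rule assms(5)[OF that]) (rule order_trans[OF set_omit True])
  qed
  then show ?thesis using assms(2-4) True by (auto simp: local_d_def)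
next
  case False then show ?thesis by (simp only: local_d_def) simp
qed

lemma local_d_lincomb:
  assumes "relopen W S" "local_form W S d \<eta>" "local_form W S d \<zeta>"
  shows "local_d W S (\<lambda>y vs. a * \<eta> y vs + b * \<zeta> y vs) y vs = a * local_d W S \<eta> y vs + b * local_d W S \<zeta> y vs"
proof (cases "y \<in> S \<and> set vs \<subseteq> W")
  case True
  then have "dir_deriv (\<lambda>z. a * \<eta> z (omit j vs) + b * \<zeta> z (omit j vs)) y (vs ! j) =
     a * dir_deriv (\<lambda>z. \<eta> z (omit j vs)) y (vs ! j) + b * dir_deriv (\<lambda>z. \<zeta> z (omit j vs)) y (vs ! j)"
    if "j < length vs" for j
    using that by (intro dir_deriv_lincomb[OF assms(1)] local_formD(3)[OF assms(2)] local_formD(3)[OF assms(3)]) auto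
  then show ?thesis using True
    by (simp add: local_d_def sum_distrib_left sum.distrib[symmetric] algebra_simps)
qed (auto simp: local_d_def)

text \<open>The substance is the alternating property. If the entries i and j agree, every term
  omitting another entry still contains the repetition, and the two remaining terms cancel.\<close>

lemma local_form_local_d:
  assumes W: "relopen W S" and \<eta>: "local_form W S d \<eta>"
  shows "local_form W S (Suc d) (local_d W S \<eta>)"
proof -
  note sW = relopen_subspace[OF W]
  note \<eta>a = local_formD(1)[OF \<eta>] and \<eta>s = local_formD(3)[OF \<eta>]
  have in_W: "vs ! j \<in> W" if "set vs \<subseteq> W" "j < length vs" for vs j using that by auto
  have om: "set (omit j vs) \<subseteq> W" if "set vs \<subseteq> W" for j vs by (rule order_trans[OF set_omit that])
  have "alt_form W (Suc d) (local_d W S \<eta> y)" if y: "y \<in> S" for y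
    unfolding alt_form_def
  proof (intro conjI allI impI)
    fix vs assume vs: "\<not> (length vs = Suc d \<and> set vs \<subseteq> W)"
    show "local_d W S \<eta> y vs = 0"
    proof (cases "set vs \<subseteq> W")
      case True
      then have len: "length vs \<noteq> Suc d" using vs by auto
      have "dir_deriv (\<lambda>z. \<eta> z (omit j vs)) y (vs ! j) = 0" if j: "j < length vs" for j
      proof -
        have "length (omit j vs) \<noteq> d" using length_omit[OF j] len j by linarith
        then have "\<eta> z (omit j vs) = 0" if "z \<in> S" for z
          using alt_form_zero[OF \<eta>a[OF that], of "omit j vs"] by blast
        then have "dir_deriv (\<lambda>z. \<eta> z (omit j vs)) y (vs ! j) = dir_deriv (\<lambda>z. 0::real) y (vs ! j)"
          by (intro dir_deriv_local[OF W y in_W[OF True j]])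
        then show ?thesis by simp
      qed
      then show ?thesis by (simp add: local_d_def)
    qed (simp add: local_d_def)
  next
    fix vs j u v a b assume as: "length vs = Suc d \<and> set vs \<subseteq> W \<and> j < Suc d \<and> u \<in> W \<and> v \<in> W"
    then have len: "length vs = Suc d" and vs: "set vs \<subseteq> W" and j: "j < Suc d" and u: "u \<in> W" and v: "v \<in> W" by auto
    have uv: "a *\<^sub>R u + b *\<^sub>R v \<in> W" using u v sW by (intro subspace_add subspace_scale)
    have upd: "set (vs[j := w]) \<subseteq> W" if "w \<in> W" for w
      using vs that set_update_subset_insert[of vs j w] by blast
    have "dir_deriv (\<lambda>z. \<eta> z (omit k (vs[j := a *\<^sub>R u + b *\<^sub>R v]))) y (vs[j := a *\<^sub>R u + b *\<^sub>R v] ! k) =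
       a * dir_deriv (\<lambda>z. \<eta> z (omit k (vs[j := u]))) y (vs[j := u] ! k) +
       b * dir_deriv (\<lambda>z. \<eta> z (omit k (vs[j := v]))) y (vs[j := v] ! k)" if k: "k < Suc d" for k
    proof (cases "k = j")
      case True
      have "dir_deriv (\<lambda>z. \<eta> z (omit j vs)) y (a *\<^sub>R u + b *\<^sub>R v) =
        a *\<^sub>R dir_deriv (\<lambda>z. \<eta> z (omit j vs)) y u + b *\<^sub>R dir_deriv (\<lambda>z. \<eta> z (omit j vs)) y v"
        by (rule dir_deriv_linear[OF W y smooth_on_differentiable[OF \<eta>s y] u v])
      then show ?thesis using True j len by simp
    next
      case False
      \<comment> \<open>The place of the entry j after the entry k has been removed.\<close>
      define l where "l = (if j < k then j else j - 1)"
      have om': "omit k (vs[j := w]) = (omit k vs)[l := w]" for w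
        unfolding l_def by (rule omit_update) (use False k j len in auto)
      have l: "l < d" using False k j by (auto simp: l_def)
      have lk: "length (omit k vs) = d" using length_omit[of k vs] k len by simp
      have "dir_deriv (\<lambda>z. \<eta> z ((omit k vs)[l := a *\<^sub>R u + b *\<^sub>R v])) y (vs ! k) =
        dir_deriv (\<lambda>z. a * \<eta> z ((omit k vs)[l := u]) + b * \<eta> z ((omit k vs)[l := v])) y (vs ! k)"
        by (rule dir_deriv_local[OF W y])
           (use in_W[OF vs, of k] k len alt_form_update[OF \<eta>a lk om[OF vs] l u v] in auto)
      also have "\<dots> = a * dir_deriv (\<lambda>z. \<eta> z ((omit k vs)[l := u])) y (vs ! k) + b * dir_deriv (\<lambda>z. \<eta> z ((omit k vs)[l := v])) y (vs ! k)"
        by (rule dir_deriv_lincomb[OF W \<eta>s \<eta>s y]) (use in_W[OF vs, of k] k len in auto)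
      finally show ?thesis unfolding om' using False by simp
    qed
    then show "local_d W S \<eta> y (vs[j := a *\<^sub>R u + b *\<^sub>R v]) = a * local_d W S \<eta> y (vs[j := u]) + b * local_d W S \<eta> y (vs[j := v])"
      using y upd[OF uv] upd[OF u] upd[OF v] len
      by (simp add: local_d_def sum_distrib_left sum.distrib[symmetric] algebra_simps)
  next
    fix vs i j assume as: "length vs = Suc d \<and> set vs \<subseteq> W \<and> i < j \<and> j < Suc d \<and> vs ! i = vs ! j"
    then have len: "length vs = Suc d" and vs: "set vs \<subseteq> W" and ij: "i < j" "j < Suc d" and eq: "vs ! i = vs ! j" by auto
    let ?t = "\<lambda>k. (-1) ^ k * dir_deriv (\<lambda>z. \<eta> z (omit k vs)) y (vs ! k)"
    \<comment> \<open>The repeated pair survives the omission, at the shifted places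
      \<open>i'\<close> and \<open>j'\<close>.\<close>
    have 0: "dir_deriv (\<lambda>z. \<eta> z (omit k vs)) y (vs ! k) = 0" if k: "k < Suc d" "k \<noteq> i" "k \<noteq> j" for k
    proof -
      define i' j' where "i' = (if i < k then i else i - 1)" and "j' = (if j < k then j else j - 1)"
      have lk: "length (omit k vs) = d" using length_omit[of k vs] k len by simp
      have ij': "i' < j'" "j' < d" using ij k by (auto simp: i'_def j'_def)
      have "omit k vs ! i' = vs ! i" "omit k vs ! j' = vs ! j"
        using ij k len by (auto simp: i'_def j'_def nth_append min_def)
      then have "\<eta> z (omit k vs) = 0" if "z \<in> S" for z
        using alt_form_repeat[OF \<eta>a[OF that] om[OF vs] ij'(1), of k] ij' lk eq by simp
      then have "dir_deriv (\<lambda>z. \<eta> z (omit k vs)) y (vs ! k) = dir_deriv (\<lambda>z. 0::real) y (vs ! k)"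
        by (intro dir_deriv_local[OF W y in_W[OF vs]]) (use k len in auto)
      then show ?thesis by simp
    qed
    define A B C where "A = take i vs" and "B = take (j - Suc i) (drop (Suc i) vs)" and "C = drop (Suc j) vs"
    let ?u = "vs ! i"
    have u: "?u \<in> W" using in_W[OF vs, of i] ij len by auto
    have "vs = A @ ?u # drop (Suc i) vs" unfolding A_def using ij len by (simp add: Cons_nth_drop_Suc)
    moreover have "drop (Suc i) vs = B @ ?u # C"
    proof -
      have "drop (Suc i) vs = B @ drop (j - Suc i) (drop (Suc i) vs)" unfolding B_def by (rule append_take_drop_id[symmetric])
      also have "drop (j - Suc i) (drop (Suc i) vs) = drop j vs" using ij by simp
      also have "\<dots> = vs ! j # C" unfolding C_def using ij len by (simp add: Cons_nth_drop_Suc)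
      finally show ?thesis using eq by simp
    qed
    ultimately have vsd: "vs = A @ ?u # B @ ?u # C" by simp
    have lA: "length A = i" and lB: "length B = j - Suc i" using ij len by (auto simp: A_def B_def)
    have sub: "set A \<subseteq> W" "set B \<subseteq> W" "set C \<subseteq> W"
      using vs by (subst (asm) vsd; simp)+
    have oi: "omit i vs = A @ B @ ?u # C" using vsd lA
      by (metis A_def \<open>drop (Suc i) vs = B @ ?u # C\<close>)
    have oj: "omit j vs = A @ ?u # B @ C"
    proof -
      have "j = length (A @ ?u # B)" using lA lB ij by simp
      moreover have "vs = (A @ ?u # B) @ ?u # C" using vsd by simp
      ultimately have "take j vs = A @ ?u # B" by (metis append_eq_conv_conj)
      then show ?thesis by (simp add: C_def)
    qed
    \<comment> \<open>With the common entry u the two lists are A B u C and A u B C: they differ by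
      moving u across B, which has j - i - 1 entries. Together with the signs of the terms i and j
      this makes them opposite.\<close>
    have ee: "\<eta> z (omit i vs) = (-1) ^ (j - Suc i) * \<eta> z (omit j vs)" if z: "z \<in> S" for z
    proof -
      have "\<eta> z ((A @ B) @ ?u # C) = (-1) ^ length (A @ B) * \<eta> z (?u # (A @ B) @ C)"
        by (rule alt_form_front[OF \<eta>a[OF z] sW]) (use sub u in auto)
      moreover have "\<eta> z (A @ ?u # B @ C) = (-1) ^ length A * \<eta> z (?u # A @ B @ C)"
        by (rule alt_form_front[OF \<eta>a[OF z] sW]) (use sub u in auto)
      ultimately show ?thesis unfolding oi oj using lA lB by (simp add: power_add)
    qed
    have "dir_deriv (\<lambda>z. \<eta> z (omit i vs)) y ?u = dir_deriv (\<lambda>z. (-1) ^ (j - Suc i) * \<eta> z (omit j vs)) y ?u"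
      by (rule dir_deriv_local[OF W y u]) (rule ee)
    also have "\<dots> = (-1) ^ (j - Suc i) * dir_deriv (\<lambda>z. \<eta> z (omit j vs)) y ?u"
      by (rule dir_deriv_cmult[OF W \<eta>s y u])
    finally have e1: "?t i = (-1) ^ i * (-1) ^ (j - Suc i) * dir_deriv (\<lambda>z. \<eta> z (omit j vs)) y ?u" by simp
    have "(-1::real) ^ j = - ((-1) ^ i * (-1) ^ (j - Suc i))"
      unfolding power_add[symmetric] using ij by (metis Suc_diff_Suc add_Suc_right le_add_diff_inverse less_imp_le_nat minus_one_mult_self mult_minus1 power_Suc)
    then have e2: "?t i + ?t j = 0" using e1 eq by simp
    have "(\<Sum>k<length vs. ?t k) = sum ?t {i, j}"
      by (rule sum.mono_neutral_right) (use ij len 0 in auto)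
    also have "\<dots> = 0" using e2 ij by simp
    finally show "local_d W S \<eta> y vs = 0" using y vs by (simp add: local_d_def)
  qed
  moreover have "smooth_on W S (\<lambda>y. local_d W S \<eta> y vs)" if vs: "set vs \<subseteq> W" for vs
  proof -
    have "smooth_on W S (\<lambda>y. \<Sum>j<length vs. (-1) ^ j * dir_deriv (\<lambda>z. \<eta> z (omit j vs)) y (vs ! j))"
      by (intro smooth_on_sum smooth_on_cmult smooth_on_dir_deriv[OF W \<eta>s] in_W[OF vs]) auto
    then show ?thesis
      by (subst smooth_on_cong) (use vs in \<open>auto simp: local_d_def\<close>)
  qed
  ultimately show ?thesis by (auto simp: local_form_def local_d_def)
qed

text \<open>Twofold application produces second derivatives in the directions of two omitted
  entries; they are symmetric by \<open>dir_deriv_commute\<close>, while the signs of the two orders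
  of omission are opposite.\<close>

lemma local_d_local_d:
  assumes W: "relopen W S" and \<eta>: "local_form W S d \<eta>"
  shows "local_d W S (local_d W S \<eta>) y vs = 0"
proof (cases "y \<in> S \<and> set vs \<subseteq> W")
  case True
  then have y: "y \<in> S" and vs: "set vs \<subseteq> W" by auto
  note \<eta>s = local_formD(3)[OF \<eta>]
  let ?n = "length vs"
  \<comment> \<open>Here j is the entry omitted first and i a place in the shortened list. For i < j
    the same pair of vectors is reached by omitting i first and then place j - 1.\<close>
  define a where "a j i = dir_deriv (\<lambda>z. dir_deriv (\<lambda>z. \<eta> z (omit i (omit j vs))) z (omit j vs ! i)) y (vs ! j)" for i j
  have om: "set (omit j vs) \<subseteq> W" for j by (rule order_trans[OF set_omit vs])
  have omW: "omit j vs ! i \<in> W" if "j < ?n" "i < ?n - 1" for i j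
    using that nth_mem[of i "omit j vs"] om[of j] length_omit[of j vs] by auto
  have "dir_deriv (\<lambda>z. local_d W S \<eta> z (omit j vs)) y (vs ! j) = (\<Sum>i<?n - 1. (-1) ^ i * a j i)" if j: "j < ?n" for j
  proof -
    have vj: "vs ! j \<in> W" using vs j by auto
    have "dir_deriv (\<lambda>z. local_d W S \<eta> z (omit j vs)) y (vs ! j) =
      dir_deriv (\<lambda>z. \<Sum>i<?n - 1. (-1) ^ i * dir_deriv (\<lambda>z. \<eta> z (omit i (omit j vs))) z (omit j vs ! i)) y (vs ! j)"
      by (rule dir_deriv_local[OF W y vj]) (use om length_omit[OF j] in \<open>simp add: local_d_def del: length_append\<close>)
    also have "\<dots> = (\<Sum>i<?n - 1. dir_deriv (\<lambda>z. (-1) ^ i * dir_deriv (\<lambda>z. \<eta> z (omit i (omit j vs))) z (omit j vs ! i)) y (vs ! j))"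
      by (rule dir_deriv_sum[OF W _ y vj]) (use omW[OF j] in \<open>auto intro!: smooth_on_cmult smooth_on_dir_deriv[OF W \<eta>s]\<close>)
    also have "\<dots> = (\<Sum>i<?n - 1. (-1) ^ i * a j i)"
      unfolding a_def by (intro sum.cong refl dir_deriv_cmult[OF W _ y vj] smooth_on_dir_deriv[OF W \<eta>s] omW[OF j]) auto
    finally show ?thesis .
  qed
  then have "local_d W S (local_d W S \<eta>) y vs = (\<Sum>j<?n. (-1) ^ j * (\<Sum>i<?n - 1. (-1) ^ i * a j i))"
    using True by (subst local_d_def) simp
  also have "\<dots> = 0"
  proof (rule alternating_double_sum)
    fix i j assume ij: "i < j" "j < ?n"
    have e: "omit j vs ! i = vs ! i" "omit i vs ! (j - 1) = vs ! j"
      using ij by (auto simp: nth_append min_def)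
    show "a j i = a i (j - 1)" unfolding a_def e omit_omit[OF ij]
      by (rule dir_deriv_commute[OF W \<eta>s y]) (use vs ij in auto)
  qed
  finally show ?thesis .
qed (auto simp: local_d_def)

subsection \<open>Pullback of local forms\<close>

text \<open>A Leibniz rule for a form whose base point and arguments all move; pulled-back forms are
  of this kind, their arguments being derivatives of f. The induction removes the first argument by
  expanding it in the basis: its coordinates are functions, and contraction with a basis vector
  leaves a form of one degree less.\<close>

lemma smooth_on_form_args:
  assumes W: "relopen W S" and V: "relopen V T" and f: "smooth_on W S f" "f ` S \<subseteq> T"
  shows "local_form V T (length us) \<eta> \<Longrightarrow> (\<And>u. u \<in> set us \<Longrightarrow> smooth_on W S u \<and> u ` S \<subseteq> V) \<Longrightarrow>
    smooth_on W S (\<lambda>y. \<eta> (f y) (map (\<lambda>u. u y) us)) \<and>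
    (\<forall>y\<in>S. \<forall>v\<in>W. dir_deriv (\<lambda>y. \<eta> (f y) (map (\<lambda>u. u y) us)) y v =
      dir_deriv (\<lambda>z. \<eta> z (map (\<lambda>u. u y) us)) (f y) (dir_deriv f y v) +
      (\<Sum>j<length us. \<eta> (f y) ((map (\<lambda>u. u y) us)[j := dir_deriv (us ! j) y v])))"
proof (induction us arbitrary: \<eta>)
  case Nil
  note s = local_formD(3)[OF Nil(1)]
  show ?case using smooth_on_compose[OF W V f s] dir_deriv_chain[OF W V f s] by simp
next
  case (Cons u us)
  note sV = relopen_subspace[OF V]
  have bV: "b \<in> V" if "b \<in> onb V" for b using onb(2)[OF sV] that by auto
  \<comment> \<open>Contraction with a constant basis vector, to which the induction hypothesis for
    the shorter list applies.\<close>
  define \<iota> where "\<iota> b z vs = \<eta> z (b # vs)" for b z vs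
  have lf: "local_form V T (length us) (\<iota> b)" if "b \<in> onb V" for b
    unfolding \<iota>_def[abs_def] by (rule local_form_contract) (use Cons.prems bV[OF that] in auto)
  have u: "smooth_on W S u" "u ` S \<subseteq> V" using Cons.prems(2) by auto
  have us: "set (map (\<lambda>u. u y) us) \<subseteq> V" if "y \<in> S" for y using Cons.prems(2) that by auto
  have alt: "alt_form V (Suc (length us)) (\<eta> (f y))" if "y \<in> S" for y
    using local_formD(1)[OF Cons.prems(1)] f that by auto
  have ubs: "smooth_on W S (\<lambda>y. u y \<bullet> b)" for b
    by (rule smooth_on_bounded_linear_comp[OF bounded_linear_inner_left u(1)])
  define g where "g b = (\<lambda>y. \<iota> b (f y) (map (\<lambda>u. u y) us))" for b
  have IH: "smooth_on W S (g b)"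
    "\<And>y v. y \<in> S \<Longrightarrow> v \<in> W \<Longrightarrow> dir_deriv (g b) y v =
      dir_deriv (\<lambda>z. \<iota> b z (map (\<lambda>u. u y) us)) (f y) (dir_deriv f y v) +
      (\<Sum>j<length us. \<iota> b (f y) ((map (\<lambda>u. u y) us)[j := dir_deriv (us ! j) y v]))" if "b \<in> onb V" for b
    using Cons.IH[OF lf[OF that]] Cons.prems(2) unfolding g_def by auto
  have ex: "\<eta> (f y) (map (\<lambda>u. u y) (u # us)) = (\<Sum>b\<in>onb V. (u y \<bullet> b) * g b y)" if "y \<in> S" for y
    using alt_form_expand_head[OF alt[OF that] sV us[OF that], of "u y"] u(2) that by (auto simp: \<iota>_def g_def)
  have gs: "smooth_on W S (\<lambda>y. (u y \<bullet> b) * g b y)" if "b \<in> onb V" for b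
    by (rule smooth_on_bilinear[OF bounded_bilinear_mult W ubs IH(1)[OF that]])
  have "smooth_on W S (\<lambda>y. \<Sum>b\<in>onb V. (u y \<bullet> b) * g b y)"
    by (rule smooth_on_sum) (rule gs)
  then have "smooth_on W S (\<lambda>y. \<eta> (f y) (map (\<lambda>u. u y) (u # us)))"
    using smooth_on_cong[of S "\<lambda>y. \<eta> (f y) (map (\<lambda>u. u y) (u # us))" "\<lambda>y. \<Sum>b\<in>onb V. (u y \<bullet> b) * g b y" W] ex by blast
  moreover have "dir_deriv (\<lambda>y. \<eta> (f y) (map (\<lambda>u. u y) (u # us))) y v =
      dir_deriv (\<lambda>z. \<eta> z (map (\<lambda>u. u y) (u # us))) (f y) (dir_deriv f y v) +
      (\<Sum>j<length (u # us). \<eta> (f y) ((map (\<lambda>u. u y) (u # us))[j := dir_deriv ((u # us) ! j) y v]))"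
    if y: "y \<in> S" and v: "v \<in> W" for y v
  proof -
    let ?us = "map (\<lambda>u. u y) us" and ?w = "dir_deriv f y v"
    have w: "?w \<in> V"
      by (rule dir_deriv_image[OF W f(1) _ sV y v]) (use f(2) relopen_subset[OF V] in auto)
    have du: "dir_deriv u y v \<in> V" by (rule dir_deriv_image[OF W u sV y v])
    have fy: "f y \<in> T" using f y by auto
    have "dir_deriv (\<lambda>y. \<eta> (f y) (map (\<lambda>u. u y) (u # us))) y v = dir_deriv (\<lambda>y. \<Sum>b\<in>onb V. (u y \<bullet> b) * g b y) y v"
      by (rule dir_deriv_local[OF W y v ex])
    also have "\<dots> = (\<Sum>b\<in>onb V. dir_deriv (\<lambda>y. (u y \<bullet> b) * g b y) y v)"
      by (rule dir_deriv_sum[OF W gs y v])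
    also have "\<dots> = (\<Sum>b\<in>onb V. (u y \<bullet> b) * dir_deriv (g b) y v + (dir_deriv u y v \<bullet> b) * g b y)"
      using dir_deriv_bilinear[OF bounded_bilinear_mult W ubs IH(1) y v]
        dir_deriv_bounded_linear_comp[OF W u(1) bounded_linear_inner_left y v]
      by (intro sum.cong) auto
    also have "\<dots> = (\<Sum>b\<in>onb V. (u y \<bullet> b) * dir_deriv (\<lambda>z. \<iota> b z ?us) (f y) ?w) +
       (\<Sum>b\<in>onb V. (u y \<bullet> b) * (\<Sum>j<length us. \<iota> b (f y) (?us[j := dir_deriv (us ! j) y v]))) +
       (\<Sum>b\<in>onb V. (dir_deriv u y v \<bullet> b) * g b y)"
      using IH(2)[OF _ y v] by (simp add: sum.distrib algebra_simps)
    also have "(\<Sum>b\<in>onb V. (dir_deriv u y v \<bullet> b) * g b y) = \<eta> (f y) (dir_deriv u y v # ?us)"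
      using alt_form_expand_head[OF alt[OF y] sV us[OF y] du] by (simp add: \<iota>_def g_def)
    also have "(\<Sum>b\<in>onb V. (u y \<bullet> b) * (\<Sum>j<length us. \<iota> b (f y) (?us[j := dir_deriv (us ! j) y v]))) =
        (\<Sum>j<length us. \<eta> (f y) (u y # ?us[j := dir_deriv (us ! j) y v]))"
    proof -
      have "(\<Sum>b\<in>onb V. (u y \<bullet> b) * \<iota> b (f y) (?us[j := dir_deriv (us ! j) y v])) =
        \<eta> (f y) (u y # ?us[j := dir_deriv (us ! j) y v])" if j: "j < length us" for j
      proof -
        have "dir_deriv (us ! j) y v \<in> V"
          by (rule dir_deriv_image[OF W _ _ sV y v]) (use Cons.prems(2) j in auto)
        then have "set (?us[j := dir_deriv (us ! j) y v]) \<subseteq> V"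
          using us[OF y] set_update_subset_insert[of ?us j "dir_deriv (us ! j) y v"] by blast
        then show ?thesis
          using alt_form_expand_head[OF alt[OF y] sV, of _ "u y"] u(2) y by (auto simp: \<iota>_def)
      qed
      then show ?thesis by (subst sum_distrib_left, subst sum.swap) simp
    qed
    also have "(\<Sum>b\<in>onb V. (u y \<bullet> b) * dir_deriv (\<lambda>z. \<iota> b z ?us) (f y) ?w) =
       dir_deriv (\<lambda>z. \<eta> z (map (\<lambda>u. u y) (u # us))) (f y) ?w"
    proof -
      have "dir_deriv (\<lambda>z. \<eta> z (map (\<lambda>u. u y) (u # us))) (f y) ?w =
         dir_deriv (\<lambda>z. \<Sum>b\<in>onb V. (u y \<bullet> b) * \<iota> b z ?us) (f y) ?w"
        using alt_form_expand_head[OF local_formD(1)[OF Cons.prems(1)] sV us[OF y], of _ "u y"] u(2) y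
        by (intro dir_deriv_local[OF V fy w]) (auto simp: \<iota>_def)
      also have "\<dots> = (\<Sum>b\<in>onb V. dir_deriv (\<lambda>z. (u y \<bullet> b) * \<iota> b z ?us) (f y) ?w)"
        by (intro dir_deriv_sum[OF V _ fy w] smooth_on_cmult local_formD(3)[OF lf])
      also have "\<dots> = (\<Sum>b\<in>onb V. (u y \<bullet> b) * dir_deriv (\<lambda>z. \<iota> b z ?us) (f y) ?w)"
        by (intro sum.cong refl dir_deriv_cmult[OF V local_formD(3)[OF lf] fy w])
      finally show ?thesis by simp
    qed
    finally show ?thesis unfolding length_Cons sum.lessThan_Suc_shift by simp
  qed
  ultimately show ?case by blast
qed

definition local_pull :: "'a::euclidean_space set \<Rightarrow> 'a set \<Rightarrow> ('a \<Rightarrow> 'b::euclidean_space) \<Rightarrow>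
    ('b \<Rightarrow> 'b list \<Rightarrow> real) \<Rightarrow> 'a \<Rightarrow> 'a list \<Rightarrow> real" where
  "local_pull W S f \<eta> y vs = (if y \<in> S \<and> set vs \<subseteq> W then \<eta> (f y) (map (dir_deriv f y) vs) else 0)"

lemma local_form_pull:
  assumes W: "relopen W S" and V: "relopen V T" and f: "smooth_on W S f" "f ` S \<subseteq> T"
    and \<eta>: "local_form V T d \<eta>"
  shows "local_form W S d (local_pull W S f \<eta>)"
proof -
  note sV = relopen_subspace[OF V]
  have fV: "f ` S \<subseteq> V" using f(2) relopen_subset[OF V] by auto
  have Df: "dir_deriv f y v \<in> V" if "y \<in> S" "v \<in> W" for y v
    by (rule dir_deriv_image[OF W f(1) fV sV that])
  have "alt_form W d (local_pull W S f \<eta> y)" if y: "y \<in> S" for y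
  proof -
    have a: "alt_form V d (\<eta> (f y))" using local_formD(1)[OF \<eta>] f(2) y by auto
    have sub: "set (map (dir_deriv f y) vs) \<subseteq> V" if "set vs \<subseteq> W" for vs using Df[OF y] that by auto
    show ?thesis unfolding alt_form_def
    proof (intro conjI allI impI)
      fix vs assume "\<not> (length vs = d \<and> set vs \<subseteq> W)"
      then show "local_pull W S f \<eta> y vs = 0" using alt_form_zero[OF a, of "map (dir_deriv f y) vs"]
        by (auto simp: local_pull_def)
    next
      fix vs j u v a' b' assume as: "length vs = d \<and> set vs \<subseteq> W \<and> j < d \<and> u \<in> W \<and> v \<in> W"
      have upd: "set (vs[j := w]) \<subseteq> W" if "w \<in> W" for w
        using as that set_update_subset_insert[of vs j w] by blast
      have uv: "a' *\<^sub>R u + b' *\<^sub>R v \<in> W" using as relopen_subspace[OF W] by (auto intro: subspace_add subspace_scale)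
      have "dir_deriv f y (a' *\<^sub>R u + b' *\<^sub>R v) = a' *\<^sub>R dir_deriv f y u + b' *\<^sub>R dir_deriv f y v"
        by (rule dir_deriv_linear[OF W y smooth_on_differentiable[OF f(1) y]]) (use as in auto)
      then show "local_pull W S f \<eta> y (vs[j := a' *\<^sub>R u + b' *\<^sub>R v]) =
         a' * local_pull W S f \<eta> y (vs[j := u]) + b' * local_pull W S f \<eta> y (vs[j := v])"
        using y upd[OF uv] upd[of u] upd[of v] as sub[of vs] Df[OF y]
          alt_form_update[OF a, of "map (dir_deriv f y) vs" j "dir_deriv f y u" "dir_deriv f y v" a' b']
        by (simp add: local_pull_def map_update)
    next
      fix vs i j assume "length vs = d \<and> set vs \<subseteq> W \<and> i < j \<and> j < d \<and> vs ! i = vs ! j"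
      then show "local_pull W S f \<eta> y vs = 0"
        using alt_form_repeat[OF a, of "map (dir_deriv f y) vs" i j] sub[of vs] by (simp add: local_pull_def)
    qed
  qed
  moreover have "smooth_on W S (\<lambda>y. local_pull W S f \<eta> y vs)" if vs: "length vs = d" "set vs \<subseteq> W" for vs
  proof -
    let ?us = "map (\<lambda>v y. dir_deriv f y v) vs"
    have "smooth_on W S (\<lambda>y. \<eta> (f y) (map (\<lambda>u. u y) ?us))"
      by (rule conjunct1[OF smooth_on_form_args[OF W V f]])
         (use \<eta> vs Df in \<open>auto intro!: smooth_on_dir_deriv[OF W f(1)]\<close>)
    then show ?thesis by (subst smooth_on_cong) (use vs in \<open>auto simp: local_pull_def o_def\<close>)
  qed
  ultimately show ?thesis by (auto simp: local_form_def local_pull_def)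
qed

text \<open>By the Leibniz rule the left side is the right side plus terms containing second
  derivatives of f. Those are symmetric in the two vectors while the form is alternating, so they
  cancel in pairs.\<close>

lemma local_d_pull:
  assumes W: "relopen W S" and V: "relopen V T" and f: "smooth_on W S f" "f ` S \<subseteq> T"
    and \<eta>: "local_form V T d \<eta>"
  shows "local_d W S (local_pull W S f \<eta>) y vs = local_pull W S f (local_d V T \<eta>) y vs"
proof (cases "y \<in> S \<and> set vs \<subseteq> W")
  case True
  then have y: "y \<in> S" and vs: "set vs \<subseteq> W" by auto
  note lp = local_form_pull[OF assms]
  show ?thesis
  proof (cases "length vs = Suc d")
    case False
    \<comment> \<open>On lists of the wrong length both sides vanish by the normalisation of forms;
      the Leibniz rule is applied to lists of length d + 1 only.\<close>
    have "local_d W S (local_pull W S f \<eta>) y vs = 0"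
      using alt_form_zero[OF local_formD(1)[OF local_form_local_d[OF W lp] y]] False by blast
    moreover have "local_d V T \<eta> (f y) (map (dir_deriv f y) vs) = 0"
      using alt_form_zero[OF local_formD(1)[OF local_form_local_d[OF V \<eta>], of "f y"]] f y False by auto
    ultimately show ?thesis by (simp add: local_pull_def)
  next
    case len: True
    let ?n = "length vs" and ?D = "dir_deriv f y"
    note sV = relopen_subspace[OF V]
    have fV: "f ` S \<subseteq> V" using f(2) relopen_subset[OF V] by auto
    have Df: "dir_deriv f z v \<in> V" if "z \<in> S" "v \<in> W" for z v
      by (rule dir_deriv_image[OF W f(1) fV sV that])
    have om: "set (omit j vs) \<subseteq> W" for j by (rule order_trans[OF set_omit vs])
    have omW: "omit j vs ! i \<in> W" if "j < ?n" "i < ?n - 1" for i j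
      using that nth_mem[of i "omit j vs"] om[of j] length_omit[of j vs] by auto
    have fy: "f y \<in> T" using f y by auto
    note alt = local_formD(1)[OF \<eta> fy]
    \<comment> \<open>The terms with a second derivative of f, its value moved to the front of the
      argument list at the cost of the sign \<open>(-1) ^ i\<close>.\<close>
    define a where "a j i = \<eta> (f y) (dir_deriv (\<lambda>z. dir_deriv f z (omit j vs ! i)) y (vs ! j) # map ?D (omit i (omit j vs)))" for i j
    have "dir_deriv (\<lambda>z. local_pull W S f \<eta> z (omit j vs)) y (vs ! j) =
       dir_deriv (\<lambda>z. \<eta> z (omit j (map ?D vs))) (f y) (map ?D vs ! j) + (\<Sum>i<?n - 1. (-1) ^ i * a j i)"
      if j: "j < ?n" for j
    proof -
      let ?us = "map (\<lambda>v z. dir_deriv f z v) (omit j vs)"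
      have vj: "vs ! j \<in> W" using vs j by auto
      have lj: "length (omit j vs) = ?n - 1" by (rule length_omit[OF j])
      have mp: "map (\<lambda>u. u z) ?us = map (dir_deriv f z) (omit j vs)" for z by (simp add: o_def)
      have "dir_deriv (\<lambda>z. local_pull W S f \<eta> z (omit j vs)) y (vs ! j) =
        dir_deriv (\<lambda>z. \<eta> (f z) (map (\<lambda>u. u z) ?us)) y (vs ! j)"
        by (rule dir_deriv_local[OF W y vj]) (use om[of j] in \<open>simp add: local_pull_def o_def\<close>)
      also have "\<dots> = dir_deriv (\<lambda>z. \<eta> z (map (\<lambda>u. u y) ?us)) (f y) (dir_deriv f y (vs ! j)) +
        (\<Sum>i<length ?us. \<eta> (f y) ((map (\<lambda>u. u y) ?us)[i := dir_deriv (?us ! i) y (vs ! j)]))"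
      proof (rule conjunct2[OF smooth_on_form_args[OF W V f], rule_format, OF _ _ y vj])
        show "local_form V T (length ?us) \<eta>" using \<eta> lj len by simp
        fix u assume "u \<in> set ?us"
        then show "smooth_on W S u \<and> u ` S \<subseteq> V" using om[of j] Df by (auto intro!: smooth_on_dir_deriv[OF W f(1)])
      qed
      also have "(\<Sum>i<length ?us. \<eta> (f y) ((map (\<lambda>u. u y) ?us)[i := dir_deriv (?us ! i) y (vs ! j)])) = (\<Sum>i<?n - 1. (-1) ^ i * a j i)"
      proof (rule sum.cong)
        fix i assume "i \<in> {..<?n - 1}"
        then have i: "i < ?n - 1" by simp
        have ui: "?us ! i = (\<lambda>z. dir_deriv f z (omit j vs ! i))" by (rule nth_map) (use i lj in simp)
        have dV: "dir_deriv (\<lambda>z. dir_deriv f z (omit j vs ! i)) y (vs ! j) \<in> V"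
          by (rule dir_deriv_image[OF W smooth_on_dir_deriv[OF W f(1)] _ sV y vj]) (use omW[OF j i] Df in auto)
        have sj: "set (map ?D (omit j vs)) \<subseteq> V" using om[of j] Df[OF y] by auto
        show "\<eta> (f y) ((map (\<lambda>u. u y) ?us)[i := dir_deriv (?us ! i) y (vs ! j)]) = (-1) ^ i * a j i"
          unfolding mp ui a_def map_omit[of _ i]
          by (rule alt_form_front_update[OF alt sV sj dV]) (use i lj in simp)
      qed (use lj in simp)
      finally show ?thesis unfolding mp map_omit[of ?D] using j by simp
    qed
    then have "local_d W S (local_pull W S f \<eta>) y vs =
      (\<Sum>j<?n. (-1) ^ j * dir_deriv (\<lambda>z. \<eta> z (omit j (map ?D vs))) (f y) (map ?D vs ! j)) +
      (\<Sum>j<?n. (-1) ^ j * (\<Sum>i<?n - 1. (-1) ^ i * a j i))"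
      using True by (subst local_d_def) (simp add: distrib_left sum.distrib)
    also have "(\<Sum>j<?n. (-1) ^ j * (\<Sum>i<?n - 1. (-1) ^ i * a j i)) = 0"
    proof (rule alternating_double_sum)
      fix i j assume ij: "i < j" "j < ?n"
      have e: "omit j vs ! i = vs ! i" "omit i vs ! (j - 1) = vs ! j"
        using ij by (auto simp: nth_append min_def)
      have "dir_deriv (\<lambda>z. dir_deriv f z (vs ! i)) y (vs ! j) = dir_deriv (\<lambda>z. dir_deriv f z (vs ! j)) y (vs ! i)"
        by (rule dir_deriv_commute[OF W f(1) y]) (use vs ij in auto)
      then show "a j i = a i (j - 1)" unfolding a_def e omit_omit[OF ij] by simp
    qed
    also have "(\<Sum>j<?n. (-1) ^ j * dir_deriv (\<lambda>z. \<eta> z (omit j (map ?D vs))) (f y) (map ?D vs ! j)) =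
      local_d V T \<eta> (f y) (map ?D vs)"
    proof -
      have "set (map ?D vs) \<subseteq> V" using vs Df[OF y] by auto
      then show ?thesis using fy by (simp add: local_d_def)
    qed
    also have "\<dots> = local_pull W S f (local_d V T \<eta>) y vs" using True by (simp add: local_pull_def)
    finally show ?thesis by simp
  qed
qed (auto simp: local_d_def local_pull_def)

section \<open>Manifolds given by an atlas\<close>

definition coord_ok :: "('x, 'a::euclidean_space) coord \<Rightarrow> bool" where
  "coord_ok c \<longleftrightarrow> inj_on (cmap c) (cdom c) \<and> relopen (cmodel c) (cimg c)"

definition rep_dom :: "('x \<Rightarrow> 'y) \<Rightarrow> ('x, 'a) coord \<Rightarrow> ('y, 'b) coord \<Rightarrow> 'a set" where
  "rep_dom f c c' = cmap c ` {x \<in> cdom c. f x \<in> cdom c'}"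

definition smooth_between ::
  "('x \<Rightarrow> 'y) \<Rightarrow> ('x, 'a::euclidean_space) coord \<Rightarrow> ('y, 'b::euclidean_space) coord \<Rightarrow> bool" where
  "smooth_between f c c' \<longleftrightarrow> relopen (cmodel c) (rep_dom f c c') \<and>
     smooth_on (cmodel c) (rep_dom f c c') (local_rep f c c')"

text \<open>
  The topology enters the arguments below only through the openness of the domains of coordinate
  expressions, so it is left out of the notions of manifold and smooth map used in them.
\<close>

definition amfd :: "('x, 'a::euclidean_space) manifold \<Rightarrow> bool" where
  "amfd M \<longleftrightarrow> (\<forall>c\<in>matlas M. coord_ok c) \<and> mpts M = (\<Union>c\<in>matlas M. cdom c) \<and>
     (\<forall>c\<in>matlas M. \<forall>c'\<in>matlas M. smooth_between (\<lambda>x. x) c c')"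

definition asmooth ::
  "('x, 'a::euclidean_space) manifold \<Rightarrow> ('y, 'b::euclidean_space) manifold \<Rightarrow> ('x \<Rightarrow> 'y) \<Rightarrow> bool" where
  "asmooth M N f \<longleftrightarrow> f ` mpts M \<subseteq> mpts N \<and> (\<forall>c\<in>matlas M. \<forall>c'\<in>matlas N. smooth_between f c c')"

lemma amfdD:
  assumes "amfd M"
  shows "c \<in> matlas M \<Longrightarrow> coord_ok c" "c \<in> matlas M \<Longrightarrow> x \<in> cdom c \<Longrightarrow> x \<in> mpts M"
    "x \<in> mpts M \<Longrightarrow> \<exists>c\<in>matlas M. x \<in> cdom c"
    "c \<in> matlas M \<Longrightarrow> c' \<in> matlas M \<Longrightarrow> smooth_between (\<lambda>x. x) c c'"
  using assms by (auto simp: amfd_def)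

lemma asmoothD:
  assumes "asmooth M N f"
  shows "x \<in> mpts M \<Longrightarrow> f x \<in> mpts N" "c \<in> matlas M \<Longrightarrow> c' \<in> matlas N \<Longrightarrow> smooth_between f c c'"
  using assms by (auto simp: asmooth_def)

lemma coord_okD:
  assumes "coord_ok c"
  shows "relopen (cmodel c) (cimg c)" "subspace (cmodel c)"
    "x \<in> cdom c \<Longrightarrow> cinv c (cmap c x) = x" "y \<in> cimg c \<Longrightarrow> cinv c y \<in> cdom c"
    "y \<in> cimg c \<Longrightarrow> cmap c (cinv c y) = y"
  using assms by (auto simp: coord_ok_def inv_into_into f_inv_into_f relopen_def)

lemma local_rep_cmap: "coord_ok c \<Longrightarrow> x \<in> cdom c \<Longrightarrow> local_rep f c c' (cmap c x) = cmap c' (f x)"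
  by (simp add: local_rep_def coord_okD)

lemma rep_dom_iff: "coord_ok c \<Longrightarrow> x \<in> cdom c \<Longrightarrow> cmap c x \<in> rep_dom f c c' \<longleftrightarrow> f x \<in> cdom c'"
  by (auto simp: rep_dom_def coord_ok_def inj_on_def)

lemma rep_dom_subset: "rep_dom f c c' \<subseteq> cimg c"
  by (auto simp: rep_dom_def)

lemma local_rep_image: "coord_ok c \<Longrightarrow> local_rep f c c' ` rep_dom f c c' \<subseteq> cimg c'"
  by (auto simp: rep_dom_def local_rep_cmap)

lemma smooth_betweenD:
  assumes "smooth_between f c c'"
  shows "relopen (cmodel c) (rep_dom f c c')" "smooth_on (cmodel c) (rep_dom f c c') (local_rep f c c')"
  using assms by (auto simp: smooth_between_def)

lemma smooth_between_cong:
  assumes "smooth_between f c c'" "coord_ok c" "\<And>x. x \<in> cdom c \<Longrightarrow> f x = g x"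
  shows "smooth_between g c c'"
proof -
  have 1: "rep_dom f c c' = rep_dom g c c'" using assms(3) by (auto simp: rep_dom_def)
  have "local_rep f c c' y = local_rep g c c' y" if "y \<in> rep_dom f c c'" for y
    using that assms(2,3) by (auto simp: rep_dom_def local_rep_cmap)
  then have "smooth_on (cmodel c) (rep_dom f c c') (local_rep f c c') = smooth_on (cmodel c) (rep_dom f c c') (local_rep g c c')"
    by (rule smooth_on_cong)
  then show ?thesis using assms(1) 1 by (simp add: smooth_between_def)
qed

lemma local_rep_deriv_in:
  assumes "smooth_between f c c'" "coord_ok c" "coord_ok c'" "x \<in> cdom c" "f x \<in> cdom c'" "v \<in> cmodel c"
  shows "dir_deriv (local_rep f c c') (cmap c x) v \<in> cmodel c'"
proof (rule dir_deriv_image[OF smooth_betweenD[OF assms(1)] _ coord_okD(2)[OF assms(3)] _ assms(6)])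
  show "local_rep f c c' ` rep_dom f c c' \<subseteq> cmodel c'"
    using local_rep_image[OF assms(2)] relopen_subset[OF coord_okD(1)[OF assms(3)]] by (rule order_trans)
  show "cmap c x \<in> rep_dom f c c'" using assms by (simp add: rep_dom_iff)
qed

text \<open>The coordinate expression of the composition factors through \<open>c'\<close> only
  where f has values in the domain of \<open>c'\<close>. \<open>P\<close> is this part of its
  domain, and it is all that local statements need.\<close>

lemma local_rep_chain:
  assumes f: "smooth_between f c c'" and g: "smooth_between g c' c''"
    and c: "coord_ok c" "coord_ok c'"
  defines "P \<equiv> {y \<in> rep_dom f c c'. local_rep f c c' y \<in> rep_dom g c' c''}"
  shows "relopen (cmodel c) P" "P \<subseteq> rep_dom (\<lambda>x. g (f x)) c c''"
    "\<And>x. x \<in> cdom c \<Longrightarrow> f x \<in> cdom c' \<Longrightarrow> g (f x) \<in> cdom c'' \<Longrightarrow> cmap c x \<in> P"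
    "smooth_on (cmodel c) P (local_rep (\<lambda>x. g (f x)) c c'')"
    "\<And>x v. x \<in> cdom c \<Longrightarrow> f x \<in> cdom c' \<Longrightarrow> g (f x) \<in> cdom c'' \<Longrightarrow> v \<in> cmodel c \<Longrightarrow>
      dir_deriv (local_rep (\<lambda>x. g (f x)) c c'') (cmap c x) v =
      dir_deriv (local_rep g c' c'') (cmap c' (f x)) (dir_deriv (local_rep f c c') (cmap c x) v)"
proof -
  note f' = smooth_betweenD[OF f] and g' = smooth_betweenD[OF g]
  show P: "relopen (cmodel c) P" unfolding P_def
    by (rule relopen_preimage[OF f'(1) g'(1) smooth_on_continuous[OF f'(2)]])
       (use local_rep_image[OF c(1), of f c'] relopen_subset[OF coord_okD(1)[OF c(2)]] in blast)
  have Pi: "\<exists>x. y = cmap c x \<and> x \<in> cdom c \<and> f x \<in> cdom c' \<and> g (f x) \<in> cdom c''" if "y \<in> P" for y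
  proof -
    have "y \<in> rep_dom f c c'" and g: "local_rep f c c' y \<in> rep_dom g c' c''" using that by (auto simp: P_def)
    then obtain x where x: "y = cmap c x" "x \<in> cdom c" "f x \<in> cdom c'" by (auto simp: rep_dom_def)
    then show ?thesis using g by (auto simp: local_rep_cmap[OF c(1)] rep_dom_iff[OF c(2)])
  qed
  show "P \<subseteq> rep_dom (\<lambda>x. g (f x)) c c''" using Pi by (fastforce simp: rep_dom_def)
  show inP: "cmap c x \<in> P" if "x \<in> cdom c" "f x \<in> cdom c'" "g (f x) \<in> cdom c''" for x
    using that by (simp add: P_def rep_dom_iff[OF c(1)] rep_dom_iff[OF c(2)] local_rep_cmap[OF c(1)])
  have sf: "smooth_on (cmodel c) P (local_rep f c c')"
    by (rule smooth_on_subset[OF f'(2)]) (auto simp: P_def)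
  have im: "local_rep f c c' ` P \<subseteq> rep_dom g c' c''" by (auto simp: P_def)
  have eq: "local_rep (\<lambda>x. g (f x)) c c'' y = local_rep g c' c'' (local_rep f c c' y)" if "y \<in> P" for y
    using Pi[OF that] by (auto simp: local_rep_cmap[OF c(1)] local_rep_cmap[OF c(2)])
  have "smooth_on (cmodel c) P (\<lambda>y. local_rep g c' c'' (local_rep f c c' y))"
    by (rule smooth_on_compose[OF P g'(1) sf im g'(2)])
  moreover have "smooth_on (cmodel c) P (local_rep (\<lambda>x. g (f x)) c c'') = smooth_on (cmodel c) P (\<lambda>y. local_rep g c' c'' (local_rep f c c' y))"
    by (rule smooth_on_cong) (rule eq)
  ultimately show "smooth_on (cmodel c) P (local_rep (\<lambda>x. g (f x)) c c'')" by simp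
  fix x v assume x: "x \<in> cdom c" "f x \<in> cdom c'" "g (f x) \<in> cdom c''" and v: "v \<in> cmodel c"
  have "dir_deriv (local_rep (\<lambda>x. g (f x)) c c'') (cmap c x) v = dir_deriv (\<lambda>y. local_rep g c' c'' (local_rep f c c' y)) (cmap c x) v"
    by (rule dir_deriv_local[OF P inP[OF x] v eq])
  also have "\<dots> = dir_deriv (local_rep g c' c'') (local_rep f c c' (cmap c x)) (dir_deriv (local_rep f c c') (cmap c x) v)"
    by (rule dir_deriv_chain[OF P g'(1) sf im g'(2) inP[OF x] v])
  finally show "dir_deriv (local_rep (\<lambda>x. g (f x)) c c'') (cmap c x) v =
      dir_deriv (local_rep g c' c'') (cmap c' (f x)) (dir_deriv (local_rep f c c') (cmap c x) v)"
    using x by (simp add: local_rep_cmap[OF c(1)])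
qed

lemma smooth_betweenI_local:
  assumes c: "coord_ok c"
    and "\<And>x. x \<in> cdom c \<Longrightarrow> f x \<in> cdom c' \<Longrightarrow> \<exists>P. relopen (cmodel c) P \<and> cmap c x \<in> P \<and>
      P \<subseteq> rep_dom f c c' \<and> smooth_on (cmodel c) P (local_rep f c c')"
  shows "smooth_between f c c'"
proof -
  have *: "\<exists>P. relopen (cmodel c) P \<and> y \<in> P \<and> P \<subseteq> rep_dom f c c' \<and> smooth_on (cmodel c) P (local_rep f c c')"
    if "y \<in> rep_dom f c c'" for y using that assms(2) by (auto simp: rep_dom_def)
  have r: "relopen (cmodel c) (rep_dom f c c')"
    by (rule relopen_Un_local[OF coord_okD(2)[OF c]]) (use * in blast)
  moreover have "smooth_on (cmodel c) (rep_dom f c c') (local_rep f c c')"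
    by (rule smooth_on_local[OF r]) (use * in blast)
  ultimately show ?thesis by (simp add: smooth_between_def)
qed

text \<open>Smoothness is local, so it suffices that the images under f are covered by intermediate
  coordinates. Their set C is left open: it will be an atlas, or a single coordinate.\<close>

lemma smooth_between_compose:
  assumes c: "coord_ok c" and C: "\<And>c'. c' \<in> C \<Longrightarrow> coord_ok c' \<and> smooth_between f c c' \<and> smooth_between g c' c''"
    and cov: "\<And>x. x \<in> cdom c \<Longrightarrow> g (f x) \<in> cdom c'' \<Longrightarrow> \<exists>c'\<in>C. f x \<in> cdom c'"
  shows "smooth_between (\<lambda>x. g (f x)) c c''"
proof (rule smooth_betweenI_local[OF c])
  fix x assume x: "x \<in> cdom c" "g (f x) \<in> cdom c''"
  then obtain c' where c': "c' \<in> C" "f x \<in> cdom c'" using cov by blast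
  then have "coord_ok c'" "smooth_between f c c'" "smooth_between g c' c''" using C by auto
  from local_rep_chain[OF this(2,3) c this(1)] x c'
  show "\<exists>P. relopen (cmodel c) P \<and> cmap c x \<in> P \<and>
      P \<subseteq> rep_dom (\<lambda>x. g (f x)) c c'' \<and> smooth_on (cmodel c) P (local_rep (\<lambda>x. g (f x)) c c'')"
    by blast
qed

lemma asmooth_compose:
  assumes "amfd M" "amfd N" "asmooth M N f" "asmooth N L g"
  shows "asmooth M L (\<lambda>x. g (f x))"
  unfolding asmooth_def
proof (intro conjI ballI)
  show "(\<lambda>x. g (f x)) ` mpts M \<subseteq> mpts L" using asmoothD(1)[OF assms(3)] asmoothD(1)[OF assms(4)] by auto
  fix c c'' assume c: "c \<in> matlas M" "c'' \<in> matlas L"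
  show "smooth_between (\<lambda>x. g (f x)) c c''"
  proof (rule smooth_between_compose[where C="matlas N"])
    show "coord_ok c" using amfdD(1)[OF assms(1)] c by blast
    show "coord_ok c' \<and> smooth_between f c c' \<and> smooth_between g c' c''" if "c' \<in> matlas N" for c'
      using amfdD(1)[OF assms(2) that] asmoothD(2)[OF assms(3) c(1) that] asmoothD(2)[OF assms(4) that c(2)] by blast
    show "\<exists>c'\<in>matlas N. f x \<in> cdom c'" if "x \<in> cdom c" for x
      using amfdD(3)[OF assms(2)] asmoothD(1)[OF assms(3)] amfdD(2)[OF assms(1) c(1)] that by blast
  qed
qed

lemma asmooth_cong:
  assumes "asmooth M N f" "amfd M" "\<And>x. x \<in> mpts M \<Longrightarrow> f x = g x"
  shows "asmooth M N g"
  unfolding asmooth_def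
proof (intro conjI ballI)
  show "g ` mpts M \<subseteq> mpts N" using asmoothD(1)[OF assms(1)] assms(3) by auto
  fix c c' assume c: "c \<in> matlas M" "c' \<in> matlas N"
  show "smooth_between g c c'"
    by (rule smooth_between_cong[OF asmoothD(2)[OF assms(1) c] amfdD(1)[OF assms(2) c(1)]])
       (use assms(3) amfdD(2)[OF assms(2) c(1)] in auto)
qed

lemma asmooth_id: "amfd M \<Longrightarrow> asmooth M M (\<lambda>x. x)"
  by (auto simp: asmooth_def amfd_def)

subsection \<open>Differential forms\<close>

lemma formsD:
  assumes "\<omega> \<in> forms M d"
  shows "c \<notin> matlas M \<Longrightarrow> \<omega> c y vs = 0" "c \<in> matlas M \<Longrightarrow> local_form (cmodel c) (cimg c) d (\<omega> c)"
  using assms by (auto simp: forms_def)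

lemma forms_vanish:
  assumes "\<omega> \<in> forms M d" "\<not> (c \<in> matlas M \<and> y \<in> cimg c \<and> set vs \<subseteq> cmodel c)"
  shows "\<omega> c y vs = 0"
  using assms formsD[OF assms(1)] local_formD(1,2) alt_form_zero by metis

lemma forms_change:
  assumes "\<omega> \<in> forms M d" "c \<in> matlas M" "c' \<in> matlas M" "x \<in> cdom c" "x \<in> cdom c'" "coord_ok c" "set vs \<subseteq> cmodel c"
  shows "\<omega> c (cmap c x) vs = \<omega> c' (cmap c' x) (map (dir_deriv (local_rep (\<lambda>x. x) c c') (cmap c x)) vs)"
proof -
  have "cmap c x \<in> cmap c ` (cdom c \<inter> cdom c')" using assms by auto
  then have "\<omega> c (cmap c x) vs = \<omega> c' (local_rep (\<lambda>x. x) c c' (cmap c x)) (map (dir_deriv (local_rep (\<lambda>x. x) c c') (cmap c x)) vs)"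
    using assms(1-3,7) unfolding forms_def by blast
  then show ?thesis using assms by (simp add: local_rep_cmap)
qed

lemma formsI:
  assumes M: "amfd M" and "\<And>c y vs. c \<notin> matlas M \<Longrightarrow> \<omega> c y vs = 0"
    and "\<And>c. c \<in> matlas M \<Longrightarrow> local_form (cmodel c) (cimg c) d (\<omega> c)"
    and "\<And>c c' x vs. c \<in> matlas M \<Longrightarrow> c' \<in> matlas M \<Longrightarrow> x \<in> cdom c \<Longrightarrow> x \<in> cdom c' \<Longrightarrow> set vs \<subseteq> cmodel c \<Longrightarrow>
      \<omega> c (cmap c x) vs = \<omega> c' (cmap c' x) (map (dir_deriv (local_rep (\<lambda>x. x) c c') (cmap c x)) vs)"
  shows "\<omega> \<in> forms M d"
proof -
  have "\<omega> c = (\<lambda>_ _. 0)" if "c \<notin> matlas M" for c using assms(2)[OF that] by (intro ext)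
  then show ?thesis unfolding forms_def using assms(3,4) by (auto simp: local_rep_cmap amfdD(1)[OF M])
qed

text \<open>Removes the arbitrary choice of the target coordinate in \<open>pullback\<close>: two
  choices differ by a transition map, under which forms are invariant, and the chain rule merges its
  derivative with that of f.\<close>

lemma pullback_eval:
  assumes M: "amfd M" and N: "amfd N" and f: "asmooth M N f" and \<omega>: "\<omega> \<in> forms N d"
    and c: "c \<in> matlas M" "x \<in> cdom c" and c': "c' \<in> matlas N" "f x \<in> cdom c'" and vs: "set vs \<subseteq> cmodel c"
  shows "pullback f M N \<omega> c (cmap c x) vs = \<omega> c' (cmap c' (f x)) (map (dir_deriv (local_rep f c c') (cmap c x)) vs)"
proof -
  note ok = amfdD(1)[OF M c(1)]
  have cx: "cinv c (cmap c x) = x" using coord_okD(3)[OF ok] c by blast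
  \<comment> \<open>The coordinate that the definition of \<open>pullback\<close> selects.\<close>
  define e where "e = (SOME c'. c' \<in> matlas N \<and> f x \<in> cdom c')"
  have "e \<in> matlas N \<and> f x \<in> cdom e" unfolding e_def by (rule someI[of _ c']) (use c' in auto)
  then have e: "e \<in> matlas N" "f x \<in> cdom e" by auto
  note oke = amfdD(1)[OF N e(1)]
  note fe = asmoothD(2)[OF f c(1) e(1)]
  have fc': "smooth_between (\<lambda>x. x) e c'" using amfdD(4)[OF N e(1) c'(1)] .
  have in_e: "dir_deriv (local_rep f c e) (cmap c x) v \<in> cmodel e" if "v \<in> cmodel c" for v
    by (rule local_rep_deriv_in[OF fe ok oke c(2) e(2) that])
  have "pullback f M N \<omega> c (cmap c x) vs = \<omega> e (local_rep f c e (cmap c x)) (map (dir_deriv (local_rep f c e) (cmap c x)) vs)"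
    using c vs by (simp add: pullback_def cx e_def[symmetric] Let_def)
  also have "local_rep f c e (cmap c x) = cmap e (f x)" using ok c by (simp add: local_rep_cmap)
  also have "\<omega> e (cmap e (f x)) (map (dir_deriv (local_rep f c e) (cmap c x)) vs) =
     \<omega> c' (cmap c' (f x)) (map (dir_deriv (local_rep (\<lambda>x. x) e c') (cmap e (f x))) (map (dir_deriv (local_rep f c e) (cmap c x)) vs))"
    by (rule forms_change[OF \<omega> e(1) c'(1) e(2) c'(2) oke]) (use in_e vs in auto)
  also have "map (dir_deriv (local_rep (\<lambda>x. x) e c') (cmap e (f x))) (map (dir_deriv (local_rep f c e) (cmap c x)) vs) =
    map (dir_deriv (local_rep f c c') (cmap c x)) vs"
    using local_rep_chain(5)[OF fe fc' ok oke c(2) e(2) c'(2)] vs by auto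
  finally show ?thesis .
qed

lemma pullback_vanish:
  "\<not> (c \<in> matlas M \<and> y \<in> cimg c \<and> set vs \<subseteq> cmodel c) \<Longrightarrow> pullback f M N \<omega> c y vs = 0"
  by (simp only: pullback_def if_False)

lemma pullback_local:
  assumes M: "amfd M" and N: "amfd N" and f: "asmooth M N f" and \<omega>: "\<omega> \<in> forms N d"
    and c: "c \<in> matlas M" and c': "c' \<in> matlas N" and y: "y \<in> rep_dom f c c'"
  shows "pullback f M N \<omega> c y vs = local_pull (cmodel c) (rep_dom f c c') (local_rep f c c') (\<omega> c') y vs"
proof -
  obtain x where x: "y = cmap c x" "x \<in> cdom c" "f x \<in> cdom c'" using y by (auto simp: rep_dom_def)
  show ?thesis
  proof (cases "set vs \<subseteq> cmodel c")
    case True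
    then show ?thesis using pullback_eval[OF M N f \<omega> c x(2) c' x(3) True] y x
      by (simp add: local_pull_def local_rep_cmap[OF amfdD(1)[OF M c]])
  next
    case False
    then show ?thesis by (simp only: pullback_def local_pull_def) simp
  qed
qed

lemma local_formI_local:
  assumes W: "relopen W S" and out: "\<And>y vs. y \<notin> S \<Longrightarrow> \<eta> y vs = 0"
    and loc: "\<And>y. y \<in> S \<Longrightarrow> \<exists>T \<zeta>. relopen W T \<and> y \<in> T \<and> T \<subseteq> S \<and> local_form W T d \<zeta> \<and> (\<forall>z\<in>T. \<forall>vs. \<eta> z vs = \<zeta> z vs)"
  shows "local_form W S d \<eta>"
  unfolding local_form_def
proof (intro conjI ballI allI impI)
  fix y assume "y \<in> S"
  then obtain T \<zeta> where T: "y \<in> T" "local_form W T d \<zeta>" "\<forall>z\<in>T. \<forall>vs. \<eta> z vs = \<zeta> z vs" using loc by blast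
  then have "\<eta> y = \<zeta> y" by auto
  then show "alt_form W d (\<eta> y)" using local_formD(1)[OF T(2,1)] by simp
next
  fix vs show "smooth_on W S (\<lambda>y. \<eta> y vs)"
  proof (rule smooth_on_local[OF W])
    fix y assume "y \<in> S"
    then obtain T \<zeta> where T: "relopen W T" "y \<in> T" "T \<subseteq> S" "local_form W T d \<zeta>" "\<forall>z\<in>T. \<forall>vs. \<eta> z vs = \<zeta> z vs" using loc by blast
    then have "smooth_on W T (\<lambda>y. \<eta> y vs) = smooth_on W T (\<lambda>y. \<zeta> y vs)" by (intro smooth_on_cong) auto
    then have "smooth_on W T (\<lambda>y. \<eta> y vs)" using local_formD(3)[OF T(4)] by simp
    then show "\<exists>T. relopen W T \<and> y \<in> T \<and> T \<subseteq> S \<and> smooth_on W T (\<lambda>y. \<eta> y vs)" using T by blast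
  qed
qed (use out in auto)

lemma pullback_forms:
  assumes M: "amfd M" and N: "amfd N" and f: "asmooth M N f" and \<omega>: "\<omega> \<in> forms N d"
  shows "pullback f M N \<omega> \<in> forms M d"
proof (rule formsI[OF M])
  fix c assume c: "c \<in> matlas M"
  note ok = amfdD(1)[OF M c]
  show "local_form (cmodel c) (cimg c) d (pullback f M N \<omega> c)"
  proof (rule local_formI_local[OF coord_okD(1)[OF ok]])
    fix y assume "y \<in> cimg c"
    then obtain x where x: "x \<in> cdom c" "y = cmap c x" by auto
    then obtain c' where c': "c' \<in> matlas N" "f x \<in> cdom c'"
      using amfdD(3)[OF N] asmoothD(1)[OF f] amfdD(2)[OF M c] by blast
    let ?T = "rep_dom f c c'" and ?\<zeta> = "local_pull (cmodel c) (rep_dom f c c') (local_rep f c c') (\<omega> c')"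
    note fc' = smooth_betweenD[OF asmoothD(2)[OF f c c'(1)]]
    have "local_form (cmodel c) ?T d ?\<zeta>"
      by (rule local_form_pull[OF fc'(1) coord_okD(1)[OF amfdD(1)[OF N c'(1)]] fc'(2) local_rep_image[OF ok] formsD(2)[OF \<omega> c'(1)]])
    moreover have "y \<in> ?T" using x c' by (auto simp: rep_dom_def)
    moreover have "\<forall>z\<in>?T. \<forall>vs. pullback f M N \<omega> c z vs = ?\<zeta> z vs"
      using pullback_local[OF M N f \<omega> c c'(1)] by blast
    ultimately show "\<exists>T \<zeta>. relopen (cmodel c) T \<and> y \<in> T \<and> T \<subseteq> cimg c \<and> local_form (cmodel c) T d \<zeta> \<and>
        (\<forall>z\<in>T. \<forall>vs. pullback f M N \<omega> c z vs = \<zeta> z vs)"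
      using fc'(1) rep_dom_subset by metis
  qed (simp add: pullback_def)
next
  fix c e x vs assume c: "c \<in> matlas M" "e \<in> matlas M" "x \<in> cdom c" "x \<in> cdom e" and vs: "set vs \<subseteq> cmodel c"
  note ok = amfdD(1)[OF M c(1)] amfdD(1)[OF M c(2)]
  obtain c' where c': "c' \<in> matlas N" "f x \<in> cdom c'"
    using amfdD(3)[OF N] asmoothD(1)[OF f] amfdD(2)[OF M c(1,3)] by blast
  note id = amfdD(4)[OF M c(1,2)]
  have sub: "set (map (dir_deriv (local_rep (\<lambda>x. x) c e) (cmap c x)) vs) \<subseteq> cmodel e"
    using local_rep_deriv_in[OF id ok c(3,4)] vs by auto
  have "map (dir_deriv (local_rep f e c') (cmap e x)) (map (dir_deriv (local_rep (\<lambda>x. x) c e) (cmap c x)) vs) =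
     map (dir_deriv (local_rep f c c') (cmap c x)) vs"
    using local_rep_chain(5)[OF id asmoothD(2)[OF f c(2) c'(1)] ok c(3,4) c'(2)] vs by auto
  note mp = this
  show "pullback f M N \<omega> c (cmap c x) vs = pullback f M N \<omega> e (cmap e x) (map (dir_deriv (local_rep (\<lambda>x. x) c e) (cmap c x)) vs)"
    using pullback_eval[OF M N f \<omega> c(1,3) c' vs] pullback_eval[OF M N f \<omega> c(2,4) c' sub] unfolding mp by simp
qed (simp add: pullback_def)

text \<open>Independence of coordinates is naturality of the local exterior derivative, applied to
  the transition maps.\<close>

lemma ext_d_forms:
  assumes M: "amfd M" and \<omega>: "\<omega> \<in> forms M d"
  shows "ext_d M \<omega> \<in> forms M (Suc d)"
proof (rule formsI[OF M])
  fix c assume c: "c \<in> matlas M"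
  show "local_form (cmodel c) (cimg c) (Suc d) (ext_d M \<omega> c)"
    using local_form_local_d[OF coord_okD(1)[OF amfdD(1)[OF M c]] formsD(2)[OF \<omega> c]] c by (simp add: ext_d_def)
next
  fix c e x vs assume c: "c \<in> matlas M" "e \<in> matlas M" "x \<in> cdom c" "x \<in> cdom e" and vs: "set vs \<subseteq> cmodel c"
  note ok = amfdD(1)[OF M c(1)] amfdD(1)[OF M c(2)]
  note id = smooth_betweenD[OF amfdD(4)[OF M c(1,2)]]
  let ?P = "rep_dom (\<lambda>x. x) c e" and ?k = "local_rep (\<lambda>x. x) c e"
  have xP: "cmap c x \<in> ?P" using c by (simp add: rep_dom_iff[OF ok(1)])
  have eq: "\<omega> c z us = local_pull (cmodel c) ?P ?k (\<omega> e) z us" if z: "z \<in> ?P" and us: "set us \<subseteq> cmodel c" for z us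
  proof -
    obtain x where x: "z = cmap c x" "x \<in> cdom c" "x \<in> cdom e" using z by (auto simp: rep_dom_def)
    show ?thesis using forms_change[OF \<omega> c(1,2) x(2,3) ok(1) us] z us x
      by (simp add: local_pull_def local_rep_cmap[OF ok(1)])
  qed
  have "local_d (cmodel c) (cimg c) (\<omega> c) (cmap c x) vs = local_d (cmodel c) ?P (local_pull (cmodel c) ?P ?k (\<omega> e)) (cmap c x) vs"
    by (rule local_d_local[OF id(1) xP rep_dom_subset order_refl eq])
  also have "\<dots> = local_pull (cmodel c) ?P ?k (local_d (cmodel e) (cimg e) (\<omega> e)) (cmap c x) vs"
    by (rule local_d_pull[OF id(1) coord_okD(1)[OF ok(2)] id(2) local_rep_image[OF ok(1)] formsD(2)[OF \<omega> c(2)]])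
  finally show "ext_d M \<omega> c (cmap c x) vs = ext_d M \<omega> e (cmap e x) (map (dir_deriv ?k (cmap c x)) vs)"
    using c xP vs by (simp add: ext_d_def local_pull_def local_rep_cmap[OF ok(1)])
qed (simp add: ext_d_def)

lemma ext_d_ext_d:
  assumes M: "amfd M" and \<omega>: "\<omega> \<in> forms M d"
  shows "ext_d M (ext_d M \<omega>) = (\<lambda>_ _ _. 0)"
proof (intro ext)
  fix c y vs show "ext_d M (ext_d M \<omega>) c y vs = 0"
    using local_d_local_d[OF coord_okD(1)[OF amfdD(1)[OF M]] formsD(2)[OF \<omega>], of c y vs]
    by (simp add: ext_d_def)
qed

lemma ext_d_vanish:
  "\<not> (c \<in> matlas M \<and> y \<in> cimg c \<and> set vs \<subseteq> cmodel c) \<Longrightarrow> ext_d M \<omega> c y vs = 0"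
  by (auto simp: ext_d_def local_d_def)

lemma ext_d_pullback:
  assumes M: "amfd M" and N: "amfd N" and f: "asmooth M N f" and \<omega>: "\<omega> \<in> forms N d"
  shows "ext_d M (pullback f M N \<omega>) = pullback f M N (ext_d N \<omega>)"
proof (intro ext)
  fix c y vs
  show "ext_d M (pullback f M N \<omega>) c y vs = pullback f M N (ext_d N \<omega>) c y vs"
  proof (cases "c \<in> matlas M \<and> y \<in> cimg c \<and> set vs \<subseteq> cmodel c")
    case True
    then obtain x where c: "c \<in> matlas M" and x: "x \<in> cdom c" "y = cmap c x" by auto
    then obtain c' where c': "c' \<in> matlas N" "f x \<in> cdom c'"
      using amfdD(3)[OF N] asmoothD(1)[OF f] amfdD(2)[OF M c] by blast
    note ok = amfdD(1)[OF M c] amfdD(1)[OF N c'(1)]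
    note s = smooth_betweenD[OF asmoothD(2)[OF f c c'(1)]]
    let ?P = "rep_dom f c c'" and ?k = "local_rep f c c'"
    have yP: "y \<in> ?P" using c' x by (simp add: rep_dom_iff[OF ok(1)])
    have "local_d (cmodel c) (cimg c) (pullback f M N \<omega> c) y vs = local_d (cmodel c) ?P (local_pull (cmodel c) ?P ?k (\<omega> c')) y vs"
      by (rule local_d_local[OF s(1) yP rep_dom_subset order_refl pullback_local[OF M N f \<omega> c c'(1)]])
    also have "\<dots> = local_pull (cmodel c) ?P ?k (local_d (cmodel c') (cimg c') (\<omega> c')) y vs"
      by (rule local_d_pull[OF s(1) coord_okD(1)[OF ok(2)] s(2) local_rep_image[OF ok(1)] formsD(2)[OF \<omega> c'(1)]])
    also have "\<dots> = local_pull (cmodel c) ?P ?k (ext_d N \<omega> c') y vs" using c' by (simp add: ext_d_def)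
    also have "\<dots> = pullback f M N (ext_d N \<omega>) c y vs"
      by (rule pullback_local[OF M N f ext_d_forms[OF N \<omega>] c c'(1) yP, symmetric])
    finally show ?thesis using c by (simp add: ext_d_def)
  next
    case False then show ?thesis using ext_d_vanish[OF False] pullback_vanish[OF False] by simp
  qed
qed

lemma pullback_pullback:
  assumes M: "amfd M" and N: "amfd N" and L: "amfd L" and f: "asmooth M N f" and g: "asmooth N L g" and \<omega>: "\<omega> \<in> forms L d"
  shows "pullback f M N (pullback g N L \<omega>) = pullback (\<lambda>x. g (f x)) M L \<omega>"
proof (intro ext)
  fix c y vs
  show "pullback f M N (pullback g N L \<omega>) c y vs = pullback (\<lambda>x. g (f x)) M L \<omega> c y vs"
  proof (cases "c \<in> matlas M \<and> y \<in> cimg c \<and> set vs \<subseteq> cmodel c")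
    case True
    then obtain x where c: "c \<in> matlas M" and x: "x \<in> cdom c" "y = cmap c x" by auto
    then obtain c' where c': "c' \<in> matlas N" "f x \<in> cdom c'"
      using amfdD(3)[OF N] asmoothD(1)[OF f] amfdD(2)[OF M c] by blast
    then obtain c'' where c'': "c'' \<in> matlas L" "g (f x) \<in> cdom c''"
      using amfdD(3)[OF L] asmoothD(1)[OF g] amfdD(2)[OF N c'(1)] by blast
    note ok = amfdD(1)[OF M c] amfdD(1)[OF N c'(1)]
    note s = asmoothD(2)[OF f c c'(1)]
    have vs: "set vs \<subseteq> cmodel c" using True by blast
    have sub: "set (map (dir_deriv (local_rep f c c') (cmap c x)) vs) \<subseteq> cmodel c'"
      using local_rep_deriv_in[OF s ok x(1) c'(2)] vs by auto
    have "map (dir_deriv (local_rep g c' c'') (cmap c' (f x))) (map (dir_deriv (local_rep f c c') (cmap c x)) vs) =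
      map (dir_deriv (local_rep (\<lambda>x. g (f x)) c c'') (cmap c x)) vs"
      using local_rep_chain(5)[OF s asmoothD(2)[OF g c'(1) c''(1)] ok x(1) c'(2) c''(2)] vs by auto
    note mp = this
    show ?thesis unfolding x(2)
      using pullback_eval[OF M N f pullback_forms[OF N L g \<omega>] c x(1) c' vs]
        pullback_eval[OF N L g \<omega> c' c'' sub]
        pullback_eval[OF M L asmooth_compose[OF M N f g] \<omega> c x(1) c'' vs] unfolding mp by simp
  next
    case False
    show ?thesis by (rule trans[OF pullback_vanish[OF False] pullback_vanish[OF False, symmetric]])
  qed
qed

lemma pullback_id:
  assumes M: "amfd M" and \<omega>: "\<omega> \<in> forms M d"
  shows "pullback (\<lambda>x. x) M M \<omega> = \<omega>"
proof (intro ext)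
  fix c y vs
  show "pullback (\<lambda>x. x) M M \<omega> c y vs = \<omega> c y vs"
  proof (cases "c \<in> matlas M \<and> y \<in> cimg c \<and> set vs \<subseteq> cmodel c")
    case True
    then obtain x where c: "c \<in> matlas M" and x: "x \<in> cdom c" "y = cmap c x" by auto
    then show ?thesis
      using pullback_eval[OF M M asmooth_id[OF M] \<omega> c x(1) c x(1)] forms_change[OF \<omega> c c x(1) x(1) amfdD(1)[OF M c]] True by simp
  next
    case False then show ?thesis using forms_vanish[OF \<omega> False] pullback_vanish[OF False] by simp
  qed
qed

lemma pullback_cong:
  assumes M: "amfd M" and N: "amfd N" and f: "asmooth M N f" and \<omega>: "\<omega> \<in> forms N d" and eq: "\<And>x. x \<in> mpts M \<Longrightarrow> f x = g x"
  shows "pullback f M N \<omega> = pullback g M N \<omega>"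
proof (intro ext)
  fix c y vs
  show "pullback f M N \<omega> c y vs = pullback g M N \<omega> c y vs"
  proof (cases "c \<in> matlas M \<and> y \<in> cimg c \<and> set vs \<subseteq> cmodel c")
    case True
    then obtain x where c: "c \<in> matlas M" and x: "x \<in> cdom c" "y = cmap c x" by auto
    have xM: "x \<in> mpts M" using amfdD(2)[OF M c x(1)] .
    have vs: "set vs \<subseteq> cmodel c" using True by blast
    note g = asmooth_cong[OF f M eq]
    obtain c' where c': "c' \<in> matlas N" "f x \<in> cdom c'"
      using amfdD(3)[OF N] asmoothD(1)[OF f xM] by blast
    have gx: "g x \<in> cdom c'" using c' eq[OF xM] by simp
    note ok = amfdD(1)[OF M c]
    have "dir_deriv (local_rep f c c') (cmap c x) v = dir_deriv (local_rep g c c') (cmap c x) v" if "v \<in> cmodel c" for v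
      by (rule dir_deriv_local[OF coord_okD(1)[OF ok] _ that]) (use x eq amfdD(2)[OF M c] in \<open>auto simp: local_rep_cmap[OF ok]\<close>)
    then have "map (dir_deriv (local_rep f c c') (cmap c x)) vs = map (dir_deriv (local_rep g c c') (cmap c x)) vs"
      using vs by auto
    note mp = this
    show ?thesis unfolding x(2)
      using pullback_eval[OF M N f \<omega> c x(1) c' vs] pullback_eval[OF M N g \<omega> c x(1) c'(1) gx vs] eq[OF xM] unfolding mp by simp
  next
    case False
    show ?thesis by (rule trans[OF pullback_vanish[OF False] pullback_vanish[OF False, symmetric]])
  qed
qed

lemma forms_lincomb:
  assumes M: "amfd M" and \<omega>: "\<omega> \<in> forms M d" and \<eta>: "\<eta> \<in> forms M d"
  shows "(\<lambda>c y vs. a * \<omega> c y vs + b * \<eta> c y vs) \<in> forms M d"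
proof (rule formsI[OF M])
  fix c assume c: "c \<in> matlas M"
  show "local_form (cmodel c) (cimg c) d (\<lambda>y vs. a * \<omega> c y vs + b * \<eta> c y vs)"
    by (rule local_form_lincomb[OF formsD(2)[OF \<omega> c] formsD(2)[OF \<eta> c]])
next
  fix c e x vs assume c: "c \<in> matlas M" "e \<in> matlas M" "x \<in> cdom c" "x \<in> cdom e" and vs: "set vs \<subseteq> cmodel c"
  show "a * \<omega> c (cmap c x) vs + b * \<eta> c (cmap c x) vs =
    a * \<omega> e (cmap e x) (map (dir_deriv (local_rep (\<lambda>x. x) c e) (cmap c x)) vs) +
    b * \<eta> e (cmap e x) (map (dir_deriv (local_rep (\<lambda>x. x) c e) (cmap c x)) vs)"
    using forms_change[OF \<omega> c amfdD(1)[OF M c(1)] vs] forms_change[OF \<eta> c amfdD(1)[OF M c(1)] vs] by simp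
qed (simp add: formsD(1)[OF \<omega>] formsD(1)[OF \<eta>])

lemma ext_d_lincomb:
  assumes M: "amfd M" and \<omega>: "\<omega> \<in> forms M d" and \<eta>: "\<eta> \<in> forms M d"
  shows "ext_d M (\<lambda>c y vs. a * \<omega> c y vs + b * \<eta> c y vs) = (\<lambda>c y vs. a * ext_d M \<omega> c y vs + b * ext_d M \<eta> c y vs)"
proof (intro ext)
  fix c y vs
  show "ext_d M (\<lambda>c y vs. a * \<omega> c y vs + b * \<eta> c y vs) c y vs = a * ext_d M \<omega> c y vs + b * ext_d M \<eta> c y vs"
    using local_d_lincomb[OF coord_okD(1)[OF amfdD(1)[OF M]] formsD(2)[OF \<omega>] formsD(2)[OF \<eta>], of c a b y vs]
    by (simp add: ext_d_def)
qed

lemma pullback_lincomb: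
  "pullback f M N (\<lambda>c y vs. a * \<omega> c y vs + b * \<eta> c y vs) =
    (\<lambda>c y vs. a * pullback f M N \<omega> c y vs + b * pullback f M N \<eta> c y vs)"
  by (auto simp: pullback_def Let_def fun_eq_iff)

subsection \<open>Products with a vector space\<close>

definition prod_coord :: "'f::euclidean_space set \<Rightarrow> ('x, 'a::euclidean_space) coord \<Rightarrow> ('x \<times> 'f, 'a \<times> 'f) coord" where
  "prod_coord F c = Coord (cdom c \<times> F) (\<lambda>(x, v). (cmap c x, v)) (cmodel c \<times> F)"

lemma prod_coord_sel [simp]:
  "cdom (prod_coord F c) = cdom c \<times> F" "cmap (prod_coord F c) (x, v) = (cmap c x, v)"
  "cmodel (prod_coord F c) = cmodel c \<times> F"
  by (simp_all add: prod_coord_def)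

lemma cmap_prod_coord: "cmap (prod_coord F c) p = (cmap c (fst p), snd p)"
  by (cases p) simp

lemma cimg_prod_coord [simp]: "cmap (prod_coord F c) ` (A \<times> B) = cmap c ` A \<times> B"
  by (force simp: prod_coord_def)

lemma matlas_prod_space [simp]: "matlas (prod_space M F) = prod_coord F ` matlas M"
  by (simp add: prod_space_def prod_coord_def[abs_def])

lemma coord_ok_prod: "coord_ok c \<Longrightarrow> subspace F \<Longrightarrow> coord_ok (prod_coord F c)"
  by (auto simp: coord_ok_def inj_on_def relopen_Times relopen_self)

lemma smooth_betweenI:
  assumes "coord_ok c" "relopen (cmodel c) P" "P = rep_dom f c c'" "smooth_on (cmodel c) P h"
    "\<And>x. x \<in> cdom c \<Longrightarrow> f x \<in> cdom c' \<Longrightarrow> cmap c' (f x) = h (cmap c x)"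
  shows "smooth_between f c c'"
proof -
  have "smooth_on (cmodel c) P (local_rep f c c') = smooth_on (cmodel c) P h"
    by (rule smooth_on_cong) (use assms(3,5) in \<open>auto simp: rep_dom_def local_rep_cmap[OF assms(1)]\<close>)
  then show ?thesis using assms(2-4) by (simp add: smooth_between_def)
qed

context
  fixes c :: "('x, 'a::euclidean_space) coord" and c' :: "('y, 'b::euclidean_space) coord"
    and f :: "'x \<Rightarrow> 'y" and F :: "'f::euclidean_space set"
  assumes c: "coord_ok c" and f: "smooth_between f c c'" and F: "subspace F"
begin

lemma relopen_rep_dom_Times: "relopen (cmodel c \<times> F) (rep_dom f c c' \<times> F)"
  by (intro relopen_Times relopen_self F smooth_betweenD(1)[OF f])

lemma smooth_on_local_rep_fst:
  "smooth_on (cmodel c \<times> F) (rep_dom f c c' \<times> F) (\<lambda>p. local_rep f c c' (fst p))"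
  by (rule smooth_on_compose[OF relopen_rep_dom_Times smooth_betweenD(1)[OF f]
       smooth_on_bounded_linear[OF bounded_linear_fst] _ smooth_betweenD(2)[OF f]]) auto

lemma rep_dom_prod:
  "rep_dom (\<lambda>p. (f (fst p), snd p)) (prod_coord F c) (prod_coord F c') = rep_dom f c c' \<times> F"
  by (force simp: rep_dom_def cmap_prod_coord)

lemma smooth_between_prod:
  "smooth_between (\<lambda>p. (f (fst p), snd p)) (prod_coord F c) (prod_coord F c')"
proof (rule smooth_betweenI[where P="rep_dom f c c' \<times> F" and h="\<lambda>p. (local_rep f c c' (fst p), snd p)"])
  show "smooth_on (cmodel (prod_coord F c)) (rep_dom f c c' \<times> F) (\<lambda>p. (local_rep f c c' (fst p), snd p))"
    using smooth_on_Pair[OF smooth_on_local_rep_fst smooth_on_bounded_linear[OF bounded_linear_snd]] by simp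
qed (auto simp: relopen_rep_dom_Times rep_dom_prod coord_ok_prod[OF c F] local_rep_cmap[OF c])

lemma dir_deriv_prod:
  assumes x: "x \<in> cdom c" "f x \<in> cdom c'" and v: "v \<in> cmodel c" and s: "s \<in> F" "t \<in> F"
  shows "dir_deriv (local_rep (\<lambda>p. (f (fst p), snd p)) (prod_coord F c) (prod_coord F c')) (cmap c x, s) (v, t) =
    (dir_deriv (local_rep f c c') (cmap c x) v, t)"
proof -
  let ?R = "rep_dom f c c' \<times> F" and ?W = "cmodel c \<times> F"
  have y: "(cmap c x, s) \<in> ?R" "(v, t) \<in> ?W" using x s v by (simp_all add: rep_dom_iff[OF c])
  have "dir_deriv (local_rep (\<lambda>p. (f (fst p), snd p)) (prod_coord F c) (prod_coord F c')) (cmap c x, s) (v, t) =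
    dir_deriv (\<lambda>p. (local_rep f c c' (fst p), snd p)) (cmap c x, s) (v, t)"
  proof (rule dir_deriv_local[OF relopen_rep_dom_Times y])
    fix z assume "z \<in> ?R"
    then obtain x w where z: "z = (cmap c x, w)" "x \<in> cdom c" "w \<in> F" by (auto simp: rep_dom_def)
    then show "local_rep (\<lambda>p. (f (fst p), snd p)) (prod_coord F c) (prod_coord F c') z = (local_rep f c c' (fst z), snd z)"
      using local_rep_cmap[OF coord_ok_prod[OF c F], of "(x, w)" "\<lambda>p. (f (fst p), snd p)" "prod_coord F c'"]
        local_rep_cmap[OF c, of x f c'] by simp
  qed
  also have "\<dots> = (dir_deriv (\<lambda>p. local_rep f c c' (fst p)) (cmap c x, s) (v, t), dir_deriv snd (cmap c x, s) (v, t))"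
    by (rule dir_deriv_pair[OF relopen_rep_dom_Times smooth_on_local_rep_fst smooth_on_bounded_linear[OF bounded_linear_snd] y])
  also have "dir_deriv (\<lambda>p. local_rep f c c' (fst p)) (cmap c x, s) (v, t) =
     dir_deriv (local_rep f c c') (fst (cmap c x, s)) (dir_deriv fst (cmap c x, s) (v, t))"
    by (rule dir_deriv_chain[OF relopen_rep_dom_Times smooth_betweenD(1)[OF f]
       smooth_on_bounded_linear[OF bounded_linear_fst] _ smooth_betweenD(2)[OF f] y]) auto
  finally show ?thesis by (simp add: dir_deriv_bounded_linear[OF bounded_linear_fst] dir_deriv_bounded_linear[OF bounded_linear_snd])
qed

lemma smooth_between_incl:
  assumes "s \<in> F"
  shows "smooth_between (\<lambda>x. (f x, s)) c (prod_coord F c')"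
proof (rule smooth_betweenI[where P="rep_dom f c c'" and h="\<lambda>y. (local_rep f c c' y, s)"])
  show "smooth_on (cmodel c) (rep_dom f c c') (\<lambda>y. (local_rep f c c' y, s))"
    by (intro smooth_on_Pair smooth_on_const smooth_betweenD(2)[OF f])
qed (use assms smooth_betweenD(1)[OF f] in \<open>auto simp: c rep_dom_def local_rep_cmap[OF c]\<close>)

lemma dir_deriv_incl:
  assumes x: "x \<in> cdom c" "f x \<in> cdom c'" and v: "v \<in> cmodel c" and s: "s \<in> F"
  shows "dir_deriv (local_rep (\<lambda>x. (f x, s)) c (prod_coord F c')) (cmap c x) v =
    (dir_deriv (local_rep f c c') (cmap c x) v, 0)"
proof -
  have y: "cmap c x \<in> rep_dom f c c'" using x by (simp add: rep_dom_iff[OF c])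
  have "dir_deriv (local_rep (\<lambda>x. (f x, s)) c (prod_coord F c')) (cmap c x) v =
    dir_deriv (\<lambda>y. (local_rep f c c' y, s)) (cmap c x) v"
    by (rule dir_deriv_local[OF smooth_betweenD(1)[OF f] y v]) (auto simp: rep_dom_def local_rep_cmap[OF c])
  also have "\<dots> = (dir_deriv (local_rep f c c') (cmap c x) v, dir_deriv (\<lambda>y. s) (cmap c x) v)"
    by (rule dir_deriv_pair[OF smooth_betweenD[OF f] smooth_on_const y v])
  finally show ?thesis by simp
qed

lemma smooth_between_fst: "smooth_between (\<lambda>p. f (fst p)) (prod_coord F c) c'"
proof (rule smooth_betweenI[where P="rep_dom f c c' \<times> F" and h="\<lambda>p. local_rep f c c' (fst p)"])
  show "rep_dom f c c' \<times> F = rep_dom (\<lambda>p. f (fst p)) (prod_coord F c) c'"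
    by (force simp: rep_dom_def cmap_prod_coord)
  show "smooth_on (cmodel (prod_coord F c)) (rep_dom f c c' \<times> F) (\<lambda>p. local_rep f c c' (fst p))"
    using smooth_on_local_rep_fst by simp
qed (auto simp: relopen_rep_dom_Times coord_ok_prod[OF c F] local_rep_cmap[OF c])

text \<open>The scaling factor is the last factor of the source, which is thus a cylinder over the
  bundle chart; this is the form in which the homotopy is used. The map f enters as a transition map
  of the base.\<close>

lemma smooth_between_scale:
  "smooth_between (\<lambda>p. (f (fst (fst p)), snd p *\<^sub>R snd (fst p))) (prod_coord UNIV (prod_coord F c)) (prod_coord F c')"
proof (rule smooth_betweenI[where P="(rep_dom f c c' \<times> F) \<times> UNIV" and
      h="\<lambda>p. (local_rep f c c' (fst (fst p)), snd p *\<^sub>R snd (fst p))"])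
  have R: "relopen ((cmodel c \<times> F) \<times> (UNIV :: real set)) ((rep_dom f c c' \<times> F) \<times> UNIV)"
    by (intro relopen_Times_UNIV relopen_rep_dom_Times)
  then show "relopen (cmodel (prod_coord (UNIV :: real set) (prod_coord F c))) ((rep_dom f c c' \<times> F) \<times> UNIV)" by simp
  have 1: "smooth_on ((cmodel c \<times> F) \<times> UNIV) ((rep_dom f c c' \<times> F) \<times> (UNIV :: real set)) (\<lambda>p. local_rep f c c' (fst (fst p)))"
    by (rule smooth_on_compose[OF R relopen_rep_dom_Times smooth_on_bounded_linear[OF bounded_linear_fst] _ smooth_on_local_rep_fst]) auto
  have 2: "smooth_on ((cmodel c \<times> F) \<times> UNIV) ((rep_dom f c c' \<times> F) \<times> (UNIV :: real set)) (\<lambda>p. snd p *\<^sub>R snd (fst p))"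
    by (intro smooth_on_bilinear[OF bounded_bilinear_scaleR R] smooth_on_bounded_linear bounded_linear_snd
        smooth_on_snd bounded_linear_fst)
  show "smooth_on (cmodel (prod_coord (UNIV :: real set) (prod_coord F c))) ((rep_dom f c c' \<times> F) \<times> UNIV)
     (\<lambda>p. (local_rep f c c' (fst (fst p)), snd p *\<^sub>R snd (fst p)))"
    using smooth_on_Pair[OF 1 2] by simp
  show "(rep_dom f c c' \<times> F) \<times> UNIV = rep_dom (\<lambda>p. (f (fst (fst p)), snd p *\<^sub>R snd (fst p))) (prod_coord (UNIV :: real set) (prod_coord F c)) (prod_coord F c')"
    using F by (force simp: rep_dom_def cmap_prod_coord intro: subspace_scale)
qed (auto simp: coord_ok_prod[OF coord_ok_prod[OF c F] subspace_UNIV] local_rep_cmap[OF c])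

end

lemma amfd_prod:
  assumes M: "amfd M" and F: "subspace F"
  shows "amfd (prod_space M F)"
  unfolding amfd_def
proof (intro conjI ballI)
  show "mpts (prod_space M F) = (\<Union>c\<in>matlas (prod_space M F). cdom c)"
    using M by (auto simp: amfd_def)
  fix c assume "c \<in> matlas (prod_space M F)"
  then obtain e where e: "e \<in> matlas M" "c = prod_coord F e" by auto
  then show "coord_ok c" using coord_ok_prod[OF amfdD(1)[OF M] F] by simp
  fix c' assume "c' \<in> matlas (prod_space M F)"
  then obtain e' where e': "e' \<in> matlas M" "c' = prod_coord F e'" by auto
  show "smooth_between (\<lambda>x. x) c c'"
    using smooth_between_prod[OF amfdD(1)[OF M e(1)] amfdD(4)[OF M e(1) e'(1)] F] e e' by simp
qed

lemma asmooth_prod: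
  assumes "amfd M" "asmooth M N f" "subspace F"
  shows "asmooth (prod_space M F) (prod_space N F) (\<lambda>p. (f (fst p), snd p))"
  using assms smooth_between_prod[OF amfdD(1)[OF assms(1)] asmoothD(2)[OF assms(2)] assms(3)]
  by (auto simp: asmooth_def)

lemma asmooth_incl:
  assumes "amfd M" "subspace F" "s \<in> F"
  shows "asmooth M (prod_space M F) (\<lambda>x. (x, s))"
  using assms smooth_between_incl[OF amfdD(1)[OF assms(1)] amfdD(4)[OF assms(1)] assms(2)]
  by (auto simp: asmooth_def)

lemma asmooth_fst:
  assumes "amfd M" "subspace F"
  shows "asmooth (prod_space M F) M fst"
  using assms smooth_between_fst[OF amfdD(1)[OF assms(1)] amfdD(4)[OF assms(1)] assms(2)]
  by (auto simp: asmooth_def)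

lemma asmooth_scale:
  assumes "amfd M" "subspace F"
  shows "asmooth (prod_space (prod_space M F) UNIV) (prod_space M F) (\<lambda>p. (fst (fst p), snd p *\<^sub>R snd (fst p)))"
  using assms smooth_between_scale[OF amfdD(1)[OF assms(1)] amfdD(4)[OF assms(1)] assms(2)]
  by (auto simp: asmooth_def subspace_scale)

subsection \<open>Compatible coordinates and slices\<close>

text \<open>Counterpart of \<open>max_atlas\<close> without the topology;
  \<open>max_atlas_iff\<close> connects the two.\<close>

definition amax :: "('x, 'a::euclidean_space) manifold \<Rightarrow> ('x, 'a) coord set" where
  "amax M = {c. coord_ok c \<and> cdom c \<subseteq> mpts M \<and>
     (\<forall>c'\<in>matlas M. smooth_between (\<lambda>x. x) c c' \<and> smooth_between (\<lambda>x. x) c' c)}"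

lemma amaxD:
  assumes "c \<in> amax M"
  shows "coord_ok c" "x \<in> cdom c \<Longrightarrow> x \<in> mpts M" "c' \<in> matlas M \<Longrightarrow> smooth_between (\<lambda>x. x) c c'"
    "c' \<in> matlas M \<Longrightarrow> smooth_between (\<lambda>x. x) c' c"
  using assms by (auto simp: amax_def)

lemma amax_smooth_between:
  assumes M: "amfd M" and N: "amfd N" and f: "asmooth M N f" and c: "c \<in> amax M" and c': "c' \<in> amax N"
  shows "smooth_between f c c'"
proof -
  have 1: "smooth_between f c e" if e: "e \<in> matlas N" for e
    by (rule smooth_between_compose[of c "matlas M" "\<lambda>x. x" f e])
       (use amaxD[OF c] amfdD[OF M] asmoothD(2)[OF f _ e] in blast)+
  show ?thesis
    by (rule smooth_between_compose[of c "matlas N" f "\<lambda>x. x" c'])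
       (use amaxD[OF c] amaxD[OF c'] amfdD[OF N] 1 in blast)+
qed

lemma amax_prod:
  assumes "amfd M" "subspace F" "c \<in> amax M"
  shows "prod_coord F c \<in> amax (prod_space M F)"
  using amaxD[OF assms(3)] coord_ok_prod[OF amaxD(1)[OF assms(3)] assms(2)]
    smooth_between_prod[OF amaxD(1)[OF assms(3)] amaxD(3)[OF assms(3)] assms(2)]
    smooth_between_prod[OF amfdD(1)[OF assms(1)] amaxD(4)[OF assms(3)] assms(2)]
  by (auto simp: amax_def)

definition slice_of :: "('x, 'a::euclidean_space) manifold \<Rightarrow> 'x set \<Rightarrow> ('x, 'a) coord \<Rightarrow> bool" where
  "slice_of M A c \<longleftrightarrow> (\<exists>e\<in>amax M. cdom c = cdom e \<inter> A \<and> cmap c = cmap e \<and> subspace (cmodel c) \<and>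
     cmodel c \<subseteq> cmodel e \<and> cimg c = cimg e \<inter> cmodel c)"

text \<open>A relation and not an equation with \<open>submanifold\<close>, because the cylinder
  over a submanifold must qualify too: its atlas consists of product coordinates only and not of all
  slice coordinates of the ambient cylinder.\<close>

definition sliced :: "('x, 'a::euclidean_space) manifold \<Rightarrow> 'x set \<Rightarrow> ('x, 'a) manifold \<Rightarrow> bool" where
  "sliced M A M' \<longleftrightarrow> mpts M' = A \<and> A \<subseteq> mpts M \<and> A = (\<Union>c\<in>matlas M'. cdom c) \<and> (\<forall>c\<in>matlas M'. slice_of M A c)"

lemma slice_of_coord_ok: "slice_of M A c \<Longrightarrow> coord_ok c"
  unfolding slice_of_def coord_ok_def
  by (auto simp: inj_on_Int dest!: amaxD(1) intro: relopen_mono simp: coord_ok_def)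

text \<open>Models of slices are subspaces of the ambient model, and smoothness refers to functions
  into the ambient type. So the expression of f in slices is the restriction of its ambient
  expression to the smaller model.\<close>

lemma slice_of_smooth_between:
  assumes M: "amfd M" and N: "amfd N" and f: "asmooth M N f" and fA: "f ` A \<subseteq> B"
    and c: "slice_of M A c" and c': "slice_of N B c'"
  shows "smooth_between f c c'"
proof -
  obtain e where e: "e \<in> amax M" "cdom c = cdom e \<inter> A" "cmap c = cmap e" "subspace (cmodel c)"
    "cmodel c \<subseteq> cmodel e" "cimg c = cimg e \<inter> cmodel c"
    using c unfolding slice_of_def by blast
  obtain e' where e': "e' \<in> amax N" "cdom c' = cdom e' \<inter> B" "cmap c' = cmap e'"
    using c' unfolding slice_of_def by blast
  note ok = amaxD(1)[OF e(1)]
  note s = smooth_betweenD[OF amax_smooth_between[OF M N f e(1) e'(1)]]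
  \<comment> \<open>A slice contains every point of its ambient coordinate that is mapped into the
    model; hence intersecting with the model cuts out exactly the domain of the restricted
    expression.\<close>
  have inA: "x \<in> A" if "x \<in> cdom e" "cmap e x \<in> cmodel c" for x
  proof -
    have "cmap e x \<in> cimg c" using that e(6) by auto
    then obtain z where "z \<in> cdom e \<inter> A" "cmap e z = cmap e x" unfolding e(2,3) by (metis imageE)
    then show ?thesis using ok that(1) by (auto simp: coord_ok_def dest: inj_onD)
  qed
  have P: "rep_dom f e e' \<inter> cmodel c = rep_dom f c c'"
  proof
    show "rep_dom f e e' \<inter> cmodel c \<subseteq> rep_dom f c c'"
      using inA fA by (fastforce simp: rep_dom_def e(2,3) e'(2))
    show "rep_dom f c c' \<subseteq> rep_dom f e e' \<inter> cmodel c"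
      using e(6) by (auto simp: rep_dom_def e(2,3) e'(2))
  qed
  show ?thesis
  proof (rule smooth_betweenI[OF slice_of_coord_ok[OF c] _ P])
    show "relopen (cmodel c) (rep_dom f e e' \<inter> cmodel c)" by (rule relopen_mono[OF s(1) e(4,5)])
    show "smooth_on (cmodel c) (rep_dom f e e' \<inter> cmodel c) (local_rep f e e')"
      by (rule smooth_on_subset[OF s(2)]) (use e in auto)
    show "cmap c' (f x) = local_rep f e e' (cmap c x)" if "x \<in> cdom c" for x
      using that by (simp add: e(2,3) e'(3) local_rep_cmap[OF ok])
  qed
qed

lemma sliced_amfd:
  assumes M: "amfd M" and s: "sliced M A M'"
  shows "amfd M'"
  using s slice_of_smooth_between[OF M M asmooth_id[OF M], of A A]
  by (auto simp: sliced_def amfd_def intro: slice_of_coord_ok)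

lemma sliced_asmooth:
  assumes "amfd M" "amfd N" "asmooth M N f" "sliced M A M'" "sliced N B N'" "f ` A \<subseteq> B"
  shows "asmooth M' N' f"
  using assms(4-6) slice_of_smooth_between[OF assms(1-3,6)] by (auto simp: sliced_def asmooth_def)

lemma sliced_prod:
  assumes M: "amfd M" and s: "sliced M A M'" and F: "subspace F"
  shows "sliced (prod_space M F) (A \<times> F) (prod_space M' F)"
proof -
  have "slice_of (prod_space M F) (A \<times> F) (prod_coord F c)" if c: "slice_of M A c" for c
  proof -
    obtain e where e: "e \<in> amax M" "cdom c = cdom e \<inter> A" "cmap c = cmap e" "subspace (cmodel c)"
      "cmodel c \<subseteq> cmodel e" "cimg c = cimg e \<inter> cmodel c"
      using c unfolding slice_of_def by blast
    have "cimg (prod_coord F c) = cimg (prod_coord F e) \<inter> cmodel (prod_coord F c)"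
      using e(6) by auto
    then show ?thesis unfolding slice_of_def
      using amax_prod[OF M F e(1)] e subspace_Times[OF e(4) F]
      by (intro bexI[of _ "prod_coord F e"]) (auto simp: fun_eq_iff cmap_prod_coord)
  qed
  then show ?thesis using s unfolding sliced_def by auto
qed

subsection \<open>Integration along the fibres of \<open>M \<times> [0, 1]\<close>\<close>

text \<open>The factor is the whole line and not the unit interval, so that coordinate images are
  open in a linear space; only the integration is confined to \<open>{0..1}\<close>.\<close>

abbreviation cylinder :: "('x, 'a::euclidean_space) manifold \<Rightarrow> ('x \<times> real, 'a \<times> real) manifold" where
  "cylinder M \<equiv> prod_space M UNIV"

abbreviation cyl_coord :: "('x, 'a::euclidean_space) coord \<Rightarrow> ('x \<times> real, 'a \<times> real) coord" where
  "cyl_coord c \<equiv> prod_coord UNIV c"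

definition lift_args :: "'a list \<Rightarrow> ('a \<times> real) list" where
  "lift_args vs = map (\<lambda>v. (v, 0)) vs"

lemma lift_args_simps [simp]:
  "length (lift_args vs) = length vs" "set (lift_args vs) = set vs \<times> {0}"
  "j < length vs \<Longrightarrow> lift_args vs ! j = (vs ! j, 0)"
  "lift_args (omit j vs) = omit j (lift_args vs)"
  "lift_args (vs[j := u]) = (lift_args vs)[j := (u, 0)]"
  by (auto simp: lift_args_def take_map drop_map map_update)

text \<open>The vector \<open>(0, 1)\<close> is the coordinate field \<partial>/\<partial>s. Its
  position as first argument fixes the signs in \<open>fibre_integral_homotopy\<close>.\<close>

definition fibre_integral :: "('x, 'a::euclidean_space) manifold \<Rightarrow> ('x \<times> real, 'a \<times> real) form \<Rightarrow> ('x, 'a) form" where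
  "fibre_integral M \<eta> = (\<lambda>c y vs. if c \<in> matlas M \<and> y \<in> cimg c \<and> set vs \<subseteq> cmodel c
     then integral {0..1} (\<lambda>s. \<eta> (cyl_coord c) (y, s) ((0, 1) # lift_args vs)) else 0)"

lemma cylinder_form:
  assumes M: "amfd M" and \<eta>: "\<eta> \<in> forms (cylinder M) d" and c: "c \<in> matlas M"
  shows "local_form (cmodel c \<times> UNIV) (cimg c \<times> UNIV) d (\<eta> (cyl_coord c))"
    "relopen (cmodel c \<times> (UNIV :: real set)) (cimg c \<times> UNIV)"
    "y \<in> cimg c \<Longrightarrow> alt_form (cmodel c \<times> UNIV) d (\<eta> (cyl_coord c) (y, s))"
    "smooth_on (cmodel c \<times> UNIV) (cimg c \<times> UNIV) (\<lambda>p. \<eta> (cyl_coord c) p vs)"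
    "y \<in> cimg c \<Longrightarrow> continuous_on A (\<lambda>s. \<eta> (cyl_coord c) (y, s) vs)"
proof -
  show l: "local_form (cmodel c \<times> UNIV) (cimg c \<times> UNIV) d (\<eta> (cyl_coord c))"
    using formsD(2)[OF \<eta>, of "cyl_coord c"] c by simp
  show "relopen (cmodel c \<times> (UNIV :: real set)) (cimg c \<times> UNIV)"
    using relopen_Times_UNIV[OF coord_okD(1)[OF amfdD(1)[OF M c]]] .
  show "y \<in> cimg c \<Longrightarrow> alt_form (cmodel c \<times> UNIV) d (\<eta> (cyl_coord c) (y, s))"
    using local_formD(1)[OF l, of "(y, s)"] by auto
  show sm: "smooth_on (cmodel c \<times> UNIV) (cimg c \<times> UNIV) (\<lambda>p. \<eta> (cyl_coord c) p vs)"
    by (rule local_formD(3)[OF l])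
  show "y \<in> cimg c \<Longrightarrow> continuous_on A (\<lambda>s. \<eta> (cyl_coord c) (y, s) vs)"
    by (rule continuous_on_compose2[OF smooth_on_continuous[OF sm]]) (auto intro!: continuous_intros)
qed

text \<open>The product of f with the identity preserves \<partial>/\<partial>s and carries lifted
  vectors to lifted vectors, so its derivative can be applied to all arguments under the integral.
  The lemma covers coordinate changes and maps of manifolds alike.\<close>

lemma fibre_integral_natural_aux:
  assumes M: "amfd M" and N: "amfd N" and f: "smooth_between f c c'" and \<eta>: "\<eta> \<in> forms (cylinder N) (Suc d)"
    and c: "c \<in> matlas M" "x \<in> cdom c" and c': "c' \<in> matlas N" "f x \<in> cdom c'" and vs: "set vs \<subseteq> cmodel c"
  shows "fibre_integral N \<eta> c' (cmap c' (f x)) (map (dir_deriv (local_rep f c c') (cmap c x)) vs) =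
    integral {0..1} (\<lambda>s. \<eta> (cyl_coord c') (cmap c' (f x), s)
      (map (dir_deriv (local_rep (\<lambda>p. (f (fst p), snd p)) (cyl_coord c) (cyl_coord c')) (cmap c x, s)) ((0, 1) # lift_args vs)))"
proof -
  note ok = amfdD(1)[OF M c(1)] amfdD(1)[OF N c'(1)]
  have sub: "set (map (dir_deriv (local_rep f c c') (cmap c x)) vs) \<subseteq> cmodel c'"
    using local_rep_deriv_in[OF f ok c(2) c'(2)] vs by auto
  \<comment> \<open>The base component of \<partial>/\<partial>s is 0 and has to remain 0.\<close>
  have "dir_deriv (local_rep f c c') (cmap c x) 0 = 0"
  proof -
    have y: "cmap c x \<in> rep_dom f c c'" using c c' by (simp add: rep_dom_iff[OF ok(1)])
    show ?thesis using dir_deriv_linear[OF smooth_betweenD(1)[OF f] y smooth_on_differentiable[OF smooth_betweenD(2)[OF f] y], of 0 0 0 0]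
      subspace_0[OF coord_okD(2)[OF ok(1)]] by simp
  qed
  then have "map (dir_deriv (local_rep (\<lambda>p. (f (fst p), snd p)) (cyl_coord c) (cyl_coord c')) (cmap c x, s)) ((0, 1) # lift_args vs) =
     (0, 1) # lift_args (map (dir_deriv (local_rep f c c') (cmap c x)) vs)" for s
    using dir_deriv_prod[OF ok(1) f subspace_UNIV c(2) c'(2)] vs subspace_0[OF coord_okD(2)[OF ok(1)]]
    by (auto simp: lift_args_def)
  then show ?thesis using c' sub by (simp add: fibre_integral_def)
qed

lemma fibre_integral_forms:
  assumes M: "amfd M" and \<eta>: "\<eta> \<in> forms (cylinder M) (Suc d)"
  shows "fibre_integral M \<eta> \<in> forms M d"
proof (rule formsI[OF M])
  fix c assume c: "c \<in> matlas M"
  note cf = cylinder_form[OF M \<eta> c]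
  have int: "(\<lambda>s. \<eta> (cyl_coord c) (y, s) vs) integrable_on {0..1}" if "y \<in> cimg c" for y vs
    by (intro integrable_continuous_interval cf(5)[OF that])
  note sW = coord_okD(2)[OF amfdD(1)[OF M c]]
  have "alt_form (cmodel c) d (fibre_integral M \<eta> c y)" if y: "y \<in> cimg c" for y
    unfolding alt_form_def
  proof (intro conjI allI impI)
    fix vs assume "\<not> (length vs = d \<and> set vs \<subseteq> cmodel c)"
    then have "set vs \<subseteq> cmodel c \<Longrightarrow> \<eta> (cyl_coord c) (y, s) ((0, 1) # lift_args vs) = 0" for s
      by (intro alt_form_zero[OF cf(3)[OF y]]) auto
    then show "fibre_integral M \<eta> c y vs = 0" by (simp add: fibre_integral_def)
  next
    fix vs j u v a b assume as: "length vs = d \<and> set vs \<subseteq> cmodel c \<and> j < d \<and> u \<in> cmodel c \<and> v \<in> cmodel c"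
    have upd: "set (vs[j := w]) \<subseteq> cmodel c" if "w \<in> cmodel c" for w
      using as that set_update_subset_insert[of vs j w] by blast
    have uv: "a *\<^sub>R u + b *\<^sub>R v \<in> cmodel c" using as sW by (auto intro: subspace_add subspace_scale)
    have "\<eta> (cyl_coord c) (y, s) ((0, 1) # lift_args (vs[j := a *\<^sub>R u + b *\<^sub>R v])) =
       a * \<eta> (cyl_coord c) (y, s) ((0, 1) # lift_args (vs[j := u])) + b * \<eta> (cyl_coord c) (y, s) ((0, 1) # lift_args (vs[j := v]))" for s
      using alt_form_update[OF cf(3)[OF y, of s], of "(0, 1) # lift_args vs" "Suc j" "(u, 0)" "(v, 0)" a b] as subspace_0[OF sW]
      by auto
    then show "fibre_integral M \<eta> c y (vs[j := a *\<^sub>R u + b *\<^sub>R v]) = a * fibre_integral M \<eta> c y (vs[j := u]) + b * fibre_integral M \<eta> c y (vs[j := v])"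
      using upd[OF uv] upd[of u] upd[of v] as c y
      by (simp add: fibre_integral_def integral_add integral_mult_right integrable_on_mult_right int del: lift_args_simps)
  next
    fix vs i j assume as: "length vs = d \<and> set vs \<subseteq> cmodel c \<and> i < j \<and> j < d \<and> vs ! i = vs ! j"
    have "\<eta> (cyl_coord c) (y, s) ((0, 1) # lift_args vs) = 0" for s
      by (rule alt_form_repeat[OF cf(3)[OF y], of _ "Suc i" "Suc j"]) (use as subspace_0[OF sW] in auto)
    then show "fibre_integral M \<eta> c y vs = 0" by (simp add: fibre_integral_def)
  qed
  moreover have "smooth_on (cmodel c) (cimg c) (\<lambda>y. fibre_integral M \<eta> c y vs)" if "set vs \<subseteq> cmodel c" for vs
  proof -
    have "smooth_on (cmodel c) (cimg c) (\<lambda>y. integral {0..1} (\<lambda>s. \<eta> (cyl_coord c) (y, s) ((0, 1) # lift_args vs)))"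
      using smooth_on_parameter_integral[OF coord_okD(1)[OF amfdD(1)[OF M c]] cf(4)] .
    then show ?thesis by (subst smooth_on_cong) (use that c in \<open>auto simp: fibre_integral_def\<close>)
  qed
  ultimately show "local_form (cmodel c) (cimg c) d (fibre_integral M \<eta> c)"
    unfolding local_form_def by (auto simp: fibre_integral_def fun_eq_iff)
next
  fix c e x vs assume c: "c \<in> matlas M" "e \<in> matlas M" "x \<in> cdom c" "x \<in> cdom e" and vs: "set vs \<subseteq> cmodel c"
  note ok = amfdD(1)[OF M c(1)]
  have sub: "set ((0, 1) # lift_args vs) \<subseteq> cmodel (cyl_coord c)"
    using vs subspace_0[OF coord_okD(2)[OF ok]] by auto
  have "\<eta> (cyl_coord c) (cmap c x, s) ((0, 1) # lift_args vs) = \<eta> (cyl_coord e) (cmap e x, s)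
      (map (dir_deriv (local_rep (\<lambda>p. p) (cyl_coord c) (cyl_coord e)) (cmap c x, s)) ((0, 1) # lift_args vs))" for s
    using forms_change[OF \<eta> _ _ _ _ coord_ok_prod[OF ok subspace_UNIV] sub, of "cyl_coord e" "(x, s)"] c by simp
  then show "fibre_integral M \<eta> c (cmap c x) vs = fibre_integral M \<eta> e (cmap e x) (map (dir_deriv (local_rep (\<lambda>x. x) c e) (cmap c x)) vs)"
    using fibre_integral_natural_aux[OF M M amfdD(4)[OF M c(1,2)] \<eta> c(1,3,2,4) vs] c vs
    by (simp add: fibre_integral_def)
qed (simp add: fibre_integral_def)

lemma fibre_integral_natural:
  assumes M: "amfd M" and N: "amfd N" and f: "asmooth M N f" and \<eta>: "\<eta> \<in> forms (cylinder N) (Suc d)"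
  shows "pullback f M N (fibre_integral N \<eta>) =
    fibre_integral M (pullback (\<lambda>p. (f (fst p), snd p)) (cylinder M) (cylinder N) \<eta>)"
proof (intro ext)
  fix c y vs
  show "pullback f M N (fibre_integral N \<eta>) c y vs =
    fibre_integral M (pullback (\<lambda>p. (f (fst p), snd p)) (cylinder M) (cylinder N) \<eta>) c y vs"
  proof (cases "c \<in> matlas M \<and> y \<in> cimg c \<and> set vs \<subseteq> cmodel c")
    case True
    then obtain x where c: "c \<in> matlas M" and x: "x \<in> cdom c" "y = cmap c x" by auto
    have vs: "set vs \<subseteq> cmodel c" using True by blast
    obtain c' where c': "c' \<in> matlas N" "f x \<in> cdom c'"
      using amfdD(3)[OF N] asmoothD(1)[OF f] amfdD(2)[OF M c] x by blast
    note ok = amfdD(1)[OF M c]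
    have sub: "set ((0, 1) # lift_args vs) \<subseteq> cmodel (cyl_coord c)"
      using vs subspace_0[OF coord_okD(2)[OF ok]] by auto
    have "pullback (\<lambda>p. (f (fst p), snd p)) (cylinder M) (cylinder N) \<eta> (cyl_coord c) (cmap c x, s) ((0, 1) # lift_args vs) =
      \<eta> (cyl_coord c') (cmap c' (f x), s) (map (dir_deriv (local_rep (\<lambda>p. (f (fst p), snd p)) (cyl_coord c) (cyl_coord c')) (cmap c x, s)) ((0, 1) # lift_args vs))" for s
      using pullback_eval[OF amfd_prod[OF M subspace_UNIV] amfd_prod[OF N subspace_UNIV] asmooth_prod[OF M f subspace_UNIV] \<eta>,
         of "cyl_coord c" "(x, s)" "cyl_coord c'", OF _ _ _ _ sub] c c' x by simp
    then show ?thesis unfolding x(2)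
      using pullback_eval[OF M N f fibre_integral_forms[OF N \<eta>] c x(1) c' vs]
        fibre_integral_natural_aux[OF M N asmoothD(2)[OF f c c'(1)] \<eta> c x(1) c' vs] c x vs
      by (simp add: fibre_integral_def)
  next
    case False
    then show ?thesis by (auto simp: pullback_vanish fibre_integral_def)
  qed
qed

lemma pullback_incl:
  assumes M: "amfd M" and \<eta>: "\<eta> \<in> forms (cylinder M) d"
    and c: "c \<in> matlas M" and y: "y \<in> cimg c" and vs: "set vs \<subseteq> cmodel c"
  shows "pullback (\<lambda>x. (x, s)) M (cylinder M) \<eta> c y vs = \<eta> (cyl_coord c) (y, s) (lift_args vs)"
proof -
  obtain x where x: "y = cmap c x" "x \<in> cdom c" using y by auto
  note ok = amfdD(1)[OF M c]
  have ident: "dir_deriv (local_rep (\<lambda>x. x) c c) (cmap c x) v = v" if "v \<in> cmodel c" for v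
  proof -
    have "dir_deriv (local_rep (\<lambda>x. x) c c) (cmap c x) v = dir_deriv (\<lambda>y. y) (cmap c x) v"
      by (rule dir_deriv_local[OF coord_okD(1)[OF ok] _ that]) (use x in \<open>auto simp: local_rep_cmap[OF ok]\<close>)
    then show ?thesis by simp
  qed
  have mp: "map (dir_deriv (local_rep (\<lambda>x. (x, s)) c (cyl_coord c)) (cmap c x)) vs = lift_args vs"
    using dir_deriv_incl[OF ok amfdD(4)[OF M c c] subspace_UNIV x(2) x(2), of _ s] ident vs
    by (auto simp: lift_args_def)
  show ?thesis unfolding x(1)
    using pullback_eval[OF M amfd_prod[OF M subspace_UNIV] asmooth_incl[OF M subspace_UNIV, of s] \<eta> c x(2), of "cyl_coord c" vs] c x vs
    unfolding mp by simp
qed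

text \<open>The integrated Cartan formula for \<partial>/\<partial>s. Derivatives in directions of M
  occur in both summands with opposite signs, by differentiation under the integral; what is left is
  the integral of an s-derivative.\<close>

lemma fibre_integral_homotopy:
  assumes M: "amfd M" and \<eta>: "\<eta> \<in> forms (cylinder M) d"
  shows "ext_d M (fibre_integral M \<eta>) c y vs + fibre_integral M (ext_d (cylinder M) \<eta>) c y vs =
    pullback (\<lambda>x. (x, 1)) M (cylinder M) \<eta> c y vs - pullback (\<lambda>x. (x, 0)) M (cylinder M) \<eta> c y vs"
proof (cases "c \<in> matlas M \<and> y \<in> cimg c \<and> set vs \<subseteq> cmodel c")
  case True
  then have c: "c \<in> matlas M" and y: "y \<in> cimg c" and vs: "set vs \<subseteq> cmodel c" by auto
  note ok = amfdD(1)[OF M c]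
  note W = coord_okD(1)[OF ok] and sW = coord_okD(2)[OF ok]
  note cf = cylinder_form[OF M \<eta> c]
  let ?\<eta> = "\<eta> (cyl_coord c)" and ?n = "length vs" and ?vs = "lift_args vs"
  define A where "A j s = dir_deriv (\<lambda>p. ?\<eta> p ((0, 1) # omit j ?vs)) (y, s) (vs ! j, 0)" for j s
  define B where "B s = dir_deriv (\<lambda>p. ?\<eta> p ?vs) (y, s) (0, 1)" for s
  have vj: "vs ! j \<in> cmodel c" if "j < ?n" for j using vs that by auto
  have om: "set (omit j vs) \<subseteq> cmodel c" for j by (rule order_trans[OF set_omit vs])
  have intd: "(\<lambda>s. dir_deriv (\<lambda>p. ?\<eta> p us) (y, s) w) integrable_on {0..1}" if "w \<in> cmodel c \<times> UNIV" for us w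
    by (rule integrable_continuous_interval, rule continuous_on_compose2[OF smooth_on_continuous[OF smooth_on_dir_deriv[OF cf(2,4) that]]])
       (use y in \<open>auto intro!: continuous_intros\<close>)
  have intA: "A j integrable_on {0..1}" if "j < ?n" for j
    unfolding A_def[abs_def] using intd vj[OF that] by simp
  have intB: "B integrable_on {0..1}" unfolding B_def[abs_def] using intd[of "(0, 1)"] subspace_0[OF sW] by simp
  have "dir_deriv (\<lambda>z. fibre_integral M \<eta> c z (omit j vs)) y (vs ! j) = integral {0..1} (A j)" if j: "j < ?n" for j
  proof -
    have "dir_deriv (\<lambda>z. fibre_integral M \<eta> c z (omit j vs)) y (vs ! j) =
      dir_deriv (\<lambda>z. integral {0..1} (\<lambda>s. ?\<eta> (z, s) ((0, 1) # omit j ?vs))) y (vs ! j)"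
      by (rule dir_deriv_local[OF W y vj[OF j]]) (use c om[of j] in \<open>simp add: fibre_integral_def\<close>)
    also have "\<dots> = integral {0..1} (A j)" unfolding A_def[abs_def]
      by (rule dir_deriv_parameter_integral[OF W cf(4) y vj[OF j]])
    finally show ?thesis .
  qed
  then have 1: "ext_d M (fibre_integral M \<eta>) c y vs = (\<Sum>j<?n. (-1) ^ j * integral {0..1} (A j))"
    using True by (simp add: ext_d_def local_d_def)
  have "ext_d (cylinder M) \<eta> (cyl_coord c) (y, s) ((0, 1) # ?vs) = B s - (\<Sum>j<?n. (-1) ^ j * A j s)" for s
  proof -
    have "set ((0, 1) # ?vs) \<subseteq> cmodel c \<times> UNIV" using vs subspace_0[OF sW] by auto
    then have "ext_d (cylinder M) \<eta> (cyl_coord c) (y, s) ((0, 1) # ?vs) =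
      (\<Sum>j<Suc ?n. (-1) ^ j * dir_deriv (\<lambda>z. ?\<eta> z (omit j ((0, 1) # ?vs))) (y, s) (((0, 1) # ?vs) ! j))"
      using c y by (simp add: ext_d_def local_d_def)
    \<comment> \<open>Omitting the first entry \<partial>/\<partial>s gives \<open>B\<close>; the
      other entries are shifted by one place, which turns their signs around.\<close>
    also have "\<dots> = B s - (\<Sum>j<?n. (-1) ^ j * A j s)"
      unfolding sum.lessThan_Suc_shift by (simp add: B_def A_def sum_negf)
    finally show ?thesis .
  qed
  then have "fibre_integral M (ext_d (cylinder M) \<eta>) c y vs = integral {0..1} (\<lambda>s. B s - (\<Sum>j<?n. (-1) ^ j * A j s))"
    using True by (simp add: fibre_integral_def)
  also have "\<dots> = integral {0..1} B - (\<Sum>j<?n. integral {0..1} (\<lambda>s. (-1) ^ j * A j s))"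
  proof -
    have i: "(\<lambda>s. (-1) ^ j * A j s) integrable_on {0..1}" if "j < ?n" for j
      using integrable_on_cmult_left[OF intA[OF that]] by simp
    then have "(\<lambda>s. \<Sum>j<?n. (-1) ^ j * A j s) integrable_on {0..1}" by (intro integrable_sum) auto
    then show ?thesis using i by (simp only: integral_diff[OF intB], subst integral_sum) auto
  qed
  also have "\<dots> = integral {0..1} B - (\<Sum>j<?n. (-1) ^ j * integral {0..1} (A j))"
    by (simp add: integral_mult_right)
  also have "integral {0..1} B = ?\<eta> (y, 1) ?vs - ?\<eta> (y, 0) ?vs"
  proof -
    have "(B has_integral ?\<eta> ((y, 0) + 1 *\<^sub>R (0, 1)) ?vs - ?\<eta> ((y, 0) + 0 *\<^sub>R (0, 1)) ?vs) {0..1}"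
    proof (rule fundamental_theorem_of_calculus)
      fix s :: real
      have "((\<lambda>r. ?\<eta> ((y, 0) + r *\<^sub>R (0, 1)) ?vs) has_vector_derivative
         dir_deriv (\<lambda>p. ?\<eta> p ?vs) ((y, 0) + s *\<^sub>R (0, 1)) (0, 1)) (at s)"
        by (rule line_deriv[OF cf(2,4)]) (use y subspace_0[OF sW] in auto)
      then show "((\<lambda>r. ?\<eta> ((y, 0) + r *\<^sub>R (0, 1)) ?vs) has_vector_derivative B s) (at s within {0..1})"
        by (simp add: B_def has_vector_derivative_at_within)
    qed simp
    then show ?thesis by (simp add: integral_unique)
  qed
  finally show ?thesis using 1 pullback_incl[OF M \<eta> c y vs, of 1] pullback_incl[OF M \<eta> c y vs, of 0] by simp
next
  case False
  then show ?thesis by (auto simp: pullback_vanish fibre_integral_def ext_d_vanish)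
qed

section \<open>Quotient groups and direct sums\<close>

text \<open>The algebra of a homotopy equivalence in a single degree, with G the closed and H the
  exact forms: R is a strict right inverse of F, and a left inverse modulo H.\<close>

lemma FactGroup_iso:
  assumes G: "comm_group G" and G': "comm_group G'" and H: "subgroup H G" and H': "subgroup H' G'"
    and F: "F \<in> hom G G'" "F ` H \<subseteq> H'" and R: "R \<in> hom G' G" "R ` H' \<subseteq> H"
    and RF: "\<And>x. x \<in> carrier G \<Longrightarrow> \<exists>h\<in>H. x = h \<otimes>\<^bsub>G\<^esub> R (F x)"
    and FR: "\<And>z. z \<in> carrier G' \<Longrightarrow> F (R z) = z"
  shows "(\<lambda>K. \<Union>x\<in>K. H' #>\<^bsub>G'\<^esub> F x) \<in> iso (G Mod H) (G' Mod H')"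
proof -
  interpret G: comm_group G by (rule G)
  interpret G': comm_group G' by (rule G')
  interpret N: normal H G by (rule G.subgroup_imp_normal[OF H])
  interpret N': normal H' G' by (rule G'.subgroup_imp_normal[OF H'])
  let ?P = "\<lambda>K. \<Union>x\<in>K. H' #>\<^bsub>G'\<^esub> F x"
  have Fc: "F x \<in> carrier G'" if "x \<in> carrier G" for x using F(1) that by (auto simp: hom_def)
  have Rc: "R x \<in> carrier G" if "x \<in> carrier G'" for x using R(1) that by (auto simp: hom_def)
  \<comment> \<open>The union over a coset is a single coset, since F maps H into \<open>H'\<close>;
    it therefore does not depend on a representative.\<close>
  have P: "?P (H #>\<^bsub>G\<^esub> a) = H' #>\<^bsub>G'\<^esub> F a" if a: "a \<in> carrier G" for a
  proof -
    have "H' #>\<^bsub>G'\<^esub> F x = H' #>\<^bsub>G'\<^esub> F a" if x: "x \<in> H #>\<^bsub>G\<^esub> a" for x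
    proof -
      obtain h where h: "h \<in> H" "x = h \<otimes>\<^bsub>G\<^esub> a" using x by (auto simp: r_coset_def)
      then have "F x = F h \<otimes>\<^bsub>G'\<^esub> F a" using F(1) a by (auto simp: hom_def N.mem_carrier)
      then have "F x \<in> H' #>\<^bsub>G'\<^esub> F a" using F(2) h by (auto simp: r_coset_def)
      then show ?thesis using G'.repr_independence[OF _ Fc[OF a] H'] by simp
    qed
    moreover have "a \<in> H #>\<^bsub>G\<^esub> a" by (rule G.rcos_self[OF a H])
    ultimately show ?thesis by blast
  qed
  have car: "carrier (G Mod H) = (\<lambda>a. H #>\<^bsub>G\<^esub> a) ` carrier G" "carrier (G' Mod H') = (\<lambda>a. H' #>\<^bsub>G'\<^esub> a) ` carrier G'"
    by (auto simp: FactGroup_def RCOSETS_def)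
  have hom: "?P \<in> hom (G Mod H) (G' Mod H')"
  proof (rule homI)
    fix K assume "K \<in> carrier (G Mod H)"
    then obtain a where a: "a \<in> carrier G" "K = H #>\<^bsub>G\<^esub> a" using car by auto
    then show "?P K \<in> carrier (G' Mod H')" using P[OF a(1)] Fc car(2) by simp
    fix L assume "L \<in> carrier (G Mod H)"
    then obtain b where b: "b \<in> carrier G" "L = H #>\<^bsub>G\<^esub> b" using car by auto
    have "K \<otimes>\<^bsub>G Mod H\<^esub> L = H #>\<^bsub>G\<^esub> (a \<otimes>\<^bsub>G\<^esub> b)"
      using N.rcos_sum a b by (simp add: FactGroup_def)
    then have "?P (K \<otimes>\<^bsub>G Mod H\<^esub> L) = H' #>\<^bsub>G'\<^esub> F (a \<otimes>\<^bsub>G\<^esub> b)" using P a b by simp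
    also have "F (a \<otimes>\<^bsub>G\<^esub> b) = F a \<otimes>\<^bsub>G'\<^esub> F b" using F(1) a b by (auto simp: hom_def)
    also have "H' #>\<^bsub>G'\<^esub> (F a \<otimes>\<^bsub>G'\<^esub> F b) = ?P K \<otimes>\<^bsub>G' Mod H'\<^esub> ?P L"
      using N'.rcos_sum[OF Fc Fc] P a b by (simp add: FactGroup_def)
    finally show "?P (K \<otimes>\<^bsub>G Mod H\<^esub> L) = ?P K \<otimes>\<^bsub>G' Mod H'\<^esub> ?P L" .
  qed
  have "inj_on ?P (carrier (G Mod H))"
  proof (rule inj_onI)
    fix K L assume "K \<in> carrier (G Mod H)" "L \<in> carrier (G Mod H)" and eq: "?P K = ?P L"
    then obtain a b where a: "a \<in> carrier G" "K = H #>\<^bsub>G\<^esub> a" and b: "b \<in> carrier G" "L = H #>\<^bsub>G\<^esub> b" using car by auto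
    have "F a \<in> H' #>\<^bsub>G'\<^esub> F b" using eq P a b G'.rcos_self[OF Fc[OF a(1)] H'] by simp
    then obtain h where h: "h \<in> H'" "F a = h \<otimes>\<^bsub>G'\<^esub> F b" by (auto simp: r_coset_def)
    obtain e where e: "e \<in> H" "a = e \<otimes>\<^bsub>G\<^esub> R (F a)" using RF a by blast
    obtain e' where e': "e' \<in> H" "b = e' \<otimes>\<^bsub>G\<^esub> R (F b)" using RF b by blast
    have "R (F a) = R h \<otimes>\<^bsub>G\<^esub> R (F b)" using R(1) h Fc[OF b(1)] by (auto simp: hom_def N'.mem_carrier)
    moreover have "R (F b) = inv\<^bsub>G\<^esub> e' \<otimes>\<^bsub>G\<^esub> b"
      using e' b Rc[OF Fc[OF b(1)]] by (metis G.inv_solve_left N.mem_carrier)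
    \<comment> \<open>If F a and F b differ by h in \<open>H'\<close>, then a and b differ by
      \<open>R h\<close> and by the two errors e and \<open>e'\<close> of R as a left inverse, all
      of which lie in H.\<close>
    ultimately have "a = e \<otimes>\<^bsub>G\<^esub> (R h \<otimes>\<^bsub>G\<^esub> (inv\<^bsub>G\<^esub> e' \<otimes>\<^bsub>G\<^esub> b))" using e(2) by simp
    also have "\<dots> = (e \<otimes>\<^bsub>G\<^esub> (R h \<otimes>\<^bsub>G\<^esub> inv\<^bsub>G\<^esub> e')) \<otimes>\<^bsub>G\<^esub> b"
      using e(1) e'(1) h(1) b(1) Rc N.mem_carrier N'.mem_carrier by (simp add: G.m_assoc)
    also have "e \<otimes>\<^bsub>G\<^esub> (R h \<otimes>\<^bsub>G\<^esub> inv\<^bsub>G\<^esub> e') \<in> H" using e(1) e'(1) h(1) R(2) by (auto intro!: N.m_closed)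
    ultimately have "a \<in> H #>\<^bsub>G\<^esub> b" by (auto simp: r_coset_def)
    then show "K = L" using G.repr_independence[OF _ b(1) H] a b by simp
  qed
  moreover have "?P ` carrier (G Mod H) = carrier (G' Mod H')"
  proof
    show "?P ` carrier (G Mod H) \<subseteq> carrier (G' Mod H')" using hom by (auto simp: hom_def)
    show "carrier (G' Mod H') \<subseteq> ?P ` carrier (G Mod H)"
    proof
      fix L assume "L \<in> carrier (G' Mod H')"
      then obtain z where z: "z \<in> carrier G'" "L = H' #>\<^bsub>G'\<^esub> z" using car by auto
      then have "L = ?P (H #>\<^bsub>G\<^esub> R z)" using P[OF Rc] FR by simp
      then show "L \<in> ?P ` carrier (G Mod H)" using car(1) Rc[OF z(1)] by blast
    qed
  qed
  ultimately show ?thesis using hom by (simp add: iso_def bij_betw_def)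
qed

text \<open>The bijection \<tau> relabels the summands. Elements of the sum have finite support;
  \<tau> matches supports because an isomorphism sends nothing but the identity to the
  identity.\<close>

lemma sum_group_iso:
  assumes G: "\<And>i. i \<in> I \<Longrightarrow> group (G i)" and G': "\<And>j. j \<in> I' \<Longrightarrow> group (G' j)"
    and \<tau>: "bij_betw \<tau> I' I" and P: "\<And>j. j \<in> I' \<Longrightarrow> P j \<in> iso (G (\<tau> j)) (G' j)"
  shows "(\<lambda>K. \<lambda>j\<in>I'. P j (K (\<tau> j))) \<in> iso (sum_group I G) (sum_group I' G')"
proof -
  let ?\<Phi> = "\<lambda>K. \<lambda>j\<in>I'. P j (K (\<tau> j))"
  have \<tau>I: "\<tau> j \<in> I" if "j \<in> I'" for j using \<tau> that by (auto simp: bij_betw_def)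
  have Pb: "bij_betw (P j) (carrier (G (\<tau> j))) (carrier (G' j))" and Ph: "P j \<in> hom (G (\<tau> j)) (G' j)" if "j \<in> I'" for j
    using P[OF that] by (auto simp: iso_def)
  have P1: "P j x = \<one>\<^bsub>G' j\<^esub> \<longleftrightarrow> x = \<one>\<^bsub>G (\<tau> j)\<^esub>" if "j \<in> I'" "x \<in> carrier (G (\<tau> j))" for j x
  proof -
    have "P j \<one>\<^bsub>G (\<tau> j)\<^esub> = \<one>\<^bsub>G' j\<^esub>" by (rule hom_one[OF Ph[OF that(1)] G[OF \<tau>I[OF that(1)]] G'[OF that(1)]])
    moreover have "\<one>\<^bsub>G (\<tau> j)\<^esub> \<in> carrier (G (\<tau> j))" by (meson G[OF \<tau>I[OF that(1)]] group.is_monoid monoid.one_closed)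
    ultimately show ?thesis using Pb[OF that(1)] that(2) by (metis bij_betw_def inj_onD)
  qed
  have c: "carrier (sum_group I G) = {x \<in> \<Pi>\<^sub>E i\<in>I. carrier (G i). finite {i \<in> I. x i \<noteq> \<one>\<^bsub>G i\<^esub>}}"
    by (rule carrier_sum_group[OF G])
  have c': "carrier (sum_group I' G') = {x \<in> \<Pi>\<^sub>E i\<in>I'. carrier (G' i). finite {i \<in> I'. x i \<noteq> \<one>\<^bsub>G' i\<^esub>}}"
    by (rule carrier_sum_group[OF G'])
  have supp: "{i \<in> I. K i \<noteq> \<one>\<^bsub>G i\<^esub>} = \<tau> ` {j \<in> I'. P j (K (\<tau> j)) \<noteq> \<one>\<^bsub>G' j\<^esub>}" if "\<And>i. i \<in> I \<Longrightarrow> K i \<in> carrier (G i)" for K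
    using \<tau> P1 that \<tau>I by (auto simp: bij_betw_def image_iff)
  have inj: "inj_on \<tau> A" if "A \<subseteq> I'" for A using \<tau> that by (auto simp: bij_betw_def inj_on_def)
  have hom: "?\<Phi> \<in> hom (sum_group I G) (sum_group I' G')"
  proof (rule homI)
    fix K assume K: "K \<in> carrier (sum_group I G)"
    then have Kc: "\<And>i. i \<in> I \<Longrightarrow> K i \<in> carrier (G i)" and fin: "finite {i \<in> I. K i \<noteq> \<one>\<^bsub>G i\<^esub>}" unfolding c by auto
    have "finite {j \<in> I'. P j (K (\<tau> j)) \<noteq> \<one>\<^bsub>G' j\<^esub>}"
      using fin supp[OF Kc] finite_image_iff[OF inj[of "{j \<in> I'. P j (K (\<tau> j)) \<noteq> \<one>\<^bsub>G' j\<^esub>}"]] by auto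
    then have "finite {j \<in> I'. ?\<Phi> K j \<noteq> \<one>\<^bsub>G' j\<^esub>}" by (rule back_subst[where P=finite]) auto
    moreover have "?\<Phi> K \<in> (\<Pi>\<^sub>E j\<in>I'. carrier (G' j))"
      using bij_betwE[OF Pb] Kc \<tau>I by auto
    ultimately show "?\<Phi> K \<in> carrier (sum_group I' G')" unfolding c' by simp
    fix L assume L: "L \<in> carrier (sum_group I G)"
    then have Lc: "\<And>i. i \<in> I \<Longrightarrow> L i \<in> carrier (G i)" unfolding c by auto
    have "P j (K (\<tau> j) \<otimes>\<^bsub>G (\<tau> j)\<^esub> L (\<tau> j)) = P j (K (\<tau> j)) \<otimes>\<^bsub>G' j\<^esub> P j (L (\<tau> j))" if "j \<in> I'" for j
      using Ph[OF that] Kc[OF \<tau>I[OF that]] Lc[OF \<tau>I[OF that]] by (auto simp: hom_def)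
    then show "?\<Phi> (K \<otimes>\<^bsub>sum_group I G\<^esub> L) = ?\<Phi> K \<otimes>\<^bsub>sum_group I' G'\<^esub> ?\<Phi> L"
      using \<tau>I by (auto simp: fun_eq_iff)
  qed
  have "inj_on ?\<Phi> (carrier (sum_group I G))"
  proof (rule inj_onI)
    fix K L assume K: "K \<in> carrier (sum_group I G)" and L: "L \<in> carrier (sum_group I G)" and eq: "?\<Phi> K = ?\<Phi> L"
    show "K = L"
    proof (rule PiE_ext)
      show "K \<in> (\<Pi>\<^sub>E i\<in>I. carrier (G i))" "L \<in> (\<Pi>\<^sub>E i\<in>I. carrier (G i))" using K L unfolding c by auto
      fix i assume i: "i \<in> I"
      then obtain j where j: "j \<in> I'" "i = \<tau> j" using \<tau> by (auto simp: bij_betw_def)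
      have "P j (K i) = P j (L i)" using fun_cong[OF eq, of j] j by simp
      moreover have "K i \<in> carrier (G (\<tau> j))" "L i \<in> carrier (G (\<tau> j))" using K L i j unfolding c by auto
      ultimately show "K i = L i" using Pb[OF j(1)] by (auto simp: bij_betw_def dest: inj_onD)
    qed
  qed
  moreover have "\<exists>K\<in>carrier (sum_group I G). ?\<Phi> K = L" if L: "L \<in> carrier (sum_group I' G')" for L
  proof -
    have Lc: "L j \<in> carrier (G' j)" if "j \<in> I'" for j using L that unfolding c' by auto
    define \<rho> where "\<rho> = inv_into I' \<tau>"
    have \<rho>: "\<rho> i \<in> I'" "\<tau> (\<rho> i) = i" if "i \<in> I" for i
      using \<tau> that by (auto simp: \<rho>_def bij_betw_def inv_into_into f_inv_into_f)
    have \<rho>\<tau>: "\<rho> (\<tau> j) = j" if "j \<in> I'" for j using \<tau> that by (simp add: \<rho>_def bij_betw_def)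
    \<comment> \<open>Surjectivity by solving in each summand; the support of this family is the
      relabelled support of L and hence finite.\<close>
    define K where "K = (\<lambda>i\<in>I. inv_into (carrier (G i)) (P (\<rho> i)) (L (\<rho> i)))"
    have Kc: "K i \<in> carrier (G i)" if "i \<in> I" for i
      using Pb[OF \<rho>(1)[OF that]] Lc[OF \<rho>(1)[OF that]] \<rho>(2)[OF that] that
      by (auto simp: K_def bij_betw_def intro: inv_into_into)
    have PK: "P j (K (\<tau> j)) = L j" if "j \<in> I'" for j
      using Pb[OF that] Lc[OF that] \<tau>I[OF that] \<rho>\<tau>[OF that]
      by (auto simp: K_def bij_betw_def f_inv_into_f)
    have "{i \<in> I. K i \<noteq> \<one>\<^bsub>G i\<^esub>} = \<tau> ` {j \<in> I'. L j \<noteq> \<one>\<^bsub>G' j\<^esub>}"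
      using supp[OF Kc] PK by (auto cong: conj_cong)
    moreover have "finite {j \<in> I'. L j \<noteq> \<one>\<^bsub>G' j\<^esub>}" using L unfolding c' by simp
    ultimately have "finite {i \<in> I. K i \<noteq> \<one>\<^bsub>G i\<^esub>}" by simp
    then have "K \<in> carrier (sum_group I G)" unfolding c using Kc by (auto simp: K_def)
    moreover have "?\<Phi> K = L"
      by (rule PiE_ext[of _ I' "\<lambda>j. carrier (G' j)"]) (use L Lc PK in \<open>auto simp: c'\<close>)
    ultimately show ?thesis by blast
  qed
  ultimately show ?thesis using hom by (auto simp: iso_def bij_betw_def hom_def image_iff)
qed

section \<open>Forms on chart systems\<close>

text \<open>Invariance under the local groups and compatibility with injections are the same
  pullback condition; collecting both kinds of maps lets each argument be made once.\<close>

definition structure_maps :: "('i, 'x, 'a, 'g, 'm) chart_system_scheme \<Rightarrow> 'i \<Rightarrow> 'i \<Rightarrow> ('x \<Rightarrow> 'x) set" where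
  "structure_maps D i j = fst ` injs D i j \<union> {cact D i g | g. i = j \<and> g \<in> carrier (cgrp D i)}"

definition smooth_system :: "('i, 'x, 'a::euclidean_space, 'g, 'm) chart_system_scheme \<Rightarrow> bool" where
  "smooth_system D \<longleftrightarrow> (\<forall>i\<in>charts D. amfd (cmfd D i)) \<and>
     (\<forall>i\<in>charts D. \<forall>j\<in>charts D. \<forall>\<sigma>\<in>structure_maps D i j. asmooth (cmfd D i) (cmfd D j) \<sigma>)"

lemma smooth_systemD:
  assumes "smooth_system D" "i \<in> charts D"
  shows "amfd (cmfd D i)" "j \<in> charts D \<Longrightarrow> \<sigma> \<in> structure_maps D i j \<Longrightarrow> asmooth (cmfd D i) (cmfd D j) \<sigma>"
  using assms by (auto simp: smooth_system_def)

lemma orb_forms_iff: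
  "\<omega> \<in> orb_forms D d \<longleftrightarrow> (\<forall>i. i \<notin> charts D \<longrightarrow> \<omega> i = (\<lambda>_ _ _. 0)) \<and> (\<forall>i\<in>charts D. \<omega> i \<in> forms (cmfd D i) d) \<and>
     (\<forall>i\<in>charts D. \<forall>j\<in>charts D. \<forall>\<sigma>\<in>structure_maps D i j. pullback \<sigma> (cmfd D i) (cmfd D j) (\<omega> j) = \<omega> i)"
  unfolding orb_forms_def structure_maps_def by blast

lemma orb_formsD:
  assumes "\<omega> \<in> orb_forms D d"
  shows "i \<notin> charts D \<Longrightarrow> \<omega> i = (\<lambda>_ _ _. 0)" "i \<in> charts D \<Longrightarrow> \<omega> i \<in> forms (cmfd D i) d"
    "i \<in> charts D \<Longrightarrow> j \<in> charts D \<Longrightarrow> \<sigma> \<in> structure_maps D i j \<Longrightarrow> pullback \<sigma> (cmfd D i) (cmfd D j) (\<omega> j) = \<omega> i"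
  using assms unfolding orb_forms_iff by auto

text \<open>One operation for sum and inverse: the coefficients 1, 1 give the group law, and -1, 0
  the inverse.\<close>

definition lincomb :: "real \<Rightarrow> ('i, 'x, 'a) orb_form \<Rightarrow> real \<Rightarrow> ('i, 'x, 'a) orb_form \<Rightarrow> ('i, 'x, 'a) orb_form" where
  "lincomb a \<omega> b \<eta> = (\<lambda>i c y vs. a * \<omega> i c y vs + b * \<eta> i c y vs)"

lemma orb_forms_lincomb:
  assumes "smooth_system D" "\<omega> \<in> orb_forms D d" "\<eta> \<in> orb_forms D d"
  shows "lincomb a \<omega> b \<eta> \<in> orb_forms D d"
  unfolding orb_forms_iff lincomb_def
  using orb_formsD[OF assms(2)] orb_formsD[OF assms(3)]
  by (auto intro!: forms_lincomb smooth_systemD(1)[OF assms(1)] simp: pullback_lincomb)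

lemma orb_d_lincomb:
  assumes "smooth_system D" "\<omega> \<in> orb_forms D d" "\<eta> \<in> orb_forms D d"
  shows "orb_d D (lincomb a \<omega> b \<eta>) = lincomb a (orb_d D \<omega>) b (orb_d D \<eta>)"
proof
  fix i show "orb_d D (lincomb a \<omega> b \<eta>) i = lincomb a (orb_d D \<omega>) b (orb_d D \<eta>) i"
    using ext_d_lincomb[OF smooth_systemD(1)[OF assms(1)] orb_formsD(2)[OF assms(2)] orb_formsD(2)[OF assms(3)], of i]
    by (auto simp: orb_d_def lincomb_def)
qed

lemma orb_d_forms:
  assumes D: "smooth_system D" and \<omega>: "\<omega> \<in> orb_forms D d"
  shows "orb_d D \<omega> \<in> orb_forms D (Suc d)"
  unfolding orb_forms_iff
proof (intro conjI ballI allI impI)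
  fix i assume i: "i \<in> charts D"
  show "orb_d D \<omega> i \<in> forms (cmfd D i) (Suc d)"
    using ext_d_forms[OF smooth_systemD(1)[OF D i] orb_formsD(2)[OF \<omega> i]] i by (simp add: orb_d_def)
  fix j \<sigma> assume j: "j \<in> charts D" and \<sigma>: "\<sigma> \<in> structure_maps D i j"
  show "pullback \<sigma> (cmfd D i) (cmfd D j) (orb_d D \<omega> j) = orb_d D \<omega> i"
    using ext_d_pullback[OF smooth_systemD(1)[OF D i] smooth_systemD(1)[OF D j] smooth_systemD(2)[OF D i j \<sigma>] orb_formsD(2)[OF \<omega> j]]
      orb_formsD(3)[OF \<omega> i j \<sigma>] i j by (simp add: orb_d_def)
qed (simp add: orb_d_def)

lemma orb_d_orb_d:
  assumes D: "smooth_system D" and \<omega>: "\<omega> \<in> orb_forms D d"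
  shows "orb_d D (orb_d D \<omega>) = (\<lambda>_ _ _ _. 0)"
  using ext_d_ext_d[OF smooth_systemD(1)[OF D] orb_formsD(2)[OF \<omega>]] by (auto simp: orb_d_def)

lemma zero_orb_form: "smooth_system D \<Longrightarrow> (\<lambda>_ _ _ _. 0) \<in> orb_forms D d"
  by (auto simp: orb_forms_iff pullback_def fun_eq_iff Let_def forms_def local_form_def alt_form_zero_fun smooth_on_const)

lemma orb_d_zero: "orb_d D (\<lambda>_ _ _ _. 0) = (\<lambda>_ _ _ _. 0)"
  by (auto simp: orb_d_def ext_d_def local_d_def fun_eq_iff)

lemma closed_forms_sel [simp]:
  "\<one>\<^bsub>closed_forms D d\<^esub> = (\<lambda>_ _ _ _. 0)" "\<omega> \<otimes>\<^bsub>closed_forms D d\<^esub> \<eta> = lincomb 1 \<omega> 1 \<eta>"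
  "\<omega> \<in> carrier (closed_forms D d) \<longleftrightarrow> \<omega> \<in> orb_forms D d \<and> orb_d D \<omega> = (\<lambda>_ _ _ _. 0)"
  by (simp_all add: closed_forms_def lincomb_def)

lemma closed_forms_lincomb:
  assumes "smooth_system D" "\<omega> \<in> carrier (closed_forms D d)" "\<eta> \<in> carrier (closed_forms D d)"
  shows "lincomb a \<omega> b \<eta> \<in> carrier (closed_forms D d)"
proof -
  have f: "\<omega> \<in> orb_forms D d" "\<eta> \<in> orb_forms D d" using assms by auto
  have "orb_d D (lincomb a \<omega> b \<eta>) = (\<lambda>_ _ _ _. 0)"
    unfolding orb_d_lincomb[OF assms(1) f] using assms by (simp add: lincomb_def)
  then show ?thesis using orb_forms_lincomb[OF assms(1) f] by simp
qed

lemma comm_group_closed_forms: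
  assumes D: "smooth_system D"
  shows "comm_group (closed_forms D d)"
proof (rule comm_groupI)
  fix x assume x: "x \<in> carrier (closed_forms D d)"
  show "\<exists>y\<in>carrier (closed_forms D d). y \<otimes>\<^bsub>closed_forms D d\<^esub> x = \<one>\<^bsub>closed_forms D d\<^esub>"
    using closed_forms_lincomb[OF D x x, of "-1" 0]
    by (intro bexI[of _ "lincomb (-1) x 0 x"]) (auto simp: lincomb_def)
next
  fix x y assume "x \<in> carrier (closed_forms D d)" "y \<in> carrier (closed_forms D d)"
  from closed_forms_lincomb[OF D this, of 1 1]
  show "x \<otimes>\<^bsub>closed_forms D d\<^esub> y \<in> carrier (closed_forms D d)" by simp
qed (use zero_orb_form[OF D] in \<open>auto simp: lincomb_def orb_d_zero add_ac\<close>)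

lemma exact_forms_lincomb:
  assumes "smooth_system D" "\<omega> \<in> exact_forms D d" "\<eta> \<in> exact_forms D d"
  shows "lincomb a \<omega> b \<eta> \<in> exact_forms D d"
proof (cases d)
  case 0 then show ?thesis using assms by (simp add: lincomb_def)
next
  case (Suc d')
  then obtain x y where xy: "\<omega> = orb_d D x" "x \<in> orb_forms D d'" "\<eta> = orb_d D y" "y \<in> orb_forms D d'"
    using assms by auto
  then have "lincomb a \<omega> b \<eta> = orb_d D (lincomb a x b y)" using orb_d_lincomb[OF assms(1) xy(2,4)] by simp
  then show ?thesis unfolding Suc using orb_forms_lincomb[OF assms(1) xy(2,4)] by auto
qed

lemma exact_forms_closed:
  assumes "smooth_system D"
  shows "exact_forms D d \<subseteq> carrier (closed_forms D d)"
  using zero_orb_form[OF assms] orb_d_forms[OF assms] orb_d_orb_d[OF assms]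
  by (cases d) (auto simp: orb_d_zero)

lemma subgroup_exact_forms:
  assumes D: "smooth_system D"
  shows "subgroup (exact_forms D d) (closed_forms D d)"
proof -
  interpret comm_group "closed_forms D d" by (rule comm_group_closed_forms[OF D])
  have z: "(\<lambda>_ _ _ _. 0) \<in> exact_forms D d"
    using zero_orb_form[OF D] orb_d_zero[of D] by (cases d) (auto simp: image_iff intro!: bexI[of _ "\<lambda>_ _ _ _. 0"])
  show ?thesis
  proof (rule subgroupI)
    fix a assume a: "a \<in> exact_forms D d"
    then have ac: "a \<in> carrier (closed_forms D d)" using exact_forms_closed[OF D] by blast
    have "inv\<^bsub>closed_forms D d\<^esub> a = lincomb (-1) a 0 a"
    proof (rule inv_equality[OF _ ac closed_forms_lincomb[OF D ac ac]])
      show "lincomb (-1) a 0 a \<otimes>\<^bsub>closed_forms D d\<^esub> a = \<one>\<^bsub>closed_forms D d\<^esub>" by (simp add: lincomb_def)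
    qed
    then show "inv\<^bsub>closed_forms D d\<^esub> a \<in> exact_forms D d" using exact_forms_lincomb[OF D a a] by simp
    fix b assume "b \<in> exact_forms D d"
    then show "a \<otimes>\<^bsub>closed_forms D d\<^esub> b \<in> exact_forms D d" using exact_forms_lincomb[OF D a] by simp
  qed (use z exact_forms_closed[OF D] in auto)
qed

lemma group_deRham:
  assumes D: "smooth_system D"
  shows "group (deRham D d)"
  unfolding deRham_def
  by (rule normal.factorgroup_is_group, rule comm_group.subgroup_imp_normal)
     (rule comm_group_closed_forms[OF D], rule subgroup_exact_forms[OF D])

subsection \<open>Maps of chart systems\<close>

text \<open>The partner \<open>\<sigma>'\<close> of \<sigma> makes pullback respect invariance:
  pulling back along f and then along \<sigma> is pulling back along \<open>\<sigma>'\<close> and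
  then along f.\<close>

definition system_map ::
  "('i \<Rightarrow> 'x \<Rightarrow> 'y) \<Rightarrow> ('i, 'x, 'a::euclidean_space, 'g, 'm) chart_system_scheme \<Rightarrow>
   ('i, 'y, 'b::euclidean_space, 'h, 'n) chart_system_scheme \<Rightarrow> bool" where
  "system_map f D D' \<longleftrightarrow> charts D = charts D' \<and> (\<forall>i\<in>charts D. asmooth (cmfd D i) (cmfd D' i) (f i)) \<and>
     (\<forall>i\<in>charts D. \<forall>j\<in>charts D. \<forall>\<sigma>\<in>structure_maps D i j. \<exists>\<sigma>'\<in>structure_maps D' i j.
        \<forall>x\<in>cpts D i. f j (\<sigma> x) = \<sigma>' (f i x))"

context
  fixes f :: "'i \<Rightarrow> 'x \<Rightarrow> 'y" and D :: "('i, 'x, 'a::euclidean_space, 'g, 'm) chart_system_scheme"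
    and D' :: "('i, 'y, 'b::euclidean_space, 'g, 'm) chart_system_scheme"
  assumes D: "smooth_system D" and D': "smooth_system D'" and f: "system_map f D D'"
begin

lemma system_map_sel:
  "charts D' = charts D" "i \<in> charts D \<Longrightarrow> asmooth (cmfd D i) (cmfd D' i) (f i)"
  "i \<in> charts D \<Longrightarrow> amfd (cmfd D' i)"
  using f D' by (auto simp: system_map_def smooth_system_def)

lemma orb_pullback_forms:
  assumes \<omega>: "\<omega> \<in> orb_forms D' d"
  shows "orb_pullback f D D' \<omega> \<in> orb_forms D d"
  unfolding orb_forms_iff
proof (intro conjI ballI allI impI)
  have \<omega>f: "\<omega> i \<in> forms (cmfd D' i) d" if "i \<in> charts D" for i using orb_formsD(2)[OF \<omega>] that system_map_sel(1) by blast
  fix i assume i: "i \<in> charts D"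
  note Di = smooth_systemD(1)[OF D i] and D'i = system_map_sel(3)[OF i] and fi = system_map_sel(2)[OF i]
  show "orb_pullback f D D' \<omega> i \<in> forms (cmfd D i) d"
    using pullback_forms[OF Di D'i fi \<omega>f[OF i]] i by (simp add: orb_pullback_def)
  fix j \<sigma> assume j: "j \<in> charts D" and \<sigma>: "\<sigma> \<in> structure_maps D i j"
  note Dj = smooth_systemD(1)[OF D j] and D'j = system_map_sel(3)[OF j] and fj = system_map_sel(2)[OF j]
  obtain \<sigma>' where \<sigma>': "\<sigma>' \<in> structure_maps D' i j" "\<And>x. x \<in> cpts D i \<Longrightarrow> f j (\<sigma> x) = \<sigma>' (f i x)"
    using f i j \<sigma> unfolding system_map_def by blast
  have i': "i \<in> charts D'" and j': "j \<in> charts D'" using i j system_map_sel(1) by auto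
  note s = smooth_systemD(2)[OF D i j \<sigma>] and s' = smooth_systemD(2)[OF D' i' j' \<sigma>'(1)]
  have "pullback \<sigma> (cmfd D i) (cmfd D j) (pullback (f j) (cmfd D j) (cmfd D' j) (\<omega> j)) =
    pullback (\<lambda>x. f j (\<sigma> x)) (cmfd D i) (cmfd D' j) (\<omega> j)"
    by (rule pullback_pullback[OF Di Dj D'j s fj \<omega>f[OF j]])
  also have "\<dots> = pullback (\<lambda>x. \<sigma>' (f i x)) (cmfd D i) (cmfd D' j) (\<omega> j)"
    by (rule pullback_cong[OF Di D'j asmooth_compose[OF Di Dj s fj] \<omega>f[OF j] \<sigma>'(2)])
  also have "\<dots> = pullback (f i) (cmfd D i) (cmfd D' i) (pullback \<sigma>' (cmfd D' i) (cmfd D' j) (\<omega> j))"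
    by (rule pullback_pullback[OF Di D'i D'j fi s' \<omega>f[OF j], symmetric])
  also have "pullback \<sigma>' (cmfd D' i) (cmfd D' j) (\<omega> j) = \<omega> i" by (rule orb_formsD(3)[OF \<omega> i' j' \<sigma>'(1)])
  finally show "pullback \<sigma> (cmfd D i) (cmfd D j) (orb_pullback f D D' \<omega> j) = orb_pullback f D D' \<omega> i"
    using i j by (simp add: orb_pullback_def)
qed (simp add: orb_pullback_def)

lemma orb_pullback_orb_d:
  assumes \<omega>: "\<omega> \<in> orb_forms D' d"
  shows "orb_d D (orb_pullback f D D' \<omega>) = orb_pullback f D D' (orb_d D' \<omega>)"
proof
  fix i show "orb_d D (orb_pullback f D D' \<omega>) i = orb_pullback f D D' (orb_d D' \<omega>) i"
    using ext_d_pullback[OF smooth_systemD(1)[OF D] system_map_sel(3,2) orb_formsD(2)[OF \<omega>], of i] system_map_sel(1)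
    by (simp add: orb_d_def orb_pullback_def)
qed

lemma orb_pullback_lincomb:
  "orb_pullback f D D' (lincomb a \<omega> b \<eta>) = lincomb a (orb_pullback f D D' \<omega>) b (orb_pullback f D D' \<eta>)"
  by (auto simp: orb_pullback_def lincomb_def pullback_lincomb fun_eq_iff)

lemma orb_pullback_zero: "orb_pullback f D D' (\<lambda>_ _ _ _. 0) = (\<lambda>_ _ _ _. 0)"
  by (auto simp: orb_pullback_def pullback_def fun_eq_iff Let_def)

lemma orb_pullback_hom: "orb_pullback f D D' \<in> hom (closed_forms D' d) (closed_forms D d)"
  using orb_pullback_forms orb_pullback_orb_d
  by (intro homI) (auto simp: orb_pullback_lincomb orb_pullback_zero)

lemma orb_pullback_exact: "orb_pullback f D D' ` exact_forms D' d \<subseteq> exact_forms D d"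
proof (cases d)
  case 0 then show ?thesis by (simp add: orb_pullback_zero)
next
  case (Suc d')
  then show ?thesis using orb_pullback_forms orb_pullback_orb_d[symmetric] by auto
qed

end

subsection \<open>Homotopy invariance\<close>

lemma fibre_integral_zero: "fibre_integral M (\<lambda>_ _ _. 0) = (\<lambda>_ _ _. 0)"
  by (auto simp: fibre_integral_def fun_eq_iff)

text \<open>The maps \<iota> and \<rho> give homomorphisms in both directions. The homotopy h joins
  \<open>\<iota> \<circ> \<rho>\<close> to the identity, and \<open>hs\<close>, its commutation with
  the structure maps at each time, makes the homotopy operator preserve invariant forms.\<close>

theorem deRham_pullback_iso:
  fixes D :: "('i, 'x, 'a::euclidean_space, 'g, 'm) chart_system_scheme"
    and E :: "('i, 'y, 'b::euclidean_space, 'g, 'm) chart_system_scheme"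
  assumes D: "smooth_system D" and E: "smooth_system E"
    and \<iota>: "system_map \<iota> D E" and \<rho>: "system_map \<rho> E D"
    and \<rho>\<iota>: "\<And>i x. i \<in> charts D \<Longrightarrow> x \<in> cpts D i \<Longrightarrow> \<rho> i (\<iota> i x) = x"
    and h: "\<And>i. i \<in> charts E \<Longrightarrow> asmooth (cylinder (cmfd E i)) (cmfd E i) (h i)"
    and h1: "\<And>i e. i \<in> charts E \<Longrightarrow> e \<in> cpts E i \<Longrightarrow> h i (e, 1) = e"
    and h0: "\<And>i e. i \<in> charts E \<Longrightarrow> e \<in> cpts E i \<Longrightarrow> h i (e, 0) = \<iota> i (\<rho> i e)"
    and hs: "\<And>i j \<sigma> e s. i \<in> charts E \<Longrightarrow> j \<in> charts E \<Longrightarrow> \<sigma> \<in> structure_maps E i j \<Longrightarrow> e \<in> cpts E i \<Longrightarrow>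
      h j (\<sigma> e, s) = \<sigma> (h i (e, s))"
  shows "deRham_pullback \<iota> D E d \<in> iso (deRham E d) (deRham D d)"
proof -
  let ?F = "orb_pullback \<iota> D E" and ?R = "orb_pullback \<rho> E D"
  have ch: "charts E = charts D" using \<iota> by (simp add: system_map_def)
  have Ei: "amfd (cmfd E i)" if "i \<in> charts E" for i using smooth_systemD(1)[OF E that] .
  have Di: "amfd (cmfd D i)" if "i \<in> charts D" for i using smooth_systemD(1)[OF D that] .
  have Ci: "amfd (cylinder (cmfd E i))" if "i \<in> charts E" for i by (rule amfd_prod[OF Ei[OF that] subspace_UNIV])
  have \<iota>i: "asmooth (cmfd D i) (cmfd E i) (\<iota> i)" if "i \<in> charts E" for i using \<iota> that ch by (simp add: system_map_def)
  have \<rho>i: "asmooth (cmfd E i) (cmfd D i) (\<rho> i)" if "i \<in> charts E" for i using \<rho> that by (simp add: system_map_def)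
  have incl: "asmooth (cmfd E i) (cylinder (cmfd E i)) (\<lambda>x. (x, s))" if "i \<in> charts E" for i and s :: real
    by (rule asmooth_incl[OF Ei[OF that] subspace_UNIV]) simp
  have FR: "?F (?R z) = z" if z: "z \<in> orb_forms D d" for z
  proof
    fix i show "?F (?R z) i = z i"
    proof (cases "i \<in> charts D")
      case True
      then have iE: "i \<in> charts E" using ch by simp
      note zi = orb_formsD(2)[OF z True]
      have "?F (?R z) i = pullback (\<lambda>x. \<rho> i (\<iota> i x)) (cmfd D i) (cmfd D i) (z i)"
        using pullback_pullback[OF Di[OF True] Ei[OF iE] Di[OF True] \<iota>i[OF iE] \<rho>i[OF iE] zi] True iE
        by (simp add: orb_pullback_def)
      also have "\<dots> = pullback (\<lambda>x. x) (cmfd D i) (cmfd D i) (z i)"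
        by (rule pullback_cong[OF Di[OF True] Di[OF True] asmooth_compose[OF Di[OF True] Ei[OF iE] \<iota>i[OF iE] \<rho>i[OF iE]] zi])
           (rule \<rho>\<iota>[OF True])
      also have "\<dots> = z i" by (rule pullback_id[OF Di[OF True] zi])
      finally show ?thesis .
    next
      case False then show ?thesis using orb_formsD(1)[OF z False] by (simp add: orb_pullback_def)
    qed
  qed
  \<comment> \<open>The form on the cylinder to be integrated along the fibres; \<open>K\<close> is
    the homotopy operator, set to zero off the charts as orbifold forms are.\<close>
  define H where "H \<omega> i = pullback (h i) (cylinder (cmfd E i)) (cmfd E i) (\<omega> i)" for \<omega> i
  define K where "K \<omega> = (\<lambda>i. if i \<in> charts E then fibre_integral (cmfd E i) (H \<omega> i) else (\<lambda>_ _ _. 0))" for \<omega>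
  have Hf: "H \<omega> i \<in> forms (cylinder (cmfd E i)) d" if "\<omega> \<in> orb_forms E d" "i \<in> charts E" for \<omega> i d
    unfolding H_def by (rule pullback_forms[OF Ci Ei h orb_formsD(2)[OF that(1)]]) (use that in auto)
  have KE: "K \<omega> \<in> orb_forms E d" if \<omega>: "\<omega> \<in> orb_forms E (Suc d)" for \<omega> d
    unfolding orb_forms_iff
  proof (intro conjI ballI allI impI)
    fix i assume i: "i \<in> charts E"
    show "K \<omega> i \<in> forms (cmfd E i) d" using fibre_integral_forms[OF Ei[OF i] Hf[OF \<omega> i]] i by (simp add: K_def)
    fix j \<sigma> assume j: "j \<in> charts E" and \<sigma>: "\<sigma> \<in> structure_maps E i j"
    note s = smooth_systemD(2)[OF E i j \<sigma>] and \<omega>j = orb_formsD(2)[OF \<omega> j]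
    let ?s = "\<lambda>p. (\<sigma> (fst p), snd p :: real)"
    have ss: "asmooth (cylinder (cmfd E i)) (cylinder (cmfd E j)) ?s" by (rule asmooth_prod[OF Ei[OF i] s subspace_UNIV])
    have "pullback ?s (cylinder (cmfd E i)) (cylinder (cmfd E j)) (H \<omega> j) =
      pullback (\<lambda>p. h j (?s p)) (cylinder (cmfd E i)) (cmfd E j) (\<omega> j)"
      unfolding H_def by (rule pullback_pullback[OF Ci[OF i] Ci[OF j] Ei[OF j] ss h[OF j] \<omega>j])
    also have "\<dots> = pullback (\<lambda>p. \<sigma> (h i p)) (cylinder (cmfd E i)) (cmfd E j) (\<omega> j)"
      by (rule pullback_cong[OF Ci[OF i] Ei[OF j] asmooth_compose[OF Ci[OF i] Ci[OF j] ss h[OF j]] \<omega>j])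
         (use hs[OF i j \<sigma>] in auto)
    also have "\<dots> = pullback (h i) (cylinder (cmfd E i)) (cmfd E i) (pullback \<sigma> (cmfd E i) (cmfd E j) (\<omega> j))"
      by (rule pullback_pullback[OF Ci[OF i] Ei[OF i] Ei[OF j] h[OF i] s \<omega>j, symmetric])
    also have "\<dots> = H \<omega> i" using orb_formsD(3)[OF \<omega> i j \<sigma>] by (simp add: H_def)
    finally show "pullback \<sigma> (cmfd E i) (cmfd E j) (K \<omega> j) = K \<omega> i"
      using fibre_integral_natural[OF Ei[OF i] Ei[OF j] s Hf[OF \<omega> j]] i j by (simp add: K_def)
  qed (simp add: K_def)
  have homotopy: "\<omega> i c y vs = ext_d (cmfd E i) (fibre_integral (cmfd E i) (H \<omega> i)) c y vs + ?R (?F \<omega>) i c y vs"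
    if \<omega>: "\<omega> \<in> orb_forms E d" and cl: "orb_d E \<omega> = (\<lambda>_ _ _ _. 0)" and i: "i \<in> charts E" for \<omega> i c y vs
  proof -
    note \<omega>i = orb_formsD(2)[OF \<omega> i]
    have iD: "i \<in> charts D" using i ch by simp
    \<comment> \<open>Only closed forms are considered, so the summand of the homotopy formula that
      contains the exterior derivative of the pulled-back form drops out.\<close>
    have "ext_d (cylinder (cmfd E i)) (H \<omega> i) = pullback (h i) (cylinder (cmfd E i)) (cmfd E i) (ext_d (cmfd E i) (\<omega> i))"
      unfolding H_def by (rule ext_d_pullback[OF Ci[OF i] Ei[OF i] h[OF i] \<omega>i])
    also have "ext_d (cmfd E i) (\<omega> i) = (\<lambda>_ _ _. 0)" using fun_cong[OF cl, of i] i by (simp add: orb_d_def)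
    also have "pullback (h i) (cylinder (cmfd E i)) (cmfd E i) (\<lambda>_ _ _. 0) = (\<lambda>_ _ _. 0)"
      by (auto simp: pullback_def Let_def fun_eq_iff)
    finally have dH: "ext_d (cylinder (cmfd E i)) (H \<omega> i) = (\<lambda>_ _ _. 0)" .
    have pp: "pullback (\<lambda>x. (x, s)) (cmfd E i) (cylinder (cmfd E i)) (H \<omega> i) = pullback (\<lambda>x. h i (x, s)) (cmfd E i) (cmfd E i) (\<omega> i)" for s
      unfolding H_def by (rule pullback_pullback[OF Ei[OF i] Ci[OF i] Ei[OF i] incl[OF i] h[OF i] \<omega>i])
    note hi = asmooth_compose[OF Ei[OF i] Ci[OF i] incl[OF i] h[OF i]]
    have 1: "pullback (\<lambda>x. h i (x, 1)) (cmfd E i) (cmfd E i) (\<omega> i) = \<omega> i"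
      using pullback_cong[OF Ei[OF i] Ei[OF i] hi[of 1] \<omega>i h1[OF i]] pullback_id[OF Ei[OF i] \<omega>i] by simp
    have 0: "pullback (\<lambda>x. h i (x, 0)) (cmfd E i) (cmfd E i) (\<omega> i) = ?R (?F \<omega>) i"
      using pullback_cong[OF Ei[OF i] Ei[OF i] hi[of 0] \<omega>i h0[OF i]]
        pullback_pullback[OF Ei[OF i] Di[OF iD] Ei[OF i] \<rho>i[OF i] \<iota>i[OF i] \<omega>i] i iD
      by (simp add: orb_pullback_def)
    show ?thesis using fibre_integral_homotopy[OF Ei[OF i] Hf[OF \<omega> i], of c y vs]
      unfolding dH pp 1 0 fibre_integral_zero by simp
  qed
  have RF: "\<exists>e\<in>exact_forms E d. \<omega> = e \<otimes>\<^bsub>closed_forms E d\<^esub> ?R (?F \<omega>)" if \<omega>: "\<omega> \<in> carrier (closed_forms E d)" for \<omega>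
  proof -
    have \<omega>': "\<omega> \<in> orb_forms E d" "orb_d E \<omega> = (\<lambda>_ _ _ _. 0)" using \<omega> by auto
    have eq: "\<omega> = lincomb 1 (orb_d E (K \<omega>)) 1 (?R (?F \<omega>))"
    proof (intro ext)
      fix i c y vs
      show "\<omega> i c y vs = lincomb 1 (orb_d E (K \<omega>)) 1 (?R (?F \<omega>)) i c y vs"
        using homotopy[OF \<omega>', of i c y vs] orb_formsD(1)[OF \<omega>'(1), of i]
        by (cases "i \<in> charts E") (auto simp: lincomb_def orb_d_def K_def orb_pullback_def)
    qed
    show ?thesis
    proof (cases d)
      case (Suc d')
      then have "orb_d E (K \<omega>) \<in> exact_forms E d" using KE[of \<omega> d'] \<omega>' by auto
      then show ?thesis using eq by auto
    next
      case 0
      \<comment> \<open>In degree 0 the only exact form is zero, so the correction term has to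
        vanish: a function has no argument in which \<partial>/\<partial>s could be
        inserted.\<close>
      have "K \<omega> = (\<lambda>_ _ _ _. 0)"
      proof (intro ext)
        fix i c y vs show "K \<omega> i c y vs = 0"
        proof (cases "i \<in> charts E \<and> c \<in> matlas (cmfd E i) \<and> y \<in> cimg c \<and> set vs \<subseteq> cmodel c")
          case True
          then have i: "i \<in> charts E" and c: "c \<in> matlas (cmfd E i)" and y: "y \<in> cimg c" by auto
          have "H \<omega> i (cyl_coord c) (y, s) ((0, 1) # lift_args vs) = 0" for s
            by (rule alt_form_zero[OF cylinder_form(3)[OF Ei[OF i] Hf[OF \<omega>'(1) i] c y]]) (use 0 in simp)
          then show ?thesis by (simp add: K_def fibre_integral_def)
        qed (auto simp: K_def fibre_integral_def)
      qed
      then have "orb_d E (K \<omega>) = (\<lambda>_ _ _ _. 0)" by (simp add: orb_d_zero)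
      then show ?thesis using eq 0 by simp
    qed
  qed
  have "(\<lambda>L. \<Union>\<omega>\<in>L. exact_forms D d #>\<^bsub>closed_forms D d\<^esub> ?F \<omega>) \<in> iso (closed_forms E d Mod exact_forms E d) (closed_forms D d Mod exact_forms D d)"
  proof (rule FactGroup_iso[OF comm_group_closed_forms[OF E] comm_group_closed_forms[OF D] subgroup_exact_forms[OF E] subgroup_exact_forms[OF D]])
    show "?F \<in> hom (closed_forms E d) (closed_forms D d)" "?F ` exact_forms E d \<subseteq> exact_forms D d"
      using orb_pullback_hom[OF D E \<iota>] orb_pullback_exact[OF D E \<iota>] by auto
    show "?R \<in> hom (closed_forms D d) (closed_forms E d)" "?R ` exact_forms D d \<subseteq> exact_forms E d"
      using orb_pullback_hom[OF E D \<rho>] orb_pullback_exact[OF E D \<rho>] by auto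
  qed (use RF FR in auto)
  then show ?thesis unfolding deRham_def deRham_pullback_def[abs_def] .
qed

section \<open>Coordinates of topological manifolds\<close>

lemma is_coord_ok: "is_coord X c \<Longrightarrow> coord_ok c"
  unfolding is_coord_def coord_ok_def relopen_def
  by (auto dest!: homeomorphic_imp_injective_map dest: openin_subset simp: Int_absorb1)

lemma is_coord_openin_image:
  assumes c: "is_coord X c" and U: "openin X U" "U \<subseteq> cdom c"
  shows "relopen (cmodel c) (cmap c ` U)"
proof -
  have "openin (subtopology X (cdom c)) U"
    using c U by (simp add: is_coord_def openin_open_subtopology)
  then have "openin (top_of_set (cimg c)) (cmap c ` U)"
    using c homeomorphic_imp_open_map unfolding is_coord_def open_map_def by blast
  then show ?thesis using c unfolding is_coord_def relopen_def by (auto intro: openin_trans)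
qed

text \<open>Here continuity is turned into openness in the model space, the only form in which the
  topology is used by \<open>smooth_between\<close>.\<close>

lemma relopen_rep_dom:
  assumes "is_coord X c" "is_coord Y c'" "continuous_map X Y f"
  shows "relopen (cmodel c) (rep_dom f c c')"
  unfolding rep_dom_def
  by (rule is_coord_openin_image[OF assms(1)])
     (use assms in \<open>auto simp: is_coord_def intro: openin_continuous_map_preimage_gen\<close>)

lemma smooth_between_id:
  assumes "is_coord X c" "is_coord X c'"
  shows "smooth_between (\<lambda>x. x) c c' \<longleftrightarrow>
    smooth_on (cmodel c) (cmap c ` (cdom c \<inter> cdom c')) (local_rep (\<lambda>x. x) c c')"
proof -
  have "rep_dom (\<lambda>x. x) c c' = cmap c ` (cdom c \<inter> cdom c')" by (auto simp: rep_dom_def)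
  then show ?thesis using relopen_rep_dom[OF assms continuous_map_id[unfolded id_def]] by (simp add: smooth_between_def)
qed

lemma coord_compat_iff:
  assumes "is_coord X c" "is_coord X c'"
  shows "coord_compat c c' \<longleftrightarrow> smooth_between (\<lambda>x. x) c c' \<and> smooth_between (\<lambda>x. x) c' c"
  unfolding coord_compat_def smooth_between_id[OF assms] smooth_between_id[OF assms(2,1)]
  by (simp add: Int_commute)

lemma smooth_manifold_is_coord: "smooth_manifold n M \<Longrightarrow> c \<in> matlas M \<Longrightarrow> is_coord (mtop M) c"
  by (simp add: smooth_manifold_def)

lemma smooth_manifold_amfd:
  assumes "smooth_manifold n M"
  shows "amfd M"
  unfolding amfd_def
proof (intro conjI ballI)
  fix c c' assume c: "c \<in> matlas M" "c' \<in> matlas M"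
  note ic = smooth_manifold_is_coord[OF assms c(1)] smooth_manifold_is_coord[OF assms c(2)]
  show "coord_ok c" by (rule is_coord_ok[OF ic(1)])
  show "smooth_between (\<lambda>x. x) c c'" using assms c coord_compat_iff[OF ic] by (auto simp: smooth_manifold_def)
next
  show "mpts M = (\<Union>c\<in>matlas M. cdom c)" using assms unfolding smooth_manifold_def by blast
qed

lemma max_atlas_iff:
  assumes "smooth_manifold n M"
  shows "c \<in> max_atlas M \<longleftrightarrow> is_coord (mtop M) c \<and> c \<in> amax M"
proof -
  have "cdom c \<subseteq> mpts M" if "is_coord (mtop M) c" using that by (auto simp: is_coord_def dest: openin_subset)
  then show ?thesis
    using coord_compat_iff[OF _ smooth_manifold_is_coord[OF assms]] is_coord_ok[of "mtop M" c]
    by (auto simp: max_atlas_def amax_def)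
qed

lemma smooth_map_on_asmooth:
  assumes M: "smooth_manifold n M" and N: "smooth_manifold l N" and f: "smooth_map_on M (mpts M) N f"
  shows "asmooth M N f"
proof -
  have cont: "continuous_map (mtop M) (mtop N) f" using f by (simp add: smooth_map_on_def)
  show ?thesis unfolding asmooth_def
  proof (intro conjI ballI)
    show "f ` mpts M \<subseteq> mpts N" using cont by (auto simp: continuous_map_def)
    fix c c' assume c: "c \<in> matlas M" "c' \<in> matlas N"
    note ic = smooth_manifold_is_coord[OF M c(1)] smooth_manifold_is_coord[OF N c(2)]
    have e: "{x \<in> cdom c \<inter> mpts M. f x \<in> cdom c'} = {x \<in> cdom c. f x \<in> cdom c'}"
      using amfdD(2)[OF smooth_manifold_amfd[OF M] c(1)] by auto
    have "smooth_on (cmodel c) (cmap c ` {x \<in> cdom c \<inter> mpts M. f x \<in> cdom c'}) (local_rep f c c')"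
      using f c unfolding smooth_map_on_def by blast
    then show "smooth_between f c c'"
      using relopen_rep_dom[OF ic cont] unfolding smooth_between_def rep_dom_def e by simp
  qed
qed

lemma is_coord_prod:
  assumes c: "is_coord X c" and F: "subspace F"
  shows "is_coord (prod_topology X (top_of_set F)) (prod_coord F c)"
proof -
  have oc: "openin X (cdom c)" and hc: "homeomorphic_map (subtopology X (cdom c)) (top_of_set (cimg c)) (cmap c)"
    using c by (auto simp: is_coord_def)
  obtain g where g: "homeomorphic_maps (subtopology X (cdom c)) (top_of_set (cimg c)) (cmap c) g"
    using hc homeomorphic_map_maps by blast
  have "homeomorphic_maps (prod_topology (subtopology X (cdom c)) (top_of_set F)) (prod_topology (top_of_set (cimg c)) (top_of_set F))
      (\<lambda>(x, y). (cmap c x, id y)) (\<lambda>(x, y). (g x, id y))"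
    by (intro homeomorphic_maps_prod[THEN iffD2] disjI2 conjI g) (simp add: homeomorphic_maps_def id_def)
  moreover have "prod_topology (subtopology X (cdom c)) (top_of_set F) = subtopology (prod_topology X (top_of_set F)) (cdom c \<times> F)"
    by (simp add: subtopology_Times subtopology_subtopology)
  moreover have "prod_topology (top_of_set (cimg c)) (top_of_set F) = top_of_set (cimg c \<times> F)"
    by simp
  moreover have "(\<lambda>(x, y). (cmap c x, id y)) = cmap (prod_coord F c)" by (auto simp: fun_eq_iff)
  ultimately have "homeomorphic_map (subtopology (prod_topology X (top_of_set F)) (cdom c \<times> F)) (top_of_set (cimg c \<times> F)) (cmap (prod_coord F c))"
    using homeomorphic_map_maps by metis
  moreover have "relopen (cmodel c \<times> F) (cimg c \<times> F)"
    using relopen_Times[OF coord_okD(1)[OF is_coord_ok[OF c]] relopen_self[OF F]] .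
  ultimately show ?thesis using oc by (simp add: is_coord_def relopen_def openin_prod_Times_iff)
qed

lemma max_atlas_prod:
  assumes M: "smooth_manifold n M" and P: "smooth_manifold l (prod_space M F)" and F: "subspace F" and c: "c \<in> max_atlas M"
  shows "prod_coord F c \<in> max_atlas (prod_space M F)"
proof -
  have c': "is_coord (mtop M) c" "c \<in> amax M" using c max_atlas_iff[OF M] by auto
  have "is_coord (mtop (prod_space M F)) (prod_coord F c)"
    using is_coord_prod[OF c'(1) F] by (simp add: prod_space_def)
  then show ?thesis using amax_prod[OF smooth_manifold_amfd[OF M] F c'(2)] max_atlas_iff[OF P] by simp
qed

text \<open>A coordinate followed by a diffeomorphism \<Theta> of open parts of model spaces, with
  inverse \<Xi>, is again a coordinate. It is meant for straightening the fibre action.\<close>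

lemma max_atlas_change:
  fixes e :: "('x, 'a::euclidean_space) coord"
  assumes P: "smooth_manifold n P" and e: "e \<in> max_atlas P"
    and S: "relopen (cmodel e) S" "S \<subseteq> cimg e" and S': "relopen W S'"
    and \<Theta>: "smooth_on (cmodel e) S \<Theta>" "\<And>y. y \<in> S \<Longrightarrow> \<Theta> y \<in> S'" "\<And>y. y \<in> S \<Longrightarrow> \<Xi> (\<Theta> y) = y"
    and \<Xi>: "smooth_on W S' \<Xi>" "\<And>y. y \<in> S' \<Longrightarrow> \<Xi> y \<in> S" "\<And>y. y \<in> S' \<Longrightarrow> \<Theta> (\<Xi> y) = y"
  shows "Coord {x \<in> cdom e. cmap e x \<in> S} (\<lambda>x. \<Theta> (cmap e x)) W \<in> max_atlas P"
proof -
  let ?D = "{x \<in> cdom e. cmap e x \<in> S}"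
  let ?C = "Coord ?D (\<lambda>x. \<Theta> (cmap e x)) W"
  have ie: "is_coord (mtop P) e" "e \<in> amax P" using e max_atlas_iff[OF P] by auto
  note oke = is_coord_ok[OF ie(1)]
  have oc: "openin (mtop P) (cdom e)" and he: "homeomorphic_map (subtopology (mtop P) (cdom e)) (top_of_set (cimg e)) (cmap e)"
    using ie(1) by (auto simp: is_coord_def)
  have im: "cmap e ` ?D = S" using S(2) by auto
  have SS': "\<Theta> ` S = S'" using \<Theta>(2) \<Xi>(2,3) by force
  have imC: "cimg ?C = S'" using im SS' by (simp add: image_image[symmetric])
  have tope: "topspace (subtopology (mtop P) (cdom e)) = cdom e" using openin_subset[OF oc] by auto
  have oD: "openin (mtop P) ?D"
  proof -
    have "openin (top_of_set (cimg e)) S" using S coord_okD(1)[OF oke]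
      by (metis openin_subset_trans relopen_def relopen_subset)
    from openin_continuous_map_preimage[OF homeomorphic_imp_continuous_map[OF he] this]
    have "openin (subtopology (mtop P) (cdom e)) ?D" unfolding tope .
    then show ?thesis using oc by (simp add: openin_open_subtopology)
  qed
  have h1: "homeomorphic_map (subtopology (mtop P) ?D) (top_of_set S) (cmap e)"
  proof -
    have "homeomorphic_map (subtopology (subtopology (mtop P) (cdom e)) ?D) (subtopology (top_of_set (cimg e)) S) (cmap e)"
      by (rule homeomorphic_map_subtopologies[OF he]) (use tope im S(2) in auto)
    moreover have "cdom e \<inter> ?D = ?D" "cimg e \<inter> S = S" using S(2) by auto
    ultimately show ?thesis by (simp add: subtopology_subtopology)
  qed
  have h2: "homeomorphic_map (top_of_set S) (top_of_set S') \<Theta>"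
    unfolding homeomorphic_map_maps homeomorphic_maps_def
    by (rule exI[of _ \<Xi>])
       (use \<Theta> \<Xi> in \<open>auto intro: smooth_on_continuous simp: continuous_map_in_subtopology\<close>)
  have hC: "homeomorphic_map (subtopology (mtop P) ?D) (top_of_set S') (\<lambda>x. \<Theta> (cmap e x))"
    using homeomorphic_map_compose[OF h1 h2] by (simp add: o_def)
  have iC: "is_coord (mtop P) ?C"
    unfolding is_coord_def imC using oD hC S' by (simp add: relopen_def)
  note okC = is_coord_ok[OF iC]
  have Ce: "smooth_between (\<lambda>x. x) ?C e"
  proof (rule smooth_betweenI[OF okC _ _ , of S' _ _ \<Xi>])
    show "S' = rep_dom (\<lambda>x. x) ?C e" using imC by (auto simp: rep_dom_def)
  qed (use S' \<Xi>(1) \<Theta>(3) in auto)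
  have eC: "smooth_between (\<lambda>x. x) e ?C"
  proof (rule smooth_betweenI[OF oke S(1) _ \<Theta>(1)])
    show "S = rep_dom (\<lambda>x. x) e ?C" using im by (auto simp: rep_dom_def)
  qed auto
  have "?C \<in> amax P" unfolding amax_def
  proof (intro CollectI conjI ballI)
    show "cdom ?C \<subseteq> mpts P" using openin_subset[OF oD] by simp
    fix c' assume c': "c' \<in> matlas P"
    note okc' = amfdD(1)[OF smooth_manifold_amfd[OF P] c']
    \<comment> \<open>Transitions between the new coordinate and the atlas factor through e, to
      which it is related by \<Theta> and \<Xi>.\<close>
    show "smooth_between (\<lambda>x. x) ?C c'"
      by (rule smooth_between_compose[of ?C "{e}" "\<lambda>x. x" "\<lambda>x. x" c'])
         (use okC oke Ce amaxD(3)[OF ie(2) c'] in auto)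
    show "smooth_between (\<lambda>x. x) c' ?C"
      by (rule smooth_between_compose[of c' "{e}" "\<lambda>x. x" "\<lambda>x. x" ?C])
         (use okc' oke eC amaxD(4)[OF ie(2) c'] in auto)
  qed (rule okC)
  then show ?thesis using iC max_atlas_iff[OF P] by simp
qed

lemma sliced_submanifold:
  assumes M: "smooth_manifold n M" and A: "A \<subseteq> mpts M"
    and cov: "\<And>x. x \<in> A \<Longrightarrow> \<exists>c W. c \<in> max_atlas M \<and> x \<in> cdom c \<and> subspace W \<and> W \<subseteq> cmodel c \<and>
       cmap c ` (cdom c \<inter> A) = cimg c \<inter> W"
  shows "sliced M A (submanifold M A)"
  unfolding sliced_def
proof (intro conjI ballI)
  show "mpts (submanifold M A) = A" using A by (auto simp: submanifold_def)
  show "A = (\<Union>c\<in>matlas (submanifold M A). cdom c)"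
  proof
    show "A \<subseteq> (\<Union>c\<in>matlas (submanifold M A). cdom c)"
    proof
      fix x assume x: "x \<in> A"
      then obtain c W where c: "c \<in> max_atlas M" "x \<in> cdom c" "subspace W" "W \<subseteq> cmodel c" "cmap c ` (cdom c \<inter> A) = cimg c \<inter> W"
        using cov by blast
      then have "Coord (cdom c \<inter> A) (cmap c) W \<in> matlas (submanifold M A)" unfolding submanifold_def by auto
      then show "x \<in> (\<Union>c\<in>matlas (submanifold M A). cdom c)" by (rule UN_I) (use x c(2) in simp)
    qed
  qed (auto simp: submanifold_def)
  fix c assume "c \<in> matlas (submanifold M A)"
  then obtain e W where e: "c = Coord (cdom e \<inter> A) (cmap e) W" "e \<in> max_atlas M" "subspace W" "W \<subseteq> cmodel e"
    "cmap e ` (cdom e \<inter> A) = cimg e \<inter> W" unfolding submanifold_def by auto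
  then show "slice_of M A c" unfolding slice_of_def
    using max_atlas_iff[OF M] by (intro bexI[of _ e]) auto
qed (rule A)

section \<open>Fixed-point sets\<close>

lemma linear_map_on_compose:
  assumes "linear_map_on U V f" "linear_map_on V W g"
  shows "linear_map_on U W (\<lambda>v. g (f v))"
proof -
  have f: "f ` U \<subseteq> V" "\<And>u v a b. u \<in> U \<Longrightarrow> v \<in> U \<Longrightarrow> f (a *\<^sub>R u + b *\<^sub>R v) = a *\<^sub>R f u + b *\<^sub>R f v"
    and g: "g ` V \<subseteq> W" "\<And>u v a b. u \<in> V \<Longrightarrow> v \<in> V \<Longrightarrow> g (a *\<^sub>R u + b *\<^sub>R v) = a *\<^sub>R g u + b *\<^sub>R g v"
    using assms by (auto simp: linear_map_on_def)
  show ?thesis unfolding linear_map_on_def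
  proof (intro conjI ballI allI)
    fix u v a b assume "u \<in> U" "v \<in> U"
    then show "g (f (a *\<^sub>R u + b *\<^sub>R v)) = a *\<^sub>R g (f u) + b *\<^sub>R g (f v)"
      using f(1) by (simp add: f(2) g(2) image_subset_iff)
  qed (use f(1) g(1) in auto)
qed

text \<open>L is linear on F only; the basis expansion extends it to a linear map of the ambient
  space, to which the count of dimensions applies.\<close>

lemma linear_map_on_inj_surj:
  fixes L :: "'f::euclidean_space \<Rightarrow> 'f"
  assumes F: "subspace F" and L: "linear_map_on F F L" and inj: "inj_on L F"
  shows "L ` F = F"
proof -
  define L' where "L' v = (\<Sum>b\<in>onb F. (v \<bullet> b) *\<^sub>R L b)" for v
  have "bounded_linear L'" unfolding L'_def
    by (intro bounded_linear_sum bounded_linear_compose[OF bounded_linear_scaleR_left] bounded_linear_inner_left)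
  then have lin: "linear L'" by (rule bounded_linear.linear)
  have eq: "L' v = L v" if "v \<in> F" for v using linear_map_on_expand[OF L F that] by (simp add: L'_def)
  have im: "L' ` F = L ` F" using eq by auto
  have "dim (L' ` F) = dim F"
    by (rule dim_image_eq[OF lin]) (use inj eq F in \<open>simp add: span_eq_iff[THEN iffD2] inj_on_def\<close>)
  then have "L' ` F = F"
    using L im F lin by (intro subspace_dim_equal linear_subspace_image) (auto simp: linear_map_on_def)
  then show ?thesis using im by simp
qed

lemma smooth_on_linear_map_on:
  fixes L :: "'f::euclidean_space \<Rightarrow> 'g::real_normed_vector"
  assumes F: "subspace F" and L: "linear_map_on F G L" and f: "smooth_on W S f" "f ` S \<subseteq> F"
  shows "smooth_on W S (\<lambda>y. L (f y))"
proof -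
  have "bounded_linear (\<lambda>v. \<Sum>b\<in>onb F. (v \<bullet> b) *\<^sub>R L b)"
    by (intro bounded_linear_sum bounded_linear_compose[OF bounded_linear_scaleR_left] bounded_linear_inner_left)
  then have "smooth_on W S (\<lambda>y. \<Sum>b\<in>onb F. (f y \<bullet> b) *\<^sub>R L b)" using f(1) by (rule smooth_on_bounded_linear_comp)
  moreover have "L (f y) = (\<Sum>b\<in>onb F. (f y \<bullet> b) *\<^sub>R L b)" if "y \<in> S" for y
    using linear_map_on_expand[OF L F] f(2) that by blast
  ultimately show ?thesis using smooth_on_cong[of S "\<lambda>y. L (f y)" "\<lambda>y. \<Sum>b\<in>onb F. (f y \<bullet> b) *\<^sub>R L b" W] by simp
qed

lemma orbifold_vector_bundleD:
  assumes "orbifold_vector_bundle n k Q B" "i \<in> charts Q"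
  shows "subspace (fibre B)" "orbifold_chart (n + k) (total_space Q B) i"
    "g \<in> carrier (cgrp Q i) \<Longrightarrow> x \<in> cpts Q i \<Longrightarrow> v \<in> fibre B \<Longrightarrow> fst (eact B i g (x, v)) = cact Q i g x"
    "g \<in> carrier (cgrp Q i) \<Longrightarrow> x \<in> cpts Q i \<Longrightarrow> linear_map_on (fibre B) (fibre B) (\<lambda>v. snd (eact B i g (x, v)))"
    "j \<in> charts Q \<Longrightarrow> a \<in> injs Q i j \<Longrightarrow> x \<in> cpts Q i \<Longrightarrow> linear_map_on (fibre B) (fibre B) (btrans B i j a x)"
  using assms unfolding orbifold_vector_bundle_def by blast+

text \<open>In the coordinate that identifies g with A, being fixed by g means lying in the
  eigenspace of A for the eigenvalue 1.\<close>

lemma fixed_pts_coord_image: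
  assumes G: "group_action (cgrp D i) (cpts D i) (cact D i)" "g \<in> carrier (cgrp D i)" and c: "coord_ok c" "cdom c = cpts D i"
    and A: "orthogonal_transformation A" "\<And>z. z \<in> cpts D i \<Longrightarrow> cmap c (cact D i g z) = A (cmap c z)"
  defines "W \<equiv> {y \<in> cmodel c. A y = y}"
  shows "subspace W" "W \<subseteq> cmodel c" "x \<in> cpts D i \<Longrightarrow> x \<in> fixed_pts D i g \<longleftrightarrow> cmap c x \<in> W"
proof -
  have lin: "linear A" using A(1) by (rule orthogonal_transformation_linear)
  show "subspace W" using coord_okD(2)[OF c(1)]
    by (auto simp: W_def subspace_def linear_0[OF lin] linear_add[OF lin] linear_scale[OF lin])
  show "W \<subseteq> cmodel c" by (auto simp: W_def)
  assume x: "x \<in> cpts D i"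
  have gx: "cact D i g x \<in> cpts D i" using group_action.element_image[OF G(1,2) x] by simp
  have "cmap c x \<in> cmodel c" using relopen_in[OF coord_okD(1)[OF c(1)]] x c(2) by auto
  moreover have "cact D i g x = x \<longleftrightarrow> A (cmap c x) = cmap c x"
    using A(2)[OF x] coord_okD(3)[OF c(1)] x gx c(2) by metis
  ultimately show "x \<in> fixed_pts D i g \<longleftrightarrow> cmap c x \<in> W" using x by (auto simp: fixed_pts_def W_def)
qed

lemma coord_image_Int:
  assumes "coord_ok c" "\<And>x. x \<in> cdom c \<Longrightarrow> x \<in> A \<longleftrightarrow> cmap c x \<in> W"
  shows "cmap c ` (cdom c \<inter> A) = cimg c \<inter> W"
  using assms(2) by auto

text \<open>
  Averaging over the powers of \<open>g\<close> gives fibre coordinates near \<open>x\<^sub>0\<close> in which \<open>g\<close> acts on the fibres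
  over its fixed points by a constant linear map, so that its fixed-point set becomes a linear subspace.
\<close>

lemma bundle_fixed_pts_slice:
  assumes Q: "orbifold_chart n Q i" and B: "orbifold_vector_bundle n k Q B" and i: "i \<in> charts Q"
    and g: "g \<in> carrier (cgrp Q i)"
    and c: "c \<in> max_atlas (cmfd Q i)" "cdom c = cpts Q i"
    and A: "orthogonal_transformation A" "\<And>z. z \<in> cpts Q i \<Longrightarrow> cmap c (cact Q i g z) = A (cmap c z)"
    and p: "(x\<^sub>0, v\<^sub>0) \<in> fixed_pts (total_space Q B) i g"
  shows "\<exists>C W. C \<in> max_atlas (prod_space (cmfd Q i) (fibre B)) \<and> (x\<^sub>0, v\<^sub>0) \<in> cdom C \<and> subspace W \<and> W \<subseteq> cmodel C \<and>
    cmap C ` (cdom C \<inter> fixed_pts (total_space Q B) i g) = cimg C \<inter> W"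
proof -
  let ?M = "cmfd Q i" and ?F = "fibre B" and ?G = "cgrp Q i" and ?V = "cpts Q i"
  let ?P = "prod_space ?M ?F"
  note bd = orbifold_vector_bundleD[OF B i]
  note F = bd(1)
  have M: "smooth_manifold n ?M" and V: "group_action ?G ?V (cact Q i)" and fin: "finite (carrier ?G)"
    using Q unfolding orbifold_chart_def by blast+
  have P: "smooth_manifold (n + k) ?P" and VF: "group_action ?G (?V \<times> ?F) (eact B i)"
    and sact: "\<And>h. h \<in> carrier ?G \<Longrightarrow> smooth_map_on ?P (mpts ?P) ?P (eact B i h)"
    using bd(2) unfolding orbifold_chart_def total_space_simps mpts_prod_space by blast+
  interpret V: group_action ?G ?V "cact Q i" by (rule V)
  interpret VF: group_action ?G "?V \<times> ?F" "eact B i" by (rule VF)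
  interpret group ?G by (rule V.group_hom[THEN group_hom.axioms(1)])
  have ic: "is_coord (mtop ?M) c" "c \<in> amax ?M" using c(1) max_atlas_iff[OF M] by auto
  note okc = is_coord_ok[OF ic(1)]
  define X where "X = cmodel c"
  define S where "S = cimg c"
  have XS: "relopen X S" using coord_okD(1)[OF okc] by (simp add: X_def S_def)
  define \<beta> where "\<beta> h x v = snd (eact B i h (x, v))" for h x v
  have act: "eact B i h (x, v) = (cact Q i h x, \<beta> h x v)" if "h \<in> carrier ?G" "x \<in> ?V" "v \<in> ?F" for h x v
    using bd(3)[OF that] by (simp add: \<beta>_def prod_eq_iff)
  have \<beta>lin: "linear_map_on ?F ?F (\<beta> h x)" if "h \<in> carrier ?G" "x \<in> ?V" for h x
    using bd(4)[OF that] by (simp add: \<beta>_def[abs_def])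
  have \<beta>F: "\<beta> h x v \<in> ?F" if "h \<in> carrier ?G" "x \<in> ?V" "v \<in> ?F" for h x v
    using linear_map_on_in[OF \<beta>lin[OF that(1,2)] that(3)] .
  \<comment> \<open>The fibre parts of the action form a cocycle over the action on the base; they
    compose like group elements only where the base point is fixed.\<close>
  have comp: "\<beta> (h \<otimes>\<^bsub>?G\<^esub> h') x v = \<beta> h (cact Q i h' x) (\<beta> h' x v)" if "h \<in> carrier ?G" "h' \<in> carrier ?G" "x \<in> ?V" "v \<in> ?F" for h h' x v
  proof -
    have "eact B i (h \<otimes>\<^bsub>?G\<^esub> h') (x, v) = eact B i h (cact Q i h' x, \<beta> h' x v)"
      unfolding act[OF that(2-4), symmetric] by (rule VF.composition_rule) (use that in auto)
    then show ?thesis unfolding \<beta>_def[of "h \<otimes>\<^bsub>?G\<^esub> h'" x v] \<beta>_def[of h "cact Q i h' x" "\<beta> h' x v"] by simp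
  qed
  have \<beta>1: "\<beta> \<one>\<^bsub>?G\<^esub> x v = v" if "x \<in> ?V" "v \<in> ?F" for x v
    using VF.id_eq_one that by (metis SigmaI \<beta>_def restrict_apply' snd_conv)
  have x0: "x\<^sub>0 \<in> ?V" "v\<^sub>0 \<in> ?F" and gp: "eact B i g (x\<^sub>0, v\<^sub>0) = (x\<^sub>0, v\<^sub>0)" using p by (auto simp: fixed_pts_def)
  have gx0: "cact Q i g x\<^sub>0 = x\<^sub>0" using gp act[OF g x0] by simp
  define \<gamma> where "\<gamma> j = g [^]\<^bsub>?G\<^esub> (j::nat)" for j
  have \<gamma>c: "\<gamma> j \<in> carrier ?G" "inv\<^bsub>?G\<^esub> (\<gamma> j) \<in> carrier ?G" for j using g by (auto simp: \<gamma>_def)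
  have \<gamma>Suc: "\<gamma> (Suc j) = \<gamma> j \<otimes>\<^bsub>?G\<^esub> g" for j by (simp add: \<gamma>_def)
  \<comment> \<open>The order of the group in place of that of g: all that matters is that the
    powers of g return to the identity after m steps.\<close>
  define m where "m = order ?G"
  have m: "m > 0" using fin order_gt_0_iff_finite by (simp add: m_def)
  have \<gamma>0: "\<gamma> 0 = \<one>\<^bsub>?G\<^esub>" and \<gamma>m: "\<gamma> m = \<one>\<^bsub>?G\<^esub>" using pow_order_eq_1[OF g] by (auto simp: \<gamma>_def m_def)
  have \<gamma>x0: "cact Q i (\<gamma> j) x\<^sub>0 = x\<^sub>0" for j
  proof (induction j)
    case 0 then show ?case using V.id_eq_one x0 by (metis \<gamma>0 restrict_apply')
  next
    case (Suc j)
    then show ?case using V.composition_rule[OF x0(1) \<gamma>c(1) g, of j] gx0 by (simp add: \<gamma>Suc)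
  qed
  have i\<gamma>x0: "cact Q i (inv\<^bsub>?G\<^esub> (\<gamma> j)) x\<^sub>0 = x\<^sub>0" for j
    using V.orbit_sym_aux[OF \<gamma>c(1) x0(1) \<gamma>x0] .
  \<comment> \<open>Each summand goes from the fibre over x by a power of g and returns by the
    inverse power taken at \<open>x\<^sub>0\<close>. The sum is not divided by m, so at
    \<open>x\<^sub>0\<close> it is m times the identity.\<close>
  define T where "T x v = (\<Sum>j<m. \<beta> (inv\<^bsub>?G\<^esub> (\<gamma> j)) x\<^sub>0 (\<beta> (\<gamma> j) x v))" for x v
  have Tterm: "linear_map_on ?F ?F (\<lambda>v. \<beta> (inv\<^bsub>?G\<^esub> (\<gamma> j)) x\<^sub>0 (\<beta> (\<gamma> j) x v))" if x: "x \<in> ?V" for x j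
    by (rule linear_map_on_compose[OF \<beta>lin[OF \<gamma>c(1) x] \<beta>lin[OF \<gamma>c(2) x0(1)]])
  have Tlin: "linear_map_on ?F ?F (T x)" if x: "x \<in> ?V" for x
    unfolding linear_map_on_def
  proof (intro conjI ballI allI)
    show "T x ` ?F \<subseteq> ?F" unfolding T_def using linear_map_on_in[OF Tterm[OF x]] by (auto intro: subspace_sum[OF F])
    fix u v a b assume "u \<in> ?F" "v \<in> ?F"
    then show "T x (a *\<^sub>R u + b *\<^sub>R v) = a *\<^sub>R T x u + b *\<^sub>R T x v"
      using Tterm[OF x] by (simp only: T_def scaleR_sum_right sum.distrib[symmetric]) (simp add: linear_map_on_def)
  qed
  have Tx0: "T x\<^sub>0 v = real m *\<^sub>R v" if v: "v \<in> ?F" for v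
  proof -
    have "\<beta> (inv\<^bsub>?G\<^esub> (\<gamma> j)) x\<^sub>0 (\<beta> (\<gamma> j) x\<^sub>0 v) = v" for j
      using comp[OF \<gamma>c(2,1) x0(1) v, of j j] \<gamma>x0[of j] \<gamma>c(1)[of j] \<beta>1[OF x0(1) v] by simp
    then show ?thesis by (simp add: T_def sum_constant_scaleR)
  qed
  \<comment> \<open>Over a fixed point x of g, replacing v by its image under g raises the power of
    g by one in each summand. The summation over a full cycle absorbs the shift and leaves a factor
    g acting at \<open>x\<^sub>0\<close>.\<close>
  have equiv: "T x (\<beta> g x v) = \<beta> g x\<^sub>0 (T x v)" if x: "x \<in> ?V" and fx: "cact Q i g x = x" and v: "v \<in> ?F" for x v
  proof -
    define b where "b j = \<beta> (g \<otimes>\<^bsub>?G\<^esub> inv\<^bsub>?G\<^esub> (\<gamma> j)) x\<^sub>0 (\<beta> (\<gamma> j) x v)" for j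
    have "\<beta> (\<gamma> j) x (\<beta> g x v) = \<beta> (\<gamma> (Suc j)) x v" for j
      using comp[OF \<gamma>c(1) g x v, of j] fx by (simp add: \<gamma>Suc)
    moreover have "g \<otimes>\<^bsub>?G\<^esub> inv\<^bsub>?G\<^esub> (\<gamma> (Suc j)) = inv\<^bsub>?G\<^esub> (\<gamma> j)" for j
      using g \<gamma>c[of j] by (simp add: \<gamma>Suc inv_mult_group m_assoc[symmetric])
    ultimately have "T x (\<beta> g x v) = (\<Sum>j<m. b (Suc j))" by (simp add: T_def b_def)
    also have "\<dots> = (\<Sum>j<m. b j)"
    proof -
      have "b m = b 0" by (simp add: b_def \<gamma>0 \<gamma>m)
      then show ?thesis using sum.lessThan_Suc_shift[of b m] sum.lessThan_Suc[of b m] by simp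
    qed
    also have "\<dots> = (\<Sum>j<m. \<beta> g x\<^sub>0 (\<beta> (inv\<^bsub>?G\<^esub> (\<gamma> j)) x\<^sub>0 (\<beta> (\<gamma> j) x v)))"
      unfolding b_def using comp[OF g \<gamma>c(2) x0(1) \<beta>F[OF \<gamma>c(1) x v]] i\<gamma>x0 by simp
    also have "\<dots> = \<beta> g x\<^sub>0 (T x v)" unfolding T_def
      by (rule linear_map_on_sum[OF \<beta>lin[OF g x0(1)] F, symmetric]) (use linear_map_on_in[OF Tterm[OF x]] v in auto)
    finally show ?thesis .
  qed
  define T' where "T' y = T (cinv c y)" for y
  have cV: "cinv c y \<in> ?V" if "y \<in> S" for y using coord_okD(4)[OF okc] that c(2) by (simp add: S_def)
  have T'lin: "linear_map_on ?F ?F (T' y)" if "y \<in> S" for y unfolding T'_def by (rule Tlin[OF cV[OF that]])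
  note Pa = smooth_manifold_amfd[OF P]
  note pc = amax_prod[OF smooth_manifold_amfd[OF M] F ic(2)]
  \<comment> \<open>The inner factor of each summand is the fibre component of the action in product
    coordinates; the outer one is a linear map independent of x.\<close>
  have sT': "smooth_on (X \<times> ?F) (S \<times> ?F) (\<lambda>q. T' (fst q) (snd q))"
    unfolding T'_def T_def
  proof (rule smooth_on_sum)
    fix j
    let ?c = "prod_coord ?F c"
    have "smooth_between (eact B i (\<gamma> j)) ?c ?c"
      by (rule amax_smooth_between[OF Pa Pa smooth_map_on_asmooth[OF P P sact[OF \<gamma>c(1)]] pc pc])
    moreover have "rep_dom (eact B i (\<gamma> j)) ?c ?c = S \<times> ?F"
    proof -
      have "{q \<in> cdom ?c. eact B i (\<gamma> j) q \<in> cdom ?c} = ?V \<times> ?F"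
      proof -
        have "eact B i (\<gamma> j) q \<in> ?V \<times> ?F" if "q \<in> ?V \<times> ?F" for q
          by (rule VF.element_image[OF \<gamma>c(1) that refl])
        then show ?thesis by (simp add: c(2)) blast
      qed
      then show ?thesis by (simp add: rep_dom_def S_def c(2))
    qed
    ultimately have "smooth_on (X \<times> ?F) (S \<times> ?F) (local_rep (eact B i (\<gamma> j)) ?c ?c)"
      unfolding smooth_between_def by (simp add: X_def)
    then have sl: "smooth_on (X \<times> ?F) (S \<times> ?F) (\<lambda>q. snd (local_rep (eact B i (\<gamma> j)) ?c ?c q))" by (rule smooth_on_snd)
    have eq: "snd (local_rep (eact B i (\<gamma> j)) ?c ?c q) = \<beta> (\<gamma> j) (cinv c (fst q)) (snd q)" if qS: "q \<in> S \<times> ?F" for q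
    proof -
      obtain x v where q: "q = cmap ?c (x, v)" "x \<in> cdom c" "v \<in> ?F" using qS by (force simp: S_def cmap_prod_coord)
      have "local_rep (eact B i (\<gamma> j)) ?c ?c q = cmap ?c (eact B i (\<gamma> j) (x, v))"
        unfolding q(1) by (rule local_rep_cmap[OF amaxD(1)[OF pc]]) (use q in simp)
      moreover have "cinv c (fst q) = x" "snd q = v" using coord_okD(3)[OF okc q(2)] by (simp_all add: q(1))
      ultimately show ?thesis by (simp only: cmap_prod_coord snd_conv \<beta>_def)
    qed
    have sm: "smooth_on (X \<times> ?F) (S \<times> ?F) (\<lambda>q. \<beta> (\<gamma> j) (cinv c (fst q)) (snd q))"
      by (rule iffD1[OF smooth_on_cong[OF eq] sl])
    show "smooth_on (X \<times> ?F) (S \<times> ?F) (\<lambda>q. \<beta> (inv\<^bsub>?G\<^esub> (\<gamma> j)) x\<^sub>0 (\<beta> (\<gamma> j) (cinv c (fst q)) (snd q)))"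
      by (rule smooth_on_linear_map_on[OF F \<beta>lin[OF \<gamma>c(2) x0(1)] sm]) (use \<beta>F[OF \<gamma>c(1) cV] in auto)
  qed
  have y0: "cmap c x\<^sub>0 \<in> S" using x0 c(2) by (simp add: S_def)
  have cx: "cinv c (cmap c x) = x" if "x \<in> ?V" for x using coord_okD(3)[OF okc] that c(2) by simp
  have inj0: "inj_on (T' (cmap c x\<^sub>0)) ?F"
    using m by (auto simp: inj_on_def T'_def cx[OF x0(1)] Tx0)
  have cT': "continuous_on S (\<lambda>z. T' z v)" if "v \<in> ?F" for v
    by (rule continuous_on_compose2[OF smooth_on_continuous[OF sT'], of S "\<lambda>z. (z, v)", simplified])
       (use that in \<open>auto intro!: continuous_intros\<close>)
  \<comment> \<open>T is invertible at \<open>x\<^sub>0\<close>, hence injective with a uniform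
    bound on a neighbourhood U, and there bijective on the fibre by dimension.\<close>
  obtain U \<kappa> where U: "\<kappa> > 0" "relopen X U" "cmap c x\<^sub>0 \<in> U" "U \<subseteq> S"
    "\<And>z v. z \<in> U \<Longrightarrow> v \<in> ?F \<Longrightarrow> \<kappa> * norm v \<le> norm (T' z v)"
    using linear_family_lower_bound[OF XS F y0 T'lin cT' inj0] by metis
  have injU: "inj_on (T' z) ?F" if z: "z \<in> U" for z
  proof (rule inj_onI)
    fix u v assume uv: "u \<in> ?F" "v \<in> ?F" "T' z u = T' z v"
    have "T' z (u - v) = 0" using linear_map_on_diff[OF T'lin uv(1,2)] uv(3) z U(4) by auto
    then have "\<kappa> * norm (u - v) \<le> 0" using U(5)[OF z subspace_diff[OF F uv(1,2)]] by simp
    then show "u = v" using U(1) by (simp add: mult_le_0_iff)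
  qed
  have surU: "T' z ` ?F = ?F" if z: "z \<in> U" for z
    by (rule linear_map_on_inj_surj[OF F T'lin injU[OF z]]) (use z U(4) in auto)
  define R where "R z w = inv_into ?F (T' z) w" for z w
  have R: "R z w \<in> ?F" "T' z (R z w) = w" "R z (T' z w) = w" if "z \<in> U" "w \<in> ?F" for z w
    using surU[OF that(1)] injU[OF that(1)] that(2) by (auto simp: R_def inv_into_into f_inv_into_f)
  have UF: "relopen (X \<times> ?F) (U \<times> ?F)" by (intro relopen_Times U relopen_self F)
  have sTU: "smooth_on (X \<times> ?F) (U \<times> ?F) (\<lambda>q. T' (fst q) (snd q))"
    by (rule smooth_on_subset[OF sT']) (use U(4) in auto)
  have sRU: "smooth_on (X \<times> ?F) (U \<times> ?F) (\<lambda>q. R (fst q) (snd q))"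
    by (rule smooth_on_inverse_family[OF U(2) F T'lin sTU R]) (use U(4) in auto)
  have sf: "smooth_on (X \<times> ?F) (U \<times> ?F) fst" by (rule smooth_on_bounded_linear[OF bounded_linear_fst])
  \<comment> \<open>The change of fibre coordinates by T, identical on the base;
    \<open>?\<Xi>\<close> is smooth by \<open>smooth_on_inverse_family\<close>.\<close>
  let ?\<Theta> = "\<lambda>q. (fst q, T' (fst q) (snd q))" and ?\<Xi> = "\<lambda>q. (fst q, R (fst q) (snd q))"
  define C where "C = Coord {q \<in> cdom (prod_coord ?F c). cmap (prod_coord ?F c) q \<in> U \<times> ?F} (\<lambda>q. ?\<Theta> (cmap (prod_coord ?F c) q)) (X \<times> ?F)"
  have C: "C \<in> max_atlas ?P" unfolding C_def
  proof (rule max_atlas_change[OF P max_atlas_prod[OF M P F c(1)], where S'="U \<times> ?F" and \<Xi>="?\<Xi>"])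
    show "smooth_on (cmodel (prod_coord ?F c)) (U \<times> ?F) ?\<Theta>" using smooth_on_Pair[OF sf sTU] by (simp add: X_def)
    show "smooth_on (X \<times> ?F) (U \<times> ?F) ?\<Xi>" by (rule smooth_on_Pair[OF sf sRU])
    show "relopen (cmodel (prod_coord ?F c)) (U \<times> ?F)" using UF by (simp add: X_def)
    show "U \<times> ?F \<subseteq> cimg (prod_coord ?F c)" using U(4) by (auto simp: S_def)
    show "?\<Theta> q \<in> U \<times> ?F" if "q \<in> U \<times> ?F" for q using that linear_map_on_in[OF T'lin] U(4) by auto
  qed (use UF R in auto)
  have cC: "cdom C = {q. fst q \<in> ?V \<and> cmap c (fst q) \<in> U \<and> snd q \<in> ?F}"
    by (auto simp: C_def c(2) cmap_prod_coord)
  have mC: "cmap C (x, v) = (cmap c x, T x v)" if "x \<in> ?V" for x v using cx[OF that] by (simp add: C_def T'_def)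
  note okC = is_coord_ok[OF conjunct1[OF iffD1[OF max_atlas_iff[OF P] C]]]
  note fc = fixed_pts_coord_image[OF V g okc c(2) A]
  define W where "W = {y \<in> cmodel c. A y = y} \<times> {v \<in> ?F. \<beta> g x\<^sub>0 v = v}"
  have subF: "subspace {v \<in> ?F. \<beta> g x\<^sub>0 v = v}"
    using F \<beta>lin[OF g x0(1)] by (auto simp: subspace_def linear_map_on_zero[OF _ F] linear_map_on_add linear_map_on_scale)
  have "cmap C ` (cdom C \<inter> fixed_pts (total_space Q B) i g) = cimg C \<inter> W"
  proof (rule coord_image_Int[OF okC])
    fix q assume q: "q \<in> cdom C"
    then obtain x v where qx: "q = (x, v)" "x \<in> ?V" "cmap c x \<in> U" "v \<in> ?F" using cC by (cases q) auto
    have xW: "x \<in> fixed_pts Q i g \<longleftrightarrow> cmap c x \<in> {y \<in> cmodel c. A y = y}" by (rule fc(3)[OF _ qx(2)])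
    have "q \<in> fixed_pts (total_space Q B) i g \<longleftrightarrow> x \<in> fixed_pts Q i g \<and> \<beta> g x v = v"
      using qx act[OF g qx(2,4)] by (auto simp: fixed_pts_def)
    \<comment> \<open>T intertwines the fibre actions only over fixed points of g. This suffices,
      since a fixed point of the bundle chart lies over a fixed point of the base.\<close>
    moreover have "\<beta> g x v = v \<longleftrightarrow> \<beta> g x\<^sub>0 (T x v) = T x v" if "x \<in> fixed_pts Q i g"
    proof -
      have "T x (\<beta> g x v) = \<beta> g x\<^sub>0 (T x v)" using equiv[OF qx(2) _ qx(4)] that by (simp add: fixed_pts_def)
      moreover have "inj_on (T x) ?F" using injU[OF qx(3)] by (simp add: T'_def cx[OF qx(2)])
      ultimately show ?thesis using qx(4) \<beta>F[OF g qx(2,4)] by (auto dest: inj_onD)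
    qed
    moreover have "T x v \<in> ?F" by (rule linear_map_on_in[OF Tlin[OF qx(2)] qx(4)])
    ultimately show "q \<in> fixed_pts (total_space Q B) i g \<longleftrightarrow> cmap C q \<in> W"
      using xW by (auto simp: qx(1) mC[OF qx(2)] W_def)
  qed
  moreover have "(x\<^sub>0, v\<^sub>0) \<in> cdom C" using x0 U(3) by (simp add: cC)
  moreover have "subspace W" unfolding W_def by (rule subspace_Times[OF fc(1) subF])
  moreover have "W \<subseteq> cmodel C" by (auto simp: W_def C_def X_def)
  ultimately show ?thesis using C by blast
qed

section \<open>Sectors\<close>

lemma orbifoldD:
  assumes "orbifold n D" "i \<in> charts D"
  shows "orbifold_chart n D i" "smooth_manifold n (cmfd D i)" "group_action (cgrp D i) (cpts D i) (cact D i)"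
    "g \<in> carrier (cgrp D i) \<Longrightarrow> asmooth (cmfd D i) (cmfd D i) (cact D i g)"
    "j \<in> charts D \<Longrightarrow> a \<in> injs D i j \<Longrightarrow> asmooth (cmfd D i) (cmfd D j) (fst a)"
    "j \<in> charts D \<Longrightarrow> a \<in> injs D i j \<Longrightarrow> g \<in> carrier (cgrp D i) \<Longrightarrow> x \<in> cpts D i \<Longrightarrow>
       fst a (cact D i g x) = cact D j (snd a g) (fst a x)"
proof -
  show oc: "orbifold_chart n D i" using assms unfolding orbifold_def by blast
  then show M: "smooth_manifold n (cmfd D i)" and "group_action (cgrp D i) (cpts D i) (cact D i)"
    unfolding orbifold_chart_def by blast+
  show "g \<in> carrier (cgrp D i) \<Longrightarrow> asmooth (cmfd D i) (cmfd D i) (cact D i g)"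
    using oc smooth_map_on_asmooth[OF M M] unfolding orbifold_chart_def by blast
  assume j: "j \<in> charts D" and a: "a \<in> injs D i j"
  have N: "smooth_manifold n (cmfd D j)" using assms(1) j unfolding orbifold_def orbifold_chart_def by blast
  have inj: "injection D i j a" using assms j a unfolding orbifold_def by blast
  show "asmooth (cmfd D i) (cmfd D j) (fst a)"
    using inj smooth_map_on_asmooth[OF M N] by (auto simp: injection_def smooth_open_embedding_def split: prod.splits)
  show "g \<in> carrier (cgrp D i) \<Longrightarrow> x \<in> cpts D i \<Longrightarrow> fst a (cact D i g x) = cact D j (snd a g) (fst a x)"
    using inj by (auto simp: injection_def split: prod.splits)
qed

lemma sector_sel [simp]:
  "charts (sector D t) = t"
  "cmfd (sector D t) (i, g) = submanifold (cmfd D i) (fixed_pts D i g)"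
  "cgrp (sector D t) (i, g) = (cgrp D i)\<lparr>carrier := centralizer (cgrp D i) g\<rparr>"
  "cact (sector D t) (i, g) h = restrict (cact D i h) (fixed_pts D i g)"
  by (simp_all add: sector_def)

text \<open>
  The maps of which the structure maps of a sector are the restrictions. The group action is among
  them, as conjugation by an element of the centralizer fixes \<open>g\<close>.
\<close>

definition ambient_maps ::
  "('i, 'x, 'a::euclidean_space, 'g, 'm) chart_system_scheme \<Rightarrow> 'i \<times> 'g \<Rightarrow> 'i \<times> 'g \<Rightarrow> ('x \<Rightarrow> 'x) set" where
  "ambient_maps D = (\<lambda>(i, g) (j, g'). {fst a | a. a \<in> injs D i j \<and> snd a g = g'} \<union>
     {cact D i h | h. i = j \<and> h \<in> carrier (cgrp D i) \<and> h \<otimes>\<^bsub>cgrp D i\<^esub> g \<otimes>\<^bsub>cgrp D i\<^esub> inv\<^bsub>cgrp D i\<^esub> h = g'})"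

lemma fst_image_Collect:
  "(\<And>a. F a = R (H a)) \<Longrightarrow> fst ` {(F a, G a) | a. P a} = R ` {H a | a. P a}"
  by force

lemma structure_maps_sector:
  assumes "group (cgrp D i)" "g \<in> carrier (cgrp D i)"
  shows "structure_maps (sector D t) (i, g) (j, g') = (\<lambda>\<sigma>. restrict \<sigma> (fixed_pts D i g)) ` ambient_maps D (i, g) (j, g')"
proof -
  interpret group "cgrp D i" by (rule assms(1))
  have cen: "h \<otimes>\<^bsub>cgrp D i\<^esub> g \<otimes>\<^bsub>cgrp D i\<^esub> inv\<^bsub>cgrp D i\<^esub> h = g" "h \<in> carrier (cgrp D i)" if "h \<in> centralizer (cgrp D i) g" for h
    using that assms(2) by (auto simp: centralizer_def m_assoc)
  have "fst ` injs (sector D t) (i, g) (j, g') = (\<lambda>\<sigma>. restrict \<sigma> (fixed_pts D i g)) ` ambient_maps D (i, g) (j, g')"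
    by (simp only: sector_def ambient_maps_def chart_system.select_convs prod.case image_Un
      fst_image_Collect[of "\<lambda>a. restrict (fst a) (fixed_pts D i g)" "\<lambda>\<sigma>. restrict \<sigma> (fixed_pts D i g)" fst, OF refl]
      fst_image_Collect[of "\<lambda>h. restrict (cact D i h) (fixed_pts D i g)" "\<lambda>\<sigma>. restrict \<sigma> (fixed_pts D i g)" "cact D i", OF refl])
  moreover have "{cact (sector D t) (i, g) h | h. (i, g) = (j, g') \<and> h \<in> carrier (cgrp (sector D t) (i, g))}
     \<subseteq> (\<lambda>\<sigma>. restrict \<sigma> (fixed_pts D i g)) ` ambient_maps D (i, g) (j, g')"
  proof clarify
    fix h assume h: "i = j" "g = g'" "h \<in> carrier (cgrp (sector D t) (j, g'))"
    then have hc: "h \<in> centralizer (cgrp D i) g" by simp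
    have "cact D i h \<in> ambient_maps D (i, g) (j, g')"
      unfolding ambient_maps_def prod.case using cen[OF hc] h(1,2) by blast
    then show "cact (sector D t) (j, g') h \<in> (\<lambda>\<sigma>. restrict \<sigma> (fixed_pts D j g')) ` ambient_maps D (j, g') (j, g')"
      using h(1,2) by simp
  qed
  ultimately show ?thesis unfolding structure_maps_def by blast
qed

text \<open>Injections satisfying \<theta>(g) = g' are equivariant for these two elements, and a
  group element h satisfies g' h = h g when g' is the conjugate of g by h. Either identity carries
  points fixed by g to points fixed by g'.\<close>

lemma ambient_maps_smooth:
  assumes D: "orbifold n D" and i: "i \<in> charts D" "j \<in> charts D" and g: "g \<in> carrier (cgrp D i)"
    and \<sigma>: "\<sigma> \<in> ambient_maps D (i, g) (j, g')"
  shows "asmooth (cmfd D i) (cmfd D j) \<sigma>" "\<sigma> ` fixed_pts D i g \<subseteq> fixed_pts D j g'"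
proof -
  interpret V: group_action "cgrp D i" "cpts D i" "cact D i" by (rule orbifoldD(3)[OF D i(1)])
  interpret group "cgrp D i" by (rule V.group_hom[THEN group_hom.axioms(1)])
  have "asmooth (cmfd D i) (cmfd D j) \<sigma> \<and> (\<forall>x\<in>fixed_pts D i g. cact D j g' (\<sigma> x) = \<sigma> x)"
  proof -
    consider (inj) a where "\<sigma> = fst a" "a \<in> injs D i j" "snd a g = g'"
      | (act) h where "\<sigma> = cact D i h" "i = j" "h \<in> carrier (cgrp D i)" "h \<otimes>\<^bsub>cgrp D i\<^esub> g \<otimes>\<^bsub>cgrp D i\<^esub> inv\<^bsub>cgrp D i\<^esub> h = g'"
      using \<sigma> unfolding ambient_maps_def by auto
    then show ?thesis
    proof cases
      case inj
      have "cact D j g' (\<sigma> x) = \<sigma> x" if "x \<in> fixed_pts D i g" for x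
        using orbifoldD(6)[OF D i inj(2) g, of x] that by (simp add: fixed_pts_def inj)
      then show ?thesis using orbifoldD(5)[OF D i inj(2)] inj(1) by simp
    next
      case act
      have "cact D j g' (\<sigma> x) = \<sigma> x" if x: "x \<in> cpts D i" "cact D i g x = x" for x
      proof -
        have g': "g' \<in> carrier (cgrp D i)" unfolding act(4)[symmetric] using act(3) g by simp
        have "cact D i g' (cact D i h x) = cact D i (g' \<otimes>\<^bsub>cgrp D i\<^esub> h) x"
          using V.composition_rule[OF x(1) g' act(3)] by simp
        also have "g' \<otimes>\<^bsub>cgrp D i\<^esub> h = h \<otimes>\<^bsub>cgrp D i\<^esub> g" unfolding act(4)[symmetric] using act(3) g by (simp add: m_assoc)
        also have "cact D i (h \<otimes>\<^bsub>cgrp D i\<^esub> g) x = cact D i h (cact D i g x)"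
          by (rule V.composition_rule[OF x(1) act(3) g])
        finally show ?thesis using act x by simp
      qed
      then show ?thesis using act orbifoldD(4)[OF D i(1) act(3)] by (auto simp: fixed_pts_def)
    qed
  qed
  then show "asmooth (cmfd D i) (cmfd D j) \<sigma>" "\<sigma> ` fixed_pts D i g \<subseteq> fixed_pts D j g'"
    using asmoothD(1) by (auto simp: fixed_pts_def)
qed

lemma smooth_system_sector:
  assumes D: "orbifold n D" and t: "\<And>i g. (i, g) \<in> t \<Longrightarrow> i \<in> charts D \<and> g \<in> carrier (cgrp D i)"
    and sl: "\<And>i g. (i, g) \<in> t \<Longrightarrow> sliced (cmfd D i) (fixed_pts D i g) (submanifold (cmfd D i) (fixed_pts D i g))"
  shows "smooth_system (sector D t)"
proof -
  have a: "amfd (cmfd D i)" if "i \<in> charts D" for i by (rule smooth_manifold_amfd[OF orbifoldD(2)[OF D that]])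
  have am: "amfd (submanifold (cmfd D i) (fixed_pts D i g))" if "(i, g) \<in> t" for i g
    using sliced_amfd[OF a sl[OF that]] t[OF that] by blast
  have "asmooth (cmfd (sector D t) (i, g)) (cmfd (sector D t) (j, g')) \<sigma>"
    if p: "(i, g) \<in> t" "(j, g') \<in> t" and \<sigma>: "\<sigma> \<in> structure_maps (sector D t) (i, g) (j, g')" for i g j g' \<sigma>
  proof -
    have i: "i \<in> charts D" "j \<in> charts D" and g: "g \<in> carrier (cgrp D i)" using t p by blast+
    have "group (cgrp D i)" using group_action.group_hom[OF orbifoldD(3)[OF D i(1)]] group_hom.axioms(1) by blast
    then obtain \<sigma>0 where \<sigma>0: "\<sigma>0 \<in> ambient_maps D (i, g) (j, g')" "\<sigma> = restrict \<sigma>0 (fixed_pts D i g)"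
      using \<sigma> structure_maps_sector[OF _ g] by auto
    note s = ambient_maps_smooth[OF D i g \<sigma>0(1)]
    have "asmooth (submanifold (cmfd D i) (fixed_pts D i g)) (submanifold (cmfd D j) (fixed_pts D j g')) \<sigma>0"
      by (rule sliced_asmooth[OF a[OF i(1)] a[OF i(2)] s(1) sl[OF p(1)] sl[OF p(2)] s(2)])
    then show ?thesis unfolding sector_sel
      by (rule asmooth_cong[OF _ am[OF p(1)]]) (auto simp: \<sigma>0(2) submanifold_def)
  qed
  then show ?thesis unfolding smooth_system_def using am by auto
qed

section \<open>Sectors of the total space over those of the base\<close>

context
  fixes Q :: "('i, 'x, 'a::euclidean_space, 'g, 'q) orbifold_data"
    and B :: "('i, 'x, 'g, 'q, 'f::euclidean_space, 'e) bundle_data"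
    and n k :: nat and t :: "('i \<times> 'g) set"
  assumes Q: "orbifold n Q" and B: "orbifold_vector_bundle n k Q B"
    and t: "t \<subseteq> point_elems Q"
begin

private abbreviation (input) E where "E \<equiv> total_space Q B"

lemma in_point_elems:
  assumes "(i, g) \<in> t"
  shows "i \<in> charts Q" "g \<in> carrier (cgrp Q i)" "\<exists>x. centre_of Q i x"
  using t assms unfolding point_elems_def by blast+

lemma orbifold_E: "orbifold (n + k) E"
  by (rule total_space_orbifold[OF Q B])

lemma amfd_Q: "i \<in> charts Q \<Longrightarrow> amfd (cmfd Q i)"
  by (rule smooth_manifold_amfd[OF orbifoldD(2)[OF Q]])

lemma fibre_subspace: "i \<in> charts Q \<Longrightarrow> subspace (fibre B)"
  using orbifold_vector_bundleD(1)[OF B] .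

lemma eact_eq:
  assumes "i \<in> charts Q" "g \<in> carrier (cgrp Q i)" "x \<in> cpts Q i" "v \<in> fibre B"
  shows "eact B i g (x, v) = (cact Q i g x, snd (eact B i g (x, v)))"
  using orbifold_vector_bundleD(3)[OF B assms] by (simp add: prod_eq_iff)

lemma fixed_pts_E:
  assumes "(i, g) \<in> t" "(x, v) \<in> fixed_pts E i g"
  shows "x \<in> fixed_pts Q i g" "v \<in> fibre B" "(x, s *\<^sub>R v) \<in> fixed_pts E i g"
proof -
  note ig = in_point_elems[OF assms(1)]
  have xv: "x \<in> cpts Q i" "v \<in> fibre B" "eact B i g (x, v) = (x, v)" using assms(2) by (auto simp: fixed_pts_def)
  then show "v \<in> fibre B" by simp
  show "x \<in> fixed_pts Q i g" using eact_eq[OF ig(1,2) xv(1,2)] xv by (auto simp: fixed_pts_def)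
  have sv: "s *\<^sub>R v \<in> fibre B" using fibre_subspace[OF ig(1)] xv by (auto intro: subspace_scale)
  have "snd (eact B i g (x, s *\<^sub>R v)) = s *\<^sub>R snd (eact B i g (x, v))"
    by (rule linear_map_on_scale[OF orbifold_vector_bundleD(4)[OF B ig(1,2) xv(1)] xv(2)])
  then show "(x, s *\<^sub>R v) \<in> fixed_pts E i g"
    using eact_eq[OF ig(1,2) xv(1) sv] eact_eq[OF ig(1,2) xv(1,2)] xv sv by (auto simp: fixed_pts_def)
qed

lemma zero_fixed_pts:
  assumes "(i, g) \<in> t" "x \<in> fixed_pts Q i g"
  shows "(x, 0) \<in> fixed_pts E i g"
proof -
  note ig = in_point_elems[OF assms(1)]
  have x: "x \<in> cpts Q i" "cact Q i g x = x" using assms(2) by (auto simp: fixed_pts_def)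
  note F = fibre_subspace[OF ig(1)]
  have "snd (eact B i g (x, 0)) = 0"
    by (rule linear_map_on_zero[OF orbifold_vector_bundleD(4)[OF B ig(1,2) x(1)] F])
  then show ?thesis using eact_eq[OF ig(1,2) x(1) subspace_0[OF F]] x subspace_0[OF F] by (auto simp: fixed_pts_def)
qed

lemma sliced_fixed_pts:
  assumes "(i, g) \<in> t"
  shows "sliced (cmfd Q i) (fixed_pts Q i g) (submanifold (cmfd Q i) (fixed_pts Q i g))"
    "sliced (cmfd E i) (fixed_pts E i g) (submanifold (cmfd E i) (fixed_pts E i g))"
proof -
  note ig = in_point_elems[OF assms]
  note M = orbifoldD(2)[OF Q ig(1)]
  have P: "smooth_manifold (n + k) (cmfd E i)" using orbifoldD(2)[OF orbifold_E, of i] ig by simp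
  \<comment> \<open>The linear coordinate at the centre is defined on the whole chart, so it serves
    at every fixed point and not at the centre alone.\<close>
  obtain x c where c: "c \<in> max_atlas (cmfd Q i)" "cdom c = cpts Q i"
    "\<forall>g\<in>carrier (cgrp Q i). \<exists>A. orthogonal_transformation A \<and> (\<forall>z\<in>cpts Q i. cmap c (cact Q i g z) = A (cmap c z))"
    using ig(3) unfolding centre_of_def by blast
  obtain A where A: "orthogonal_transformation A" "\<And>z. z \<in> cpts Q i \<Longrightarrow> cmap c (cact Q i g z) = A (cmap c z)"
    using c(3) ig(2) by blast
  have ok: "coord_ok c" using c(1) max_atlas_iff[OF M] is_coord_ok by blast
  note f = fixed_pts_coord_image[OF orbifoldD(3)[OF Q ig(1)] ig(2) ok c(2) A]
  show "sliced (cmfd Q i) (fixed_pts Q i g) (submanifold (cmfd Q i) (fixed_pts Q i g))"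
  proof (rule sliced_submanifold[OF M])
    have "cmap c ` (cdom c \<inter> fixed_pts Q i g) = cimg c \<inter> {y \<in> cmodel c. A y = y}"
      by (rule coord_image_Int[OF ok]) (use f(3) c(2) in auto)
    then show "\<exists>c W. c \<in> max_atlas (cmfd Q i) \<and> x \<in> cdom c \<and> subspace W \<and> W \<subseteq> cmodel c \<and>
       cmap c ` (cdom c \<inter> fixed_pts Q i g) = cimg c \<inter> W" if "x \<in> fixed_pts Q i g" for x
      using that c(1,2) f(1,2) by (intro exI[of _ c] exI[of _ "{y \<in> cmodel c. A y = y}"]) (auto simp: fixed_pts_def)
  qed (auto simp: fixed_pts_def)
  show "sliced (cmfd E i) (fixed_pts E i g) (submanifold (cmfd E i) (fixed_pts E i g))"
  proof (rule sliced_submanifold[OF P])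
    fix p assume p: "p \<in> fixed_pts E i g"
    then show "\<exists>C W. C \<in> max_atlas (cmfd E i) \<and> p \<in> cdom C \<and> subspace W \<and> W \<subseteq> cmodel C \<and>
       cmap C ` (cdom C \<inter> fixed_pts E i g) = cimg C \<inter> W"
      using bundle_fixed_pts_slice[OF orbifoldD(1)[OF Q ig(1)] B ig(1,2) c(1,2) A, of "fst p" "snd p"] by simp
  qed (auto simp: fixed_pts_def)
qed

lemma smooth_system_sectors: "smooth_system (sector Q t)" "smooth_system (sector E t)"
  using in_point_elems sliced_fixed_pts
  by (auto intro!: smooth_system_sector[OF Q] smooth_system_sector[OF orbifold_E])

text \<open>L depends on x but not on v, so \<open>\<sigma>'\<close> is linear on fibres over
  \<sigma>. Only fixed points matter, because the structure maps of sectors are restrictions to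
  them.\<close>

definition covers :: "'i \<times> 'g \<Rightarrow> ('x \<Rightarrow> 'x) \<Rightarrow> ('x \<times> 'f \<Rightarrow> 'x \<times> 'f) \<Rightarrow> bool" where
  "covers p \<sigma> \<sigma>' \<longleftrightarrow> (\<forall>x\<in>fixed_pts Q (fst p) (snd p). \<exists>L. linear_map_on (fibre B) (fibre B) L \<and>
     (\<forall>v. (x, v) \<in> fixed_pts E (fst p) (snd p) \<longrightarrow> \<sigma>' (x, v) = (\<sigma> x, L v)))"

lemma ambient_maps_covers:
  assumes p: "(i, g) \<in> t" "(j, g') \<in> t"
  shows "\<sigma> \<in> ambient_maps Q (i, g) (j, g') \<Longrightarrow> \<exists>\<sigma>'\<in>ambient_maps E (i, g) (j, g'). covers (i, g) \<sigma> \<sigma>'"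
    "\<sigma>' \<in> ambient_maps E (i, g) (j, g') \<Longrightarrow> \<exists>\<sigma>\<in>ambient_maps Q (i, g) (j, g'). covers (i, g) \<sigma> \<sigma>'"
proof -
  note ig = in_point_elems[OF p(1)] and jg = in_point_elems[OF p(2)]
  have covers_inj: "covers (i, g) (fst a) (fst (bundle_injection Q B i j a))" if a: "a \<in> injs Q i j" for a
    unfolding covers_def
    using orbifold_vector_bundleD(5)[OF B ig(1) jg(1) a]
    by (auto simp: fixed_pts_def bundle_injection_def)
  have covers_act: "covers (i, g) (cact Q i h) (eact B i h)" if h: "h \<in> carrier (cgrp Q i)" for h
    unfolding covers_def
  proof
    fix x assume "x \<in> fixed_pts Q (fst (i, g)) (snd (i, g))"
    then have x: "x \<in> cpts Q i" by (auto simp: fixed_pts_def)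
    show "\<exists>L. linear_map_on (fibre B) (fibre B) L \<and>
     (\<forall>v. (x, v) \<in> fixed_pts E (fst (i, g)) (snd (i, g)) \<longrightarrow> eact B i h (x, v) = (cact Q i h x, L v))"
      using orbifold_vector_bundleD(4)[OF B ig(1) h x] eact_eq[OF ig(1) h x]
      by (intro exI[of _ "\<lambda>v. snd (eact B i h (x, v))"]) (auto simp: fixed_pts_def)
  qed
  show "\<exists>\<sigma>'\<in>ambient_maps E (i, g) (j, g'). covers (i, g) \<sigma> \<sigma>'" if am: "\<sigma> \<in> ambient_maps Q (i, g) (j, g')"
  proof -
    consider (inj) a where "\<sigma> = fst a" "a \<in> injs Q i j" "snd a g = g'"
      | (act) h where "\<sigma> = cact Q i h" "i = j" "h \<in> carrier (cgrp Q i)" "h \<otimes>\<^bsub>cgrp Q i\<^esub> g \<otimes>\<^bsub>cgrp Q i\<^esub> inv\<^bsub>cgrp Q i\<^esub> h = g'"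
      using am unfolding ambient_maps_def by auto
    then show ?thesis
    proof cases
      case (inj a)
      have "fst (bundle_injection Q B i j a) \<in> ambient_maps E (i, g) (j, g')"
        using inj by (auto simp: ambient_maps_def bundle_injection_def)
      then show ?thesis using covers_inj[OF inj(2)] inj(1) by blast
    next
      case (act h)
      have "eact B i h \<in> ambient_maps E (i, g) (j, g')" using act by (auto simp: ambient_maps_def)
      then show ?thesis using covers_act[OF act(3)] act(1) by blast
    qed
  qed
  show "\<exists>\<sigma>\<in>ambient_maps Q (i, g) (j, g'). covers (i, g) \<sigma> \<sigma>'" if am: "\<sigma>' \<in> ambient_maps E (i, g) (j, g')"
  proof -
    consider (inj) a where "\<sigma>' = fst (bundle_injection Q B i j a)" "a \<in> injs Q i j" "snd a g = g'"
      | (act) h where "\<sigma>' = eact B i h" "i = j" "h \<in> carrier (cgrp Q i)" "h \<otimes>\<^bsub>cgrp Q i\<^esub> g \<otimes>\<^bsub>cgrp Q i\<^esub> inv\<^bsub>cgrp Q i\<^esub> h = g'"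
      using am unfolding ambient_maps_def by (auto simp: bundle_injection_def)
    then show ?thesis
    proof cases
      case (inj a)
      have "fst a \<in> ambient_maps Q (i, g) (j, g')" using inj unfolding ambient_maps_def prod.case by blast
      then show ?thesis using covers_inj[OF inj(2)] inj(1) by blast
    next
      case (act h)
      have "cact Q i h \<in> ambient_maps Q (i, g) (j, g')" using act by (auto simp: ambient_maps_def)
      then show ?thesis using covers_act[OF act(3)] act(1) by blast
    qed
  qed
qed

lemma group_cgrp: "(i, g) \<in> t \<Longrightarrow> group (cgrp Q i)"
  using group_action.group_hom[OF orbifoldD(3)[OF Q in_point_elems(1)]] group_hom.axioms(1) by blast

lemma structure_maps_covers:
  assumes p: "p \<in> t" "q \<in> t"
  shows "\<sigma> \<in> structure_maps (sector Q t) p q \<Longrightarrow> \<exists>\<sigma>'\<in>structure_maps (sector E t) p q. covers p \<sigma> \<sigma>'"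
    "\<sigma>' \<in> structure_maps (sector E t) p q \<Longrightarrow> \<exists>\<sigma>\<in>structure_maps (sector Q t) p q. covers p \<sigma> \<sigma>'"
proof -
  obtain i g j g' where e: "p = (i, g)" "q = (j, g')" by (cases p, cases q)
  note pt = p[unfolded e]
  note ig = in_point_elems[OF pt(1)]
  have sQ: "structure_maps (sector Q t) p q = (\<lambda>\<sigma>. restrict \<sigma> (fixed_pts Q i g)) ` ambient_maps Q (i, g) (j, g')"
    unfolding e by (rule structure_maps_sector[OF group_cgrp[OF pt(1)] ig(2)])
  have sE: "structure_maps (sector E t) p q = (\<lambda>\<sigma>. restrict \<sigma> (fixed_pts E i g)) ` ambient_maps E (i, g) (j, g')"
    unfolding e by (rule structure_maps_sector) (use group_cgrp[OF pt(1)] ig(2) in auto)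
  have cov: "covers p (restrict \<sigma> (fixed_pts Q i g)) (restrict \<sigma>' (fixed_pts E i g)) \<longleftrightarrow> covers p \<sigma> \<sigma>'" for \<sigma> \<sigma>'
    by (auto simp: covers_def e cong: ball_cong)
  show "\<sigma> \<in> structure_maps (sector Q t) p q \<Longrightarrow> \<exists>\<sigma>'\<in>structure_maps (sector E t) p q. covers p \<sigma> \<sigma>'"
    unfolding sQ sE using ambient_maps_covers(1)[OF pt] cov[unfolded e] unfolding e by fast
  show "\<sigma>' \<in> structure_maps (sector E t) p q \<Longrightarrow> \<exists>\<sigma>\<in>structure_maps (sector Q t) p q. covers p \<sigma> \<sigma>'"
    unfolding sQ sE using ambient_maps_covers(2)[OF pt] cov[unfolded e] unfolding e by fast
qed

lemma sector_cpts:
  "p \<in> t \<Longrightarrow> cpts (sector Q t) p = fixed_pts Q (fst p) (snd p)"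
  "p \<in> t \<Longrightarrow> cpts (sector E t) p = fixed_pts E (fst p) (snd p)"
  by (cases p; auto simp: submanifold_def fixed_pts_def)+

text \<open>The compatibilities with a structure map all come from the linear map L in
  \<open>covers\<close>: L 0 = 0 for the zero section, the first component for the projection, and L
  (s v) = s L v for the scaling.\<close>

lemma sector_deRham_iso:
  "deRham_pullback (\<lambda>_ x. (x, 0)) (sector Q t) (sector E t) d \<in> iso (deRham (sector E t) d) (deRham (sector Q t) d)"
proof (rule deRham_pullback_iso[OF smooth_system_sectors, where \<rho>="\<lambda>_. fst" and h="\<lambda>_ q. (fst (fst q), snd q *\<^sub>R snd (fst q))"])
  have \<iota>: "asmooth (cmfd (sector Q t) p) (cmfd (sector E t) p) (\<lambda>x. (x, 0))"
    and \<rho>: "asmooth (cmfd (sector E t) p) (cmfd (sector Q t) p) fst"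
    and h: "asmooth (cylinder (cmfd (sector E t) p)) (cmfd (sector E t) p) (\<lambda>q. (fst (fst q), snd q *\<^sub>R snd (fst q)))"
    if pt: "p \<in> t" for p
  proof -
    obtain i g where p: "p = (i, g)" "(i, g) \<in> t" using pt by (cases p) auto
    note ig = in_point_elems[OF p(2)]
    note M = amfd_Q[OF ig(1)] and F = fibre_subspace[OF ig(1)] and sl = sliced_fixed_pts[OF p(2)]
    note P = amfd_prod[OF M F]
    have P': "cmfd E i = prod_space (cmfd Q i) (fibre B)" by simp
    show "asmooth (cmfd (sector Q t) p) (cmfd (sector E t) p) (\<lambda>x. (x, 0))"
      unfolding p sector_sel
      by (rule sliced_asmooth[OF M P[folded P'] _ sl])
         (use asmooth_incl[OF M F subspace_0[OF F]] zero_fixed_pts[OF p(2)] in auto)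
    show "asmooth (cmfd (sector E t) p) (cmfd (sector Q t) p) fst"
      unfolding p sector_sel
      by (rule sliced_asmooth[OF P[folded P'] M _ sl(2,1)])
         (use asmooth_fst[OF M F] fixed_pts_E(1)[OF p(2)] in auto)
    show "asmooth (cylinder (cmfd (sector E t) p)) (cmfd (sector E t) p) (\<lambda>q. (fst (fst q), snd q *\<^sub>R snd (fst q)))"
      unfolding p sector_sel
      \<comment> \<open>The cylinder over the fixed-point set is a slice of the cylinder over the
        ambient chart, so the scaling restricts to it from there.\<close>
      by (rule sliced_asmooth[OF amfd_prod[OF P[folded P'] subspace_UNIV] P[folded P'] _
           sliced_prod[OF P[folded P'] sl(2) subspace_UNIV] sl(2)])
         (use asmooth_scale[OF M F] fixed_pts_E(3)[OF p(2)] in auto)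
  qed
  show "asmooth (cylinder (cmfd (sector E t) p)) (cmfd (sector E t) p) (\<lambda>q. (fst (fst q), snd q *\<^sub>R snd (fst q)))"
    if "p \<in> charts (sector E t)" for p using h that by simp
  show "system_map (\<lambda>_ x. (x, 0)) (sector Q t) (sector E t)"
    unfolding system_map_def
  proof (intro conjI ballI)
    fix p q \<sigma> assume "p \<in> charts (sector Q t)" "q \<in> charts (sector Q t)" and \<sigma>: "\<sigma> \<in> structure_maps (sector Q t) p q"
    then have p: "p \<in> t" "q \<in> t" by simp_all
    obtain i g where pe: "p = (i, g)" by (cases p)
    obtain \<sigma>' where \<sigma>': "\<sigma>' \<in> structure_maps (sector E t) p q" "covers p \<sigma> \<sigma>'" using structure_maps_covers(1)[OF p \<sigma>] by blast
    have "(\<sigma> x, 0) = \<sigma>' (x, 0)" if xf: "x \<in> fixed_pts Q i g" for x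
    proof -
      obtain L where L: "linear_map_on (fibre B) (fibre B) L" "\<forall>v. (x, v) \<in> fixed_pts E i g \<longrightarrow> \<sigma>' (x, v) = (\<sigma> x, L v)"
        using \<sigma>'(2) xf unfolding covers_def pe by auto
      then show ?thesis using zero_fixed_pts[OF p(1)[unfolded pe] xf]
          linear_map_on_zero[OF L(1) fibre_subspace[OF in_point_elems(1)[OF p(1)[unfolded pe]]]] by simp
    qed
    then show "\<exists>\<sigma>'\<in>structure_maps (sector E t) p q. \<forall>x\<in>cpts (sector Q t) p. (\<sigma> x, 0) = \<sigma>' (x, 0)"
      using \<sigma>'(1) sector_cpts(1)[OF p(1)] pe by auto
  qed (use \<iota> in simp_all)
  show "system_map (\<lambda>_. fst) (sector E t) (sector Q t)"
    unfolding system_map_def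
  proof (intro conjI ballI)
    fix p q \<sigma>' assume "p \<in> charts (sector E t)" "q \<in> charts (sector E t)" and \<sigma>': "\<sigma>' \<in> structure_maps (sector E t) p q"
    then have p: "p \<in> t" "q \<in> t" by simp_all
    obtain i g where pe: "p = (i, g)" by (cases p)
    obtain \<sigma> where \<sigma>: "\<sigma> \<in> structure_maps (sector Q t) p q" "covers p \<sigma> \<sigma>'" using structure_maps_covers(2)[OF p \<sigma>'] by blast
    have "fst (\<sigma>' e) = \<sigma> (fst e)" if "e \<in> fixed_pts E i g" for e
      using \<sigma>(2) fixed_pts_E(1)[OF p(1)[unfolded pe], of "fst e" "snd e"] that unfolding covers_def pe
      by (metis fst_conv prod.collapse snd_conv)
    then show "\<exists>\<sigma>\<in>structure_maps (sector Q t) p q. \<forall>e\<in>cpts (sector E t) p. fst (\<sigma>' e) = \<sigma> (fst e)"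
      using \<sigma>(1) sector_cpts(2)[OF p(1)] pe by auto
  qed (use \<rho> in simp_all)
  fix p q \<sigma>' e and s :: real
  assume "p \<in> charts (sector E t)" "q \<in> charts (sector E t)" and \<sigma>': "\<sigma>' \<in> structure_maps (sector E t) p q"
    and e: "e \<in> cpts (sector E t) p"
  then have p: "p \<in> t" "q \<in> t" by simp_all
  obtain i g where pe: "p = (i, g)" by (cases p)
  obtain x v where ee: "e = (x, v)" by (cases e)
  note pt = p(1)[unfolded pe]
  have xv: "(x, v) \<in> fixed_pts E i g" using e sector_cpts(2)[OF p(1)] pe ee by simp
  obtain \<sigma> where \<sigma>: "covers p \<sigma> \<sigma>'" using structure_maps_covers(2)[OF p \<sigma>'] by blast
  obtain L where L: "linear_map_on (fibre B) (fibre B) L" "\<forall>v. (x, v) \<in> fixed_pts E i g \<longrightarrow> \<sigma>' (x, v) = (\<sigma> x, L v)"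
    using \<sigma> fixed_pts_E(1)[OF pt xv] unfolding covers_def pe by auto
  show "(fst (fst (\<sigma>' e, s)), snd (\<sigma>' e, s) *\<^sub>R snd (fst (\<sigma>' e, s))) =
      \<sigma>' (fst (fst (e, s)), snd (e, s) *\<^sub>R snd (fst (e, s)))"
    using L(2) xv fixed_pts_E(3)[OF pt xv, of s] linear_map_on_scale[OF L(1) fixed_pts_E(2)[OF pt xv]] by (simp add: ee)
qed simp_all

end

theorem lemma6:
  fixes Q :: "('i, 'x, 'a::euclidean_space, 'g, 'q) orbifold_data"
    and B :: "('i, 'x, 'g, 'q, 'f::euclidean_space, 'e) bundle_data"
    and J\<^sub>Q :: "('i, 'x, 'a) endo_field"
    and J\<^sub>E :: "('i, 'x \<times> 'f, 'a \<times> 'f) endo_field"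
    and n k :: nat
  assumes "orbifold n Q" and "has_point_charts Q"
    and "orbifold_vector_bundle n k Q B"
    and "almost_complex Q J\<^sub>Q"
    and "almost_complex (total_space Q B) J\<^sub>E"
  shows "zero_section_restriction Q B J\<^sub>Q J\<^sub>E \<in> iso (H_orb_total Q B J\<^sub>E) (H_orb_base Q J\<^sub>Q)"
proof -
  let ?T = "sector_classes Q" and ?\<sigma>Q = "base_shift Q J\<^sub>Q" and ?\<sigma>E = "total_shift Q B J\<^sub>E"
  \<comment> \<open>Of the total degree r only the de Rham degree, r minus twice the shift, is kept:
    exchanging one shift for the other leaves it unchanged. Hence \<tau> is a bijection of the index
    sets, and the isomorphism is one of ungraded groups.\<close>
  let ?\<tau> = "\<lambda>(r, t). (r - 2 * ?\<sigma>Q t + 2 * ?\<sigma>E t, t)"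
  let ?P = "\<lambda>(r, t). deRham_pullback (\<lambda>_ x. (x, 0)) (sector Q t) (sector (total_space Q B) t) (nat \<lfloor>r - 2 * ?\<sigma>Q t\<rfloor>)"
  \<comment> \<open>The equivalence relation is cut down to \<open>point_elems Q\<close> before the
    quotient is taken; so each chart in a class has a centre, and with it a linear
    coordinate.\<close>
  have T: "t \<subseteq> point_elems Q" if "t \<in> ?T" for t
    using that by (auto simp: sector_classes_def quotient_def)
  have iso: "(\<lambda>K. \<lambda>j\<in>orb_degrees ?T ?\<sigma>Q. ?P j (K (?\<tau> j))) \<in>
    iso (sum_group (orb_degrees ?T ?\<sigma>E) (\<lambda>(r, t). deRham (sector (total_space Q B) t) (nat \<lfloor>r - 2 * ?\<sigma>E t\<rfloor>)))
        (sum_group (orb_degrees ?T ?\<sigma>Q) (\<lambda>(r, t). deRham (sector Q t) (nat \<lfloor>r - 2 * ?\<sigma>Q t\<rfloor>)))"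
  proof (rule sum_group_iso)
    show "group ((\<lambda>(r, t). deRham (sector (total_space Q B) t) (nat \<lfloor>r - 2 * ?\<sigma>E t\<rfloor>)) i)"
      if "i \<in> orb_degrees ?T ?\<sigma>E" for i
      using that group_deRham[OF smooth_system_sectors(2)[OF assms(1,3) T]] by (auto simp: orb_degrees_def)
    show "group ((\<lambda>(r, t). deRham (sector Q t) (nat \<lfloor>r - 2 * ?\<sigma>Q t\<rfloor>)) i)"
      if "i \<in> orb_degrees ?T ?\<sigma>Q" for i
      using that group_deRham[OF smooth_system_sectors(1)[OF assms(1,3) T]] by (auto simp: orb_degrees_def)
    show "bij_betw ?\<tau> (orb_degrees ?T ?\<sigma>Q) (orb_degrees ?T ?\<sigma>E)"
      by (rule bij_betw_byWitness[where f'="\<lambda>(r, t). (r - 2 * ?\<sigma>E t + 2 * ?\<sigma>Q t, t)"]) (auto simp: orb_degrees_def)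
    fix j assume "j \<in> orb_degrees ?T ?\<sigma>Q"
    then obtain r t where j: "j = (r, t)" "t \<in> ?T" by (auto simp: orb_degrees_def)
    show "?P j \<in> iso ((\<lambda>(r, t). deRham (sector (total_space Q B) t) (nat \<lfloor>r - 2 * ?\<sigma>E t\<rfloor>)) (?\<tau> j))
      ((\<lambda>(r, t). deRham (sector Q t) (nat \<lfloor>r - 2 * ?\<sigma>Q t\<rfloor>)) j)"
      using sector_deRham_iso[OF assms(1,3) T[OF j(2)]] by (simp add: j(1))
  qed
  have eq: "zero_section_restriction Q B J\<^sub>Q J\<^sub>E = (\<lambda>K. \<lambda>j\<in>orb_degrees ?T ?\<sigma>Q. ?P j (K (?\<tau> j)))"
    by (auto simp: zero_section_restriction_def fun_eq_iff restrict_def)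
  show ?thesis unfolding H_orb_total_def H_orb_base_def orb_cohomology_def eq by (rule iso)
qed

end
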